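(* Let $F^N(t)$, $t\ge 0$, be the solution of the $N$-particle equation $\frac{d}{dt}F^N=(K_0^N+V^N)F^N$ whose initial datum $F^N(0)\in\mathfrak A_N$ is a state, let $F(t)$ be the solution of the mean field equation $\partial_tF=K_0(F)+Q(F,F)$ with initial datum $F(0)\in\mathfrak A$, $F(0)\ge 0$, $\|F(0)\|_1=1$, and let $E_j(t)$, $j=1,\dots,N$, be the associated correlation errors. Suppose that for some $C_0\ge 1$ and all $j=1,\dots,N$, $$\|E_j(0)\|_1\le C_0^{\,j}\left(\frac{j}{\sqrt N}\right)^{j}.$$ Then for all $t>0$ and all $j=1,\dots,N$, $$\|E_j(t)\|_1\le\left(C_2\,e^{C_1t\|V\|}\right)^{j}\left(\frac{j}{\sqrt N}\right)^{j},$$ where $$C_1=4\,\frac{16(2e)^{\frac1{12e}+1}}{\left|\log\left(1-\frac1{24e}\right)\right|},\qquad C_2=16(2e)^{1+\frac1{12e}}\,C_0 .$$ Suppose in addition that $\|E_1(0)\|_1\le \frac{B_0}{N}$ for some $B_0>0$. Then for all $t>0$, $$\|E_1(t)\|_1\le\frac1N\,B_2\,e^{B_1t\|V\|},\qquad B_1=2C_1,\quad B_2=B_0+\frac12+\frac{16C_2^2}{C_1-2}.$$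
   Context: **Algebras and norms.** Let $\mathfrak H$ be a complex separable Hilbert space, $\mathfrak H_n=\mathfrak H^{\otimes n}$. For $1\le k,s\le n$ let $\sigma_{k,s}$ be the unitary on $\mathfrak H_n$ exchanging the $k$-th and $s$-th tensor factors ($\sigma_{k,k}=\mathbb I$). An operator $A$ on $\mathfrak H_n$ is symmetric if $A=\sigma_{k,s}A\sigma_{k,s}^*$ for all $k,s$. For each $n\geq 1$ a $*$-algebra $\mathfrak A_n=\mathfrak A^{\otimes n}\subset\mathcal B(\mathfrak H_n)$, $\mathfrak A_1=\mathfrak A$ (possibly without unit), stable under $A\mapsto|A|=\sqrt{A^*A}$, is given, with a positive linear functional $\ell:\mathfrak A_n\to\mathbb C$ such that $\|A\|_1:=\ell(|A|)$ is a norm on $\mathfrak A_n$ and: - $|\ell(A)|\le\ell(|A|)$; - $\ell(A\otimes B)=\ell(A)\ell(B)$ for $A\in\mathfrak A_j$, $B\in\mathfrak A_{n-j}$ (hence $\|A\otimes B\|_1=\|A\|_1\|B\|_1$); - $\|\sigma_{k,s}A\sigma_{k,s}^*\|_1=\|A\|_1$. $\mathfrak A_n$ is replaced by its completion for $\|\cdot\|_1$ (same notation), and all operations are extended by continuity. A state of the $N$-particle system is a positive, symmetric $F^N\in\mathfrak A_N$ with $\|F^N\|_1=1$. **Marginals.** $\ell_n:\mathfrak A_n\to\mathfrak A_{n-1}$ are positive linear maps with $\ell_n(A_1\otimes\cdots\otimes A_n)=\ell(A_n)\,A_1\otimes\cdots\otimes A_{n-1}$ and $|\ell_n(A)|\le\ell_n(|A|)$.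 Put $\ell_{j,n}=\ell_{j+1}\cdots\ell_n:\mathfrak A_n\to\mathfrak A_j$. The $j$-particle marginal of $F^N$ is $F_j=F^N_j:=\ell_{j,N}(F^N)$ ($F_N=F^N$). **Dynamics.** $K_0$ is a (possibly unbounded) linear operator on $\mathfrak A$; $K_0^j=\sum_{i=1}^j\mathbb I_{\mathfrak A_{i-1}}\otimes K_0\otimes\mathbb I_{\mathfrak A_{j-i}}$. $V\in\mathcal B(\mathfrak A_2)$ is a symmetry preserving bounded operator (it maps symmetric elements to symmetric elements), and $\|V\|=\|V\|_{\mathfrak A_2\to\mathfrak A_2}$. For $i<r\le j$, $T_{i,r}:\mathfrak A_j\to\mathfrak A_j$ denotes $V$ acting on slots $i$ and $r$ (and as the identity on the other slots); it is a bounded operator with $\|T_{i,r}\|\le\|V\|$. Put $T_j=\sum_{1\le i<r\le j}T_{i,r}$. For $j=N$ write $V_{i,r}=T_{i,r}$ and $V^N=\frac1N\sum_{1\le i<r\le N}V_{i,r}=T_N/N$. Standing assumptions: $K_0$ and $K_0^N+V^N$ generate strongly continuous, positivity preserving, isometric semigroups for $\|\cdot\|_1$; $\|e^{t(K_0^j+T_j/N)}\|=1$ for all $t\ge0$, $1\le j\le N$; the equation $\frac{d}{dt}F^N=(K_0^N+V^N)F^N$ has a unique mild solution for every initial datum in $\mathfrak A_N$; $\ell(K_0(F))=0$ for $F\in\mathfrak A$ and $\ell_{j,N}(V_{i,r}(F^N))=0$ for $F^N\in\mathfrak A_N$, $i,r>j$, $i\ne r$. With $Q(F,G):=\ell_2(V(F\otimes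 G))$, the mean field equation $\partial_tF=K_0(F)+Q(F,F)$, $F(0)\ge0$, $\|F(0)\|_1=1$, has a unique global mild solution, which preserves positivity and $\|\cdot\|_1$. **Correlation error.** Let $J=\{1,\dots,j\}$, $K\subset J$, $k=|K|$, and $J\setminus K=\{i_1<\dots<i_{j-k}\}$, $\sigma_{J\setminus K,j}=\sigma_{i_1,1}\sigma_{i_2,2}\cdots\sigma_{i_{j-k},j-k}$ ($\sigma_{\emptyset,j}=\mathbb I$). The correlation error of order $j$ is $$E_j=\sum_{K\subset J}(-1)^{k}\,\sigma_{J\setminus K,j}\left(F_{j-k}\otimes F^{\otimes k}\right)\sigma_{J\setminus K,j}^*\in\mathfrak A_j,$$ i.e. the $K$-term has the marginal $F_{j-k}$ in the slots of $J\setminus K$ and $F$ in each slot of $K$; the terms $K=\emptyset$, $K=J$ are $F_j$ and $(-1)^jF^{\otimes j}$. $E_j(t)$ is obtained by using the marginals $F_j(t)$ of $F^N(t)$ and the mean field solution $F(t)$. *)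

theory Defs
  imports "HOL-Analysis.Analysis"
begin

class cbanach = banach +
  fixes scaleC :: "complex \<Rightarrow> 'a \<Rightarrow> 'a"  (infixr "*\<^sub>C" 75)
  assumes scaleC_add_right: "c *\<^sub>C (x + y) = c *\<^sub>C x + c *\<^sub>C y"
    and scaleC_add_left: "(c + d) *\<^sub>C x = c *\<^sub>C x + d *\<^sub>C x"
    and scaleC_scaleC: "c *\<^sub>C (d *\<^sub>C x) = (c * d) *\<^sub>C x"
    and scaleC_of_real: "complex_of_real r *\<^sub>C x = r *\<^sub>R x"
    and norm_scaleC: "norm (c *\<^sub>C x) = cmod c * norm x"

interpretation cvec: vector_space "scaleC :: complex \<Rightarrow> 'a \<Rightarrow> 'a::cbanach"
proof
  show "1 *\<^sub>C x = x" for x :: 'a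
    using scaleC_of_real[of 1 x] by simp
qed (simp_all add: scaleC_add_right scaleC_add_left scaleC_scaleC)

instantiation prod :: (cbanach, cbanach) cbanach
begin

definition scaleC_prod :: "complex \<Rightarrow> 'a \<times> 'b \<Rightarrow> 'a \<times> 'b"
  where "scaleC_prod c p = (c *\<^sub>C fst p, c *\<^sub>C snd p)"

instance
proof
  fix c d :: complex and r :: real and x y :: "'a \<times> 'b"
  show "c *\<^sub>C (x + y) = c *\<^sub>C x + c *\<^sub>C y"
    "(c + d) *\<^sub>C x = c *\<^sub>C x + d *\<^sub>C x"
    "c *\<^sub>C (d *\<^sub>C x) = (c * d) *\<^sub>C x"
    "complex_of_real r *\<^sub>C x = r *\<^sub>R x"
    by (simp_all add: scaleC_prod_def scaleC_add_right scaleC_add_left scaleC_scaleC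
        scaleC_of_real scaleR_prod_def)
  have "(cmod c * norm (fst x))\<^sup>2 + (cmod c * norm (snd x))\<^sup>2
      = (cmod c)\<^sup>2 * ((norm (fst x))\<^sup>2 + (norm (snd x))\<^sup>2)"
    by (simp add: power_mult_distrib distrib_left)
  then show "norm (c *\<^sub>C x) = cmod c * norm x"
    by (simp add: scaleC_prod_def norm_prod_def norm_scaleC real_sqrt_mult)
qed

end

class chilbert = cbanach +
  fixes cinner :: "'a \<Rightarrow> 'a \<Rightarrow> complex"
  assumes cinner_add_right: "cinner x (y + z) = cinner x y + cinner x z"
    and cinner_scaleC_right: "cinner x (c *\<^sub>C y) = c * cinner x y"
    and cinner_commute: "cinner x y = cnj (cinner y x)"
    and cinner_self: "cinner x x = complex_of_real ((norm x)\<^sup>2)"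

text \<open>Families of spaces indexed by a natural number are modelled as closed subspaces of one
  ambient space. An operator on a subspace \<open>X\<close> is a function on the ambient type of which only
  the values on \<open>X\<close> matter; where equality of operators matters, they are \<open>0\<close> off \<open>X\<close>.\<close>

definition clinear_on :: "'a::cbanach set \<Rightarrow> ('a \<Rightarrow> 'b::cbanach) \<Rightarrow> bool" where
  "clinear_on X f \<longleftrightarrow> (\<forall>x\<in>X. \<forall>y\<in>X. f (x + y) = f x + f y) \<and> (\<forall>c. \<forall>x\<in>X. f (c *\<^sub>C x) = c *\<^sub>C f x)"

definition bounded_clinear_on :: "'a::cbanach set \<Rightarrow> 'b::cbanach set \<Rightarrow> ('a \<Rightarrow> 'b) \<Rightarrow> bool" where
  "bounded_clinear_on X Y f \<longleftrightarrow>
     clinear_on X f \<and> f ` X \<subseteq> Y \<and> (\<exists>C. \<forall>x\<in>X. norm (f x) \<le> C * norm x)"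

definition onorm_on :: "'a::cbanach set \<Rightarrow> ('a \<Rightarrow> 'b::cbanach) \<Rightarrow> real" where
  "onorm_on X f = (SUP x\<in>{x\<in>X. norm x \<le> 1}. norm (f x))"

definition bounded_ops :: "'h::cbanach set \<Rightarrow> ('h \<Rightarrow> 'h) set" where
  "bounded_ops X = {T. bounded_clinear_on X X T \<and> (\<forall>x. x \<notin> X \<longrightarrow> T x = 0)}"

definition is_adjoint :: "'h::chilbert set \<Rightarrow> ('h \<Rightarrow> 'h) \<Rightarrow> ('h \<Rightarrow> 'h) \<Rightarrow> bool" where
  "is_adjoint X A B \<longleftrightarrow>
     B \<in> bounded_ops X \<and> (\<forall>x\<in>X. \<forall>y\<in>X. cinner (A x) y = cinner x (B y))"

definition pos_ops :: "'h::chilbert set \<Rightarrow> ('h \<Rightarrow> 'h) set" where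
  "pos_ops X = {P \<in> bounded_ops X. \<forall>x\<in>X. cinner x (P x) \<in> \<real>\<^sub>\<ge>\<^sub>0}"

text \<open>\<open>P\<close> is the positive square root of \<open>A\<^sup>* A\<close>.\<close>

definition is_abs :: "'h::chilbert set \<Rightarrow> ('h \<Rightarrow> 'h) \<Rightarrow> ('h \<Rightarrow> 'h) \<Rightarrow> bool" where
  "is_abs X A P \<longleftrightarrow> P \<in> pos_ops X \<and> (\<exists>B. is_adjoint X A B \<and> P \<circ> P = B \<circ> A)"

definition c0_semigroup :: "'b::cbanach set \<Rightarrow> (real \<Rightarrow> 'b \<Rightarrow> 'b) \<Rightarrow> bool" where
  "c0_semigroup X U \<longleftrightarrow>
     (\<forall>t\<ge>0. bounded_clinear_on X X (U t)) \<and>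
     (\<forall>x\<in>X. U 0 x = x) \<and>
     (\<forall>s\<ge>0. \<forall>t\<ge>0. \<forall>x\<in>X. U (s + t) x = U s (U t x)) \<and>
     (\<forall>x\<in>X. continuous_on {0..} (\<lambda>t. U t x))"

text \<open>Unbounded operators are represented by their graphs.\<close>

definition generator :: "'b::cbanach set \<Rightarrow> (real \<Rightarrow> 'b \<Rightarrow> 'b) \<Rightarrow> ('b \<times> 'b) set" where
  "generator X U = {(x, y). x \<in> X \<and> ((\<lambda>h. (U h x - x) /\<^sub>R h) \<longlongrightarrow> y) (at_right 0)}"

definition isometric_on :: "'b::cbanach set \<Rightarrow> (real \<Rightarrow> 'b \<Rightarrow> 'b) \<Rightarrow> bool" where
  "isometric_on X U \<longleftrightarrow> (\<forall>t\<ge>0. \<forall>x\<in>X. norm (U t x) = norm x)"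

text \<open>Mild (Duhamel) solutions of \<open>u' = G u + f(u)\<close>, \<open>u(0) = u0\<close>, where \<open>U\<close> is the
  semigroup generated by \<open>G\<close> on \<open>X\<close>.\<close>

definition mild_solution ::
  "'b::cbanach set \<Rightarrow> (real \<Rightarrow> 'b \<Rightarrow> 'b) \<Rightarrow> ('b \<Rightarrow> 'b) \<Rightarrow> 'b \<Rightarrow> (real \<Rightarrow> 'b) \<Rightarrow> bool" where
  "mild_solution X U f u0 u \<longleftrightarrow>
     continuous_on {0..} u \<and>
     (\<forall>t\<ge>0. u t \<in> X \<and> u t = U t u0 + integral {0..t} (\<lambda>s. U (t - s) (f (u s))))"

text \<open>
  \<open>Hsp n\<close> is the \<open>n\<close>-fold tensor power of the one-particle space \<open>Hsp 1\<close>, \<open>vtens j m\<close> the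
  tensor product of vectors of \<open>Hsp j\<close> and \<open>Hsp m\<close>, \<open>vswap n k s\<close> the exchange of the factors
  \<open>k\<close> and \<open>s\<close> (counted from 1) in \<open>Hsp n\<close>; \<open>alg n\<close> is the algebra of operators on \<open>Hsp n\<close>
  before completion, \<open>emb n\<close> its embedding into its completion. The fields from \<open>ell\<close> to \<open>oabs\<close>
  are the extensions to the completions of the functional, of the tensor product, of
  conjugation with \<open>vswap n k s\<close> and of the absolute value; \<open>ptr n\<close> is the partial trace from
  \<open>n\<close> to \<open>n - 1\<close> particles; \<open>intVI j\<close> is the interaction \<open>intV\<close> acting on the slots 1 and 2 of
  \<open>j\<close>; \<open>expK0 t\<close> is the semigroup of the operator \<open>K0\<close> with domain \<open>K0dom\<close>, and \<open>flow N j t\<close>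
  that of \<open>K0\<^sup>j + T\<^sub>j / N\<close>.\<close>

record ('h, 'b) mean_field_data =
  Hsp :: "nat \<Rightarrow> 'h set"
  vtens :: "nat \<Rightarrow> nat \<Rightarrow> 'h \<Rightarrow> 'h \<Rightarrow> 'h"
  vswap :: "nat \<Rightarrow> nat \<Rightarrow> nat \<Rightarrow> 'h \<Rightarrow> 'h"
  alg :: "nat \<Rightarrow> ('h \<Rightarrow> 'h) set"
  emb :: "nat \<Rightarrow> ('h \<Rightarrow> 'h) \<Rightarrow> 'b"
  ell :: "nat \<Rightarrow> 'b \<Rightarrow> complex"
  otens :: "nat \<Rightarrow> nat \<Rightarrow> 'b \<Rightarrow> 'b \<Rightarrow> 'b"
  oconj :: "nat \<Rightarrow> nat \<Rightarrow> nat \<Rightarrow> 'b \<Rightarrow> 'b"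
  oabs :: "nat \<Rightarrow> 'b \<Rightarrow> 'b"
  ptr :: "nat \<Rightarrow> 'b \<Rightarrow> 'b"
  intV :: "'b \<Rightarrow> 'b"
  intVI :: "nat \<Rightarrow> 'b \<Rightarrow> 'b"
  K0dom :: "'b set"
  K0 :: "'b \<Rightarrow> 'b"
  expK0 :: "real \<Rightarrow> 'b \<Rightarrow> 'b"
  flow :: "nat \<Rightarrow> nat \<Rightarrow> real \<Rightarrow> 'b \<Rightarrow> 'b"

text \<open>Iterated (right-nested) tensor product of a nonempty list of one-particle elements.\<close>

fun tprod_list :: "(nat \<Rightarrow> nat \<Rightarrow> 'a \<Rightarrow> 'a \<Rightarrow> 'a) \<Rightarrow> 'a list \<Rightarrow> 'a" where
  "tprod_list tens [] = undefined"
| "tprod_list tens [x] = x"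
| "tprod_list tens (x # y # ys) = tens 1 (length (y # ys)) x (tprod_list tens (y # ys))"

definition list_swap :: "nat \<Rightarrow> nat \<Rightarrow> 'a list \<Rightarrow> 'a list" where
  "list_swap k s xs = xs[k - 1 := xs ! (s - 1), s - 1 := xs ! (k - 1)]"

definition is_tensor_op ::
  "('h::chilbert, 'b::cbanach) mean_field_data \<Rightarrow> nat \<Rightarrow> nat \<Rightarrow> ('h \<Rightarrow> 'h) \<Rightarrow> ('h \<Rightarrow> 'h) \<Rightarrow> ('h \<Rightarrow> 'h) \<Rightarrow> bool"
  where
  "is_tensor_op S j m A B T \<longleftrightarrow>
     T \<in> bounded_ops (Hsp S (j + m)) \<and>
     (\<forall>x\<in>Hsp S j. \<forall>y\<in>Hsp S m. T (vtens S j m x y) = vtens S j m (A x) (B y))"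

text \<open>The completion of \<open>alg S n\<close>, and its cone of positive elements.\<close>

definition compl :: "('h::chilbert, 'b::cbanach) mean_field_data \<Rightarrow> nat \<Rightarrow> 'b set" where
  "compl S n = closure (emb S n ` alg S n)"

definition pcone :: "('h::chilbert, 'b::cbanach) mean_field_data \<Rightarrow> nat \<Rightarrow> 'b set" where
  "pcone S n = closure (emb S n ` (alg S n \<inter> pos_ops (Hsp S n)))"

definition symmetric_elt :: "('h::chilbert, 'b::cbanach) mean_field_data \<Rightarrow> nat \<Rightarrow> 'b \<Rightarrow> bool" where
  "symmetric_elt S n a \<longleftrightarrow> (\<forall>k\<in>{1..n}. \<forall>s\<in>{1..n}. oconj S n k s a = a)"

definition is_state :: "('h::chilbert, 'b::cbanach) mean_field_data \<Rightarrow> nat \<Rightarrow> 'b \<Rightarrow> bool" where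
  "is_state S n a \<longleftrightarrow> a \<in> pcone S n \<and> symmetric_elt S n a \<and> norm a = 1"

text \<open>\<open>marg S j n\<close> is the composition of the partial traces \<open>ptr S (j + 1), \<dots>, ptr S n\<close>.\<close>

fun marg :: "('h::chilbert, 'b::cbanach) mean_field_data \<Rightarrow> nat \<Rightarrow> nat \<Rightarrow> 'b \<Rightarrow> 'b" where
  "marg S j 0 a = a"
| "marg S j (Suc n) a = (if Suc n \<le> j then a else marg S j n (ptr S (Suc n) a))"

text \<open>For \<open>i < r\<close>: exchanging 1 with \<open>i\<close> and then 2 with \<open>r\<close> moves the slots \<open>i, r\<close> to \<open>1, 2\<close>.\<close>

definition Tir :: "('h::chilbert, 'b::cbanach) mean_field_data \<Rightarrow> nat \<Rightarrow> nat \<Rightarrow> nat \<Rightarrow> 'b \<Rightarrow> 'b" where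
  "Tir S j i r a =
     oconj S j 1 i (oconj S j 2 r (intVI S j (oconj S j 2 r (oconj S j 1 i a))))"

definition Tsum :: "('h::chilbert, 'b::cbanach) mean_field_data \<Rightarrow> nat \<Rightarrow> 'b \<Rightarrow> 'b" where
  "Tsum S j a = (\<Sum>r\<in>{1..j}. \<Sum>i\<in>{1..<r}. Tir S j i r a)"

definition normV :: "('h::chilbert, 'b::cbanach) mean_field_data \<Rightarrow> real" where
  "normV S = onorm_on (compl S 2) (intV S)"

definition meanQ :: "('h::chilbert, 'b::cbanach) mean_field_data \<Rightarrow> 'b \<Rightarrow> 'b \<Rightarrow> 'b" where
  "meanQ S a b = ptr S 2 (intV S (otens S 1 1 a b))"

text \<open>The graph of the (unbounded) operator \<open>\<Sum>\<^sub>i \<bbbI> \<otimes> K0 \<otimes> \<bbbI>\<close>: the closure of the operator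
  defined on the algebraic tensor power of the domain of \<open>K0\<close>.\<close>

definition K0_graph :: "('h::chilbert, 'b::cbanach) mean_field_data \<Rightarrow> nat \<Rightarrow> ('b \<times> 'b) set" where
  "K0_graph S j = closure (cvec.span
     {(tprod_list (otens S) as, \<Sum>i<j. tprod_list (otens S) (as[i := K0 S (as ! i)])) | as.
        length as = j \<and> set as \<subseteq> K0dom S})"

definition hamiltonian_graph ::
  "('h::chilbert, 'b::cbanach) mean_field_data \<Rightarrow> nat \<Rightarrow> nat \<Rightarrow> ('b \<times> 'b) set" where
  "hamiltonian_graph S N j = {(a, b + Tsum S j a /\<^sub>R real N) | a b. (a, b) \<in> K0_graph S j}"

abbreviation mf_mild :: "('h::chilbert, 'b::cbanach) mean_field_data \<Rightarrow> 'b \<Rightarrow> (real \<Rightarrow> 'b) \<Rightarrow> bool" where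
  "mf_mild S \<equiv> mild_solution (compl S 1) (expK0 S) (\<lambda>a. meanQ S a a)"

abbreviation nbody_mild ::
  "('h::chilbert, 'b::cbanach) mean_field_data \<Rightarrow> nat \<Rightarrow> 'b \<Rightarrow> (real \<Rightarrow> 'b) \<Rightarrow> bool" where
  "nbody_mild S N \<equiv> mild_solution (compl S N) (flow S N N) (\<lambda>_. 0)"

text \<open>The assumptions on \<open>vtens\<close> say that the spaces \<open>Hsp S n\<close>, \<open>n \<ge> 1\<close>, realize the Hilbert space
  tensor powers of \<open>Hsp S 1\<close>, which are unique up to unitary equivalence. The condition on
  elementary tensors determines \<open>vswap S n k s\<close> uniquely.\<close>

locale tensor_powers =
  fixes S :: "('h::chilbert, 'b::cbanach) mean_field_data"
  assumes Hsp_subspace: "n \<ge> 1 \<Longrightarrow> cvec.subspace (Hsp S n) \<and> closed (Hsp S n)"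
    and Hsp_separable: "\<exists>C. countable C \<and> C \<subseteq> Hsp S 1 \<and> Hsp S 1 \<subseteq> closure C"
    and vtens_bilinear:
      "\<lbrakk>j \<ge> 1; m \<ge> 1; x \<in> Hsp S j\<rbrakk> \<Longrightarrow> clinear_on (Hsp S m) (vtens S j m x)"
      "\<lbrakk>j \<ge> 1; m \<ge> 1; y \<in> Hsp S m\<rbrakk> \<Longrightarrow> clinear_on (Hsp S j) (\<lambda>x. vtens S j m x y)"
    and vtens_cinner:
      "\<lbrakk>j \<ge> 1; m \<ge> 1; x \<in> Hsp S j; y \<in> Hsp S m; x' \<in> Hsp S j; y' \<in> Hsp S m\<rbrakk> \<Longrightarrow>
         cinner (vtens S j m x y) (vtens S j m x' y') = cinner x x' * cinner y y'"
    and vtens_total: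
      "\<lbrakk>j \<ge> 1; m \<ge> 1\<rbrakk> \<Longrightarrow>
         Hsp S (j + m) = closure (cvec.span {vtens S j m x y | x y. x \<in> Hsp S j \<and> y \<in> Hsp S m})"
    and vtens_assoc:
      "\<lbrakk>i \<ge> 1; j \<ge> 1; m \<ge> 1; x \<in> Hsp S i; y \<in> Hsp S j; z \<in> Hsp S m\<rbrakk> \<Longrightarrow>
         vtens S (i + j) m (vtens S i j x y) z = vtens S i (j + m) x (vtens S j m y z)"
    and vswap_op: "\<lbrakk>k \<in> {1..n}; s \<in> {1..n}\<rbrakk> \<Longrightarrow> vswap S n k s \<in> bounded_ops (Hsp S n)"
    and vswap_apply:
      "\<lbrakk>k \<in> {1..n}; s \<in> {1..n}; length xs = n; set xs \<subseteq> Hsp S 1\<rbrakk> \<Longrightarrow>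
         vswap S n k s (tprod_list (vtens S) xs) = tprod_list (vtens S) (list_swap k s xs)"

locale tensor_algebra = tensor_powers S for S :: "('h::chilbert, 'b::cbanach) mean_field_data" +
  assumes alg_ops: "n \<ge> 1 \<Longrightarrow> alg S n \<subseteq> bounded_ops (Hsp S n)"
    and alg_zero: "n \<ge> 1 \<Longrightarrow> (\<lambda>_. 0) \<in> alg S n"
    and alg_add: "\<lbrakk>n \<ge> 1; A \<in> alg S n; B \<in> alg S n\<rbrakk> \<Longrightarrow> (\<lambda>x. A x + B x) \<in> alg S n"
    and alg_scale: "\<lbrakk>n \<ge> 1; A \<in> alg S n\<rbrakk> \<Longrightarrow> (\<lambda>x. c *\<^sub>C A x) \<in> alg S n"
    and alg_mult: "\<lbrakk>n \<ge> 1; A \<in> alg S n; B \<in> alg S n\<rbrakk> \<Longrightarrow> A \<circ> B \<in> alg S n"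
    and alg_adjoint: "\<lbrakk>n \<ge> 1; A \<in> alg S n\<rbrakk> \<Longrightarrow> \<exists>B\<in>alg S n. is_adjoint (Hsp S n) A B"
    and alg_abs: "\<lbrakk>n \<ge> 1; A \<in> alg S n\<rbrakk> \<Longrightarrow> \<exists>P\<in>alg S n. is_abs (Hsp S n) A P"
    and alg_tensor:
      "\<lbrakk>j \<ge> 1; m \<ge> 1; A \<in> alg S j; B \<in> alg S m\<rbrakk> \<Longrightarrow> \<exists>T\<in>alg S (j + m). is_tensor_op S j m A B T"
    and alg_conj:
      "\<lbrakk>k \<in> {1..n}; s \<in> {1..n}; A \<in> alg S n; is_adjoint (Hsp S n) (vswap S n k s) R\<rbrakk> \<Longrightarrow>
         vswap S n k s \<circ> A \<circ> R \<in> alg S n"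
    \<comment> \<open>\<open>compl S n\<close> is the completion of \<open>alg S n\<close> for the norm \<open>\<ell>(|A|)\<close>\<close>
    and emb_add: "\<lbrakk>n \<ge> 1; A \<in> alg S n; B \<in> alg S n\<rbrakk> \<Longrightarrow>
      emb S n (\<lambda>x. A x + B x) = emb S n A + emb S n B"
    and emb_scale: "\<lbrakk>n \<ge> 1; A \<in> alg S n\<rbrakk> \<Longrightarrow> emb S n (\<lambda>x. c *\<^sub>C A x) = c *\<^sub>C emb S n A"
    and emb_inj: "n \<ge> 1 \<Longrightarrow> inj_on (emb S n) (alg S n)"
    and norm_emb:
      "\<lbrakk>n \<ge> 1; A \<in> alg S n; P \<in> alg S n; is_abs (Hsp S n) A P\<rbrakk> \<Longrightarrow>
         complex_of_real (norm (emb S n A)) = ell S n (emb S n P)"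
    \<comment> \<open>\<open>alg S n\<close> is the tensor power of \<open>alg S 1\<close>: elementary tensors are total\<close>
    and alg_total:
      "n \<ge> 1 \<Longrightarrow> emb S n ` alg S n \<subseteq>
         closure (cvec.span {tprod_list (otens S) (map (emb S 1) As) | As.
           length As = n \<and> set As \<subseteq> alg S 1})"
    and ell_cont: "n \<ge> 1 \<Longrightarrow> continuous_on (compl S n) (ell S n)"
    and ell_linear:
      "\<lbrakk>n \<ge> 1; a \<in> compl S n; b \<in> compl S n\<rbrakk> \<Longrightarrow> ell S n (a + b) = ell S n a + ell S n b"
      "\<lbrakk>n \<ge> 1; a \<in> compl S n\<rbrakk> \<Longrightarrow> ell S n (c *\<^sub>C a) = c * ell S n a"
    and ell_pos: "\<lbrakk>n \<ge> 1; P \<in> alg S n; P \<in> pos_ops (Hsp S n)\<rbrakk> \<Longrightarrow> ell S n (emb S n P) \<in> \<real>\<^sub>\<ge>\<^sub>0"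
    and ell_abs:
      "\<lbrakk>n \<ge> 1; A \<in> alg S n; P \<in> alg S n; is_abs (Hsp S n) A P\<rbrakk> \<Longrightarrow>
         cmod (ell S n (emb S n A)) \<le> Re (ell S n (emb S n P))"
    and ell_tensor:
      "\<lbrakk>j \<ge> 1; m \<ge> 1; A \<in> alg S j; B \<in> alg S m; T \<in> alg S (j + m); is_tensor_op S j m A B T\<rbrakk> \<Longrightarrow>
         ell S (j + m) (emb S (j + m) T) = ell S j (emb S j A) * ell S m (emb S m B)"
    \<comment> \<open>a consequence of multiplicativity of \<open>\<ell>\<close>, since \<open>|A \<otimes> B| = |A| \<otimes> |B|\<close>\<close>
    and norm_tensor:
      "\<lbrakk>j \<ge> 1; m \<ge> 1; A \<in> alg S j; B \<in> alg S m; T \<in> alg S (j + m); is_tensor_op S j m A B T\<rbrakk> \<Longrightarrow>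
         norm (emb S (j + m) T) = norm (emb S j A) * norm (emb S m B)"
    and norm_conj:
      "\<lbrakk>k \<in> {1..n}; s \<in> {1..n}; A \<in> alg S n; is_adjoint (Hsp S n) (vswap S n k s) R\<rbrakk> \<Longrightarrow>
         norm (emb S n (vswap S n k s \<circ> A \<circ> R)) = norm (emb S n A)"
    \<comment> \<open>a continuous function on \<open>compl S n\<close> is determined by its values on the dense image of \<open>alg S n\<close>\<close>
    and otens_cont:
      "\<lbrakk>j \<ge> 1; m \<ge> 1\<rbrakk> \<Longrightarrow> continuous_on (compl S j \<times> compl S m) (\<lambda>(a, b). otens S j m a b)"
    and otens_emb:
      "\<lbrakk>j \<ge> 1; m \<ge> 1; A \<in> alg S j; B \<in> alg S m; T \<in> alg S (j + m); is_tensor_op S j m A B T\<rbrakk> \<Longrightarrow>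
         otens S j m (emb S j A) (emb S m B) = emb S (j + m) T"
    and oconj_cont: "\<lbrakk>k \<in> {1..n}; s \<in> {1..n}\<rbrakk> \<Longrightarrow> continuous_on (compl S n) (oconj S n k s)"
    and oconj_emb:
      "\<lbrakk>k \<in> {1..n}; s \<in> {1..n}; A \<in> alg S n; is_adjoint (Hsp S n) (vswap S n k s) R\<rbrakk> \<Longrightarrow>
         oconj S n k s (emb S n A) = emb S n (vswap S n k s \<circ> A \<circ> R)"
    and oabs_cont: "n \<ge> 1 \<Longrightarrow> continuous_on (compl S n) (oabs S n)"
    and oabs_emb:
      "\<lbrakk>n \<ge> 1; A \<in> alg S n; P \<in> alg S n; is_abs (Hsp S n) A P\<rbrakk> \<Longrightarrow> oabs S n (emb S n A) = emb S n P"
    \<comment> \<open>the order between elements of the completions is that of the cone \<open>pcone\<close>\<close>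
    and ptr_linear: "n \<ge> 2 \<Longrightarrow> clinear_on (compl S n) (ptr S n)"
    and ptr_range: "n \<ge> 2 \<Longrightarrow> ptr S n ` compl S n \<subseteq> compl S (n - 1)"
    and ptr_cont: "n \<ge> 2 \<Longrightarrow> continuous_on (compl S n) (ptr S n)"
    and ptr_pos: "n \<ge> 2 \<Longrightarrow> ptr S n ` pcone S n \<subseteq> pcone S (n - 1)"
    and ptr_tensor:
      "\<lbrakk>n \<ge> 2; length as = n; set as \<subseteq> compl S 1\<rbrakk> \<Longrightarrow>
         ptr S n (tprod_list (otens S) as) = ell S 1 (last as) *\<^sub>C tprod_list (otens S) (butlast as)"
    and ptr_abs:
      "\<lbrakk>n \<ge> 2; a \<in> compl S n\<rbrakk> \<Longrightarrow> ptr S n (oabs S n a) - oabs S (n - 1) (ptr S n a) \<in> pcone S (n - 1)"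

locale mean_field_system = tensor_algebra S
  for S :: "('h::chilbert, 'b::cbanach) mean_field_data" +
  fixes N :: nat
  assumes N_pos: "N \<ge> 1"
    and V_bounded: "bounded_clinear_on (compl S 2) (compl S 2) (intV S)"
    and V_symmetric: "\<lbrakk>a \<in> compl S 2; symmetric_elt S 2 a\<rbrakk> \<Longrightarrow> symmetric_elt S 2 (intV S a)"
    and VI_bounded: "j \<ge> 2 \<Longrightarrow> bounded_clinear_on (compl S j) (compl S j) (intVI S j)"
    and VI_norm: "\<lbrakk>j \<ge> 2; a \<in> compl S j\<rbrakk> \<Longrightarrow> norm (intVI S j a) \<le> normV S * norm a"
    and VI_2: "a \<in> compl S 2 \<Longrightarrow> intVI S 2 a = intV S a"
    and VI_tensor:
      "\<lbrakk>m \<ge> 1; a \<in> compl S 2; b \<in> compl S m\<rbrakk> \<Longrightarrow>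
         intVI S (2 + m) (otens S 2 m a b) = otens S 2 m (intV S a) b"
    and K0_dom: "cvec.subspace (K0dom S)" "K0dom S \<subseteq> compl S 1"
    and K0_linear: "clinear_on (K0dom S) (K0 S)"
    and K0_range: "K0 S ` K0dom S \<subseteq> compl S 1"
    and K0_semigroup: "c0_semigroup (compl S 1) (expK0 S)"
    and K0_generates: "generator (compl S 1) (expK0 S) = {(a, K0 S a) | a. a \<in> K0dom S}"
    and K0_isometric: "isometric_on (compl S 1) (expK0 S)"
    and K0_positive: "t \<ge> 0 \<Longrightarrow> expK0 S t ` pcone S 1 \<subseteq> pcone S 1"
    and flow_semigroup: "j \<in> {1..N} \<Longrightarrow> c0_semigroup (compl S j) (flow S N j)"
    and flow_generates: "j \<in> {1..N} \<Longrightarrow> generator (compl S j) (flow S N j) = hamiltonian_graph S N j"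
    and flow_norm: "\<lbrakk>j \<in> {1..N}; t \<ge> 0\<rbrakk> \<Longrightarrow> onorm_on (compl S j) (flow S N j t) = 1"
    and flow_isometric: "isometric_on (compl S N) (flow S N N)"
    and flow_positive: "t \<ge> 0 \<Longrightarrow> flow S N N t ` pcone S N \<subseteq> pcone S N"
    and nbody_unique:
      "a \<in> compl S N \<Longrightarrow>
         \<exists>u. nbody_mild S N a u \<and> (\<forall>v. nbody_mild S N a v \<longrightarrow> (\<forall>t\<ge>0. v t = u t))"
    and ell_K0: "a \<in> K0dom S \<Longrightarrow> ell S 1 (K0 S a) = 0"
    and marg_V:
      "\<lbrakk>1 \<le> j; j < i; i < r; r \<le> N; a \<in> compl S N\<rbrakk> \<Longrightarrow> marg S j N (Tir S N i r a) = 0"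
    and mf_unique:
      "\<lbrakk>a \<in> pcone S 1; norm a = 1\<rbrakk> \<Longrightarrow>
         \<exists>u. mf_mild S a u \<and> (\<forall>t\<ge>0. u t \<in> pcone S 1 \<and> norm (u t) = 1) \<and>
           (\<forall>v. mf_mild S a v \<longrightarrow> (\<forall>t\<ge>0. v t = u t))"

text \<open>The element \<open>F\<^bsub>m\<^esub> \<otimes> F\<^sup>\<otimes>\<^sup>k\<close> for \<open>Fm \<in> compl S m\<close>; for \<open>k = 0\<close> and \<open>m = 0\<close> it is \<open>Fm\<close>
  and \<open>F\<^sup>\<otimes>\<^sup>k\<close>.\<close>

definition tens_pow :: "('h::chilbert, 'b::cbanach) mean_field_data \<Rightarrow> nat \<Rightarrow> nat \<Rightarrow> 'b \<Rightarrow> 'b \<Rightarrow> 'b" where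
  "tens_pow S m k Fm F =
     (if k = 0 then Fm
      else if m = 0 then tprod_list (otens S) (replicate k F)
      else otens S m k Fm (tprod_list (otens S) (replicate k F)))"

text \<open>Conjugation with \<open>\<sigma>\<^bsub>i1,1\<^esub> \<sigma>\<^bsub>i2,2\<^esub> \<dots>\<close> for \<open>I = {i1 < i2 < \<dots>}\<close>.\<close>

definition conj_slots :: "('h::chilbert, 'b::cbanach) mean_field_data \<Rightarrow> nat set \<Rightarrow> nat \<Rightarrow> 'b \<Rightarrow> 'b" where
  "conj_slots S I j =
     foldr (\<lambda>(i, p). oconj S j i p) (zip (sorted_list_of_set I) [1..<Suc (card I)])"

text \<open>\<open>G\<close> is the \<open>N\<close>-particle state, whose marginals enter, and \<open>F\<close> the one-particle element.\<close>

definition corr_error ::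
  "('h::chilbert, 'b::cbanach) mean_field_data \<Rightarrow> nat \<Rightarrow> 'b \<Rightarrow> 'b \<Rightarrow> nat \<Rightarrow> 'b" where
  "corr_error S N G F j =
     (\<Sum>K\<in>Pow {1..j}. (-1) ^ card K *\<^sub>R
        conj_slots S ({1..j} - K) j (tens_pow S (j - card K) (card K) (marg S (j - card K) N G) F))"

definition const_C1 :: real where
  "const_C1 = 4 * (16 * (2 * exp 1) powr (1 / (12 * exp 1) + 1) / \<bar>ln (1 - 1 / (24 * exp 1))\<bar>)"

definition const_C2 :: "real \<Rightarrow> real" where
  "const_C2 C0 = 16 * (2 * exp 1) powr (1 + 1 / (12 * exp 1)) * C0"

definition const_B1 :: real where
  "const_B1 = 2 * const_C1"

definition const_B2 :: "real \<Rightarrow> real \<Rightarrow> real" where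
  "const_B2 C0 B0 = B0 + 1 / 2 + 16 * (const_C2 C0)\<^sup>2 / (const_C1 - 2)"

end

theory Submission
  imports Defs
begin

text \<open>
  Let \<open>P\<^sub>i\<close> trace out the slot \<open>i\<close> of an \<open>N\<close>-particle element and put \<open>F\<close> there. The \<open>P\<^sub>i\<close> are
  commuting projections, and expanding the product identifies \<open>E\<^sub>j\<close>, up to permutations of the
  slots, with the marginal of \<open>(1 - P\<^sub>1) \<dots> (1 - P\<^sub>j) F\<^sup>N\<close>. Splitting each interaction term by the
  identity \<open>1 = P\<^sub>i + (1 - P\<^sub>i)\<close> in the slots it couples shows that, relative to the contractive flow of
  \<open>K\<^sub>0\<^sup>j + T\<^sub>j / N\<close>, the norm \<open>e\<^sub>j\<close> of \<open>E\<^sub>j\<close> grows at a rate which is bounded by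
  \<open>\<parallel>V\<parallel>\<close> times a combination of \<open>j e\<^sub>j\<^sub>+\<^sub>1\<close>, \<open>j e\<^sub>j\<close> and \<open>j\<^sup>2/N\<close> times \<open>e\<^sub>j\<close>, \<open>e\<^sub>j\<^sub>-\<^sub>1\<close>, \<open>e\<^sub>j\<^sub>-\<^sub>2\<close>. Since
  \<open>K\<^sub>0\<close> is unbounded and the solutions are only mild, this is shown for time averages first.

  The functions \<open>m\<^sub>j(t) = (A(t) j / \<surd>N)\<^sup>j\<close> with \<open>A(t) = C\<^sub>2 e\<^bsup>C\<^sub>1 t \<parallel>V\<parallel>\<^esup>\<close> cannot be crossed by the \<open>e\<^sub>j\<close>:
  if \<open>A(t) j \<ge> 3 \<surd>N\<close>, then \<open>e\<^sub>j \<le> 2\<^sup>j < m\<^sub>j\<close>, and otherwise \<open>m\<^sub>j\<^sub>+\<^sub>1\<close>, \<open>(j/N) m\<^sub>j\<^sub>-\<^sub>1\<close> and \<open>(j/N) m\<^sub>j\<^sub>-\<^sub>2\<close> are at most a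
  constant times \<open>m\<^sub>j\<close>, so that \<open>m\<^sub>j\<close> grows faster than \<open>e\<^sub>j\<close>. Inserting the bound
  for \<open>e\<^sub>2\<close> into the inequality for \<open>e\<^sub>1\<close> gives the second claim.
\<close>

section \<open>Complex subspaces of complex Banach spaces\<close>

text \<open>Why the source of E_j is small: for i <= j < r the part of F^N with P_i P_r contributes
  exactly Q(F,F) in slot i, because V has trace zero. The time derivative of P_i removes this term
  with weight 1 and the interactions supply it with weight (N - j)/N, so only the weight j/N is
  left. Since F^N is symmetric, a product of factors P and 1 - P over all slots has a norm that
  depends only on the number of factors 1 - P; this closes the system of inequalities for the e_j.
  That F^N(t) stays symmetric is itself a step: V is only assumed to map symmetric elements to
  symmetric elements, so the interaction is known to commute with permutations on symmetric elements
  only. The trace zero of V is extracted from the vanishing marginal of V_{2,3}, which takes three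
  particles; N <= 2 is settled by counting terms. The constants enter through C_1 >= 58, C_2 >= 80,
  C_2 > C_0, B_2 > B_0, B_2 >= 4 and (C_1 - 2) B_2 >= 16 C_2^2.\<close>

lemma bounded_bilinear_scaleC: "bounded_bilinear (scaleC :: complex \<Rightarrow> 'a::cbanach \<Rightarrow> 'a)"
proof
  fix a a' :: complex and b b' :: 'a and r :: real
  show "(a + a') *\<^sub>C b = a *\<^sub>C b + a' *\<^sub>C b" by (rule scaleC_add_left)
  show "a *\<^sub>C (b + b') = a *\<^sub>C b + a *\<^sub>C b'" by (rule scaleC_add_right)
  show "(r *\<^sub>R a) *\<^sub>C b = r *\<^sub>R a *\<^sub>C b"
    by (simp add: scaleC_of_real[symmetric] scaleC_scaleC scaleR_conv_of_real)
  show "a *\<^sub>C r *\<^sub>R b = r *\<^sub>R a *\<^sub>C b"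
    by (simp add: scaleC_of_real[symmetric] scaleC_scaleC mult.commute)
  show "\<exists>K. \<forall>a b. norm (a *\<^sub>C (b::'a)) \<le> norm a * norm b * K"
    by (rule exI[of _ 1]) (simp add: norm_scaleC)
qed

lemmas tendsto_scaleC = bounded_bilinear.tendsto[OF bounded_bilinear_scaleC]

lemma scaleC_scaleR_commute: "c *\<^sub>C (r *\<^sub>R x) = r *\<^sub>R (c *\<^sub>C (x::'a::cbanach))"
  by (simp add: scaleC_of_real[symmetric] scaleC_scaleC mult.commute)

lemma scaleC_sum_right: "c *\<^sub>C (\<Sum>i\<in>I. f i) = (\<Sum>i\<in>I. c *\<^sub>C (f i :: 'a::cbanach))"
  by (rule cvec.scale_sum_right)

definition closed_csubspace :: "'a::cbanach set \<Rightarrow> bool" where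
  "closed_csubspace X \<longleftrightarrow> cvec.subspace X \<and> closed X"

lemma closed_csubspaceD:
  assumes "closed_csubspace X"
  shows "0 \<in> X" "x \<in> X \<Longrightarrow> y \<in> X \<Longrightarrow> x + y \<in> X" "x \<in> X \<Longrightarrow> c *\<^sub>C x \<in> X"
    "x \<in> X \<Longrightarrow> y \<in> X \<Longrightarrow> x - y \<in> X" "x \<in> X \<Longrightarrow> - x \<in> X" "x \<in> X \<Longrightarrow> r *\<^sub>R x \<in> X" "closed X"
  using assms unfolding closed_csubspace_def
  by (auto intro: cvec.subspace_0 cvec.subspace_add cvec.subspace_scale cvec.subspace_diff
      cvec.subspace_neg simp: scaleC_of_real[symmetric])

lemma closed_csubspace_sum:
  "closed_csubspace X \<Longrightarrow> (\<And>i. i \<in> I \<Longrightarrow> f i \<in> X) \<Longrightarrow> (\<Sum>i\<in>I. f i) \<in> X"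
  unfolding closed_csubspace_def by (auto intro: cvec.subspace_sum)

lemma closed_csubspace_closure:
  fixes D :: "'a::cbanach set"
  assumes "cvec.subspace D"
  shows "closed_csubspace (closure D)"
  unfolding closed_csubspace_def cvec.subspace_def
proof (intro conjI ballI allI)
  show "0 \<in> closure D"
    using assms closure_subset by (auto simp: cvec.subspace_def)
next
  fix x y assume "x \<in> closure D" "y \<in> closure D"
  then obtain f g where "\<And>n. f n \<in> D" "f \<longlonglongrightarrow> x" "\<And>n. g n \<in> D" "g \<longlonglongrightarrow> y"
    unfolding closure_sequential by metis
  then show "x + y \<in> closure D"
    unfolding closure_sequential using assms
    by (intro exI[of _ "\<lambda>n. f n + g n"]) (auto intro: tendsto_add simp: cvec.subspace_def)
next
  fix c x assume "x \<in> closure D"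
  then obtain f where "\<And>n. f n \<in> D" "f \<longlonglongrightarrow> x"
    unfolding closure_sequential by metis
  then show "c *\<^sub>C x \<in> closure D"
    unfolding closure_sequential using assms
    by (intro exI[of _ "\<lambda>n. c *\<^sub>C f n"]) (auto intro!: tendsto_scaleC simp: cvec.subspace_def)
qed simp

lemma clinear_onI:
  assumes "\<And>x y. x \<in> X \<Longrightarrow> y \<in> X \<Longrightarrow> f (x + y) = f x + f y"
    and "\<And>c x. x \<in> X \<Longrightarrow> f (c *\<^sub>C x) = c *\<^sub>C f x"
  shows "clinear_on X f"
  using assms by (auto simp: clinear_on_def)

lemma clinear_onD:
  assumes "clinear_on X f"
  shows clinear_on_add: "x \<in> X \<Longrightarrow> y \<in> X \<Longrightarrow> f (x + y) = f x + f y"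
    and clinear_on_scaleC: "x \<in> X \<Longrightarrow> f (c *\<^sub>C x) = c *\<^sub>C f x"
    and clinear_on_scaleR: "x \<in> X \<Longrightarrow> f (r *\<^sub>R x) = r *\<^sub>R f x"
  using assms by (auto simp: clinear_on_def scaleC_of_real[symmetric])

lemma clinear_on_zero:
  assumes "clinear_on X f" "closed_csubspace X"
  shows "f 0 = 0"
  using clinear_on_scaleR[OF assms(1), of 0 0] closed_csubspaceD(1)[OF assms(2)] by simp

lemma clinear_on_diff:
  assumes "clinear_on X f" "closed_csubspace X" "x \<in> X" "y \<in> X"
  shows "f (x - y) = f x - f y"
proof -
  have "f (x + (-1) *\<^sub>R y) = f x + (-1) *\<^sub>R f y"
    using assms by (simp only: clinear_onD closed_csubspaceD)
  then show ?thesis by simp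
qed

lemma clinear_on_sum:
  assumes "clinear_on X f" "closed_csubspace X" "\<And>i. i \<in> I \<Longrightarrow> g i \<in> X"
  shows "f (\<Sum>i\<in>I. g i) = (\<Sum>i\<in>I. f (g i))"
  using assms(3)
proof (induction I rule: infinite_finite_induct)
  case (insert i I)
  then have "g i \<in> X" "(\<Sum>i\<in>I. g i) \<in> X"
    by (auto intro: closed_csubspace_sum[OF assms(2)])
  with insert show ?case
    using clinear_on_add[OF assms(1)] by simp
qed (use clinear_on_zero[OF assms(1,2)] in auto)

lemma clinear_on_tendsto:
  assumes "clinear_on X L" "closed_csubspace X" "\<And>x. x \<in> X \<Longrightarrow> norm (L x) \<le> C * norm x"
    and "(f \<longlongrightarrow> a) F" "\<forall>\<^sub>F x in F. f x \<in> X" "a \<in> X"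
  shows "((\<lambda>x. L (f x)) \<longlongrightarrow> L a) F"
proof -
  have "((\<lambda>x. C * norm (f x - a)) \<longlongrightarrow> C * 0) F"
    using assms(4) by (intro tendsto_mult tendsto_const tendsto_norm_zero) (simp add: LIM_zero)
  then have "((\<lambda>x. norm (L (f x) - L a)) \<longlongrightarrow> 0) F"
  proof (rule Lim_null_comparison[rotated, OF tendsto_eq_rhs])
    show "\<forall>\<^sub>F x in F. norm (norm (L (f x) - L a)) \<le> C * norm (f x - a)"
      using assms(5) by eventually_elim
        (use assms in \<open>auto simp: clinear_on_diff[symmetric] closed_csubspaceD\<close>)
  qed simp
  then show ?thesis
    by (simp add: tendsto_norm_zero_iff LIM_zero_iff)
qed

lemma clinear_on_continuous_on:
  assumes "clinear_on X L" "closed_csubspace X" "\<And>x. x \<in> X \<Longrightarrow> norm (L x) \<le> C * norm x"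
  shows "continuous_on X L"
  unfolding continuous_on_def
proof
  fix x assume "x \<in> X"
  then show "(L \<longlongrightarrow> L x) (at x within X)"
    by (intro clinear_on_tendsto[OF assms, where f = "\<lambda>x. x"] tendsto_ident_at)
      (auto simp: eventually_at intro!: exI[of _ 1])
qed

text \<open>Used as an induction principle: the spaces below are closed spans of elementary tensors,
  so a property whose solutions form a closed subspace needs checking on those only.\<close>

lemma dense_subspace_induct:
  assumes "x \<in> closure (cvec.span B)" "\<And>b. b \<in> B \<Longrightarrow> b \<in> Y" "closed_csubspace Y"
  shows "x \<in> Y"
proof -
  have "closure (cvec.span B) \<subseteq> Y"
    using assms(2,3) by (intro closure_minimal cvec.span_minimal) (auto simp: closed_csubspace_def)
  with assms(1) show ?thesis by auto
qed

text \<open>The preimage of a closed subspace under a continuous linear map is again a closed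
  subspace, so \<open>dense_subspace_induct\<close> applies to it.\<close>

lemma clinear_on_dense_mem:
  assumes "clinear_on X f" "continuous_on X f" "X = closure (cvec.span B)"
    and "\<And>b. b \<in> B \<Longrightarrow> f b \<in> Y" "closed_csubspace Y" "x \<in> X"
  shows "f x \<in> Y"
proof -
  have X: "closed_csubspace X"
    using assms(3) closed_csubspace_closure[OF cvec.subspace_span] by simp
  have "x \<in> {x \<in> X. f x \<in> Y}"
  proof (rule dense_subspace_induct)
    show "x \<in> closure (cvec.span B)" using assms by simp
    show "b \<in> {x \<in> X. f x \<in> Y}" if "b \<in> B" for b
      using assms(3,4) that closure_subset cvec.span_superset by blast
    have "closed (f -` Y \<inter> X)"
      using assms X by (intro continuous_on_closed_vimage[THEN iffD1, rule_format])
        (auto simp: closed_csubspace_def)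
    moreover have "f -` Y \<inter> X = {x \<in> X. f x \<in> Y}" by auto
    ultimately show "closed_csubspace {x \<in> X. f x \<in> Y}"
      using closed_csubspaceD[OF X] closed_csubspaceD[OF assms(5)] clinear_on_zero[OF assms(1) X]
      by (auto simp: closed_csubspace_def cvec.subspace_def clinear_onD[OF assms(1)])
  qed
  then show ?thesis by simp
qed

lemma clinear_on_dense_eq:
  fixes f g :: "'a::cbanach \<Rightarrow> 'b::cbanach"
  assumes "clinear_on X f" "continuous_on X f" "clinear_on X g" "continuous_on X g"
    and "X = closure (cvec.span B)" "\<And>b. b \<in> B \<Longrightarrow> f b = g b" "x \<in> X"
  shows "f x = g x"
proof -
  have "f x - g x \<in> {0}"
  proof (rule clinear_on_dense_mem[where f = "\<lambda>x. f x - g x", OF _ _ assms(5)])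
    show "clinear_on X (\<lambda>x. f x - g x)"
      using assms(1,3) by (auto simp: clinear_on_def cvec.scale_right_diff_distrib)
    show "closed_csubspace {0::'b}"
      by (auto simp: closed_csubspace_def cvec.subspace_def)
  qed (use assms in \<open>auto intro: continuous_on_diff\<close>)
  then show ?thesis by simp
qed

text \<open>The extensions to the completions are given by their continuity and their values on a
  dense subspace; linearity there passes to limits of sequences.\<close>

lemma clinear_on_closure:
  assumes "cvec.subspace D" "continuous_on (closure D) f" "clinear_on D f"
  shows "clinear_on (closure D) f"
proof (rule clinear_onI)
  have seq: "(\<lambda>n. f (a n)) \<longlonglongrightarrow> f x" if "\<And>n. a n \<in> closure D" "a \<longlonglongrightarrow> x" "x \<in> closure D" for a x
    using assms(2) that unfolding continuous_on_sequentially comp_def by blast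
  have in_closure: "x \<in> D \<Longrightarrow> x \<in> closure D" for x
    using closure_subset by auto
  note ccs = closed_csubspaceD[OF closed_csubspace_closure[OF assms(1)]]
  fix x assume x: "x \<in> closure D"
  then obtain a where a: "\<And>n. a n \<in> D" "a \<longlonglongrightarrow> x"
    unfolding closure_sequential by metis
  show "f (c *\<^sub>C x) = c *\<^sub>C f x" for c
  proof (rule LIMSEQ_unique)
    show "(\<lambda>n. f (c *\<^sub>C a n)) \<longlonglongrightarrow> f (c *\<^sub>C x)"
      using x a ccs in_closure by (intro seq tendsto_scaleC tendsto_const) auto
    show "(\<lambda>n. f (c *\<^sub>C a n)) \<longlonglongrightarrow> c *\<^sub>C f x"
      using seq[OF in_closure[OF a(1)] a(2) x] assms(3) a(1)
      by (simp add: clinear_on_scaleC[OF assms(3)] tendsto_scaleC)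
  qed
  fix y assume y: "y \<in> closure D"
  then obtain b where b: "\<And>n. b n \<in> D" "b \<longlonglongrightarrow> y"
    unfolding closure_sequential by metis
  show "f (x + y) = f x + f y"
  proof (rule LIMSEQ_unique)
    show "(\<lambda>n. f (a n + b n)) \<longlonglongrightarrow> f (x + y)"
      using x y a b ccs in_closure by (intro seq tendsto_add) auto
    show "(\<lambda>n. f (a n + b n)) \<longlonglongrightarrow> f x + f y"
      using seq[OF in_closure[OF a(1)] a(2) x] seq[OF in_closure[OF b(1)] b(2) y] a(1) b(1)
      by (simp add: clinear_on_add[OF assms(3)] tendsto_add)
  qed
qed

section \<open>Integrals in closed subspaces\<close>

text \<open>The spaces are sets in one ambient type, so membership of an integral has to be shown:
  Riemann sums combine values at tags inside the interval and lie in \<open>X\<close>, which is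
  closed.\<close>

lemma integral_in_closed_csubspace:
  fixes g :: "real \<Rightarrow> 'a::cbanach"
  assumes X: "closed_csubspace X" and g: "continuous_on {a..b} g" "\<And>s. s \<in> {a..b} \<Longrightarrow> g s \<in> X"
  shows "integral {a..b} g \<in> X"
proof (rule closed_approachable[OF closed_csubspaceD(7)[OF X], THEN iffD1], intro allI impI)
  fix e :: real assume "e > 0"
  have "(g has_integral integral {a..b} g) (cbox a b)"
    using g(1) by (simp add: integrable_continuous_interval integrable_integral)
  from this[unfolded has_integral, rule_format, OF \<open>e > 0\<close>]
  obtain \<gamma> where \<gamma>: "gauge \<gamma>" and "\<forall>D. D tagged_division_of cbox a b \<and> \<gamma> fine D \<longrightarrow>
        norm ((\<Sum>(x, k)\<in>D. measure lborel k *\<^sub>R g x) - integral {a..b} g) < e"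
    by (elim exE conjE)
  then have small: "norm ((\<Sum>(x, k)\<in>D. measure lborel k *\<^sub>R g x) - integral {a..b} g) < e"
    if "D tagged_division_of cbox a b" "\<gamma> fine D" for D
    using that by blast
  obtain D where D: "D tagged_division_of cbox a b" "\<gamma> fine D"
    using fine_division_exists[OF \<gamma>] by blast
  have "(\<Sum>(x, k)\<in>D. measure lborel k *\<^sub>R g x) \<in> X"
    using tag_in_interval[OF D(1)] g(2)
    by (auto intro!: closed_csubspace_sum[OF X] closed_csubspaceD(6)[OF X])
  then show "\<exists>y\<in>X. dist y (integral {a..b} g) < e"
    using small[OF D] by (auto simp: dist_norm)
qed

text \<open>\<open>L\<close> is linear and bounded on \<open>X\<close> only. It maps Riemann sums in
  \<open>X\<close> to Riemann sums, and its bound turns the error of the first into an error of the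
  second.\<close>

lemma clinear_on_integral:
  fixes g :: "real \<Rightarrow> 'a::cbanach" and L :: "'a \<Rightarrow> 'b::cbanach"
  assumes X: "closed_csubspace X" and g: "continuous_on {a..b} g" "\<And>s. s \<in> {a..b} \<Longrightarrow> g s \<in> X"
    and L: "clinear_on X L" "\<And>x. x \<in> X \<Longrightarrow> norm (L x) \<le> C * norm x"
  shows "L (integral {a..b} g) = integral {a..b} (\<lambda>s. L (g s))"
proof -
  have "((\<lambda>s. L (g s)) has_integral L (integral {a..b} g)) (cbox a b)"
    unfolding has_integral
  proof (intro allI impI)
    fix e :: real assume "e > 0"
    \<comment> \<open>The sign of \<open>C\<close> is unknown; \<open>\<bar>C\<bar> + 1\<close> is a
      positive bound to divide by.\<close>
    then have e': "e / (\<bar>C\<bar> + 1) > 0" by simp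
    have "(g has_integral integral {a..b} g) (cbox a b)"
      using g(1) by (simp add: integrable_continuous_interval integrable_integral)
    from this[unfolded has_integral, rule_format, OF e']
    obtain \<gamma> where \<gamma>: "gauge \<gamma>" and "\<forall>D. D tagged_division_of cbox a b \<and> \<gamma> fine D \<longrightarrow>
          norm ((\<Sum>(x, k)\<in>D. measure lborel k *\<^sub>R g x) - integral {a..b} g) < e / (\<bar>C\<bar> + 1)"
      by (elim exE conjE)
    then have small: "norm ((\<Sum>(x, k)\<in>D. measure lborel k *\<^sub>R g x) - integral {a..b} g) < e / (\<bar>C\<bar> + 1)"
      if "D tagged_division_of cbox a b" "\<gamma> fine D" for D
      using that by blast
    have "norm ((\<Sum>(x, k)\<in>D. measure lborel k *\<^sub>R L (g x)) - L (integral {a..b} g)) < e"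
      if D: "D tagged_division_of cbox a b" "\<gamma> fine D" for D
    proof -
      let ?s = "\<Sum>(x, k)\<in>D. measure lborel k *\<^sub>R g x"
      have gX: "measure lborel k *\<^sub>R g x \<in> X" "g x \<in> X" if "(x, k) \<in> D" for x k
        using tag_in_interval[OF D(1) that] g(2) closed_csubspaceD(6)[OF X] by auto
      have s: "?s \<in> X" using gX by (auto intro!: closed_csubspace_sum[OF X])
      have I: "integral {a..b} g \<in> X" by (rule integral_in_closed_csubspace[OF X g])
      have "L ?s = (\<Sum>(x, k)\<in>D. measure lborel k *\<^sub>R L (g x))"
        by (subst clinear_on_sum[OF L(1) X])
          (use gX in \<open>auto simp: clinear_on_scaleR[OF L(1)] intro!: sum.cong\<close>)
      then have "norm ((\<Sum>(x, k)\<in>D. measure lborel k *\<^sub>R L (g x)) - L (integral {a..b} g))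
          = norm (L (?s - integral {a..b} g))"
        by (simp add: clinear_on_diff[OF L(1) X s I])
      also have "\<dots> \<le> C * norm (?s - integral {a..b} g)"
        using L(2) closed_csubspaceD(4)[OF X s I] by blast
      also have "\<dots> \<le> (\<bar>C\<bar> + 1) * norm (?s - integral {a..b} g)"
        by (intro mult_right_mono) auto
      also have "\<dots> < (\<bar>C\<bar> + 1) * (e / (\<bar>C\<bar> + 1))"
        using small[OF D] by (intro mult_strict_left_mono) auto
      finally show ?thesis by simp
    qed
    then show "\<exists>\<gamma>. gauge \<gamma> \<and> (\<forall>D. D tagged_division_of cbox a b \<and> \<gamma> fine D \<longrightarrow>
        norm ((\<Sum>(x, k)\<in>D. measure lborel k *\<^sub>R L (g x)) - L (integral {a..b} g)) < e)"
      using \<gamma> by blast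
  qed
  then show ?thesis
    by (metis box_real(2) integral_unique)
qed

section \<open>Right derivatives\<close>

text \<open>One-sided, because \<open>generator\<close> is a limit from the right and all
  derivatives below are read off from it.\<close>

definition has_right_derivative :: "(real \<Rightarrow> 'a::real_normed_vector) \<Rightarrow> real \<Rightarrow> 'a \<Rightarrow> bool" where
  "has_right_derivative f t d \<longleftrightarrow> ((\<lambda>h. (f (t + h) - f t) /\<^sub>R h) \<longlongrightarrow> d) (at_right 0)"

lemma integral_has_right_derivative:
  fixes g :: "real \<Rightarrow> 'a::banach"
  assumes g: "continuous_on {a..b} g" and t: "a \<le> t" "t < b"
  shows "has_right_derivative (\<lambda>u. integral {a..u} g) t (g t)"
proof -
  have "((\<lambda>u. integral {a..u} g) has_vector_derivative g t) (at t within {a..b})"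
    using integral_has_vector_derivative[OF g, of t] t by auto
  then have "((\<lambda>u. integral {a..u} g) has_vector_derivative g t) (at t within {t..b})"
    using t by (auto intro: has_vector_derivative_within_subset)
  then have "((\<lambda>u. (integral {a..u} g - integral {a..t} g - (u - t) *\<^sub>R g t) /\<^sub>R norm (u - t))
      \<longlongrightarrow> 0) (at_right t)"
    using t by (simp add: has_vector_derivative_def has_derivative_within at_within_Icc_at_right
        inverse_eq_divide diff_diff_eq)
  then have "((\<lambda>u. (integral {a..u} g - integral {a..t} g) /\<^sub>R (u - t) - g t) \<longlongrightarrow> 0) (at_right t)"
    by (rule Lim_transform_eventually)
      (auto simp: eventually_at_filter scaleR_diff_right intro!: always_eventually)
  then have "((\<lambda>u. (integral {a..u} g - integral {a..t} g) /\<^sub>R (u - t)) \<longlongrightarrow> g t) (at_right t)"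
    by (simp add: LIM_zero_iff)
  then show ?thesis
    unfolding has_right_derivative_def
    by (subst (asm) filterlim_at_right_to_0) (simp add: add.commute)
qed

lemma eventually_at_right_0_less: "b > 0 \<Longrightarrow> \<forall>\<^sub>F h in at_right (0::real). 0 < h \<and> h < b"
  by (auto simp: eventually_at_right_field)

text \<open>Mean value inequality for right derivatives. The times up to which the estimate holds
  with slack e (t - a) are closed under suprema by continuity, and before \<open>b\<close> the slack
  lets the estimate extend to the right.\<close>

lemma has_right_derivative_norm_bound:
  fixes f :: "real \<Rightarrow> 'a::real_normed_vector"
  assumes ab: "a \<le> b" and f: "continuous_on {a..b} f" and \<gamma>: "continuous_on {a..b} \<gamma>"
    and d: "\<And>t. a \<le> t \<Longrightarrow> t < b \<Longrightarrow> has_right_derivative f t (d t)"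
    and le: "\<And>t. a \<le> t \<Longrightarrow> t < b \<Longrightarrow> norm (d t) \<le> \<gamma> t"
  shows "norm (f b - f a) \<le> integral {a..b} \<gamma>"
proof -
  define \<Gamma> where "\<Gamma> = (\<lambda>t. integral {a..t} \<gamma>)"
  have "norm (f b - f a) \<le> \<Gamma> b + e * (b - a)" if e: "e > 0" for e
  proof -
    define \<psi> where "\<psi> t = norm (f t - f a) - \<Gamma> t - e * (t - a)" for t
    have cont: "continuous_on {a..b} \<psi>"
      unfolding \<psi>_def \<Gamma>_def
      by (intro continuous_intros f indefinite_integral_continuous_1 integrable_continuous_interval \<gamma>)
    define S where "S = {s \<in> {a..b}. \<forall>r\<in>{a..s}. \<psi> r \<le> 0}"
    have aS: "a \<in> S" using ab by (simp add: S_def \<psi>_def \<Gamma>_def)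
    define m where "m = Sup S"
    have bdd: "bdd_above S" by (auto simp: S_def intro!: bdd_aboveI[of _ b])
    have m: "a \<le> m" "m \<le> b"
      unfolding m_def using aS bdd by (auto intro!: cSup_upper cSup_least[of S b]) (auto simp: S_def)
    have below: "\<psi> r \<le> 0" if "a \<le> r" "r < m" for r
    proof -
      obtain s where "s \<in> S" "r < s"
        using less_cSup_iff[of S r] aS bdd \<open>r < m\<close> unfolding m_def by auto
      then show ?thesis using \<open>a \<le> r\<close> by (auto simp: S_def)
    qed
    have \<psi>m: "\<psi> m \<le> 0"
    proof (cases "m = a")
      case True
      then show ?thesis using aS ab by (auto simp: S_def)
    next
      case False
      then have "a < m" using m by simp
      have "continuous_on {a..m} \<psi>" using cont m by (auto intro: continuous_on_subset)
      then have "(\<psi> \<longlongrightarrow> \<psi> m) (at_left m)"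
        using \<open>a < m\<close> continuous_on_Icc_at_leftD by blast
      moreover have "\<forall>\<^sub>F r in at_left m. \<psi> r \<le> 0"
        using eventually_at_left_real[OF \<open>a < m\<close>] by eventually_elim (use below in auto)
      ultimately show ?thesis
        by (intro tendsto_upperbound[of \<psi> "\<psi> m"]) auto
    qed
    have "m = b"
    proof (rule ccontr)
      assume "m \<noteq> b"
      then have mb: "m < b" using m by simp
      have 1: "((\<lambda>h. norm ((f (m + h) - f m) /\<^sub>R h)) \<longlongrightarrow> norm (d m)) (at_right 0)"
        using d[OF m(1) mb] unfolding has_right_derivative_def by (rule tendsto_norm)
      have 2: "((\<lambda>h. (\<Gamma> (m + h) - \<Gamma> m) /\<^sub>R h) \<longlongrightarrow> \<gamma> m) (at_right 0)"
        using integral_has_right_derivative[OF \<gamma> m(1) mb]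
        unfolding has_right_derivative_def \<Gamma>_def .
      \<comment> \<open>The left side tends to a limit that is at most 0, hence below e: this is
        where the slack is spent.\<close>
      have "\<forall>\<^sub>F h in at_right 0. norm ((f (m + h) - f m) /\<^sub>R h) - (\<Gamma> (m + h) - \<Gamma> m) /\<^sub>R h < e"
        using le[OF m(1) mb] e by (intro order_tendstoD(2)[OF tendsto_diff[OF 1 2]]) simp
      then have "\<forall>\<^sub>F h in at_right 0. \<psi> (m + h) \<le> 0"
        using eventually_at_right_less[of "0::real"]
      proof eventually_elim
        case (elim h)
        have "norm ((f (m + h) - f m) /\<^sub>R h) = norm (f (m + h) - f m) / h"
          using elim by (simp add: divide_inverse mult.commute)
        with elim have "norm (f (m + h) - f m) - (\<Gamma> (m + h) - \<Gamma> m) \<le> e * h"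
          by (simp add: divide_simps mult.commute split: if_splits)
        moreover have "norm (f (m + h) - f a) \<le> norm (f (m + h) - f m) + norm (f m - f a)"
          by (metis dist_norm dist_triangle)
        ultimately show ?case
          using \<psi>m by (simp add: \<psi>_def algebra_simps)
      qed
      then obtain h0 where h0: "h0 > 0" "\<And>h. 0 < h \<Longrightarrow> h < h0 \<Longrightarrow> \<psi> (m + h) \<le> 0"
        unfolding eventually_at_right_field by force
      define h where "h = min (h0 / 2) (b - m)"
      have h: "0 < h" "h < h0" "m + h \<le> b"
        using h0 mb by (auto simp: h_def min_def)
      have "m + h \<in> S"
        unfolding S_def
      proof (intro CollectI conjI ballI)
        fix r assume r: "r \<in> {a..m + h}"
        show "\<psi> r \<le> 0"
        proof (cases r m rule: linorder_cases)
          case greater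
          then show ?thesis using h0(2)[of "r - m"] r h by auto
        qed (use below r \<psi>m in auto)
      qed (use m h in auto)
      then have "m + h \<le> m" using cSup_upper[of "m + h" S] bdd unfolding m_def by blast
      with h show False by simp
    qed
    with \<psi>m show ?thesis by (simp add: \<psi>_def)
  qed
  then have step: "norm (f b - f a) \<le> \<Gamma> b + e * (b - a)" if "e > 0" for e
    using that by blast
  have "norm (f b - f a) \<le> \<Gamma> b + e" if e: "e > 0" for e
  proof -
    \<comment> \<open>The added 1 keeps the denominator positive when a = b and makes the total
      slack at most e.\<close>
    have "norm (f b - f a) \<le> \<Gamma> b + e / (b - a + 1) * (b - a)"
      using ab e by (intro step) (auto intro!: divide_pos_pos)
    also have "e / (b - a + 1) * (b - a) \<le> e"
      using ab e by (auto simp: field_simps)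
    finally show ?thesis by simp
  qed
  then show ?thesis
    unfolding \<Gamma>_def by (rule field_le_epsilon)
qed

section \<open>Contraction semigroups\<close>

locale contraction_semigroup =
  fixes X :: "'b::cbanach set" and U :: "real \<Rightarrow> 'b \<Rightarrow> 'b"
  assumes X: "closed_csubspace X"
    and semigroup: "c0_semigroup X U"
    and contraction: "t \<ge> 0 \<Longrightarrow> x \<in> X \<Longrightarrow> norm (U t x) \<le> norm x"
begin

lemma U_in: "t \<ge> 0 \<Longrightarrow> x \<in> X \<Longrightarrow> U t x \<in> X"
  and U_clinear: "t \<ge> 0 \<Longrightarrow> clinear_on X (U t)"
  and U_zero: "x \<in> X \<Longrightarrow> U 0 x = x"
  and U_add: "s \<ge> 0 \<Longrightarrow> t \<ge> 0 \<Longrightarrow> x \<in> X \<Longrightarrow> U (s + t) x = U s (U t x)"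
  and U_cont: "x \<in> X \<Longrightarrow> continuous_on {0..} (\<lambda>t. U t x)"
  using semigroup by (auto simp: c0_semigroup_def bounded_clinear_on_def)

text \<open>Strong continuity gives the limit at a fixed vector; contractivity makes the maps
  equicontinuous, so the vector may vary too.\<close>

lemma tendsto_U:
  assumes "(\<tau> \<longlongrightarrow> t) F" "(x \<longlongrightarrow> a) F" "\<forall>\<^sub>F h in F. \<tau> h \<ge> 0" "\<forall>\<^sub>F h in F. x h \<in> X" "a \<in> X" "t \<ge> 0"
  shows "((\<lambda>h. U (\<tau> h) (x h)) \<longlongrightarrow> U t a) F"
proof -
  have 1: "((\<lambda>h. U (\<tau> h) a) \<longlongrightarrow> U t a) F"
    by (rule continuous_on_tendsto_compose[OF U_cont[OF assms(5)] assms(1)]) (use assms in auto)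
  have 2: "((\<lambda>h. U (\<tau> h) (x h) - U (\<tau> h) a) \<longlongrightarrow> 0) F"
  proof (rule Lim_null_comparison)
    show "\<forall>\<^sub>F h in F. norm (U (\<tau> h) (x h) - U (\<tau> h) a) \<le> norm (x h - a)"
      using assms(3,4)
    proof eventually_elim
      case (elim h)
      then show ?case
        using contraction[of "\<tau> h" "x h - a"] assms(5)
        by (simp add: clinear_on_diff[OF U_clinear X] closed_csubspaceD[OF X])
    qed
    show "((\<lambda>h. norm (x h - a)) \<longlongrightarrow> 0) F"
      using assms(2) by (intro tendsto_norm_zero) (simp add: LIM_zero)
  qed
  show ?thesis using tendsto_add[OF 2 1] by simp
qed

lemma continuous_on_U:
  assumes "continuous_on S \<tau>" "continuous_on S x" "\<And>s. s \<in> S \<Longrightarrow> \<tau> s \<ge> 0" "\<And>s. s \<in> S \<Longrightarrow> x s \<in> X"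
  shows "continuous_on S (\<lambda>s. U (\<tau> s) (x s))"
  unfolding continuous_on_def
proof
  fix s assume s: "s \<in> S"
  have ev: "\<forall>\<^sub>F h in at s within S. h \<in> S"
    by (simp add: eventually_at_filter)
  show "((\<lambda>s. U (\<tau> s) (x s)) \<longlongrightarrow> U (\<tau> s) (x s)) (at s within S)"
    using assms s ev by (intro tendsto_U) (auto simp: continuous_on_def elim: eventually_mono)
qed

text \<open>\<open>avg h x\<close> lies in the domain of the generator, which makes the regularized solutions
  classical.\<close>

definition avg :: "real \<Rightarrow> 'b \<Rightarrow> 'b" where
  "avg h x = integral {0..h} (\<lambda>r. U r x) /\<^sub>R h"

lemma U_cont_Icc: "x \<in> X \<Longrightarrow> a \<ge> 0 \<Longrightarrow> continuous_on {a..b} (\<lambda>r. U r x)"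
  by (rule continuous_on_subset[OF U_cont]) auto

lemma U_integrable: "x \<in> X \<Longrightarrow> a \<ge> 0 \<Longrightarrow> (\<lambda>r. U r x) integrable_on {a..b}"
  by (intro integrable_continuous_interval U_cont_Icc)

lemma avg_in: "x \<in> X \<Longrightarrow> avg h x \<in> X"
  unfolding avg_def
  by (intro closed_csubspaceD(6)[OF X] integral_in_closed_csubspace[OF X] U_cont_Icc U_in) auto

lemma norm_avg: "x \<in> X \<Longrightarrow> h > 0 \<Longrightarrow> norm (avg h x) \<le> norm x"
proof -
  assume x: "x \<in> X" and h: "h > 0"
  have "norm (integral {0..h} (\<lambda>r. U r x)) \<le> norm x * (h - 0)"
    by (intro integral_bound U_cont_Icc x contraction) (use h in auto)
  then show ?thesis
    using h by (simp add: avg_def field_simps)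
qed

lemma avg_clinear: "clinear_on X (avg h)"
proof (rule clinear_onI)
  fix x assume x: "x \<in> X"
  show "avg h (x + y) = avg h x + avg h y" if y: "y \<in> X" for y
  proof -
    have "integral {0..h} (\<lambda>r. U r (x + y)) = integral {0..h} (\<lambda>r. U r x + U r y)"
      by (intro integral_cong) (use x y in \<open>simp add: clinear_on_add[OF U_clinear]\<close>)
    also have "\<dots> = integral {0..h} (\<lambda>r. U r x) + integral {0..h} (\<lambda>r. U r y)"
      by (intro integral_add U_integrable x y) auto
    finally show ?thesis by (simp add: avg_def scaleR_add_right)
  qed
  show "avg h (c *\<^sub>C x) = c *\<^sub>C avg h x" for c
  proof -
    have "integral {0..h} (\<lambda>r. U r (c *\<^sub>C x)) = integral {0..h} (\<lambda>r. c *\<^sub>C U r x)"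
      by (intro integral_cong) (use x in \<open>simp add: clinear_on_scaleC[OF U_clinear]\<close>)
    also have "\<dots> = c *\<^sub>C integral {0..h} (\<lambda>r. U r x)"
      by (rule clinear_on_integral[OF X U_cont_Icc[OF x] U_in, where C = "cmod c", symmetric])
        (use x in \<open>auto intro: clinear_onI simp: scaleC_add_right scaleC_scaleC mult.commute norm_scaleC\<close>)
    finally show ?thesis by (simp add: avg_def scaleC_scaleR_commute)
  qed
qed

lemma avg_commute:
  assumes x: "x \<in> X" and t: "t \<ge> 0"
  shows "U t (avg h x) = avg h (U t x)"
proof -
  have "U t (integral {0..h} (\<lambda>r. U r x)) = integral {0..h} (\<lambda>r. U t (U r x))"
    by (rule clinear_on_integral[OF X U_cont_Icc[OF x] U_in U_clinear[OF t], where C = 1])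
      (use x t contraction in auto)
  also have "\<dots> = integral {0..h} (\<lambda>r. U r (U t x))"
    by (intro integral_cong) (use x t in \<open>simp add: U_add[symmetric] add.commute\<close>)
  finally show ?thesis
    unfolding avg_def using x
    by (subst clinear_on_scaleR[OF U_clinear[OF t]])
      (auto intro!: integral_in_closed_csubspace[OF X] U_cont_Icc U_in)
qed

lemma integral_shift:
  fixes g :: "real \<Rightarrow> 'b"
  assumes "continuous_on {a + c..b + c} g"
  shows "integral {a..b} (\<lambda>s. g (s + c)) = integral {a + c..b + c} g"
proof -
  have "(g has_integral integral {a + c..b + c} g) (cbox (a + c) (b + c))"
    using integrable_integral[OF integrable_continuous_interval[OF assms]] by simp
  from has_integral_affinity'[OF this, of 1 c]
  have "((\<lambda>s. g (s + c)) has_integral integral {a + c..b + c} g) {a..b}"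
    by simp
  then show ?thesis by (rule integral_unique)
qed

lemma integral_average_tendsto:
  fixes g :: "real \<Rightarrow> 'b"
  assumes "continuous_on {a..} g"
  shows "((\<lambda>d. integral {a..a + d} g /\<^sub>R d) \<longlongrightarrow> g a) (at_right 0)"
proof -
  have "continuous_on {a..a + 1} g" using assms by (rule continuous_on_subset) auto
  from integral_has_right_derivative[OF this, of a]
  show ?thesis by (simp add: has_right_derivative_def)
qed

lemma avg_tendsto: "x \<in> X \<Longrightarrow> ((\<lambda>h. avg h x) \<longlongrightarrow> x) (at_right 0)"
  using integral_average_tendsto[OF U_cont] by (simp add: avg_def U_zero)

text \<open>U d shifts the interval of integration by d, so in the difference quotient only the
  averages over {h..h + d} and {0..d} survive; they tend to U h x and x.\<close>

lemma avg_generator: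
  assumes x: "x \<in> X" and h: "h > 0"
  shows "(avg h x, (U h x - x) /\<^sub>R h) \<in> generator X U"
proof -
  let ?I = "\<lambda>a b. integral {a..b} (\<lambda>r. U r x)"
  have eq: "(U d (avg h x) - avg h x) /\<^sub>R d = (?I h (h + d) /\<^sub>R d - ?I 0 (0 + d) /\<^sub>R d) /\<^sub>R h"
    if d: "d > 0" for d
  proof -
    have "U d (?I 0 h) = integral {0..h} (\<lambda>r. U d (U r x))"
      using clinear_on_integral[OF X U_cont_Icc[OF x, of 0 h] U_in U_clinear[of d], where C = 1] x d
      by (simp add: contraction)
    also have "\<dots> = integral {0..h} (\<lambda>r. U (r + d) x)"
      using x d by (intro integral_cong) (simp add: U_add[symmetric] add.commute)
    also have "\<dots> = ?I d (h + d)"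
      using integral_shift[where g = "\<lambda>r. U r x" and a = 0 and b = h and c = d] x d
      by (simp add: U_cont_Icc)
    also have "\<dots> = ?I 0 (h + d) - ?I 0 d"
      using Henstock_Kurzweil_Integration.integral_combine[of 0 d "h + d" "\<lambda>r. U r x"] U_integrable[OF x] d h by (simp add: algebra_simps)
    also have "?I 0 (h + d) = ?I 0 h + ?I h (h + d)"
      using Henstock_Kurzweil_Integration.integral_combine[of 0 h "h + d" "\<lambda>r. U r x"] U_integrable[OF x] d h by simp
    finally have "U d (?I 0 h) - ?I 0 h = ?I h (h + d) - ?I 0 d" by simp
    moreover have "U d (avg h x) = U d (?I 0 h) /\<^sub>R h"
      unfolding avg_def using x d
      by (subst clinear_on_scaleR[OF U_clinear])
        (auto intro!: integral_in_closed_csubspace[OF X] U_cont_Icc U_in)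
    ultimately have "U d (avg h x) - avg h x = (?I h (h + d) - ?I 0 d) /\<^sub>R h"
      by (simp add: avg_def scaleR_diff_right[symmetric])
    then show ?thesis by (simp add: scaleR_diff_right mult.commute)
  qed
  have "((\<lambda>d. (?I h (h + d) /\<^sub>R d - ?I 0 (0 + d) /\<^sub>R d) /\<^sub>R h) \<longlongrightarrow> (U h x - U 0 x) /\<^sub>R h) (at_right 0)"
    by (intro tendsto_scaleR tendsto_const tendsto_diff integral_average_tendsto
        continuous_on_subset[OF U_cont[OF x]]) (use h in auto)
  then have "((\<lambda>d. (U d (avg h x) - avg h x) /\<^sub>R d) \<longlongrightarrow> (U h x - U 0 x) /\<^sub>R h) (at_right 0)"
    by (rule Lim_transform_eventually)
      (use eq eventually_at_right_less[of "0::real"] in \<open>auto elim: eventually_mono\<close>)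
  then show ?thesis
    using x by (simp add: generator_def avg_in U_zero)
qed

lemma generator_in:
  assumes "(x, y) \<in> generator X U"
  shows "x \<in> X" "y \<in> X"
proof -
  from assms have x: "x \<in> X" and lim: "((\<lambda>h. (U h x - x) /\<^sub>R h) \<longlongrightarrow> y) (at_right 0)"
    by (auto simp: generator_def)
  show "x \<in> X" by fact
  show "y \<in> X"
  proof (rule Lim_in_closed_set[OF closed_csubspaceD(7)[OF X] _ _ lim])
    show "\<forall>\<^sub>F h in at_right 0. (U h x - x) /\<^sub>R h \<in> X"
      using eventually_at_right_less[of "0::real"]
      by eventually_elim (use x in \<open>auto intro!: closed_csubspaceD[OF X] U_in\<close>)
  qed simp
qed

text \<open>U (t + h) factors as U t U h and as U h U t: the first gives the derivative of the
  orbit, the second that the orbit stays in the domain.\<close>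

lemma orbit_right_derivative:
  assumes "(x, y) \<in> generator X U" "t \<ge> 0"
  shows "has_right_derivative (\<lambda>t. U t x) t (U t y)" "(U t x, U t y) \<in> generator X U"
proof -
  note x = generator_in[OF assms(1)]
  have "((\<lambda>h. U t ((U h x - x) /\<^sub>R h)) \<longlongrightarrow> U t y) (at_right 0)"
    using assms x eventually_at_right_less[of "0::real"]
    by (intro tendsto_U) (auto simp: generator_def intro!: closed_csubspaceD[OF X] U_in elim: eventually_mono)
  then have lim: "((\<lambda>h. (U (t + h) x - U t x) /\<^sub>R h) \<longlongrightarrow> U t y) (at_right 0)"
  proof (rule Lim_transform_eventually)
    show "\<forall>\<^sub>F h in at_right 0. U t ((U h x - x) /\<^sub>R h) = (U (t + h) x - U t x) /\<^sub>R h"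
      using eventually_at_right_less[of "0::real"]
      by eventually_elim
        (use x assms(2) in \<open>simp add: clinear_on_scaleR[OF U_clinear] clinear_on_diff[OF U_clinear X]
          U_in U_add closed_csubspaceD[OF X]\<close>)
  qed
  then show "has_right_derivative (\<lambda>t. U t x) t (U t y)"
    by (simp add: has_right_derivative_def)
  have "((\<lambda>h. (U h (U t x) - U t x) /\<^sub>R h) \<longlongrightarrow> U t y) (at_right 0)"
    by (rule Lim_transform_eventually[OF lim])
      (use x assms(2) eventually_at_right_less[of "0::real"] in
        \<open>auto simp: U_add[symmetric] add.commute elim: eventually_mono\<close>)
  then show "(U t x, U t y) \<in> generator X U"
    using x assms(2) by (simp add: generator_def U_in)
qed

text \<open>The hypotheses say w' = G w + g through the graph of the generator G. In the derivative
  of s |-> U (T - s) (w s) the generator cancels, and U (T - s) (g s) remains, which contractivity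
  bounds by \<gamma>.\<close>

lemma duhamel_norm_bound:
  assumes T: "T \<ge> 0" and w: "continuous_on {0..T} w" "w T \<in> X"
    and d: "\<And>t. 0 \<le> t \<Longrightarrow> t < T \<Longrightarrow> has_right_derivative w t (y t)"
    and gen: "\<And>t. 0 \<le> t \<Longrightarrow> t < T \<Longrightarrow> (w t, y t - g t) \<in> generator X U"
    and \<gamma>: "continuous_on {0..T} \<gamma>" "\<And>t. 0 \<le> t \<Longrightarrow> t < T \<Longrightarrow> norm (g t) \<le> \<gamma> t"
  shows "norm (w T) \<le> norm (w 0) + integral {0..T} \<gamma>"
proof -
  have wX: "w t \<in> X" if "0 \<le> t" "t \<le> T" for t
    using generator_in[OF gen[of t]] w(2) that by (cases "t = T") auto
  define \<phi> where "\<phi> s = U (T - s) (w s)" for s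
  have "norm (\<phi> T - \<phi> 0) \<le> integral {0..T} \<gamma>"
  proof (rule has_right_derivative_norm_bound[OF T _ \<gamma>(1)])
    show "continuous_on {0..T} \<phi>"
      unfolding \<phi>_def by (intro continuous_on_U continuous_intros w) (use wX in auto)
    fix t assume t: "0 \<le> t" "t < T"
    \<comment> \<open>Subtracting the two difference quotients cancels w t and compares w (t + h)
      with U h (w t).\<close>
    have lim: "((\<lambda>h. (w (t + h) - w t) /\<^sub>R h - (U h (w t) - w t) /\<^sub>R h) \<longlongrightarrow> y t - (y t - g t)) (at_right 0)"
      using d[OF t] gen[OF t] by (intro tendsto_diff) (auto simp: has_right_derivative_def generator_def)
    have lim': "((\<lambda>h. (w (t + h) - U h (w t)) /\<^sub>R h) \<longlongrightarrow> g t) (at_right 0)"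
      using lim by (simp add: scaleR_diff_right)
    have ev: "\<forall>\<^sub>F h in at_right 0. 0 < h \<and> h < T - t"
      using t by (intro eventually_at_right_0_less) simp
    have ev': "\<forall>\<^sub>F h in at_right 0. (w (t + h) - U h (w t)) /\<^sub>R h \<in> X"
      using ev by eventually_elim (use t wX in \<open>auto intro!: closed_csubspaceD[OF X] U_in\<close>)
    \<comment> \<open>The hypotheses do not place g t in \<open>X\<close>; it is a limit of elements
      of \<open>X\<close>.\<close>
    have gX: "g t \<in> X"
      using lim' ev' by (intro Lim_in_closed_set[OF closed_csubspaceD(7)[OF X], where F = "at_right (0::real)"]) auto
    have "((\<lambda>h. U (T - t - h) ((w (t + h) - U h (w t)) /\<^sub>R h)) \<longlongrightarrow> U (T - t) (g t)) (at_right 0)"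
    proof (rule tendsto_U[OF _ lim' _ ev' gX])
      have "((\<lambda>h. T - t - h) \<longlongrightarrow> T - t - 0) (at_right 0)" by (intro tendsto_intros)
      then show "((\<lambda>h. T - t - h) \<longlongrightarrow> T - t) (at_right 0)" by simp
    qed (use ev t in \<open>auto elim: eventually_mono\<close>)
    then show "has_right_derivative \<phi> t (U (T - t) (g t))"
      unfolding has_right_derivative_def
    proof (rule Lim_transform_eventually)
      show "\<forall>\<^sub>F h in at_right 0. U (T - t - h) ((w (t + h) - U h (w t)) /\<^sub>R h) = (\<phi> (t + h) - \<phi> t) /\<^sub>R h"
        using ev
      proof eventually_elim
        case (elim h)
        then have "U (T - t - h) (U h (w t)) = U (T - t) (w t)"
          using U_add[of "T - t - h" h "w t"] wX t by simp
        then show ?case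
          using elim wX t
          by (simp add: clinear_on_scaleR[OF U_clinear] clinear_on_diff[OF U_clinear X]
              U_in closed_csubspaceD[OF X] \<phi>_def diff_diff_eq)
      qed
    qed
    show "norm (U (T - t) (g t)) \<le> \<gamma> t"
      using contraction[OF _ gX, of "T - t"] \<gamma>(2)[OF t] t by simp
  qed
  moreover have "\<phi> T = w T" "norm (\<phi> 0) \<le> norm (w 0)"
    using T wX contraction[of T "w 0"] by (auto simp: \<phi>_def U_zero)
  moreover have "norm (\<phi> T) \<le> norm (\<phi> T - \<phi> 0) + norm (\<phi> 0)"
    by (metis norm_triangle_sub add.commute)
  ultimately show ?thesis by simp
qed

text \<open>Restart at time t: the integral splits at t, and U h moves into its first part.\<close>

lemma mild_solution_step:
  assumes u: "\<And>t. t \<ge> 0 \<Longrightarrow> u t = U t u0 + integral {0..t} (\<lambda>s. U (t - s) (f s))"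
    and u0: "u0 \<in> X" and f: "continuous_on {0..} f" "\<And>s. s \<ge> 0 \<Longrightarrow> f s \<in> X"
    and t: "t \<ge> 0" and h: "h \<ge> 0"
  shows "u (t + h) = U h (u t) + integral {0..h} (\<lambda>s. U (h - s) (f (t + s)))"
proof -
  have cont: "continuous_on {a..b} (\<lambda>s. U (r - s) (f s))" if "a \<ge> 0" "b \<le> r" for a b r
    by (intro continuous_on_U continuous_intros continuous_on_subset[OF f(1)]) (use that f in auto)
  have in1: "integral {0..t} (\<lambda>s. U (t - s) (f s)) \<in> X"
    by (intro integral_in_closed_csubspace[OF X] cont U_in f) auto
  have "U h (integral {0..t} (\<lambda>s. U (t - s) (f s))) = integral {0..t} (\<lambda>s. U h (U (t - s) (f s)))"
    by (rule clinear_on_integral[OF X _ _ U_clinear[OF h], where C = 1])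
      (use cont f h contraction in \<open>auto intro: U_in\<close>)
  also have "\<dots> = integral {0..t} (\<lambda>s. U (t + h - s) (f s))"
    by (intro integral_cong) (use h f in \<open>simp add: U_add[symmetric] algebra_simps\<close>)
  finally have "U h (u t) = U (t + h) u0 + integral {0..t} (\<lambda>s. U (t + h - s) (f s))"
    using t h u0 in1 by (simp add: u clinear_on_add[OF U_clinear] U_in U_add[symmetric] add.commute)
  moreover have "integral {0..h} (\<lambda>s. U (h - s) (f (t + s)))
      = integral {t..t + h} (\<lambda>s. U (t + h - s) (f s))"
    using integral_shift[where g = "\<lambda>s. U (t + h - s) (f s)" and a = 0 and b = h and c = t] cont t
    by (simp add: add.commute)
  moreover have "integral {0..t} (\<lambda>s. U (t + h - s) (f s)) + integral {t..t + h} (\<lambda>s. U (t + h - s) (f s))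
      = integral {0..t + h} (\<lambda>s. U (t + h - s) (f s))"
    using t h by (intro Henstock_Kurzweil_Integration.integral_combine integrable_continuous_interval cont) auto
  ultimately show ?thesis
    using t h by (simp add: u add.assoc)
qed

text \<open>A mild solution need not be differentiable, but its average is. By
  \<open>mild_solution_step\<close> an increment is U d (u t) - u t plus R d; averaging turns the
  first part into the increment of an orbit that starts in the domain, and R d / d tends to f
  t.\<close>

lemma avg_mild_solution_right_derivative:
  assumes u: "\<And>t. t \<ge> 0 \<Longrightarrow> u t = U t u0 + integral {0..t} (\<lambda>s. U (t - s) (f s))"
    and uX: "\<And>t. t \<ge> 0 \<Longrightarrow> u t \<in> X"
    and u0: "u0 \<in> X" and f: "continuous_on {0..} f" "\<And>s. s \<ge> 0 \<Longrightarrow> f s \<in> X"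
    and t: "t \<ge> 0" and h: "h > 0"
  shows "has_right_derivative (\<lambda>t. avg h (u t)) t ((U h (u t) - u t) /\<^sub>R h + avg h (f t))"
proof -
  define R where "R d = integral {0..d} (\<lambda>s. U (d - s) (f (t + s)))" for d
  have RX: "R d \<in> X" for d
    unfolding R_def
    by (intro integral_in_closed_csubspace[OF X] continuous_on_U continuous_intros
        continuous_on_compose2[OF f(1)] U_in f) (use t in auto)
  have Rlim: "((\<lambda>d. R d /\<^sub>R d) \<longlongrightarrow> f t) (at_right 0)"
  proof (rule tendstoI)
    fix e :: real assume e: "e > 0"
    \<comment> \<open>Joint continuity in both times is needed, because in R d the semigroup time d
      - s and the time t + s of f vary together.\<close>
    have lim: "((\<lambda>p. U (fst p) (f (t + snd p))) \<longlongrightarrow> U 0 (f t)) (at (0, 0) within {0..} \<times> {0..})"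
    proof (rule tendsto_U)
      show "(fst \<longlongrightarrow> 0) (at (0, 0) within {0::real..} \<times> {0::real..})"
        using tendsto_fst[OF tendsto_ident_at] by fastforce
      have "((\<lambda>p. t + snd p) \<longlongrightarrow> t + 0) (at (0, 0) within {0::real..} \<times> {0::real..})"
        using tendsto_snd[OF tendsto_ident_at] by (intro tendsto_add tendsto_const) fastforce
      then show "((\<lambda>p. f (t + snd p)) \<longlongrightarrow> f t) (at (0, 0) within {0::real..} \<times> {0::real..})"
        by (intro continuous_on_tendsto_compose[OF f(1)])
          (use t in \<open>auto simp: eventually_at intro!: exI[of _ 1]\<close>)
    qed (use t f in \<open>auto simp: eventually_at intro!: exI[of _ 1]\<close>)
    then have "\<forall>\<^sub>F p in at (0, 0) within {0..} \<times> {0..}. dist (U (fst p) (f (t + snd p))) (f t) < e / 2"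
      using e f t by (auto simp: U_zero dest!: tendstoD[of _ _ _ "e / 2"])
    then obtain \<delta> where \<delta>: "\<delta> > 0" "\<And>p. p \<in> {0..} \<times> {0..} \<Longrightarrow> p \<noteq> (0, 0) \<Longrightarrow> dist p (0, 0) < \<delta> \<Longrightarrow>
        dist (U (fst p) (f (t + snd p))) (f t) < e / 2"
      unfolding eventually_at by blast
    have near: "norm (U a (f (t + b)) - f t) \<le> e / 2" if "a \<ge> 0" "b \<ge> 0" "a + b < \<delta>" for a b
    proof (cases "(a, b) = (0, 0)")
      case True
      then show ?thesis using e f t by (simp add: U_zero)
    next
      case False
      have "dist (a, b) (0, 0) \<le> a + b"
        using that sqrt_sum_squares_le_sum[of a b] by (simp add: dist_prod_def dist_real_def)
      then show ?thesis
        using \<delta>(2)[of "(a, b)"] that False by (auto simp: dist_norm)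
    qed
    show "\<forall>\<^sub>F d in at_right 0. dist (R d /\<^sub>R d) (f t) < e"
      using eventually_at_right_0_less[OF \<delta>(1)]
    proof eventually_elim
      case (elim d)
      have cont: "continuous_on {0..d} (\<lambda>s. U (d - s) (f (t + s)))"
        by (intro continuous_on_U continuous_intros continuous_on_compose2[OF f(1)] f) (use t in auto)
      have "R d - d *\<^sub>R f t = integral {0..d} (\<lambda>s. U (d - s) (f (t + s)) - f t)"
        unfolding R_def using elim by (subst integral_diff) (auto intro!: integrable_continuous_interval cont)
      moreover have "norm (integral {0..d} (\<lambda>s. U (d - s) (f (t + s)) - f t)) \<le> e / 2 * (d - 0)"
        by (intro integral_bound continuous_intros cont) (use elim near in auto)
      ultimately have le: "norm (R d - d *\<^sub>R f t) \<le> e / 2 * d" by simp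
      have "R d /\<^sub>R d - f t = (R d - d *\<^sub>R f t) /\<^sub>R d"
        using elim by (simp add: scaleR_diff_right)
      then have "norm (R d /\<^sub>R d - f t) = norm (R d - d *\<^sub>R f t) / d"
        using elim by (simp add: divide_inverse mult.commute)
      also have "\<dots> \<le> e / 2"
        using le elim by (simp add: divide_le_eq)
      finally have "norm (R d /\<^sub>R d - f t) \<le> e / 2" .
      then show ?case using e by (simp add: dist_norm)
    qed
  qed
  have "((\<lambda>d. (U d (avg h (u t)) - avg h (u t)) /\<^sub>R d + avg h (R d /\<^sub>R d))
      \<longlongrightarrow> (U h (u t) - u t) /\<^sub>R h + avg h (f t)) (at_right 0)"
  proof (intro tendsto_add)
    show "((\<lambda>d. (U d (avg h (u t)) - avg h (u t)) /\<^sub>R d) \<longlongrightarrow> (U h (u t) - u t) /\<^sub>R h) (at_right 0)"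
      using avg_generator[OF uX[OF t] h] by (simp add: generator_def)
    show "((\<lambda>d. avg h (R d /\<^sub>R d)) \<longlongrightarrow> avg h (f t)) (at_right 0)"
      by (rule clinear_on_tendsto[OF avg_clinear X _ Rlim, where C = 1])
        (use norm_avg h RX f t in \<open>auto intro!: always_eventually closed_csubspaceD(6)[OF X]\<close>)
  qed
  then show ?thesis
    unfolding has_right_derivative_def
  proof (rule Lim_transform_eventually)
    show "\<forall>\<^sub>F d in at_right 0. (U d (avg h (u t)) - avg h (u t)) /\<^sub>R d + avg h (R d /\<^sub>R d)
        = (avg h (u (t + d)) - avg h (u t)) /\<^sub>R d"
      using eventually_at_right_less[of "0::real"]
    proof eventually_elim
      case (elim d)
      have "u (t + d) = U d (u t) + R d"
        unfolding R_def using elim t by (intro mild_solution_step[OF u u0 f]) auto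
      then show ?case
        using elim uX[OF t] RX
        by (simp add: clinear_on_add[OF avg_clinear] clinear_on_scaleR[OF avg_clinear] U_in
            avg_commute[symmetric] algebra_simps)
    qed
  qed
qed

end

text \<open>\<open>onorm_on\<close> is a supremum of reals and informative only for a set bounded
  above; boundedness of \<open>f\<close> supplies this, and rescaling to norm 1 does the
  rest.\<close>

lemma onorm_on_bound:
  assumes "bounded_clinear_on X Y f" "closed_csubspace X" "x \<in> X"
  shows "norm (f x) \<le> onorm_on X f * norm x"
proof -
  obtain C where C: "\<And>x. x \<in> X \<Longrightarrow> norm (f x) \<le> C * norm x"
    using assms(1) by (auto simp: bounded_clinear_on_def)
  have lin: "clinear_on X f" using assms(1) by (simp add: bounded_clinear_on_def)
  have bdd: "bdd_above ((\<lambda>x. norm (f x)) ` {x \<in> X. norm x \<le> 1})"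
  proof (intro bdd_aboveI2)
    fix x assume x: "x \<in> {x \<in> X. norm x \<le> 1}"
    have "norm (f x) \<le> \<bar>C\<bar> * norm x" using C[of x] x
      by (smt (verit, best) mem_Collect_eq mult_right_mono norm_ge_zero)
    also have "\<dots> \<le> \<bar>C\<bar> * 1" using x by (intro mult_left_mono) auto
    finally show "norm (f x) \<le> \<bar>C\<bar>" by simp
  qed
  show ?thesis
  proof (cases "x = 0")
    case True
    then show ?thesis using C[OF assms(3)] by simp
  next
    case False
    have "norm (f (x /\<^sub>R norm x)) \<le> onorm_on X f"
      unfolding onorm_on_def
      by (rule cSUP_upper[OF _ bdd]) (use assms(3) False closed_csubspaceD(6)[OF assms(2)] in auto)
    then show ?thesis
      using False assms(3) by (simp add: clinear_on_scaleR[OF lin] field_simps)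
  qed
qed

section \<open>Elementary tensors of vectors\<close>

lemma cinner_add_left: "cinner (x + y) z = cinner x z + cinner y (z::'h::chilbert)"
  by (metis cinner_add_right cinner_commute complex_cnj_add)

lemma cinner_scaleC_left: "cinner (c *\<^sub>C x) z = cnj c * cinner x (z::'h::chilbert)"
  by (metis cinner_commute cinner_scaleC_right complex_cnj_mult)

lemma cinner_zero_left [simp]: "cinner 0 (z::'h::chilbert) = 0"
  using cinner_scaleC_left[of 0 "0::'h" z] by simp

lemma Re_cinner_eq_norms:
  "Re (cinner x y) = ((norm (x + y))\<^sup>2 - (norm x)\<^sup>2 - (norm y)\<^sup>2) / 2" for x y :: "'h::chilbert"
proof -
  have "complex_of_real ((norm (x + y))\<^sup>2) = cinner x x + cinner y y + (cinner x y + cnj (cinner x y))"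
    using cinner_commute[of y x]
    by (simp only: cinner_self[symmetric] cinner_add_left cinner_add_right) simp
  from arg_cong[OF this, of Re] show ?thesis
    by (simp add: cinner_self)
qed

text \<open>Polarization writes the inner product through norms, from which its continuity is read
  off in \<open>tendsto_cinner\<close>. The imaginary part is the real part of the inner product of
  x with - i y.\<close>

lemma cinner_eq_norms:
  fixes x y :: "'h::chilbert"
  shows "cinner x y = Complex (((norm (x + y))\<^sup>2 - (norm x)\<^sup>2 - (norm y)\<^sup>2) / 2)
    (((norm (x + (- \<i>) *\<^sub>C y))\<^sup>2 - (norm x)\<^sup>2 - (norm ((- \<i>) *\<^sub>C y))\<^sup>2) / 2)"
  by (simp only: complex_eq_iff Re_cinner_eq_norms[symmetric] cinner_scaleC_right) simp

lemma tendsto_cinner: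
  fixes f g :: "'a \<Rightarrow> 'h::chilbert"
  assumes "(f \<longlongrightarrow> a) F" "(g \<longlongrightarrow> b) F"
  shows "((\<lambda>x. cinner (f x) (g x)) \<longlongrightarrow> cinner a b) F"
  unfolding cinner_eq_norms[of "f _"] cinner_eq_norms[of a]
  by (intro tendsto_intros tendsto_scaleC assms) auto

lemma closure_eqI:
  fixes f g :: "'a::first_countable_topology \<Rightarrow> 'b::t2_space"
  assumes "continuous_on (closure D) f" "continuous_on (closure D) g"
    and "\<And>x. x \<in> D \<Longrightarrow> f x = g x" "x \<in> closure D"
  shows "f x = g x"
proof -
  obtain a where a: "\<And>n. a n \<in> D" "a \<longlonglongrightarrow> x"
    using assms(4) closure_sequential by metis
  have "a n \<in> closure D" for n using a(1) closure_subset by blast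
  then have "(\<lambda>n. f (a n)) \<longlonglongrightarrow> f x" "(\<lambda>n. g (a n)) \<longlonglongrightarrow> g x"
    using assms(4) a(2)
    by (auto intro: continuous_on_tendsto_compose[OF assms(1)] continuous_on_tendsto_compose[OF assms(2)])
  then show ?thesis using assms(3) a(1) LIMSEQ_unique by fastforce
qed

lemma closure_leI:
  fixes f g :: "'a::first_countable_topology \<Rightarrow> real"
  assumes "continuous_on (closure D) f" "continuous_on (closure D) g"
    and "\<And>x. x \<in> D \<Longrightarrow> f x \<le> g x" "x \<in> closure D"
  shows "f x \<le> g x"
proof -
  have "max (f x) (g x) = g x"
    by (rule closure_eqI[OF _ assms(2) _ assms(4), where f = "\<lambda>x. max (f x) (g x)"])
      (use assms in \<open>auto intro: continuous_on_max\<close>)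
  then show ?thesis by simp
qed

lemma prod_Icc_1_Suc:
  fixes h :: "nat \<Rightarrow> 'a::comm_monoid_mult"
  shows "(\<Prod>i\<in>{1..Suc n}. h i) = h 1 * (\<Prod>i\<in>{1..n}. h (Suc i))"
  by (induction n) (auto simp: mult_ac)

text \<open>Slots are numbered from 1 and filled by a function, so that permuting slots is
  composition with a permutation and changing one slot is a function update.\<close>

definition tprod_fun :: "(nat \<Rightarrow> nat \<Rightarrow> 'a \<Rightarrow> 'a \<Rightarrow> 'a) \<Rightarrow> nat \<Rightarrow> (nat \<Rightarrow> 'a) \<Rightarrow> 'a" where
  "tprod_fun tens n f = tprod_list tens (map f [1..<Suc n])"

lemma tprod_fun_1 [simp]: "tprod_fun tens 1 f = f 1"
  by (simp add: tprod_fun_def)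

lemma tprod_list_Cons: "xs \<noteq> [] \<Longrightarrow> tprod_list tens (x # xs) = tens 1 (length xs) x (tprod_list tens xs)"
  by (cases xs) auto

lemma tprod_fun_Suc:
  assumes "m \<ge> 1"
  shows "tprod_fun tens (Suc m) f = tens 1 m (f 1) (tprod_fun tens m (\<lambda>i. f (Suc i)))"
proof -
  have "map f [1..<Suc (Suc m)] = f 1 # map (\<lambda>i. f (Suc i)) [1..<Suc m]"
    by (subst upt_conv_Cons) (auto simp: map_Suc_upt[symmetric] simp del: upt_Suc)
  then show ?thesis
    using assms unfolding tprod_fun_def by (simp only:) (subst tprod_list_Cons, auto)
qed

lemma tprod_fun_cong:
  assumes "\<And>i. i \<in> {1..n} \<Longrightarrow> f i = g i"
  shows "tprod_fun tens n f = tprod_fun tens n g"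
proof -
  have "map f [1..<Suc n] = map g [1..<Suc n]"
    using assms by (intro map_cong) auto
  then show ?thesis by (simp only: tprod_fun_def)
qed

lemma tprod_list_eq_fun: "tprod_list tens xs = tprod_fun tens (length xs) (\<lambda>i. xs ! (i - 1))"
proof -
  have "xs = map (\<lambda>i. xs ! (i - 1)) [1..<Suc (length xs)]"
    by (intro nth_equalityI) (auto simp del: upt_Suc)
  then show ?thesis unfolding tprod_fun_def by simp
qed

lemma tprod_list_set_eq:
  "{tprod_list tens xs | xs. length xs = n \<and> set xs \<subseteq> A} = {tprod_fun tens n f | f. \<forall>i\<in>{1..n}. f i \<in> A}"
proof (intro set_eqI iffI)
  fix y assume "y \<in> {tprod_list tens xs | xs. length xs = n \<and> set xs \<subseteq> A}"
  then obtain xs where "y = tprod_list tens xs" "length xs = n" "set xs \<subseteq> A" by auto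
  then show "y \<in> {tprod_fun tens n f | f. \<forall>i\<in>{1..n}. f i \<in> A}"
    by (intro CollectI exI[of _ "\<lambda>i. xs ! (i - 1)"]) (auto simp: tprod_list_eq_fun subset_iff)
next
  fix y assume "y \<in> {tprod_fun tens n f | f. \<forall>i\<in>{1..n}. f i \<in> A}"
  then obtain f where "y = tprod_list tens (map f [1..<Suc n])" "\<forall>i\<in>{1..n}. f i \<in> A"
    unfolding tprod_fun_def by blast
  then show "y \<in> {tprod_list tens xs | xs. length xs = n \<and> set xs \<subseteq> A}"
    by (intro CollectI exI[of _ "map f [1..<Suc n]"]) auto
qed

abbreviation slot_swap :: "nat \<Rightarrow> nat \<Rightarrow> nat \<Rightarrow> nat" where
  "slot_swap \<equiv> Transposition.transpose"

lemma list_swap_map: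
  assumes "k \<in> {1..n}" "s \<in> {1..n}"
  shows "list_swap k s (map f [1..<Suc n]) = map (f \<circ> slot_swap k s) [1..<Suc n]"
proof (rule nth_equalityI)
  let ?xs = "map f [1..<Suc n]"
  have nth: "?xs ! i = f (Suc i)" if "i < n" for i
    using that by (simp del: upt_Suc)
  fix i assume "i < length (list_swap k s ?xs)"
  then have i: "i < n" by (simp add: list_swap_def del: upt_Suc)
  have "list_swap k s ?xs ! i = (if i = s - 1 then ?xs ! (k - 1) else if i = k - 1 then ?xs ! (s - 1) else ?xs ! i)"
    using i by (simp add: list_swap_def nth_list_update del: upt_Suc)
  also have "\<dots> = f (slot_swap k s (Suc i))"
  proof -
    have "i = s - 1 \<longleftrightarrow> Suc i = s" "i = k - 1 \<longleftrightarrow> Suc i = k" "k - 1 < n" "s - 1 < n" "Suc (k - 1) = k" "Suc (s - 1) = s"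
      using assms by auto
    then show ?thesis
      using i nth by (simp only: Transposition.transpose_def) auto
  qed
  also have "\<dots> = map (f \<circ> slot_swap k s) [1..<Suc n] ! i"
    using i by (simp del: upt_Suc)
  finally show "list_swap k s ?xs ! i = map (f \<circ> slot_swap k s) [1..<Suc n] ! i" .
qed (simp add: list_swap_def)

lemma transpose_in: "k \<in> A \<Longrightarrow> s \<in> A \<Longrightarrow> i \<in> A \<Longrightarrow> slot_swap k s i \<in> A"
  by (auto simp: Transposition.transpose_def)

declare One_nat_def [simp del] plus_1_eq_Suc [simp]

context tensor_powers
begin

abbreviation vt :: "nat \<Rightarrow> (nat \<Rightarrow> 'h) \<Rightarrow> 'h" where
  "vt \<equiv> tprod_fun (vtens S)"

lemma Hsp: "n \<ge> 1 \<Longrightarrow> closed_csubspace (Hsp S n)"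
  using Hsp_subspace by (auto simp: closed_csubspace_def)

lemma vtens_in: "j \<ge> 1 \<Longrightarrow> m \<ge> 1 \<Longrightarrow> x \<in> Hsp S j \<Longrightarrow> y \<in> Hsp S m \<Longrightarrow> vtens S j m x y \<in> Hsp S (j + m)"
  using vtens_total closure_subset cvec.span_superset by fastforce

lemma norm_vtens:
  assumes "j \<ge> 1" "m \<ge> 1" "x \<in> Hsp S j" "y \<in> Hsp S m"
  shows "norm (vtens S j m x y) = norm x * norm y"
proof -
  have "complex_of_real ((norm (vtens S j m x y))\<^sup>2) = complex_of_real ((norm x * norm y)\<^sup>2)"
    using vtens_cinner[OF assms assms(3,4)] by (simp only: cinner_self power_mult_distrib of_real_mult)
  then show ?thesis by (simp only: of_real_eq_iff power2_eq_iff_nonneg norm_ge_zero mult_nonneg_nonneg)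
qed

lemma vt_in: "n \<ge> 1 \<Longrightarrow> (\<And>i. i \<in> {1..n} \<Longrightarrow> x i \<in> Hsp S 1) \<Longrightarrow> vt n x \<in> Hsp S n"
proof (induction n arbitrary: x rule: nat_induct_at_least)
  case (Suc n)
  then show ?case
    using vtens_in[of 1 n "x 1" "vt n (\<lambda>i. x (Suc i))"] by (auto simp: tprod_fun_Suc)
qed simp

lemma cinner_vt:
  "n \<ge> 1 \<Longrightarrow> (\<And>i. i \<in> {1..n} \<Longrightarrow> x i \<in> Hsp S 1) \<Longrightarrow> (\<And>i. i \<in> {1..n} \<Longrightarrow> y i \<in> Hsp S 1) \<Longrightarrow>
    cinner (vt n x) (vt n y) = (\<Prod>i\<in>{1..n}. cinner (x i) (y i))"
proof (induction n arbitrary: x y rule: nat_induct_at_least)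
  case (Suc n)
  have "(\<Prod>i\<in>{1..Suc n}. cinner (x i) (y i)) = cinner (x 1) (y 1) * (\<Prod>i\<in>{1..n}. cinner (x (Suc i)) (y (Suc i)))"
    by (rule prod_Icc_1_Suc)
  moreover have "vt n (\<lambda>i. x (Suc i)) \<in> Hsp S n" "vt n (\<lambda>i. y (Suc i)) \<in> Hsp S n"
    using Suc by (auto intro!: vt_in)
  moreover have "cinner (vt n (\<lambda>i. x (Suc i))) (vt n (\<lambda>i. y (Suc i)))
      = (\<Prod>i\<in>{1..n}. cinner (x (Suc i)) (y (Suc i)))"
    using Suc.prems by (intro Suc.IH) auto
  ultimately show ?case
    using Suc vtens_cinner[of 1 n "x 1" "vt n (\<lambda>i. x (Suc i))" "y 1" "vt n (\<lambda>i. y (Suc i))"]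
    by (simp add: tprod_fun_Suc)
qed simp

definition elementary :: "nat \<Rightarrow> 'h set" where
  "elementary n = {vt n x | x. \<forall>i\<in>{1..n}. x i \<in> Hsp S 1}"

lemma elementary_subset: "n \<ge> 1 \<Longrightarrow> z \<in> elementary n \<Longrightarrow> z \<in> Hsp S n"
  unfolding elementary_def using vt_in by auto

lemma elementary_1: "elementary 1 = Hsp S 1"
  unfolding elementary_def by (auto intro: exI[of _ "\<lambda>_. _"])

lemma vtens_elementary:
  assumes "n \<ge> 1" "x \<in> Hsp S 1" "y \<in> elementary n"
  shows "vtens S 1 n x y \<in> elementary (Suc n)"
proof -
  from assms(3) obtain f where f: "y = vt n f" "\<forall>i\<in>{1..n}. f i \<in> Hsp S 1"
    by (auto simp: elementary_def)
  define g where "g = (\<lambda>i. if i = 1 then x else f (i - 1))"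
  have "vt n (\<lambda>i. g (Suc i)) = vt n f"
    by (rule tprod_fun_cong) (auto simp: g_def)
  then have "vtens S 1 n x y = vt (Suc n) g"
    using assms(1) f(1) by (simp add: tprod_fun_Suc g_def)
  moreover have "\<forall>i\<in>{1..Suc n}. g i \<in> Hsp S 1"
  proof
    fix i assume "i \<in> {1..Suc n}"
    then have "i = 1 \<or> i \<noteq> 1 \<and> i - 1 \<in> {1..n}" by auto
    then show "g i \<in> Hsp S 1"
      using f(2) assms(2) by (auto simp: g_def)
  qed
  ultimately show ?thesis
    unfolding elementary_def by (intro CollectI exI[of _ g] conjI)
qed

text \<open>\<open>vtens_total\<close> concerns two factors. Tensoring with a fixed x multiplies
  norms by norm x and is therefore continuous, so the right factor reduces to elementary tensors by
  induction.\<close>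

lemma Hsp_total: "n \<ge> 1 \<Longrightarrow> Hsp S n = closure (cvec.span (elementary n))"
proof (induction n rule: nat_induct_at_least)
  case base
  show ?case
    using Hsp_subspace[of 1] unfolding elementary_1 by (metis closure_closed cvec.span_eq_iff order_refl)
next
  case (Suc n)
  note ccs = closed_csubspace_closure[OF cvec.subspace_span]
  show ?case
  proof
    show "closure (cvec.span (elementary (Suc n))) \<subseteq> Hsp S (Suc n)"
    proof
      fix z assume "z \<in> closure (cvec.span (elementary (Suc n)))"
      then show "z \<in> Hsp S (Suc n)"
        by (rule dense_subspace_induct) (use Hsp[of "Suc n"] elementary_subset[of "Suc n"] in auto)
    qed
    show "Hsp S (Suc n) \<subseteq> closure (cvec.span (elementary (Suc n)))"
    proof
      fix z assume "z \<in> Hsp S (Suc n)"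
      then have "z \<in> closure (cvec.span {vtens S 1 n x y | x y. x \<in> Hsp S 1 \<and> y \<in> Hsp S n})"
        using vtens_total[of 1 n] Suc by simp
      then show "z \<in> closure (cvec.span (elementary (Suc n)))"
      proof (rule dense_subspace_induct[OF _ _ ccs])
        fix b assume "b \<in> {vtens S 1 n x y | x y. x \<in> Hsp S 1 \<and> y \<in> Hsp S n}"
        then obtain x y where b: "b = vtens S 1 n x y" "x \<in> Hsp S 1" "y \<in> Hsp S n" by auto
        have lin: "clinear_on (Hsp S n) (vtens S 1 n x)"
          using vtens_bilinear(1)[of 1 n x] Suc b by simp
        show "b \<in> closure (cvec.span (elementary (Suc n)))"
          unfolding b(1)
        proof (rule clinear_on_dense_mem[OF lin _ Suc.IH _ ccs b(3)])
          show "continuous_on (Hsp S n) (vtens S 1 n x)"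
            by (rule clinear_on_continuous_on[OF lin Hsp, where C = "norm x"])
              (use Suc b in \<open>auto simp: norm_vtens\<close>)
          fix c assume "c \<in> elementary n"
          then show "vtens S 1 n x c \<in> closure (cvec.span (elementary (Suc n)))"
            using vtens_elementary[of n x c] Suc b
            by (intro subsetD[OF closure_subset] cvec.span_base) auto
        qed
      qed
    qed
  qed
qed

lemma bounded_ops_clinear: "A \<in> bounded_ops X \<Longrightarrow> clinear_on X A"
  and bounded_ops_in: "A \<in> bounded_ops X \<Longrightarrow> x \<in> X \<Longrightarrow> A x \<in> X"
  and bounded_ops_off: "A \<in> bounded_ops X \<Longrightarrow> x \<notin> X \<Longrightarrow> A x = 0"
  by (simp_all add: bounded_ops_def bounded_clinear_on_def image_subset_iff)

lemma bounded_ops_continuous: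
  assumes "n \<ge> 1" "A \<in> bounded_ops (Hsp S n)"
  shows "continuous_on (Hsp S n) A"
proof -
  obtain C where "\<And>x. x \<in> Hsp S n \<Longrightarrow> norm (A x) \<le> C * norm x"
    using assms(2) by (auto simp: bounded_ops_def bounded_clinear_on_def)
  then show ?thesis
    by (rule clinear_on_continuous_on[OF bounded_ops_clinear[OF assms(2)] Hsp[OF assms(1)]])
qed

text \<open>Elements of \<open>bounded_ops\<close> vanish off the space, so agreement on a total set
  is equality of functions. This makes the operator that represents a tensor unique.\<close>

lemma bounded_ops_eqI:
  assumes "n \<ge> 1" "A \<in> bounded_ops (Hsp S n)" "B \<in> bounded_ops (Hsp S n)"
    and "\<And>x. (\<And>i. i \<in> {1..n} \<Longrightarrow> x i \<in> Hsp S 1) \<Longrightarrow> A (vt n x) = B (vt n x)"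
  shows "A = B"
proof
  fix z show "A z = B z"
  proof (cases "z \<in> Hsp S n")
    case True
    show ?thesis
      by (rule clinear_on_dense_eq[OF bounded_ops_clinear bounded_ops_continuous
            bounded_ops_clinear bounded_ops_continuous Hsp_total _ True]) (use assms in \<open>auto simp: elementary_def\<close>)
  qed (use assms bounded_ops_off in metis)
qed

lemma vswap_vt:
  assumes "k \<in> {1..n}" "s \<in> {1..n}" "\<And>i. i \<in> {1..n} \<Longrightarrow> x i \<in> Hsp S 1"
  shows "vswap S n k s (vt n x) = vt n (x \<circ> slot_swap k s)"
  unfolding tprod_fun_def list_swap_map[OF assms(1,2), symmetric]
  by (intro vswap_apply assms) (use assms(3) in auto)

text \<open>Supplies the adjoint that occurs in \<open>oconj_emb\<close>, \<open>alg_conj\<close>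
  and \<open>norm_conj\<close>. On elementary tensors both sides are products of inner products that
  differ by reindexing with the transposition; density extends this to one argument after the
  other.\<close>

lemma vswap_adjoint:
  assumes "k \<in> {1..n}" "s \<in> {1..n}"
  shows "is_adjoint (Hsp S n) (vswap S n k s) (vswap S n k s)"
  unfolding is_adjoint_def
proof (intro conjI ballI vswap_op assms)
  let ?E = "elementary n" and ?v = "vswap S n k s"
  have n: "n \<ge> 1" using assms by auto
  note op = vswap_op[OF assms] and cs = closed_csubspaceD[OF Hsp[OF n]]
  note lin = bounded_ops_clinear[OF op]
  have lim: "(\<lambda>m. ?v (a m)) \<longlonglongrightarrow> ?v x" if "\<And>m. a m \<in> Hsp S n" "a \<longlonglongrightarrow> x" "x \<in> Hsp S n" for a x
    using that by (intro continuous_on_tendsto_compose[OF bounded_ops_continuous[OF n op]]) auto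
  have tr: "bij_betw (slot_swap k s) {1..n} {1..n}"
    by (rule permutes_imp_bij[OF permutes_swap_id[OF assms]])
  have base: "cinner (?v x) y = cinner x (?v y)" if "x \<in> ?E" "y \<in> ?E" for x y
  proof -
    from that obtain f g where f: "x = vt n f" "\<And>i. i \<in> {1..n} \<Longrightarrow> f i \<in> Hsp S 1"
      and g: "y = vt n g" "\<And>i. i \<in> {1..n} \<Longrightarrow> g i \<in> Hsp S 1"
      by (auto simp: elementary_def)
    have "(\<Prod>i\<in>{1..n}. cinner ((f \<circ> slot_swap k s) i) (g i))
        = (\<Prod>i\<in>{1..n}. cinner (f i) ((g \<circ> slot_swap k s) i))"
      using prod.reindex_bij_betw[OF tr, of "\<lambda>i. cinner (f i) (g (slot_swap k s i))"] by simp
    moreover have "\<And>i. i \<in> {1..n} \<Longrightarrow> (f \<circ> slot_swap k s) i \<in> Hsp S 1"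
      "\<And>i. i \<in> {1..n} \<Longrightarrow> (g \<circ> slot_swap k s) i \<in> Hsp S 1"
      using f(2) g(2) transpose_in[OF assms] by simp_all
    ultimately show ?thesis
      unfolding f(1) g(1) using vswap_vt[OF assms f(2)] vswap_vt[OF assms g(2)]
        cinner_vt[OF n _ g(2), where x = "f \<circ> slot_swap k s"]
        cinner_vt[OF n f(2), where y = "g \<circ> slot_swap k s"]
      by simp
  qed
  have seq: "x \<in> Hsp S n \<Longrightarrow> a \<longlonglongrightarrow> x \<Longrightarrow> (\<And>m. a m \<in> Hsp S n) \<Longrightarrow> (\<lambda>m. cinner (?v (a m)) y) \<longlonglongrightarrow> cinner (?v x) y" for a x y
    by (intro tendsto_cinner lim tendsto_const)
  \<comment> \<open>The set \<open>Y\<close> of test vectors is left open: it is first the set of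
    elementary tensors and then the whole space.\<close>
  have closed: "closed_csubspace {x \<in> Hsp S n. \<forall>y\<in>Y. cinner (?v x) y = cinner x (?v y)}" for Y
    unfolding closed_csubspace_def
  proof
    show "cvec.subspace {x \<in> Hsp S n. \<forall>y\<in>Y. cinner (?v x) y = cinner x (?v y)}"
      using cs clinear_on_zero[OF lin Hsp[OF n]]
      by (auto simp: cvec.subspace_def clinear_onD[OF lin] cinner_add_left cinner_scaleC_left)
    show "closed {x \<in> Hsp S n. \<forall>y\<in>Y. cinner (?v x) y = cinner x (?v y)}"
      unfolding closed_sequential_limits
    proof (intro allI impI, elim conjE)
      fix a x assume a: "\<forall>m. a m \<in> {x \<in> Hsp S n. \<forall>y\<in>Y. cinner (?v x) y = cinner x (?v y)}" "a \<longlonglongrightarrow> x"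
      have x: "x \<in> Hsp S n" using closed_sequentially[OF cs(7) _ a(2)] a(1) by auto
      have "cinner (?v x) y = cinner x (?v y)" if "y \<in> Y" for y
      proof (rule LIMSEQ_unique)
        show "(\<lambda>m. cinner (?v (a m)) y) \<longlonglongrightarrow> cinner (?v x) y"
          using seq x a by auto
        show "(\<lambda>m. cinner (?v (a m)) y) \<longlonglongrightarrow> cinner x (?v y)"
          using a that by (auto intro: tendsto_cinner)
      qed
      then show "x \<in> {x \<in> Hsp S n. \<forall>y\<in>Y. cinner (?v x) y = cinner x (?v y)}" using x by simp
    qed
  qed
  have 1: "cinner (?v x) y = cinner x (?v y)" if "x \<in> Hsp S n" "y \<in> ?E" for x y
  proof -
    have "x \<in> {x \<in> Hsp S n. \<forall>y\<in>?E. cinner (?v x) y = cinner x (?v y)}"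
    proof (rule dense_subspace_induct[OF _ _ closed, of _ ?E])
      show "x \<in> closure (cvec.span ?E)" using that(1) unfolding Hsp_total[OF n] .
      fix b assume b: "b \<in> ?E"
      have "\<forall>y\<in>?E. cinner (?v b) y = cinner b (?v y)"
        by (intro ballI base b)
      then show "b \<in> {x \<in> Hsp S n. \<forall>y\<in>?E. cinner (?v x) y = cinner x (?v y)}"
        using elementary_subset[OF n b] by (intro CollectI conjI)
    qed
    then show ?thesis using that(2) by (elim CollectE conjE bspec)
  qed
  fix x y assume x: "x \<in> Hsp S n" and y: "y \<in> Hsp S n"
  have "y \<in> {y \<in> Hsp S n. \<forall>x\<in>Hsp S n. cinner (?v y) x = cinner y (?v x)}"
  proof (rule dense_subspace_induct[OF _ _ closed, of _ ?E])
    fix b assume b: "b \<in> ?E"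
    then have bH: "b \<in> Hsp S n" using elementary_subset[OF n] by auto
    have "cinner (?v b) x = cinner b (?v x)" if "x \<in> Hsp S n" for x
      unfolding cinner_commute[of "?v b" x] cinner_commute[of b "?v x"]
      by (simp only: 1[OF that b])
    then have "\<forall>x\<in>Hsp S n. cinner (?v b) x = cinner b (?v x)" by (intro ballI)
    then show "b \<in> {y \<in> Hsp S n. \<forall>x\<in>Hsp S n. cinner (?v y) x = cinner y (?v x)}"
      using bH by (intro CollectI conjI)
    next
    show "y \<in> closure (cvec.span ?E)" using y unfolding Hsp_total[OF n] .
  qed
  then have "cinner (?v y) x = cinner y (?v x)" using x by (elim CollectE conjE bspec)
  then show "cinner (?v x) y = cinner x (?v y)"
    unfolding cinner_commute[of "?v x" y] cinner_commute[of x "?v y"] by (simp only:)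
qed

end

section \<open>Elementary tensors of operators\<close>

context tensor_powers
begin

text \<open>\<open>vt\<close> nests to the right; \<open>vtens_assoc\<close> moves the factors into
  the left block one by one.\<close>

lemma vt_append:
  assumes "j \<ge> 1" "m \<ge> 1" "\<And>i. i \<in> {1..j + m} \<Longrightarrow> x i \<in> Hsp S 1"
  shows "vt (j + m) x = vtens S j m (vt j x) (vt m (\<lambda>i. x (j + i)))"
  using assms(1,3)
proof (induction j arbitrary: x rule: nat_induct_at_least)
  case base
  then show ?case using assms(2) by (simp add: tprod_fun_Suc)
next
  case (Suc j)
  have in1: "x 1 \<in> Hsp S 1" "vt j (\<lambda>i. x (Suc i)) \<in> Hsp S j" "vt m (\<lambda>i. x (Suc j + i)) \<in> Hsp S m"
    using Suc assms(2) by (auto intro!: vt_in)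
  have IH: "vt (j + m) (\<lambda>i. x (Suc i)) = vtens S j m (vt j (\<lambda>i. x (Suc i))) (vt m (\<lambda>i. x (Suc (j + i))))"
    using Suc.prems by (intro Suc.IH) auto
  have "vt (Suc j + m) x = vtens S 1 (j + m) (x 1) (vt (j + m) (\<lambda>i. x (Suc i)))"
    using Suc by (simp add: tprod_fun_Suc)
  also have "\<dots> = vtens S (1 + j) m (vtens S 1 j (x 1) (vt j (\<lambda>i. x (Suc i)))) (vt m (\<lambda>i. x (Suc j + i)))"
    unfolding IH using vtens_assoc[of 1 j m] Suc(1) assms(2) in1 by simp
  also have "\<dots> = vtens S (Suc j) m (vt (Suc j) x) (vt m (\<lambda>i. x (Suc j + i)))"
    using Suc by (simp add: tprod_fun_Suc)
  finally show ?case .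
qed

end

section \<open>Tensor products in the completions\<close>

context tensor_algebra
begin

abbreviation tpr :: "nat \<Rightarrow> (nat \<Rightarrow> 'b) \<Rightarrow> 'b" where
  "tpr \<equiv> tprod_fun (otens S)"

lemma alg_subspace: "n \<ge> 1 \<Longrightarrow> cvec.subspace (emb S n ` alg S n)"
  unfolding cvec.subspace_def
proof (intro conjI ballI allI)
  assume n: "n \<ge> 1"
  have "emb S n (\<lambda>x. 0 *\<^sub>C (0::'h)) = 0 *\<^sub>C emb S n (\<lambda>_. 0)"
    by (rule emb_scale[OF n alg_zero[OF n]])
  then have "emb S n (\<lambda>_. 0) = 0" by simp
  then show "0 \<in> emb S n ` alg S n" using alg_zero[OF n] by (metis imageI)
  fix x assume "x \<in> emb S n ` alg S n"
  then obtain A where A: "x = emb S n A" "A \<in> alg S n" by auto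
  show "c *\<^sub>C x \<in> emb S n ` alg S n" for c
    unfolding A(1) emb_scale[OF n A(2), symmetric] by (intro imageI alg_scale n A)
  fix y assume "y \<in> emb S n ` alg S n"
  then obtain B where B: "y = emb S n B" "B \<in> alg S n" by auto
  show "x + y \<in> emb S n ` alg S n"
    unfolding A(1) B(1) emb_add[OF n A(2) B(2), symmetric] by (intro imageI alg_add n A B)
qed

lemma compl: "n \<ge> 1 \<Longrightarrow> closed_csubspace (compl S n)"
  unfolding compl_def by (intro closed_csubspace_closure alg_subspace)

lemma emb_in: "A \<in> alg S n \<Longrightarrow> emb S n A \<in> compl S n"
  unfolding compl_def by (intro subsetD[OF closure_subset] imageI)

lemma compl_seq:
  assumes "a \<in> compl S n"
  obtains A where "\<And>i::nat. A i \<in> alg S n" "(\<lambda>i. emb S n (A i)) \<longlonglongrightarrow> a"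
proof -
  obtain f where f: "\<forall>i. f i \<in> emb S n ` alg S n" "f \<longlonglongrightarrow> a"
    using assms unfolding compl_def closure_sequential by (elim exE conjE)
  then have "\<forall>i. \<exists>A. A \<in> alg S n \<and> f i = emb S n A" by auto
  then obtain A where A: "\<forall>i. A i \<in> alg S n \<and> f i = emb S n (A i)" by metis
  then have "f = (\<lambda>i. emb S n (A i))" by auto
  with A f that show thesis by auto
qed

lemma otens_tendsto:
  assumes "j \<ge> 1" "m \<ge> 1" "(f \<longlongrightarrow> a) F" "(g \<longlongrightarrow> b) F"
    and "\<forall>\<^sub>F x in F. f x \<in> compl S j" "\<forall>\<^sub>F x in F. g x \<in> compl S m" "a \<in> compl S j" "b \<in> compl S m"
  shows "((\<lambda>x. otens S j m (f x) (g x)) \<longlongrightarrow> otens S j m a b) F"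
proof -
  have "((\<lambda>x. (\<lambda>(a, b). otens S j m a b) (f x, g x)) \<longlongrightarrow> (\<lambda>(a, b). otens S j m a b) (a, b)) F"
    by (rule continuous_on_tendsto_compose[OF otens_cont[OF assms(1,2)] tendsto_Pair[OF assms(3,4)]])
      (use assms(5-8) in \<open>auto elim: eventually_elim2\<close>)
  then show ?thesis by simp
qed

lemma otens_emb_ex:
  assumes "j \<ge> 1" "m \<ge> 1" "A \<in> alg S j" "B \<in> alg S m"
  obtains T where "T \<in> alg S (j + m)" "is_tensor_op S j m A B T" "otens S j m (emb S j A) (emb S m B) = emb S (j + m) T"
  using alg_tensor[OF assms] otens_emb[OF assms] by metis

lemma otens_seq:
  assumes "j \<ge> 1" "m \<ge> 1" "a \<in> compl S j" "b \<in> compl S m"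
    and "\<And>i::nat. A i \<in> alg S j" "(\<lambda>i. emb S j (A i)) \<longlonglongrightarrow> a"
    and "\<And>i::nat. B i \<in> alg S m" "(\<lambda>i. emb S m (B i)) \<longlonglongrightarrow> b"
  shows "(\<lambda>i. otens S j m (emb S j (A i)) (emb S m (B i))) \<longlonglongrightarrow> otens S j m a b"
  using assms by (intro otens_tendsto) (auto intro!: emb_in always_eventually)

lemma otens_in:
  assumes "j \<ge> 1" "m \<ge> 1" "a \<in> compl S j" "b \<in> compl S m"
  shows "otens S j m a b \<in> compl S (j + m)"
proof -
  obtain A where A: "\<And>i::nat. A i \<in> alg S j" "(\<lambda>i. emb S j (A i)) \<longlonglongrightarrow> a" using compl_seq[OF assms(3)] by metis
  obtain B where B: "\<And>i::nat. B i \<in> alg S m" "(\<lambda>i. emb S m (B i)) \<longlonglongrightarrow> b" using compl_seq[OF assms(4)] by metis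
  show ?thesis
  proof (rule closed_sequentially[OF _ _ otens_seq[OF assms A B]])
    show "closed (compl S (j + m))" by (simp add: compl_def)
    show "otens S j m (emb S j (A i)) (emb S m (B i)) \<in> compl S (j + m)" for i
      using otens_emb_ex[OF assms(1,2) A(1) B(1)] emb_in by metis
  qed
qed

lemma norm_otens:
  assumes "j \<ge> 1" "m \<ge> 1" "a \<in> compl S j" "b \<in> compl S m"
  shows "norm (otens S j m a b) = norm a * norm b"
proof -
  obtain A where A: "\<And>i::nat. A i \<in> alg S j" "(\<lambda>i. emb S j (A i)) \<longlonglongrightarrow> a" using compl_seq[OF assms(3)] by metis
  obtain B where B: "\<And>i::nat. B i \<in> alg S m" "(\<lambda>i. emb S m (B i)) \<longlonglongrightarrow> b" using compl_seq[OF assms(4)] by metis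
  have "norm (otens S j m (emb S j (A i)) (emb S m (B i))) = norm (emb S j (A i)) * norm (emb S m (B i))" for i
    using otens_emb_ex[OF assms(1,2) A(1) B(1)] norm_tensor[OF assms(1,2) A(1) B(1)] by metis
  then show ?thesis
    using tendsto_norm[OF otens_seq[OF assms A B]] tendsto_mult[OF tendsto_norm[OF A(2)] tendsto_norm[OF B(2)]]
    by (simp add: LIMSEQ_unique)
qed

lemma bounded_ops_add:
  assumes "A \<in> bounded_ops (Hsp S n)" "B \<in> bounded_ops (Hsp S n)" "n \<ge> 1"
  shows "(\<lambda>x. A x + B x) \<in> bounded_ops (Hsp S n)"
proof -
  obtain C where "\<And>x. x \<in> Hsp S n \<Longrightarrow> norm (A x) \<le> C * norm x"
    using assms(1) by (auto simp: bounded_ops_def bounded_clinear_on_def)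
  moreover obtain D where "\<And>x. x \<in> Hsp S n \<Longrightarrow> norm (B x) \<le> D * norm x"
    using assms(2) by (auto simp: bounded_ops_def bounded_clinear_on_def)
  ultimately have "\<forall>x\<in>Hsp S n. norm (A x + B x) \<le> (C + D) * norm x"
    by (auto intro: norm_triangle_mono simp: distrib_right)
  then have "\<exists>C. \<forall>x\<in>Hsp S n. norm (A x + B x) \<le> C * norm x" by (rule exI)
  moreover have "(\<lambda>x. A x + B x) ` Hsp S n \<subseteq> Hsp S n"
    using bounded_ops_in[OF assms(1)] bounded_ops_in[OF assms(2)] closed_csubspaceD(2)[OF Hsp[OF assms(3)]]
    by (simp add: image_subset_iff)
  ultimately show ?thesis
    using bounded_ops_clinear[OF assms(1)] bounded_ops_clinear[OF assms(2)]
    by (simp add: bounded_ops_def bounded_clinear_on_def clinear_on_def scaleC_add_right add_ac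
        bounded_ops_off[OF assms(1)] bounded_ops_off[OF assms(2)])
qed

lemma bounded_ops_scale:
  assumes "A \<in> bounded_ops (Hsp S n)" "n \<ge> 1"
  shows "(\<lambda>x. c *\<^sub>C A x) \<in> bounded_ops (Hsp S n)"
proof -
  obtain C where "\<And>x. x \<in> Hsp S n \<Longrightarrow> norm (A x) \<le> C * norm x"
    using assms by (auto simp: bounded_ops_def bounded_clinear_on_def)
  then have "\<forall>x\<in>Hsp S n. norm (c *\<^sub>C A x) \<le> (cmod c * C) * norm x"
    by (auto simp: norm_scaleC mult.assoc intro: mult_left_mono)
  then have "\<exists>C. \<forall>x\<in>Hsp S n. norm (c *\<^sub>C A x) \<le> C * norm x" by (rule exI)
  moreover have "(\<lambda>x. c *\<^sub>C A x) ` Hsp S n \<subseteq> Hsp S n"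
    using bounded_ops_in[OF assms(1)] closed_csubspaceD(3)[OF Hsp[OF assms(2)]]
    by (simp add: image_subset_iff)
  ultimately show ?thesis
    using bounded_ops_clinear[OF assms(1)]
    by (simp add: bounded_ops_def bounded_clinear_on_def clinear_on_def scaleC_add_right scaleC_scaleC
        mult.commute bounded_ops_off[OF assms(1)])
qed

text \<open>On the image of the algebra \<open>otens\<close> is specified through tensor operators.
  Sums and multiples of such operators represent the sums and multiples of a factor, which gives
  linearity there.\<close>

lemma otens_linear_emb:
  assumes jm: "j \<ge> 1" "m \<ge> 1" and A: "A \<in> alg S j" "A' \<in> alg S j" and B: "B \<in> alg S m" "B' \<in> alg S m"
  shows "otens S j m (emb S j A + emb S j A') (emb S m B)
      = otens S j m (emb S j A) (emb S m B) + otens S j m (emb S j A') (emb S m B)"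
    and "otens S j m (c *\<^sub>C emb S j A) (emb S m B) = c *\<^sub>C otens S j m (emb S j A) (emb S m B)"
    and "otens S j m (emb S j A) (emb S m B + emb S m B')
      = otens S j m (emb S j A) (emb S m B) + otens S j m (emb S j A) (emb S m B')"
    and "otens S j m (emb S j A) (c *\<^sub>C emb S m B) = c *\<^sub>C otens S j m (emb S j A) (emb S m B)"
proof -
  have jm': "j + m \<ge> 1" using jm by simp
  obtain T where T: "T \<in> alg S (j + m)" "is_tensor_op S j m A B T"
    "otens S j m (emb S j A) (emb S m B) = emb S (j + m) T"
    using otens_emb_ex[OF jm A(1) B(1)] .
  have Tb: "T \<in> bounded_ops (Hsp S (j + m))" using T(2) by (simp add: is_tensor_op_def)
  have inA: "A x \<in> Hsp S j" "A' x \<in> Hsp S j" if "x \<in> Hsp S j" for x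
    using that A alg_ops[OF jm(1)] bounded_ops_in by blast+
  have inB: "B x \<in> Hsp S m" "B' x \<in> Hsp S m" if "x \<in> Hsp S m" for x
    using that B alg_ops[OF jm(2)] bounded_ops_in by blast+
  note lin = clinear_on_add[OF vtens_bilinear(1)[OF jm]] clinear_on_add[OF vtens_bilinear(2)[OF jm]]
    clinear_on_scaleC[OF vtens_bilinear(1)[OF jm]] clinear_on_scaleC[OF vtens_bilinear(2)[OF jm]]
  show "otens S j m (emb S j A + emb S j A') (emb S m B)
      = otens S j m (emb S j A) (emb S m B) + otens S j m (emb S j A') (emb S m B)"
  proof -
    obtain T' where T': "T' \<in> alg S (j + m)" "is_tensor_op S j m A' B T'"
      "otens S j m (emb S j A') (emb S m B) = emb S (j + m) T'"
      using otens_emb_ex[OF jm A(2) B(1)] .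
    have "is_tensor_op S j m (\<lambda>x. A x + A' x) B (\<lambda>x. T x + T' x)"
      using T(2) T'(2) bounded_ops_add[OF Tb _ jm', of T']
      by (simp add: is_tensor_op_def inA inB lin)
    from otens_emb[OF jm alg_add[OF jm(1) A] B(1) alg_add[OF jm' T(1) T'(1)] this]
    show ?thesis
      by (simp add: emb_add jm jm' A T(1,3) T'(1,3))
  qed
  show "otens S j m (emb S j A) (emb S m B + emb S m B')
      = otens S j m (emb S j A) (emb S m B) + otens S j m (emb S j A) (emb S m B')"
  proof -
    obtain T' where T': "T' \<in> alg S (j + m)" "is_tensor_op S j m A B' T'"
      "otens S j m (emb S j A) (emb S m B') = emb S (j + m) T'"
      using otens_emb_ex[OF jm A(1) B(2)] .
    have "is_tensor_op S j m A (\<lambda>x. B x + B' x) (\<lambda>x. T x + T' x)"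
      using T(2) T'(2) bounded_ops_add[OF Tb _ jm', of T']
      by (simp add: is_tensor_op_def inA inB lin)
    from otens_emb[OF jm A(1) alg_add[OF jm(2) B] alg_add[OF jm' T(1) T'(1)] this]
    show ?thesis
      by (simp add: emb_add jm jm' B T(1,3) T'(1,3))
  qed
  have "is_tensor_op S j m (\<lambda>x. c *\<^sub>C A x) B (\<lambda>x. c *\<^sub>C T x)" "is_tensor_op S j m A (\<lambda>x. c *\<^sub>C B x) (\<lambda>x. c *\<^sub>C T x)"
    using T(2) bounded_ops_scale[OF Tb jm', of c]
    by (simp_all add: is_tensor_op_def inA inB lin)
  from otens_emb[OF jm alg_scale[OF jm(1) A(1)] B(1) alg_scale[OF jm' T(1)] this(1)]
    otens_emb[OF jm A(1) alg_scale[OF jm(2) B(1)] alg_scale[OF jm' T(1)] this(2)]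
  show "otens S j m (c *\<^sub>C emb S j A) (emb S m B) = c *\<^sub>C otens S j m (emb S j A) (emb S m B)"
    "otens S j m (emb S j A) (c *\<^sub>C emb S m B) = c *\<^sub>C otens S j m (emb S j A) (emb S m B)"
    by (simp_all add: emb_scale jm jm' A B T(1,3))
qed

text \<open>The assumption on the completions is joint continuity, so both arguments are
  approximated at once by algebra elements, where \<open>otens_linear_emb\<close> applies.\<close>

lemma otens_clinear:
  assumes jm: "j \<ge> 1" "m \<ge> 1"
  shows otens_clinear_left: "b \<in> compl S m \<Longrightarrow> clinear_on (compl S j) (\<lambda>a. otens S j m a b)"
    and otens_clinear_right: "a \<in> compl S j \<Longrightarrow> clinear_on (compl S m) (otens S j m a)"
proof -
  note cs = closed_csubspaceD[OF compl]
  show "clinear_on (compl S j) (\<lambda>a. otens S j m a b)" if b: "b \<in> compl S m" for b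
  proof (rule clinear_onI)
    obtain B where B: "\<And>i::nat. B i \<in> alg S m" "(\<lambda>i. emb S m (B i)) \<longlonglongrightarrow> b" using compl_seq[OF b] by metis
    fix a assume a: "a \<in> compl S j"
    obtain A where A: "\<And>i::nat. A i \<in> alg S j" "(\<lambda>i. emb S j (A i)) \<longlonglongrightarrow> a" using compl_seq[OF a] by metis
    show "otens S j m (c *\<^sub>C a) b = c *\<^sub>C otens S j m a b" for c
    proof (rule LIMSEQ_unique)
      show "(\<lambda>i. otens S j m (c *\<^sub>C emb S j (A i)) (emb S m (B i))) \<longlonglongrightarrow> otens S j m (c *\<^sub>C a) b"
        using A B a b jm by (intro otens_tendsto tendsto_scaleC) (auto intro!: always_eventually emb_in cs(2,3))
      show "(\<lambda>i. otens S j m (c *\<^sub>C emb S j (A i)) (emb S m (B i))) \<longlonglongrightarrow> c *\<^sub>C otens S j m a b"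
        using otens_linear_emb(2)[OF jm A(1) A(1) B(1) B(1)] otens_seq[OF jm a b A B]
        by (simp add: tendsto_scaleC)
    qed
    fix a' assume a': "a' \<in> compl S j"
    obtain A' where A': "\<And>i::nat. A' i \<in> alg S j" "(\<lambda>i. emb S j (A' i)) \<longlonglongrightarrow> a'" using compl_seq[OF a'] by metis
    show "otens S j m (a + a') b = otens S j m a b + otens S j m a' b"
    proof (rule LIMSEQ_unique)
      show "(\<lambda>i. otens S j m (emb S j (A i) + emb S j (A' i)) (emb S m (B i))) \<longlonglongrightarrow> otens S j m (a + a') b"
        using A A' B a a' b jm by (intro otens_tendsto tendsto_add) (auto intro!: always_eventually emb_in cs(2,3))
      show "(\<lambda>i. otens S j m (emb S j (A i) + emb S j (A' i)) (emb S m (B i))) \<longlonglongrightarrow> otens S j m a b + otens S j m a' b"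
        using otens_linear_emb(1)[OF jm A(1) A'(1) B(1) B(1)]
          tendsto_add[OF otens_seq[OF jm a b A B] otens_seq[OF jm a' b A' B]] by simp
    qed
  qed
  show "clinear_on (compl S m) (otens S j m a)" if a: "a \<in> compl S j" for a
  proof (rule clinear_onI)
    obtain A where A: "\<And>i::nat. A i \<in> alg S j" "(\<lambda>i. emb S j (A i)) \<longlonglongrightarrow> a" using compl_seq[OF a] by metis
    fix b assume b: "b \<in> compl S m"
    obtain B where B: "\<And>i::nat. B i \<in> alg S m" "(\<lambda>i. emb S m (B i)) \<longlonglongrightarrow> b" using compl_seq[OF b] by metis
    show "otens S j m a (c *\<^sub>C b) = c *\<^sub>C otens S j m a b" for c
    proof (rule LIMSEQ_unique)
      show "(\<lambda>i. otens S j m (emb S j (A i)) (c *\<^sub>C emb S m (B i))) \<longlonglongrightarrow> otens S j m a (c *\<^sub>C b)"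
        using A B a b jm by (intro otens_tendsto tendsto_scaleC) (auto intro!: always_eventually emb_in cs(2,3))
      show "(\<lambda>i. otens S j m (emb S j (A i)) (c *\<^sub>C emb S m (B i))) \<longlonglongrightarrow> c *\<^sub>C otens S j m a b"
        using otens_linear_emb(4)[OF jm A(1) A(1) B(1) B(1)] otens_seq[OF jm a b A B]
        by (simp add: tendsto_scaleC)
    qed
    fix b' assume b': "b' \<in> compl S m"
    obtain B' where B': "\<And>i::nat. B' i \<in> alg S m" "(\<lambda>i. emb S m (B' i)) \<longlonglongrightarrow> b'" using compl_seq[OF b'] by metis
    show "otens S j m a (b + b') = otens S j m a b + otens S j m a b'"
    proof (rule LIMSEQ_unique)
      show "(\<lambda>i. otens S j m (emb S j (A i)) (emb S m (B i) + emb S m (B' i))) \<longlonglongrightarrow> otens S j m a (b + b')"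
        using A B B' a b b' jm by (intro otens_tendsto tendsto_add) (auto intro!: always_eventually emb_in cs(2,3))
      show "(\<lambda>i. otens S j m (emb S j (A i)) (emb S m (B i) + emb S m (B' i))) \<longlonglongrightarrow> otens S j m a b + otens S j m a b'"
        using otens_linear_emb(3)[OF jm A(1) A(1) B(1) B'(1)]
          tendsto_add[OF otens_seq[OF jm a b A B] otens_seq[OF jm a b' A B']] by simp
    qed
  qed
qed

lemma tpr_in: "n \<ge> 1 \<Longrightarrow> (\<And>i. i \<in> {1..n} \<Longrightarrow> f i \<in> compl S 1) \<Longrightarrow> tpr n f \<in> compl S n"
proof (induction n arbitrary: f rule: nat_induct_at_least)
  case (Suc n)
  have "tpr n (\<lambda>i. f (Suc i)) \<in> compl S n" using Suc.prems by (intro Suc.IH) auto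
  then have "otens S 1 n (f 1) (tpr n (\<lambda>i. f (Suc i))) \<in> compl S (1 + n)"
    using Suc by (intro otens_in) auto
  then show ?case using Suc by (simp add: tprod_fun_Suc)
qed simp

lemma norm_tpr:
  "n \<ge> 1 \<Longrightarrow> (\<And>i. i \<in> {1..n} \<Longrightarrow> f i \<in> compl S 1) \<Longrightarrow> norm (tpr n f) = (\<Prod>i\<in>{1..n}. norm (f i))"
proof (induction n arbitrary: f rule: nat_induct_at_least)
  case (Suc n)
  have "norm (tpr n (\<lambda>i. f (Suc i))) = (\<Prod>i\<in>{1..n}. norm (f (Suc i)))"
    using Suc.prems by (intro Suc.IH) auto
  moreover have "tpr n (\<lambda>i. f (Suc i)) \<in> compl S n" using Suc by (intro tpr_in) auto
  ultimately show ?case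
    using Suc norm_otens[of 1 n "f 1" "tpr n (\<lambda>i. f (Suc i))"] prod_Icc_1_Suc[of "\<lambda>i. norm (f i)" n]
    by (simp add: tprod_fun_Suc)
qed simp

lemma tpr_tendsto:
  "n \<ge> 1 \<Longrightarrow> (\<And>i. i \<in> {1..n} \<Longrightarrow> ((\<lambda>x. f x i) \<longlongrightarrow> a i) F) \<Longrightarrow>
   (\<And>i x. i \<in> {1..n} \<Longrightarrow> f x i \<in> compl S 1) \<Longrightarrow> (\<And>i. i \<in> {1..n} \<Longrightarrow> a i \<in> compl S 1) \<Longrightarrow>
   ((\<lambda>x. tpr n (f x)) \<longlongrightarrow> tpr n a) F"
proof (induction n arbitrary: f a rule: nat_induct_at_least)
  case (Suc n)
  have "((\<lambda>x. tpr n (\<lambda>i. f x (Suc i))) \<longlongrightarrow> tpr n (\<lambda>i. a (Suc i))) F"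
    using Suc.prems by (intro Suc.IH) auto
  moreover have "tpr n (\<lambda>i. f x (Suc i)) \<in> compl S n" "tpr n (\<lambda>i. a (Suc i)) \<in> compl S n" for x
    using Suc by (auto intro!: tpr_in)
  ultimately show ?case
    using Suc by (simp add: tprod_fun_Suc) (intro otens_tendsto, auto)
qed simp

text \<open>Joins three descriptions of a tensor product of operators: an element of the algebra,
  its image in the completion, and the action on elementary vectors. Identities in the completion
  can thereby be checked on vectors.\<close>

definition is_tensor_list_op :: "nat \<Rightarrow> (nat \<Rightarrow> 'h \<Rightarrow> 'h) \<Rightarrow> ('h \<Rightarrow> 'h) \<Rightarrow> bool" where
  "is_tensor_list_op n A T \<longleftrightarrow> T \<in> alg S n \<and> tpr n (\<lambda>i. emb S 1 (A i)) = emb S n T \<and>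
     (\<forall>x. (\<forall>i\<in>{1..n}. x i \<in> Hsp S 1) \<longrightarrow> T (vt n x) = vt n (\<lambda>i. A i (x i)))"

lemma is_tensor_list_opD:
  assumes "is_tensor_list_op n A T"
  shows "T \<in> alg S n" "tpr n (\<lambda>i. emb S 1 (A i)) = emb S n T"
    "(\<And>i. i \<in> {1..n} \<Longrightarrow> x i \<in> Hsp S 1) \<Longrightarrow> T (vt n x) = vt n (\<lambda>i. A i (x i))"
  using assms by (simp_all add: is_tensor_list_op_def)

lemma ex_tensor_list_op:
  "n \<ge> 1 \<Longrightarrow> (\<And>i. i \<in> {1..n} \<Longrightarrow> A i \<in> alg S 1) \<Longrightarrow> \<exists>T. is_tensor_list_op n A T"
proof (induction n arbitrary: A rule: nat_induct_at_least)
  case base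
  then show ?case by (intro exI[of _ "A 1"]) (simp add: is_tensor_list_op_def)
next
  case (Suc n)
  have "\<exists>T. is_tensor_list_op n (\<lambda>i. A (Suc i)) T"
    using Suc.prems by (intro Suc.IH) auto
  then obtain T where "is_tensor_list_op n (\<lambda>i. A (Suc i)) T" ..
  note T = is_tensor_list_opD[OF this]
  have A1: "A 1 \<in> alg S 1" using Suc.prems by simp
  obtain T' where T': "T' \<in> alg S (1 + n)" "is_tensor_op S 1 n (A 1) T T'"
    "otens S 1 n (emb S 1 (A 1)) (emb S n T) = emb S (1 + n) T'"
    by (rule otens_emb_ex[OF order_refl Suc(1) A1 T(1)])
  have "is_tensor_list_op (Suc n) A T'"
    unfolding is_tensor_list_op_def
  proof (intro conjI allI impI)
    show "tpr (Suc n) (\<lambda>i. emb S 1 (A i)) = emb S (Suc n) T'"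
      using T' T(2) Suc(1) by (simp add: tprod_fun_Suc)
    fix x assume x: "\<forall>i\<in>{1..Suc n}. x i \<in> Hsp S 1"
    have "vt n (\<lambda>i. x (Suc i)) \<in> Hsp S n" using x Suc(1) by (intro vt_in) auto
    moreover have "T (vt n (\<lambda>i. x (Suc i))) = vt n (\<lambda>i. A (Suc i) (x (Suc i)))"
      using x by (intro T(3)) auto
    ultimately show "T' (vt (Suc n) x) = vt (Suc n) (\<lambda>i. A i (x i))"
      using T'(2) x Suc(1) by (simp add: tprod_fun_Suc is_tensor_op_def)
  qed (use T' in simp)
  then show ?case by (intro exI[of _ T'])
qed

definition alg_seq :: "nat set \<Rightarrow> (nat \<Rightarrow> 'b) \<Rightarrow> (nat \<Rightarrow> nat \<Rightarrow> 'h \<Rightarrow> 'h) \<Rightarrow> bool" where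
  "alg_seq I f A \<longleftrightarrow> (\<forall>i\<in>I. (\<forall>m. A m i \<in> alg S 1) \<and> (\<lambda>m. emb S 1 (A m i)) \<longlonglongrightarrow> f i)"

lemma alg_seqD:
  assumes "alg_seq I f A" "i \<in> I"
  shows "A m i \<in> alg S 1" "(\<lambda>m. emb S 1 (A m i)) \<longlonglongrightarrow> f i"
  using assms by (auto simp: alg_seq_def)

lemma ex_alg_seq:
  assumes "\<And>i. i \<in> I \<Longrightarrow> f i \<in> compl S 1"
  shows "\<exists>A. alg_seq I f A"
proof -
  have "\<forall>i\<in>I. \<exists>A. (\<forall>m::nat. A m \<in> alg S 1) \<and> (\<lambda>m. emb S 1 (A m)) \<longlonglongrightarrow> f i"
    using compl_seq[OF assms] by metis
  then obtain B where B: "\<forall>i\<in>I. (\<forall>m::nat. B i m \<in> alg S 1) \<and> (\<lambda>m. emb S 1 (B i m)) \<longlonglongrightarrow> f i"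
    by (rule bchoice[THEN exE])
  show ?thesis
    by (intro exI[of _ "\<lambda>m i. B i m"]) (use B in \<open>simp add: alg_seq_def\<close>)
qed

text \<open>Associativity is assumed for vectors and has to be derived for \<open>otens\<close>. For
  algebra elements both sides embed operators that agree on elementary vectors by
  \<open>vt_append\<close>; in general every slot is approximated.\<close>

lemma tpr_append:
  assumes "j \<ge> 1" "m \<ge> 1" "\<And>i. i \<in> {1..j} \<Longrightarrow> f i \<in> compl S 1" "\<And>i. i \<in> {1..m} \<Longrightarrow> g i \<in> compl S 1"
  shows "otens S j m (tpr j f) (tpr m g) = tpr (j + m) (\<lambda>i. if i \<le> j then f i else g (i - j))"
proof -
  have alg_case: "otens S j m (tpr j (\<lambda>i. emb S 1 (A i))) (tpr m (\<lambda>i. emb S 1 (B i)))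
      = tpr (j + m) (\<lambda>i. emb S 1 (if i \<le> j then A i else B (i - j)))"
    if A: "\<And>i. i \<in> {1..j} \<Longrightarrow> A i \<in> alg S 1" and B: "\<And>i. i \<in> {1..m} \<Longrightarrow> B i \<in> alg S 1" for A B
  proof -
    define C where "C = (\<lambda>i. if i \<le> j then A i else B (i - j))"
    have C: "C i \<in> alg S 1" if "i \<in> {1..j + m}" for i
    proof (cases "i \<le> j")
      case False
      then have "i - j \<in> {1..m}" using that by auto
      with B False show ?thesis by (simp add: C_def)
    qed (use A that in \<open>simp add: C_def\<close>)
    have jm: "j + m \<ge> 1" using assms(1) by simp
    obtain T1 where "is_tensor_list_op j A T1"
      using ex_tensor_list_op[OF assms(1), of A] A by blast
    note T1 = is_tensor_list_opD[OF this]
    obtain T2 where "is_tensor_list_op m B T2"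
      using ex_tensor_list_op[OF assms(2), of B] B by blast
    note T2 = is_tensor_list_opD[OF this]
    obtain T where "is_tensor_list_op (j + m) C T"
      using ex_tensor_list_op[OF jm, of C] C by blast
    note T = is_tensor_list_opD[OF this]
    obtain T' where T': "T' \<in> alg S (j + m)" "is_tensor_op S j m T1 T2 T'"
      "otens S j m (emb S j T1) (emb S m T2) = emb S (j + m) T'"
      using otens_emb_ex[OF assms(1,2) T1(1) T2(1)] .
    have "T = T'"
    proof (rule bounded_ops_eqI[OF jm])
      show "T \<in> bounded_ops (Hsp S (j + m))" "T' \<in> bounded_ops (Hsp S (j + m))"
        using T(1) T'(1) alg_ops[OF jm] by auto
      fix x assume x: "\<And>i. i \<in> {1..j + m} \<Longrightarrow> x i \<in> Hsp S 1"
      have Cx: "C i (x i) \<in> Hsp S 1" if "i \<in> {1..j + m}" for i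
        using C[OF that] x[OF that] alg_ops[of 1] by (auto intro: bounded_ops_in)
      have "vt j x \<in> Hsp S j" "vt m (\<lambda>i. x (j + i)) \<in> Hsp S m" using x assms(1,2) by (auto intro!: vt_in)
      then have "T' (vt (j + m) x) = vtens S j m (vt j (\<lambda>i. A i (x i))) (vt m (\<lambda>i. B i (x (j + i))))"
        using T'(2) T1(3)[of x] T2(3)[of "\<lambda>i. x (j + i)"] x vt_append[OF assms(1,2) x]
        by (simp add: is_tensor_op_def)
      also have "vt j (\<lambda>i. A i (x i)) = vt j (\<lambda>i. C i (x i))"
        by (rule tprod_fun_cong) (simp add: C_def)
      also have "vt m (\<lambda>i. B i (x (j + i))) = vt m (\<lambda>i. C (j + i) (x (j + i)))"
        by (rule tprod_fun_cong) (simp add: C_def)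
      also have "vtens S j m (vt j (\<lambda>i. C i (x i))) (vt m (\<lambda>i. C (j + i) (x (j + i)))) = vt (j + m) (\<lambda>i. C i (x i))"
        using vt_append[OF assms(1,2), of "\<lambda>i. C i (x i)"] Cx by simp
      finally show "T (vt (j + m) x) = T' (vt (j + m) x)"
        using T(3)[of x] x by simp
    qed
    then show ?thesis using T1(2) T2(2) T(2) T'(3) by (simp add: C_def)
  qed
  have "\<exists>A. alg_seq {1..j} f A" by (rule ex_alg_seq) (rule assms(3))
  then obtain A where "alg_seq {1..j} f A" by (rule exE)
  note A = alg_seqD[OF this]
  have "\<exists>A. alg_seq {1..m} g A" by (rule ex_alg_seq) (rule assms(4))
  then obtain B where "alg_seq {1..m} g B" by (rule exE)
  note B = alg_seqD[OF this]
  show ?thesis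
  proof (rule LIMSEQ_unique)
    show "(\<lambda>l. otens S j m (tpr j (\<lambda>i. emb S 1 (A l i))) (tpr m (\<lambda>i. emb S 1 (B l i)))) \<longlonglongrightarrow> otens S j m (tpr j f) (tpr m g)"
      using assms A B
      by (intro otens_tendsto tpr_tendsto always_eventually allI tpr_in) (auto intro: emb_in)
    have shift: "i \<le> j \<and> i \<in> {1..j} \<or> \<not> i \<le> j \<and> i - j \<in> {1..m}" if "i \<in> {1..j + m}" for i
      using that by auto
    have "(\<lambda>l. tpr (j + m) (\<lambda>i. emb S 1 (if i \<le> j then A l i else B l (i - j)))) \<longlonglongrightarrow> tpr (j + m) (\<lambda>i. if i \<le> j then f i else g (i - j))"
    proof (rule tpr_tendsto)
      fix i l assume "i \<in> {1..j + m}"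
      from shift[OF this] show "(\<lambda>l. emb S 1 (if i \<le> j then A l i else B l (i - j))) \<longlonglongrightarrow> (if i \<le> j then f i else g (i - j))"
        "emb S 1 (if i \<le> j then A l i else B l (i - j)) \<in> compl S 1"
        "(if i \<le> j then f i else g (i - j)) \<in> compl S 1"
        using A B assms(3,4) emb_in by (elim disjE conjE; simp)+
    qed (use assms in simp)
    moreover have "otens S j m (tpr j (\<lambda>i. emb S 1 (A l i))) (tpr m (\<lambda>i. emb S 1 (B l i)))
        = tpr (j + m) (\<lambda>i. emb S 1 (if i \<le> j then A l i else B l (i - j)))" for l
      by (intro alg_case A B)
    ultimately show "(\<lambda>l. otens S j m (tpr j (\<lambda>i. emb S 1 (A l i))) (tpr m (\<lambda>i. emb S 1 (B l i))))
        \<longlonglongrightarrow> tpr (j + m) (\<lambda>i. if i \<le> j then f i else g (i - j))"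
      by (simp only:)
  qed
qed

definition elem :: "nat \<Rightarrow> 'b set" where
  "elem n = {tpr n f | f. \<forall>i\<in>{1..n}. f i \<in> compl S 1}"

lemma elem_in: "n \<ge> 1 \<Longrightarrow> e \<in> elem n \<Longrightarrow> e \<in> compl S n"
  unfolding elem_def using tpr_in by auto

lemma compl_total: "n \<ge> 1 \<Longrightarrow> compl S n = closure (cvec.span (elem n))"
proof
  assume n: "n \<ge> 1"
  have "{tprod_list (otens S) (map (emb S 1) As) | As. length As = n \<and> set As \<subseteq> alg S 1}
      \<subseteq> {tprod_list (otens S) xs | xs. length xs = n \<and> set xs \<subseteq> compl S 1}"
  proof safe
    fix As assume As: "n = length As" "set As \<subseteq> alg S 1"
    then have "set (map (emb S 1) As) \<subseteq> compl S 1" using emb_in by auto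
    then show "\<exists>xs. tprod_list (otens S) (map (emb S 1) As) = tprod_list (otens S) xs \<and> length xs = length As \<and> set xs \<subseteq> compl S 1"
      by (intro exI[of _ "map (emb S 1) As"] conjI) auto
  qed
  then have "{tprod_list (otens S) (map (emb S 1) As) | As. length As = n \<and> set As \<subseteq> alg S 1} \<subseteq> elem n"
    unfolding elem_def tprod_list_set_eq .
  then have "emb S n ` alg S n \<subseteq> closure (cvec.span (elem n))"
    using alg_total[OF n] closure_mono[OF cvec.span_mono] by (meson order_trans)
  then show "compl S n \<subseteq> closure (cvec.span (elem n))"
    unfolding compl_def by (rule closure_minimal) simp
  show "closure (cvec.span (elem n)) \<subseteq> compl S n"
  proof
    fix z assume "z \<in> closure (cvec.span (elem n))"
    then show "z \<in> compl S n"
      by (rule dense_subspace_induct[OF _ elem_in[OF n] compl[OF n]])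
  qed
qed

section \<open>Exchange of slots in the completions\<close>

lemma oconj_emb_swap:
  assumes "k \<in> {1..n}" "s \<in> {1..n}" "A \<in> alg S n"
  shows "oconj S n k s (emb S n A) = emb S n (vswap S n k s \<circ> A \<circ> vswap S n k s)"
    "vswap S n k s \<circ> A \<circ> vswap S n k s \<in> alg S n"
  by (rule oconj_emb[OF assms vswap_adjoint[OF assms(1,2)]] alg_conj[OF assms vswap_adjoint[OF assms(1,2)]])+

lemma oconj_facts:
  assumes ks: "k \<in> {1..n}" "s \<in> {1..n}"
  shows oconj_clinear: "clinear_on (compl S n) (oconj S n k s)"
    and oconj_in: "a \<in> compl S n \<Longrightarrow> oconj S n k s a \<in> compl S n"
    and norm_oconj: "a \<in> compl S n \<Longrightarrow> norm (oconj S n k s a) = norm a"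
proof -
  have n: "n \<ge> 1" using ks by auto
  let ?v = "vswap S n k s"
  note op = vswap_op[OF ks] and vs = oconj_emb_swap[OF ks]
  have v_in: "?v x \<in> Hsp S n" for x
    using bounded_ops_in[OF op] bounded_ops_off[OF op] closed_csubspaceD(1)[OF Hsp[OF n]] by metis
  have A_in: "A x \<in> Hsp S n" if "A \<in> alg S n" "x \<in> Hsp S n" for A x
    using alg_ops[OF n] that bounded_ops_in by blast
  note lin = bounded_ops_clinear[OF op]
  show "clinear_on (compl S n) (oconj S n k s)"
    unfolding compl_def
  proof (rule clinear_on_closure[OF alg_subspace[OF n]])
    show "continuous_on (closure (emb S n ` alg S n)) (oconj S n k s)"
      using oconj_cont[OF ks] by (simp add: compl_def)
    show "clinear_on (emb S n ` alg S n) (oconj S n k s)"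
    proof (rule clinear_onI)
      fix x assume "x \<in> emb S n ` alg S n"
      then obtain A where A: "x = emb S n A" "A \<in> alg S n" by auto
      have "?v \<circ> (\<lambda>x. c *\<^sub>C A x) \<circ> ?v = (\<lambda>x. c *\<^sub>C (?v \<circ> A \<circ> ?v) x)" for c
        using A v_in A_in by (auto simp: clinear_on_scaleC[OF lin])
      then show "oconj S n k s (c *\<^sub>C x) = c *\<^sub>C oconj S n k s x" for c
        using vs(1)[OF alg_scale[OF n A(2), of c]] A vs
        by (simp add: emb_scale[OF n A(2)] emb_scale[OF n vs(2)[OF A(2)], unfolded comp_def, symmetric] comp_def)
      fix y assume "y \<in> emb S n ` alg S n"
      then obtain B where B: "y = emb S n B" "B \<in> alg S n" by auto
      have "?v \<circ> (\<lambda>x. A x + B x) \<circ> ?v = (\<lambda>x. (?v \<circ> A \<circ> ?v) x + (?v \<circ> B \<circ> ?v) x)"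
        using A B v_in A_in by (auto simp: clinear_on_add[OF lin])
      then show "oconj S n k s (x + y) = oconj S n k s x + oconj S n k s y"
        using vs(1)[OF alg_add[OF n A(2) B(2)]] A B vs emb_add[OF n vs(2)[OF A(2)] vs(2)[OF B(2)]]
        by (simp add: emb_add[OF n])
    qed
  qed
  have cont: "continuous_on (closure (emb S n ` alg S n)) (oconj S n k s)"
    using oconj_cont[OF ks] by (simp add: compl_def)
  show "norm (oconj S n k s a) = norm a" if "a \<in> compl S n" for a
  proof (rule closure_eqI[where f = "\<lambda>a. norm (oconj S n k s a)"])
    show "continuous_on (closure (emb S n ` alg S n)) (\<lambda>a. norm (oconj S n k s a))"
      by (intro continuous_intros cont)
    show "a \<in> closure (emb S n ` alg S n)" using that by (simp add: compl_def)
    show "norm (oconj S n k s x) = norm x" if "x \<in> emb S n ` alg S n" for x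
      using that norm_conj[OF ks _ vswap_adjoint[OF ks]] vs(1) by auto
  qed (intro continuous_intros)
  show "oconj S n k s a \<in> compl S n" if a: "a \<in> compl S n" for a
  proof -
    obtain A where A: "\<And>i::nat. A i \<in> alg S n" "(\<lambda>i. emb S n (A i)) \<longlonglongrightarrow> a" using compl_seq[OF a] by metis
    have "(\<lambda>i. oconj S n k s (emb S n (A i))) \<longlonglongrightarrow> oconj S n k s a"
      by (rule continuous_on_tendsto_compose[OF oconj_cont[OF ks] A(2) a]) (simp add: emb_in A)
    then show ?thesis
      by (rule closed_sequentially[OF closed_csubspaceD(7)[OF compl[OF n]], rotated])
        (simp add: vs emb_in A)
  qed
qed

text \<open>For algebra elements the conjugated operator and the operator of the permuted list agree
  on elementary vectors; in general every slot is approximated.\<close>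

lemma oconj_tpr:
  assumes ks: "k \<in> {1..n}" "s \<in> {1..n}" and f: "\<And>i. i \<in> {1..n} \<Longrightarrow> f i \<in> compl S 1"
  shows "oconj S n k s (tpr n f) = tpr n (f \<circ> slot_swap k s)"
proof -
  have n: "n \<ge> 1" using ks by auto
  let ?v = "vswap S n k s" and ?t = "slot_swap k s"
  have alg_case: "oconj S n k s (tpr n (\<lambda>i. emb S 1 (A i))) = tpr n (\<lambda>i. emb S 1 (A (?t i)))"
    if A: "\<And>i. i \<in> {1..n} \<Longrightarrow> A i \<in> alg S 1" for A
  proof -
    obtain T where "is_tensor_list_op n A T"
      using ex_tensor_list_op[OF n, of A] A by blast
    note T = is_tensor_list_opD[OF this]
    have A': "A (?t i) \<in> alg S 1" if "i \<in> {1..n}" for i using A transpose_in[OF ks that] by simp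
    obtain T' where "is_tensor_list_op n (\<lambda>i. A (?t i)) T'"
      using ex_tensor_list_op[OF n, of "\<lambda>i. A (?t i)"] A' by blast
    note T' = is_tensor_list_opD[OF this]
    have "?v \<circ> T \<circ> ?v = T'"
    proof (rule bounded_ops_eqI[OF n])
      show "?v \<circ> T \<circ> ?v \<in> bounded_ops (Hsp S n)" "T' \<in> bounded_ops (Hsp S n)"
        using T'(1) oconj_emb_swap(2)[OF ks T(1)] alg_ops[OF n] by auto
      fix x assume x: "\<And>i. i \<in> {1..n} \<Longrightarrow> x i \<in> Hsp S 1"
      have x': "x (?t i) \<in> Hsp S 1" if "i \<in> {1..n}" for i using x transpose_in[OF ks that] by simp
      have Ax: "A i (x (?t i)) \<in> Hsp S 1" if "i \<in> {1..n}" for i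
        using A[OF that] x'[OF that] alg_ops[of 1] by (auto intro: bounded_ops_in)
      have "T (?v (vt n x)) = vt n (\<lambda>i. A i (x (?t i)))"
        using vswap_vt[OF ks x] T(3)[of "x \<circ> ?t"] x' by simp
      then show "(?v \<circ> T \<circ> ?v) (vt n x) = T' (vt n x)"
        using vswap_vt[OF ks Ax] T'(3)[of x] x by (simp add: comp_def)
    qed
    then show ?thesis using T T' oconj_emb_swap(1)[OF ks T(1)] by simp
  qed
  have "\<exists>A. alg_seq {1..n} f A" by (rule ex_alg_seq) (rule f)
  then obtain A where "alg_seq {1..n} f A" by (rule exE)
  note A = alg_seqD[OF this]
  show ?thesis
  proof (rule LIMSEQ_unique)
    have "(\<lambda>l. tpr n (\<lambda>i. emb S 1 (A l i))) \<longlonglongrightarrow> tpr n f"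
      using n f A by (intro tpr_tendsto) (auto intro: emb_in)
    then show "(\<lambda>l. oconj S n k s (tpr n (\<lambda>i. emb S 1 (A l i)))) \<longlonglongrightarrow> oconj S n k s (tpr n f)"
      by (rule continuous_on_tendsto_compose[OF oconj_cont[OF ks]])
        (use n f A in \<open>auto intro!: tpr_in always_eventually emb_in\<close>)
    have "(\<lambda>l. tpr n (\<lambda>i. emb S 1 (A l (?t i)))) \<longlonglongrightarrow> tpr n (f \<circ> ?t)"
      using n f A transpose_in[OF ks] by (intro tpr_tendsto) (simp_all add: emb_in)
    moreover have "oconj S n k s (tpr n (\<lambda>i. emb S 1 (A l i))) = tpr n (\<lambda>i. emb S 1 (A l (?t i)))" for l
      by (intro alg_case A)
    ultimately show "(\<lambda>l. oconj S n k s (tpr n (\<lambda>i. emb S 1 (A l i)))) \<longlonglongrightarrow> tpr n (f \<circ> ?t)"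
      by (simp only:)
  qed
qed

end

section \<open>Bounded operators between subspaces\<close>

lemma bounded_clinear_onI:
  assumes "clinear_on X f" "\<And>x. x \<in> X \<Longrightarrow> f x \<in> Y" "\<And>x. x \<in> X \<Longrightarrow> norm (f x) \<le> C * norm x"
  shows "bounded_clinear_on X Y f"
  using assms by (auto simp: bounded_clinear_on_def)

lemma bounded_clinear_onD:
  assumes "bounded_clinear_on X Y f"
  shows "clinear_on X f" "x \<in> X \<Longrightarrow> f x \<in> Y" "\<exists>C. \<forall>x\<in>X. norm (f x) \<le> C * norm x"
  using assms by (auto simp: bounded_clinear_on_def)

lemma bounded_clinear_on_tendsto:
  assumes "bounded_clinear_on X Y L" "closed_csubspace X" "(f \<longlongrightarrow> a) F" "\<forall>\<^sub>F x in F. f x \<in> X" "a \<in> X"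
  shows "((\<lambda>x. L (f x)) \<longlongrightarrow> L a) F"
proof -
  obtain C where "\<forall>x\<in>X. norm (L x) \<le> C * norm x" using bounded_clinear_onD(3)[OF assms(1)] by (rule exE)
  then show ?thesis
    by (intro clinear_on_tendsto[OF bounded_clinear_onD(1)[OF assms(1)] assms(2) _ assms(3-5), where C = C]) simp
qed

lemma bounded_clinear_on_continuous:
  assumes "bounded_clinear_on X Y L" "closed_csubspace X"
  shows "continuous_on X L"
proof -
  obtain C where "\<forall>x\<in>X. norm (L x) \<le> C * norm x" using bounded_clinear_onD(3)[OF assms(1)] by (rule exE)
  then show ?thesis
    by (intro clinear_on_continuous_on[OF bounded_clinear_onD(1)[OF assms(1)] assms(2), where C = C]) simp
qed

lemma bounded_clinear_on_compose:
  assumes f: "bounded_clinear_on X Y f" and g: "bounded_clinear_on Y Z g"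
  shows "bounded_clinear_on X Z (\<lambda>x. g (f x))"
proof -
  obtain C where C: "\<forall>x\<in>X. norm (f x) \<le> C * norm x" using bounded_clinear_onD(3)[OF f] by (rule exE)
  obtain D where D: "\<forall>x\<in>Y. norm (g x) \<le> D * norm x" using bounded_clinear_onD(3)[OF g] by (rule exE)
  note f' = bounded_clinear_onD[OF f] and g' = bounded_clinear_onD[OF g]
  show ?thesis
  proof (rule bounded_clinear_onI)
    show "clinear_on X (\<lambda>x. g (f x))"
      by (rule clinear_onI) (simp_all add: clinear_onD[OF f'(1)] clinear_onD[OF g'(1)] f'(2))
    show "g (f x) \<in> Z" if "x \<in> X" for x using that f'(2) g'(2) by simp
    show "norm (g (f x)) \<le> (\<bar>D\<bar> * \<bar>C\<bar>) * norm x" if x: "x \<in> X" for x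
    proof -
      have "norm (g (f x)) \<le> D * norm (f x)" using D f'(2)[OF x] by simp
      also have "\<dots> \<le> \<bar>D\<bar> * norm (f x)" by (intro mult_right_mono) auto
      also have "norm (f x) \<le> \<bar>C\<bar> * norm x"
        by (rule order_trans[OF bspec[OF C x]]) (intro mult_right_mono, auto)
      finally show ?thesis by (simp add: mult.assoc mult_left_mono)
    qed
  qed
qed

lemma bounded_clinear_on_add:
  assumes f: "bounded_clinear_on X Y f" and g: "bounded_clinear_on X Y g" and Y: "closed_csubspace Y"
  shows "bounded_clinear_on X Y (\<lambda>x. f x + g x)"
proof -
  obtain C where C: "\<forall>x\<in>X. norm (f x) \<le> C * norm x" using bounded_clinear_onD(3)[OF f] by (rule exE)
  obtain D where D: "\<forall>x\<in>X. norm (g x) \<le> D * norm x" using bounded_clinear_onD(3)[OF g] by (rule exE)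
  note f' = bounded_clinear_onD[OF f] and g' = bounded_clinear_onD[OF g]
  show ?thesis
  proof (rule bounded_clinear_onI)
    show "clinear_on X (\<lambda>x. f x + g x)"
      by (rule clinear_onI) (simp_all add: clinear_onD[OF f'(1)] clinear_onD[OF g'(1)] scaleC_add_right)
    show "f x + g x \<in> Y" if "x \<in> X" for x using that f'(2) g'(2) closed_csubspaceD(2)[OF Y] by simp
    show "norm (f x + g x) \<le> (C + D) * norm x" if x: "x \<in> X" for x
      using norm_triangle_mono[OF bspec[OF C x] bspec[OF D x]] by (simp add: distrib_right)
  qed
qed

lemma bounded_clinear_on_scaleC:
  assumes f: "bounded_clinear_on X Y f" and Y: "closed_csubspace Y"
  shows "bounded_clinear_on X Y (\<lambda>x. c *\<^sub>C f x)"
proof -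
  obtain C where C: "\<forall>x\<in>X. norm (f x) \<le> C * norm x" using bounded_clinear_onD(3)[OF f] by (rule exE)
  note f' = bounded_clinear_onD[OF f]
  show ?thesis
  proof (rule bounded_clinear_onI)
    show "clinear_on X (\<lambda>x. c *\<^sub>C f x)"
      by (rule clinear_onI) (simp_all add: clinear_onD[OF f'(1)] scaleC_add_right scaleC_scaleC mult.commute)
    show "c *\<^sub>C f x \<in> Y" if "x \<in> X" for x using that f'(2) closed_csubspaceD(3)[OF Y] by simp
    show "norm (c *\<^sub>C f x) \<le> (cmod c * C) * norm x" if x: "x \<in> X" for x
      using mult_left_mono[OF bspec[OF C x], of "cmod c"] by (simp add: norm_scaleC mult.assoc)
  qed
qed

lemma bounded_clinear_on_scaleR:
  "bounded_clinear_on X Y f \<Longrightarrow> closed_csubspace Y \<Longrightarrow> bounded_clinear_on X Y (\<lambda>x. r *\<^sub>R f x)"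
  using bounded_clinear_on_scaleC[of X Y f "complex_of_real r"] by (simp add: scaleC_of_real)

lemma bounded_clinear_on_diff:
  assumes "bounded_clinear_on X Y f" "bounded_clinear_on X Y g" "closed_csubspace Y"
  shows "bounded_clinear_on X Y (\<lambda>x. f x - g x)"
  using bounded_clinear_on_add[OF assms(1) bounded_clinear_on_scaleR[OF assms(2,3), of "-1"] assms(3)] by simp

lemma bounded_clinear_on_zero:
  "closed_csubspace Y \<Longrightarrow> bounded_clinear_on X Y (\<lambda>_. 0)"
  by (rule bounded_clinear_onI[where C = 0]) (auto intro: clinear_onI closed_csubspaceD)

lemma bounded_clinear_on_sum:
  assumes "\<And>i. i \<in> I \<Longrightarrow> bounded_clinear_on X Y (f i)" "closed_csubspace Y"
  shows "bounded_clinear_on X Y (\<lambda>x. \<Sum>i\<in>I. f i x)"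
  using assms(1)
proof (induction I rule: infinite_finite_induct)
  case (insert i I)
  then show ?case by (simp add: bounded_clinear_on_add assms(2))
qed (simp_all add: bounded_clinear_on_zero assms(2))

lemma bounded_clinear_on_id: "bounded_clinear_on X X (\<lambda>x. x)"
  by (rule bounded_clinear_onI[where C = 1]) (auto intro: clinear_onI)

section \<open>The functional and the partial traces\<close>

text \<open>Positivity forces self-adjointness by polarization: real values of the form at sums make
  the mixed terms real, for y and for i y. Hence P P is the product of P with its adjoint.\<close>

lemma pos_ops_is_abs:
  fixes P :: "'h::chilbert \<Rightarrow> 'h"
  assumes X: "closed_csubspace X" and P: "P \<in> pos_ops X"
  shows "is_abs X P P"
proof -
  have bo: "P \<in> bounded_ops X" and real: "\<And>x. x \<in> X \<Longrightarrow> cinner x (P x) \<in> \<real>"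
    using P nonneg_Reals_subset_Reals by (auto simp: pos_ops_def)
  have lin: "clinear_on X P" using bo by (simp add: bounded_ops_def bounded_clinear_on_def)
  have "cinner (P x) y = cinner x (P y)" if x: "x \<in> X" and y: "y \<in> X" for x y
  proof -
    have im: "Im (cinner z (P w) + cinner w (P z)) = 0" if z: "z \<in> X" and w: "w \<in> X" for z w
    proof -
      have "cinner (z + w) (P (z + w)) - cinner z (P z) - cinner w (P w) \<in> \<real>"
        using z w real[of "z + w"] real[of z] real[of w] closed_csubspaceD(2)[OF X] by (intro Reals_diff) auto
      moreover have "cinner (z + w) (P (z + w)) - cinner z (P z) - cinner w (P w) = cinner z (P w) + cinner w (P z)"
        using z w by (simp add: clinear_on_add[OF lin] cinner_add_left cinner_add_right)
      ultimately show ?thesis by (simp add: complex_is_Real_iff)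
    qed
    have "Im (cinner x (P y) + cinner y (P x)) = 0" by (rule im[OF x y])
    moreover have "Im (cinner x (P (\<i> *\<^sub>C y)) + cinner (\<i> *\<^sub>C y) (P x)) = 0"
      by (rule im[OF x closed_csubspaceD(3)[OF X y]])
    ultimately have "cinner x (P y) = cnj (cinner y (P x))"
      using y by (simp add: complex_eq_iff clinear_on_scaleC[OF lin] cinner_scaleC_left cinner_scaleC_right)
    also have "\<dots> = cinner (P x) y" by (rule cinner_commute[symmetric])
    finally show ?thesis by simp
  qed
  then have "is_adjoint X P P" using bo by (simp add: is_adjoint_def)
  then show ?thesis
    unfolding is_abs_def using P by (intro conjI exI[of _ P]) auto
qed

context tensor_algebra
begin

definition in_slots :: "nat \<Rightarrow> (nat \<Rightarrow> 'b) \<Rightarrow> bool" where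
  "in_slots n f \<longleftrightarrow> (\<forall>i\<in>{1..n}. f i \<in> compl S 1)"

lemma in_slots_mono: "in_slots n f \<Longrightarrow> m \<le> n \<Longrightarrow> in_slots m f"
  by (simp add: in_slots_def)

lemma in_slots_upd: "in_slots n f \<Longrightarrow> g \<in> compl S 1 \<Longrightarrow> in_slots n (f(i := g))"
  by (simp add: in_slots_def)

lemma in_slots_comp: "in_slots n f \<Longrightarrow> (\<And>i. i \<in> {1..n} \<Longrightarrow> p i \<in> {1..n}) \<Longrightarrow> in_slots n (f \<circ> p)"
  unfolding in_slots_def comp_def by blast

lemma in_slots_shift: "in_slots n f \<Longrightarrow> k + m \<le> n \<Longrightarrow> in_slots m (\<lambda>i. f (k + i))"
  by (simp add: in_slots_def)

lemma in_slots_swap: "in_slots n f \<Longrightarrow> k \<in> {1..n} \<Longrightarrow> s \<in> {1..n} \<Longrightarrow> in_slots n (f \<circ> slot_swap k s)"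
  by (intro in_slots_comp transpose_in)

lemma tpr_in_slots: "n \<ge> 1 \<Longrightarrow> in_slots n f \<Longrightarrow> tpr n f \<in> compl S n"
  by (rule tpr_in) (simp_all add: in_slots_def)

lemma oconj_tpr_slots:
  "k \<in> {1..n} \<Longrightarrow> s \<in> {1..n} \<Longrightarrow> in_slots n f \<Longrightarrow> oconj S n k s (tpr n f) = tpr n (f \<circ> slot_swap k s)"
  by (rule oconj_tpr) (simp_all add: in_slots_def)

lemma tpr_append_slots:
  assumes "j \<ge> 1" "m \<ge> 1" "in_slots j f" "in_slots m g"
  shows "otens S j m (tpr j f) (tpr m g) = tpr (j + m) (\<lambda>i. if i \<le> j then f i else g (i - j))"
  by (rule tpr_append) (use assms in \<open>simp_all add: in_slots_def\<close>)

lemma elem_cases: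
  assumes "b \<in> elem n"
  obtains f where "b = tpr n f" "in_slots n f"
  using assms by (auto simp: elem_def in_slots_def)

section \<open>The functional on the positive cone and contractivity of the partial traces\<close>

lemma pcone_subset: "a \<in> pcone S n \<Longrightarrow> a \<in> compl S n"
  unfolding pcone_def compl_def by (rule subsetD[OF closure_mono]) auto

lemma ell_tendsto:
  assumes "n \<ge> 1" "(f \<longlongrightarrow> a) F" "\<forall>\<^sub>F x in F. f x \<in> compl S n" "a \<in> compl S n"
  shows "((\<lambda>x. ell S n (f x)) \<longlongrightarrow> ell S n a) F"
  by (rule continuous_on_tendsto_compose[OF ell_cont[OF assms(1)] assms(2,4,3)])

lemma oabs_in:
  assumes n: "n \<ge> 1" and a: "a \<in> compl S n"
  shows "oabs S n a \<in> compl S n"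
proof -
  obtain A where A: "\<And>i::nat. A i \<in> alg S n" "(\<lambda>i. emb S n (A i)) \<longlonglongrightarrow> a" using compl_seq[OF a] by metis
  have "(\<lambda>i. oabs S n (emb S n (A i))) \<longlonglongrightarrow> oabs S n a"
    by (rule continuous_on_tendsto_compose[OF oabs_cont[OF n] A(2) a]) (simp add: emb_in A)
  then show ?thesis
  proof (rule closed_sequentially[OF closed_csubspaceD(7)[OF compl[OF n]], rotated])
    fix i
    obtain P where "P \<in> alg S n" "is_abs (Hsp S n) (A i) P" using alg_abs[OF n A(1)] by blast
    then show "oabs S n (emb S n (A i)) \<in> compl S n"
      using oabs_emb[OF n A(1)] emb_in by simp
  qed
qed

lemma norm_eq_ell_oabs:
  assumes n: "n \<ge> 1" and a: "a \<in> compl S n"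
  shows "complex_of_real (norm a) = ell S n (oabs S n a)"
proof (rule closure_eqI[where f = "\<lambda>a. complex_of_real (norm a)" and g = "\<lambda>a. ell S n (oabs S n a)"])
  show "a \<in> closure (emb S n ` alg S n)" using a by (simp add: compl_def)
  show "continuous_on (closure (emb S n ` alg S n)) (\<lambda>a. complex_of_real (norm a))"
    by (intro continuous_intros)
  have "continuous_on (compl S n) (\<lambda>a. ell S n (oabs S n a))"
    by (rule continuous_on_compose2[OF ell_cont[OF n] oabs_cont[OF n]]) (auto intro: oabs_in n)
  then show "continuous_on (closure (emb S n ` alg S n)) (\<lambda>a. ell S n (oabs S n a))"
    by (simp add: compl_def)
  fix x assume "x \<in> emb S n ` alg S n"
  then obtain A where A: "x = emb S n A" "A \<in> alg S n" by auto
  obtain P where "P \<in> alg S n" "is_abs (Hsp S n) A P" using alg_abs[OF n A(2)] by blast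
  then show "complex_of_real (norm x) = ell S n (oabs S n x)"
    using norm_emb[OF n A(2)] oabs_emb[OF n A(2)] A(1) by simp
qed

lemma norm_ell:
  assumes n: "n \<ge> 1" and a: "a \<in> compl S n"
  shows "cmod (ell S n a) \<le> norm a"
proof (rule closure_leI[where f = "\<lambda>a. cmod (ell S n a)"])
  show "a \<in> closure (emb S n ` alg S n)" using a by (simp add: compl_def)
  show "continuous_on (closure (emb S n ` alg S n)) (\<lambda>a. cmod (ell S n a))"
    using ell_cont[OF n] by (intro continuous_intros) (simp add: compl_def)
  show "continuous_on (closure (emb S n ` alg S n)) norm" by (intro continuous_intros)
  fix x assume "x \<in> emb S n ` alg S n"
  then obtain A where A: "x = emb S n A" "A \<in> alg S n" by auto
  obtain P where P: "P \<in> alg S n" "is_abs (Hsp S n) A P" using alg_abs[OF n A(2)] by blast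
  have "cmod (ell S n x) \<le> Re (ell S n (emb S n P))"
    using ell_abs[OF n A(2) P] A(1) by simp
  also have "\<dots> = norm x" using norm_emb[OF n A(2) P] A(1) by (metis Re_complex_of_real)
  finally show "cmod (ell S n x) \<le> norm x" .
qed

text \<open>For an algebra element this is \<open>norm_emb\<close> with P as its own absolute value.
  It turns the norm 1 of states into trace 1.\<close>

lemma ell_pcone:
  assumes n: "n \<ge> 1" and a: "a \<in> pcone S n"
  shows "ell S n a = complex_of_real (norm a)"
proof (rule closure_eqI[where f = "ell S n" and g = "\<lambda>a. complex_of_real (norm a)"])
  let ?D = "emb S n ` (alg S n \<inter> pos_ops (Hsp S n))"
  show "a \<in> closure ?D" using a by (simp add: pcone_def)
  show "continuous_on (closure ?D) (ell S n)"
    by (rule continuous_on_subset[OF ell_cont[OF n]])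
      (auto intro: pcone_subset simp: pcone_def[symmetric])
  show "continuous_on (closure ?D) (\<lambda>a. complex_of_real (norm a))" by (intro continuous_intros)
  fix x assume "x \<in> ?D"
  then obtain P where P: "x = emb S n P" "P \<in> alg S n" "P \<in> pos_ops (Hsp S n)" by auto
  show "ell S n x = complex_of_real (norm x)"
    using norm_emb[OF n P(2,2) pos_ops_is_abs[OF Hsp[OF n] P(3)]] P(1) by simp
qed

lemma ell_otens:
  assumes "j \<ge> 1" "m \<ge> 1" "a \<in> compl S j" "b \<in> compl S m"
  shows "ell S (j + m) (otens S j m a b) = ell S j a * ell S m b"
proof -
  obtain A where A: "\<And>i::nat. A i \<in> alg S j" "(\<lambda>i. emb S j (A i)) \<longlonglongrightarrow> a" using compl_seq[OF assms(3)] by metis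
  obtain B where B: "\<And>i::nat. B i \<in> alg S m" "(\<lambda>i. emb S m (B i)) \<longlonglongrightarrow> b" using compl_seq[OF assms(4)] by metis
  have eq: "ell S (j + m) (otens S j m (emb S j (A i)) (emb S m (B i))) = ell S j (emb S j (A i)) * ell S m (emb S m (B i))" for i
  proof -
    obtain T where "T \<in> alg S (j + m)" "is_tensor_op S j m (A i) (B i) T"
      "otens S j m (emb S j (A i)) (emb S m (B i)) = emb S (j + m) T"
      by (rule otens_emb_ex[OF assms(1,2) A(1) B(1)])
    then show ?thesis using ell_tensor[OF assms(1,2) A(1) B(1)] by simp
  qed
  have in': "otens S j m (emb S j (A i)) (emb S m (B i)) \<in> compl S (j + m)" for i
    by (intro otens_in assms emb_in A B)
  have 1: "(\<lambda>i. ell S (j + m) (otens S j m (emb S j (A i)) (emb S m (B i)))) \<longlonglongrightarrow> ell S (j + m) (otens S j m a b)"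
    using assms in' by (intro ell_tendsto otens_seq A B always_eventually allI otens_in emb_in) simp_all
  have 2: "(\<lambda>i. ell S j (emb S j (A i)) * ell S m (emb S m (B i))) \<longlonglongrightarrow> ell S j a * ell S m b"
    using assms A B by (intro tendsto_mult ell_tendsto always_eventually allI emb_in)
  show ?thesis
    using 1 2 unfolding eq by (rule LIMSEQ_unique)
qed

lemma ell_tpr:
  "n \<ge> 1 \<Longrightarrow> in_slots n f \<Longrightarrow> ell S n (tpr n f) = (\<Prod>i\<in>{1..n}. ell S 1 (f i))"
proof (induction n arbitrary: f rule: nat_induct_at_least)
  case (Suc n)
  have sl: "in_slots n (\<lambda>i. f (1 + i))" using Suc.prems by (rule in_slots_shift) simp
  then have "ell S n (tpr n (\<lambda>i. f (Suc i))) = (\<Prod>i\<in>{1..n}. ell S 1 (f (Suc i)))"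
    using Suc.IH by simp
  moreover have "tpr n (\<lambda>i. f (Suc i)) \<in> compl S n" using sl Suc by (simp add: tpr_in_slots)
  moreover have "f 1 \<in> compl S 1" using Suc by (simp add: in_slots_def)
  ultimately show ?case
    using Suc ell_otens[of 1 n "f 1" "tpr n (\<lambda>i. f (Suc i))"] prod_Icc_1_Suc[of "\<lambda>i. ell S 1 (f i)" n]
    by (simp add: tprod_fun_Suc)
qed simp

lemma ptr_tpr:
  assumes "n \<ge> 2" "in_slots n f"
  shows "ptr S n (tpr n f) = ell S 1 (f n) *\<^sub>C tpr (n - 1) f"
proof -
  let ?as = "map f [1..<Suc n]"
  have "[1..<Suc n] = [1..<n] @ [n]" using assms(1) by simp
  then have "last ?as = f n" "butlast ?as = map f [1..<Suc (n - 1)]" using assms(1) by simp_all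
  moreover have "ptr S n (tprod_list (otens S) ?as) = ell S 1 (last ?as) *\<^sub>C tprod_list (otens S) (butlast ?as)"
    using assms by (intro ptr_tensor) (auto simp: in_slots_def)
  ultimately show ?thesis unfolding tprod_fun_def by simp
qed

text \<open>On an elementary tensor both sides are the product of the traces of all slots.\<close>

lemma ell_ptr:
  assumes n: "n \<ge> 2" and a: "a \<in> compl S n"
  shows "ell S (n - 1) (ptr S n a) = ell S n a"
proof -
  have n1: "n \<ge> 1" "n - 1 \<ge> 1" using n by auto
  have pin: "ptr S n x \<in> compl S (n - 1)" if "x \<in> compl S n" for x using ptr_range[OF n] that by auto
  let ?Y = "{x \<in> compl S n. ell S (n - 1) (ptr S n x) - ell S n x = 0}"
  have "a \<in> ?Y"
  proof (rule dense_subspace_induct)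
    show "a \<in> closure (cvec.span (elem n))" using a compl_total[OF n1(1)] by simp
    have "continuous_on (compl S n) (\<lambda>x. ell S (n - 1) (ptr S n x))"
      by (rule continuous_on_compose2[OF ell_cont[OF n1(2)] ptr_cont[OF n]]) (auto intro: pin)
    then have "closed ?Y"
      by (intro continuous_closed_preimage_constant continuous_on_diff ell_cont n1 closed_csubspaceD(7)[OF compl])
    moreover have "cvec.subspace ?Y"
      unfolding cvec.subspace_def
    proof (intro conjI ballI allI)
      note cs = closed_csubspaceD[OF compl[OF n1(1)]]
      have "ell S n (0 *\<^sub>C 0) = 0" "ell S (n - 1) (0 *\<^sub>C 0) = 0"
        using closed_csubspaceD(1)[OF compl] n1 by (subst ell_linear; simp)+
      then show "0 \<in> ?Y"
        using cs(1) clinear_on_zero[OF ptr_linear[OF n] compl[OF n1(1)]] by simp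
      fix x assume x: "x \<in> ?Y"
      show "c *\<^sub>C x \<in> ?Y" for c
        using x cs(3)[of x c] pin[of x] n1
        by (simp add: ell_linear clinear_on_scaleC[OF ptr_linear[OF n]])
      fix y assume y: "y \<in> ?Y"
      show "x + y \<in> ?Y"
        using x y cs(2)[of x y] pin[of x] pin[of y] n1
        by (simp add: ell_linear clinear_on_add[OF ptr_linear[OF n]])
    qed
    ultimately show "closed_csubspace ?Y" by (simp add: closed_csubspace_def)
    fix b assume "b \<in> elem n"
    then obtain f where f: "b = tpr n f" "in_slots n f" by (rule elem_cases)
    have "{1..n} = insert n {1..n - 1}" using n by auto
    moreover have f': "in_slots (n - 1) f" using in_slots_mono[OF f(2)] by simp
    ultimately show "b \<in> ?Y"
      using ell_tpr[OF n1(1) f(2)] ell_tpr[OF n1(2) f'] f(1) n tpr_in_slots[OF n1(1) f(2)] tpr_in_slots[OF n1(2) f']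
      by (simp add: ptr_tpr[OF n f(2)] ell_linear)
  qed
  then show ?thesis by simp
qed

text \<open>The difference in \<open>ptr_abs\<close> is positive, so the functional takes its norm
  as value there: norm a exceeds the norm of the partial trace by exactly the norm of that
  difference.\<close>

lemma norm_ptr:
  assumes n: "n \<ge> 2" and a: "a \<in> compl S n"
  shows "norm (ptr S n a) \<le> norm a"
proof -
  have n1: "n \<ge> 1" "n - 1 \<ge> 1" using n by auto
  have pin: "ptr S n x \<in> compl S (n - 1)" if "x \<in> compl S n" for x using ptr_range[OF n] that by auto
  let ?d = "ptr S n (oabs S n a) - oabs S (n - 1) (ptr S n a)"
  have ab: "oabs S n a \<in> compl S n" "oabs S (n - 1) (ptr S n a) \<in> compl S (n - 1)"
    using oabs_in n1 a pin by auto
  have d: "?d \<in> compl S (n - 1)" using closed_csubspaceD(4)[OF compl[OF n1(2)]] ab pin by simp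
  have "ell S (n - 1) (?d + oabs S (n - 1) (ptr S n a)) = ell S (n - 1) ?d + ell S (n - 1) (oabs S (n - 1) (ptr S n a))"
    by (rule ell_linear(1)[OF n1(2) d ab(2)])
  moreover have "ell S (n - 1) ?d = complex_of_real (norm ?d)"
    by (rule ell_pcone[OF n1(2) ptr_abs[OF n a]])
  moreover have "ell S (n - 1) (ptr S n (oabs S n a)) = complex_of_real (norm a)"
    using ell_ptr[OF n ab(1)] norm_eq_ell_oabs[OF n1(1) a] by simp
  moreover have "ell S (n - 1) (oabs S (n - 1) (ptr S n a)) = complex_of_real (norm (ptr S n a))"
    using norm_eq_ell_oabs[OF n1(2) pin[OF a]] by simp
  ultimately have "complex_of_real (norm a) = complex_of_real (norm ?d + norm (ptr S n a))" by simp
  then have "norm a = norm ?d + norm (ptr S n a)" using of_real_eq_iff by blast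
  then show ?thesis by (metis le_add_same_cancel2 norm_ge_zero)
qed

lemma ptr_bounded: "n \<ge> 2 \<Longrightarrow> bounded_clinear_on (compl S n) (compl S (n - 1)) (ptr S n)"
  by (rule bounded_clinear_onI[where C = 1]) (use ptr_linear ptr_range norm_ptr in \<open>auto simp: image_subset_iff\<close>)

lemma oconj_bounded:
  "k \<in> {1..n} \<Longrightarrow> s \<in> {1..n} \<Longrightarrow> bounded_clinear_on (compl S n) (compl S n) (oconj S n k s)"
  by (rule bounded_clinear_onI[where C = 1]) (simp_all add: oconj_facts)

lemma otens_bounded_left:
  "j \<ge> 1 \<Longrightarrow> m \<ge> 1 \<Longrightarrow> b \<in> compl S m \<Longrightarrow> bounded_clinear_on (compl S j) (compl S (j + m)) (\<lambda>a. otens S j m a b)"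
  by (rule bounded_clinear_onI[where C = "norm b"]) (simp_all add: otens_clinear otens_in norm_otens)

text \<open>The source of most operator identities below: once both sides are known to be bounded,
  they are compared on elementary tensors.\<close>

lemma bounded_eqI:
  fixes L M :: "'b \<Rightarrow> 'b"
  assumes n: "n \<ge> 1" and L: "bounded_clinear_on (compl S n) Y L" and M: "bounded_clinear_on (compl S n) Z M"
    and "\<And>f. in_slots n f \<Longrightarrow> L (tpr n f) = M (tpr n f)" "x \<in> compl S n"
  shows "L x = M x"
  by (rule clinear_on_dense_eq[OF bounded_clinear_onD(1)[OF L] bounded_clinear_on_continuous[OF L compl[OF n]]
        bounded_clinear_onD(1)[OF M] bounded_clinear_on_continuous[OF M compl[OF n]] compl_total[OF n] _ assms(5)])
    (use assms(4) in \<open>auto simp: elem_def in_slots_def\<close>)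

section \<open>Marginals\<close>

lemma marg_same: "j \<ge> 1 \<Longrightarrow> marg S j j a = a"
  by (cases j) auto

lemma marg_Suc: "n \<ge> j \<Longrightarrow> marg S j (Suc n) a = marg S j n (ptr S (Suc n) a)"
  by simp

lemma marg_bounded:
  assumes "j \<ge> 1"
  shows "n \<ge> j \<Longrightarrow> bounded_clinear_on (compl S n) (compl S j) (marg S j n)"
proof (induction n rule: nat_induct_at_least)
  case base
  show ?case unfolding marg_same[OF assms] by (rule bounded_clinear_on_id)
next
  case (Suc n)
  have "bounded_clinear_on (compl S (Suc n)) (compl S n) (ptr S (Suc n))"
    using ptr_bounded[of "Suc n"] Suc assms by simp
  from bounded_clinear_on_compose[OF this Suc.IH] show ?case
    unfolding marg_Suc[OF Suc(1)] .
qed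

lemma norm_marg: "j \<ge> 1 \<Longrightarrow> n \<ge> j \<Longrightarrow> a \<in> compl S n \<Longrightarrow> norm (marg S j n a) \<le> norm a"
proof (rotate_tac, induction n arbitrary: a rule: nat_induct_at_least)
  case (Suc n)
  have "ptr S (Suc n) a \<in> compl S n" "norm (ptr S (Suc n) a) \<le> norm a"
    using ptr_range[of "Suc n"] norm_ptr[of "Suc n" a] Suc by auto
  then show ?case
    using Suc.IH[of "ptr S (Suc n) a"] Suc.prems marg_Suc[OF Suc(1)] by simp
qed (simp add: marg_same)

lemma marg_tpr:
  assumes "j \<ge> 1"
  shows "n \<ge> j \<Longrightarrow> in_slots n f \<Longrightarrow> marg S j n (tpr n f) = (\<Prod>i\<in>{j<..n}. ell S 1 (f i)) *\<^sub>C tpr j f"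
proof (induction n rule: nat_induct_at_least)
  case base
  then show ?case by (simp add: marg_same[OF assms])
next
  case (Suc n)
  have f: "in_slots n f" by (rule in_slots_mono[OF Suc.prems]) simp
  have n: "n \<ge> 1" using Suc assms by simp
  have "{j<..Suc n} = insert (Suc n) {j<..n}" using Suc by auto
  moreover have "marg S j (Suc n) (tpr (Suc n) f) = marg S j n (ell S 1 (f (Suc n)) *\<^sub>C tpr n f)"
    using ptr_tpr[OF _ Suc.prems] n marg_Suc[OF Suc(1)] by simp
  moreover have "\<dots> = ell S 1 (f (Suc n)) *\<^sub>C marg S j n (tpr n f)"
    by (rule clinear_on_scaleC[OF bounded_clinear_onD(1)[OF marg_bounded[OF assms Suc(1)]] tpr_in_slots[OF n f]])
  ultimately show ?case using Suc.IH[OF f] by (simp add: scaleC_scaleC)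
qed

text \<open>An exchange within the first j slots leaves the product of the traces of the other slots
  unchanged.\<close>

lemma marg_oconj:
  assumes j: "j \<ge> 1" "j \<le> n" and ks: "k \<in> {1..j}" "s \<in> {1..j}" and a: "a \<in> compl S n"
  shows "marg S j n (oconj S n k s a) = oconj S j k s (marg S j n a)"
proof (rule bounded_eqI[where L = "\<lambda>a. marg S j n (oconj S n k s a)" and M = "\<lambda>a. oconj S j k s (marg S j n a)", OF _ _ _ _ a])
  have ks': "k \<in> {1..n}" "s \<in> {1..n}" using j ks by auto
  show "n \<ge> 1" using j by simp
  show "bounded_clinear_on (compl S n) (compl S j) (\<lambda>a. marg S j n (oconj S n k s a))"
    by (rule bounded_clinear_on_compose[OF oconj_bounded[OF ks'] marg_bounded[OF j]])
  show "bounded_clinear_on (compl S n) (compl S j) (\<lambda>a. oconj S j k s (marg S j n a))"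
    by (rule bounded_clinear_on_compose[OF marg_bounded[OF j] oconj_bounded[OF ks]])
  fix f assume f: "in_slots n f"
  note f' = in_slots_swap[OF f ks'] and fj = in_slots_mono[OF f j(2)]
  have "(\<Prod>i\<in>{j<..n}. ell S 1 ((f \<circ> slot_swap k s) i)) = (\<Prod>i\<in>{j<..n}. ell S 1 (f i))"
    using ks by (intro prod.cong) (auto simp: Transposition.transpose_def)
  then show "marg S j n (oconj S n k s (tpr n f)) = oconj S j k s (marg S j n (tpr n f))"
    using clinear_on_scaleC[OF oconj_clinear[OF ks] tpr_in_slots[OF j(1) fj]]
    by (simp only: oconj_tpr_slots[OF ks' f] oconj_tpr_slots[OF ks fj] marg_tpr[OF j f] marg_tpr[OF j f'])
qed

lemma tprod_list_replicate: "tprod_list (otens S) (replicate k g) = tpr k (\<lambda>_. g)"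
  by (simp add: tprod_fun_def map_replicate_const del: upt_Suc)

end

section \<open>Operators acting on single slots\<close>

text \<open>For at most two particles the estimates hold trivially. A third particle makes the
  interaction traceless.\<close>

locale large_system = mean_field_system S N
  for S :: "('h::chilbert, 'b::cbanach) mean_field_data" and N :: nat +
  assumes N3: "N \<ge> 3"
begin

abbreviation X :: "'b set" where "X \<equiv> compl S N"
abbreviation X1 :: "'b set" where "X1 \<equiv> compl S 1"
abbreviation tp :: "(nat \<Rightarrow> 'b) \<Rightarrow> 'b" where "tp \<equiv> tpr N"
abbreviation tr :: "'b \<Rightarrow> complex" where "tr \<equiv> ell S 1"

lemma N1: "N \<ge> 1" and N2: "N \<ge> 2" and NN: "N \<in> {1..N}"
  using N3 by auto

lemma X: "closed_csubspace X" and X1: "closed_csubspace X1"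
  using compl N1 by auto

lemma zero_in: "0 \<in> X" by (rule closed_csubspaceD(1)[OF X])

lemma tp_in: "in_slots N f \<Longrightarrow> tp f \<in> X"
  by (rule tpr_in_slots[OF N1])

text \<open>\<open>ins g i a\<close> traces out slot \<open>i\<close> of \<open>a\<close> and puts \<open>g\<close> there.\<close>

definition ins :: "'b \<Rightarrow> nat \<Rightarrow> 'b \<Rightarrow> 'b" where
  "ins g i a = (if a \<in> X then oconj S N i N (otens S (N - 1) 1 (ptr S N (oconj S N i N a)) g) else 0)"

lemma ins_off: "a \<notin> X \<Longrightarrow> ins g i a = 0"
  by (simp add: ins_def)

lemma otens_right_tpr:
  assumes "in_slots (N - 1) f" "g \<in> X1"
  shows "otens S (N - 1) 1 (tpr (N - 1) f) g = tp (\<lambda>l. if l \<le> N - 1 then f l else g)"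
proof -
  have "in_slots 1 (\<lambda>_. g)" using assms(2) by (simp add: in_slots_def)
  from tpr_append_slots[OF _ _ assms(1) this] show ?thesis using N2 by simp
qed

lemma ins_tp:
  assumes i: "i \<in> {1..N}" and g: "g \<in> X1" and f: "in_slots N f"
  shows "ins g i (tp f) = tr (f i) *\<^sub>C tp (f(i := g))"
proof -
  let ?f = "f \<circ> slot_swap i N" and ?h = "\<lambda>l. if l \<le> N - 1 then (f \<circ> slot_swap i N) l else g"
  have f': "in_slots N ?f" by (rule in_slots_swap[OF f i NN])
  have fm: "in_slots (N - 1) ?f" by (rule in_slots_mono[OF f']) simp
  have h: "in_slots N ?h" using fm g by (auto simp: in_slots_def)
  have N11: "N - 1 \<ge> 1" using N2 by simp
  have "ptr S N (oconj S N i N (tp f)) = tr (f i) *\<^sub>C tpr (N - 1) ?f"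
    using oconj_tpr_slots[OF i NN f] ptr_tpr[OF N2 f'] by simp
  moreover have "otens S (N - 1) 1 (tr (f i) *\<^sub>C tpr (N - 1) ?f) g = tr (f i) *\<^sub>C tp ?h"
    using clinear_on_scaleC[OF otens_clinear_left[OF N11 order_refl g] tpr_in_slots[OF N11 fm]]
      otens_right_tpr[OF fm g] by simp
  moreover have "oconj S N i N (tr (f i) *\<^sub>C tp ?h) = tr (f i) *\<^sub>C tp (?h \<circ> slot_swap i N)"
    using clinear_on_scaleC[OF oconj_clinear[OF i NN] tp_in[OF h]] oconj_tpr_slots[OF i NN h] by simp
  moreover have "tp (?h \<circ> slot_swap i N) = tp (f(i := g))"
  proof (rule tprod_fun_cong)
    fix l assume l: "l \<in> {1..N}"
    have "slot_swap i N l \<le> N - 1 \<longleftrightarrow> l \<noteq> i"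
      using l i N1 by (auto simp: Transposition.transpose_def)
    then show "(?h \<circ> slot_swap i N) l = (f(i := g)) l" by simp
  qed
  ultimately show ?thesis using tp_in[OF f] by (simp add: ins_def)
qed

lemma ptr_oconj_bounded:
  assumes "i \<in> {1..N}"
  shows "bounded_clinear_on X (compl S (N - 1)) (\<lambda>a. ptr S N (oconj S N i N a))"
  by (rule bounded_clinear_on_compose[OF oconj_bounded[OF assms NN] ptr_bounded[OF N2]])

lemma N11: "N - 1 \<ge> 1" and N_minus: "N - 1 + 1 = N"
  using N2 by auto

lemma ins_eq: "a \<in> X \<Longrightarrow> ins g i a = oconj S N i N (otens S (N - 1) 1 (ptr S N (oconj S N i N a)) g)"
  by (simp add: ins_def)

lemma otens_last_in: "b \<in> compl S (N - 1) \<Longrightarrow> g \<in> X1 \<Longrightarrow> otens S (N - 1) 1 b g \<in> X"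
  using otens_in[OF N11 order_refl] unfolding N_minus .

lemma norm_ins:
  assumes i: "i \<in> {1..N}" and g: "g \<in> X1" and a: "a \<in> X"
  shows "norm (ins g i a) \<le> norm g * norm a"
proof -
  let ?b = "ptr S N (oconj S N i N a)"
  have b: "?b \<in> compl S (N - 1)" by (rule bounded_clinear_onD(2)[OF ptr_oconj_bounded[OF i] a])
  have "norm ?b \<le> norm a" using norm_ptr[OF N2 oconj_in[OF i NN a]] norm_oconj[OF i NN a] by simp
  then have "norm ?b * norm g \<le> norm a * norm g" by (intro mult_right_mono) auto
  then show ?thesis
    using norm_oconj[OF i NN otens_last_in[OF b g]] norm_otens[OF N11 order_refl b g]
    by (simp add: ins_eq[OF a] mult.commute)
qed

lemma ins_bounded:
  assumes i: "i \<in> {1..N}" and g: "g \<in> X1"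
  shows "bounded_clinear_on X X (ins g i)"
proof -
  have "bounded_clinear_on (compl S (N - 1)) X (\<lambda>b. otens S (N - 1) 1 b g)"
    using otens_bounded_left[OF N11 order_refl g] unfolding N_minus .
  then have "bounded_clinear_on X X (\<lambda>a. oconj S N i N (otens S (N - 1) 1 (ptr S N (oconj S N i N a)) g))"
    by (intro bounded_clinear_on_compose[OF bounded_clinear_on_compose[OF ptr_oconj_bounded[OF i]] oconj_bounded[OF i NN]])
  then show ?thesis
    using closed_csubspaceD[OF X]
    by (simp add: bounded_clinear_on_def clinear_on_def ins_def image_subset_iff)
qed

lemmas ins_clinear = bounded_clinear_onD(1)[OF ins_bounded]

lemma ins_in: "i \<in> {1..N} \<Longrightarrow> g \<in> X1 \<Longrightarrow> ins g i a \<in> X"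
  using bounded_clinear_onD(2)[OF ins_bounded, of i g a] ins_off zero_in by (cases "a \<in> X") auto

lemma ins_zero: "i \<in> {1..N} \<Longrightarrow> g \<in> X1 \<Longrightarrow> ins g i 0 = 0"
  using clinear_on_zero[OF ins_clinear X] .

lemma ins_clinear_arg:
  assumes i: "i \<in> {1..N}" and a: "a \<in> X"
  shows "clinear_on X1 (\<lambda>g. ins g i a)"
proof -
  let ?b = "ptr S N (oconj S N i N a)"
  have b: "?b \<in> compl S (N - 1)" by (rule bounded_clinear_onD(2)[OF ptr_oconj_bounded[OF i] a])
  show ?thesis
    by (rule clinear_onI)
      (simp_all add: ins_eq[OF a] clinear_onD[OF otens_clinear_right[OF N11 order_refl b]]
        clinear_onD[OF oconj_clinear[OF i NN]] otens_last_in[OF b])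
qed

lemma ins_tendsto:
  assumes i: "i \<in> {1..N}" and g: "(g \<longlongrightarrow> g0) F" "\<forall>\<^sub>F x in F. g x \<in> X1" "g0 \<in> X1"
    and a: "(a \<longlongrightarrow> a0) F" "\<forall>\<^sub>F x in F. a x \<in> X" "a0 \<in> X"
  shows "((\<lambda>x. ins (g x) i (a x)) \<longlongrightarrow> ins g0 i a0) F"
proof -
  let ?p = "\<lambda>a. ptr S N (oconj S N i N a)"
  note p = bounded_clinear_onD(2)[OF ptr_oconj_bounded[OF i]]
  have 1: "((\<lambda>x. ?p (a x)) \<longlongrightarrow> ?p a0) F"
    by (rule bounded_clinear_on_tendsto[OF ptr_oconj_bounded[OF i] X a])
  have ev: "\<forall>\<^sub>F x in F. ?p (a x) \<in> compl S (N - 1)"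
    using a(2) by eventually_elim (rule p)
  have 2: "((\<lambda>x. otens S (N - 1) 1 (?p (a x)) (g x)) \<longlongrightarrow> otens S (N - 1) 1 (?p a0) g0) F"
    by (rule otens_tendsto[OF N11 order_refl 1 g(1) ev g(2) p[OF a(3)] g(3)])
  have ev2: "\<forall>\<^sub>F x in F. otens S (N - 1) 1 (?p (a x)) (g x) \<in> X"
    using ev g(2) by eventually_elim (rule otens_last_in)
  have "((\<lambda>x. oconj S N i N (otens S (N - 1) 1 (?p (a x)) (g x))) \<longlongrightarrow> oconj S N i N (otens S (N - 1) 1 (?p a0) g0)) F"
    by (rule bounded_clinear_on_tendsto[OF oconj_bounded[OF i NN] X 2 ev2 otens_last_in[OF p[OF a(3)] g(3)]])
  then show ?thesis
    unfolding ins_eq[OF a(3)]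
  proof (rule Lim_transform_eventually)
    show "\<forall>\<^sub>F x in F. oconj S N i N (otens S (N - 1) 1 (?p (a x)) (g x)) = ins (g x) i (a x)"
      using a(2) by eventually_elim (simp add: ins_eq)
  qed
qed

lemma X_eqI:
  fixes L M :: "'b \<Rightarrow> 'b"
  assumes "bounded_clinear_on X Y L" "bounded_clinear_on X Z M"
    and "\<And>f. in_slots N f \<Longrightarrow> L (tp f) = M (tp f)" "a \<in> X"
  shows "L a = M a"
  by (rule bounded_eqI[OF N1 assms(1,2) _ assms(4)]) (rule assms(3))

lemma ins_scaleC: "i \<in> {1..N} \<Longrightarrow> g \<in> X1 \<Longrightarrow> a \<in> X \<Longrightarrow> ins g i (c *\<^sub>C a) = c *\<^sub>C ins g i a"
  by (rule clinear_on_scaleC[OF ins_clinear])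

lemma ins_ins_tp:
  assumes "i \<in> {1..N}" "l \<in> {1..N}" "g \<in> X1" "h \<in> X1" "in_slots N f"
  shows "ins g i (ins h l (tp f)) = (tr (f l) * tr ((f(l := h)) i)) *\<^sub>C tp (f(l := h, i := g))"
  using in_slots_upd[OF assms(5,4), of l] assms
  by (simp add: ins_tp ins_scaleC tp_in scaleC_scaleC)

lemma ins_commute:
  assumes "i \<in> {1..N}" "l \<in> {1..N}" "g \<in> X1" "h \<in> X1" "i \<noteq> l"
  shows "ins g i (ins h l a) = ins h l (ins g i a)"
proof (cases "a \<in> X")
  case True
  show ?thesis
  proof (rule X_eqI[OF bounded_clinear_on_compose[OF ins_bounded ins_bounded]
        bounded_clinear_on_compose[OF ins_bounded ins_bounded] _ True])
    fix f assume f: "in_slots N f"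
    show "ins g i (ins h l (tp f)) = ins h l (ins g i (tp f))"
      using ins_ins_tp[OF assms(1-4) f] ins_ins_tp[OF assms(2,1,4,3) f] assms(5)
      by (simp add: fun_upd_twist mult.commute)
  qed (use assms in simp_all)
qed (use assms in \<open>simp add: ins_off ins_zero\<close>)

text \<open>With g = h this makes \<open>ins h i\<close> a projection. In general the later
  insertion prevails, since tracing out h gives the factor 1.\<close>

lemma ins_absorb:
  assumes "i \<in> {1..N}" "g \<in> X1" "h \<in> X1" "tr h = 1"
  shows "ins g i (ins h i a) = ins g i a"
proof (cases "a \<in> X")
  case True
  show ?thesis
  proof (rule X_eqI[OF bounded_clinear_on_compose[OF ins_bounded ins_bounded] ins_bounded _ True])
    fix f assume f: "in_slots N f"
    show "ins g i (ins h i (tp f)) = ins g i (tp f)"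
      using ins_ins_tp[OF assms(1,1,2,3) f] ins_tp[OF assms(1,2) f] assms(4) by simp
  qed (use assms in simp_all)
qed (use assms in \<open>simp add: ins_off ins_zero\<close>)

lemma oconj_ins:
  assumes ks: "k \<in> {1..N}" "s \<in> {1..N}" and i: "i \<in> {1..N}" and g: "g \<in> X1" and a: "a \<in> X"
  shows "oconj S N k s (ins g i a) = ins g (slot_swap k s i) (oconj S N k s a)"
proof (rule X_eqI[OF bounded_clinear_on_compose[OF ins_bounded[OF i g] oconj_bounded[OF ks]]
        bounded_clinear_on_compose[OF oconj_bounded[OF ks] ins_bounded[OF transpose_in[OF ks i] g]] _ a])
  fix f assume f: "in_slots N f"
  have "f(i := g) \<circ> slot_swap k s = (f \<circ> slot_swap k s)(slot_swap k s i := g)"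
    by (rule ext) (simp add: Transposition.transpose_def)
  then show "oconj S N k s (ins g i (tp f)) = ins g (slot_swap k s i) (oconj S N k s (tp f))"
    using f g ks i in_slots_upd[OF f g, of i] in_slots_swap[OF f ks] transpose_in[OF ks i]
    by (simp add: ins_tp oconj_tpr_slots clinear_on_scaleC[OF oconj_clinear[OF ks]] tp_in)
qed

lemma oconj_involutive:
  assumes ks: "k \<in> {1..N}" "s \<in> {1..N}" and a: "a \<in> X"
  shows "oconj S N k s (oconj S N k s a) = a"
proof (rule X_eqI[OF bounded_clinear_on_compose[OF oconj_bounded[OF ks] oconj_bounded[OF ks]] bounded_clinear_on_id _ a])
  fix f assume f: "in_slots N f"
  show "oconj S N k s (oconj S N k s (tp f)) = tp f"
    using in_slots_swap[OF f ks] f ks by (simp add: oconj_tpr_slots comp_assoc)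
qed

text \<open>The marginal traces out slot i, where g contributes 1, while the trace of the old entry
  is already the factor produced by \<open>ins\<close>.\<close>

lemma marg_ins:
  assumes j: "j \<ge> 1" and i: "j < i" "i \<le> N" and g: "g \<in> X1" "tr g = 1" and a: "a \<in> X"
  shows "marg S j N (ins g i a) = marg S j N a"
proof -
  have jN: "j \<le> N" and iN: "i \<in> {1..N}" using j i by auto
  show ?thesis
  proof (rule X_eqI[OF bounded_clinear_on_compose[OF ins_bounded[OF iN g(1)] marg_bounded[OF j jN]] marg_bounded[OF j jN] _ a])
    fix f assume f: "in_slots N f"
    have "(\<Prod>l\<in>{j<..N} - {i}. tr ((f(i := g)) l)) = (\<Prod>l\<in>{j<..N} - {i}. tr (f l))"
      by (intro prod.cong) auto
    then have "(\<Prod>l\<in>{j<..N}. tr (f l)) = tr (f i) * (\<Prod>l\<in>{j<..N} - {i}. tr (f l))"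
      "(\<Prod>l\<in>{j<..N}. tr ((f(i := g)) l)) = tr g * (\<Prod>l\<in>{j<..N} - {i}. tr (f l))"
      using prod.remove[of "{j<..N}" i "\<lambda>l. tr (f l)"] prod.remove[of "{j<..N}" i "\<lambda>l. tr ((f(i := g)) l)"] i
      by simp_all
    moreover have "tpr j (f(i := g)) = tpr j f"
      by (rule tprod_fun_cong) (use i in auto)
    moreover note f' = in_slots_upd[OF f g(1), of i]
    ultimately show "marg S j N (ins g i (tp f)) = marg S j N (tp f)"
      using clinear_on_scaleC[OF bounded_clinear_onD(1)[OF marg_bounded[OF j jN]] tp_in[OF f']]
        marg_tpr[OF j jN f] marg_tpr[OF j jN f'] g(2)
      by (simp add: ins_tp[OF iN g(1) f] scaleC_scaleC)
  qed
qed

section \<open>The interaction\<close>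

text \<open>The form of element on which \<open>VI_tensor\<close> gives \<open>intVI\<close>: any
  two-particle element in the slots 1 and 2, an elementary tensor in the others. Only the values of
  \<open>f\<close> beyond 2 enter.\<close>

definition tens2 :: "'b \<Rightarrow> (nat \<Rightarrow> 'b) \<Rightarrow> 'b" where
  "tens2 c f = otens S 2 (N - 2) c (tpr (N - 2) (\<lambda>i. f (2 + i)))"

lemma N21: "N - 2 \<ge> 1" "2 + (N - 2) = N" and le12: "(1::nat) \<le> 2"
  and slots12: "1 \<in> {1..N}" "2 \<in> {1..N}"
  using N3 by auto

lemma tail_slots: "in_slots N f \<Longrightarrow> in_slots (N - 2) (\<lambda>i. f (2 + i))"
  by (erule in_slots_shift) (use N3 in arith)

lemma tens2_bounded: "in_slots N f \<Longrightarrow> bounded_clinear_on (compl S 2) X (\<lambda>c. tens2 c f)"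
  using otens_bounded_left[OF le12 N21(1) tpr_in_slots[OF N21(1) tail_slots]] unfolding N21(2) tens2_def .

lemmas tens2_in = bounded_clinear_onD(2)[OF tens2_bounded]

lemma tens2_tpr:
  assumes "in_slots 2 h" "in_slots N f"
  shows "tens2 (tpr 2 h) f = tp (\<lambda>i. if i \<le> 2 then h i else f i)"
proof -
  have "tp (\<lambda>i. if i \<le> 2 then h i else f (2 + (i - 2))) = tp (\<lambda>i. if i \<le> 2 then h i else f i)"
    by (rule tprod_fun_cong) (metis le_add_diff_inverse linorder_linear)
  then show ?thesis
    using tpr_append_slots[OF le12 N21(1) assms(1) tail_slots[OF assms(2)]] unfolding N21(2) tens2_def by (simp only:)
qed

lemma tens2_slots: "in_slots 2 h \<Longrightarrow> in_slots N f \<Longrightarrow> in_slots N (\<lambda>i. if i \<le> 2 then h i else f i)"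
  by (simp add: in_slots_def)

lemma tp_tens2:
  assumes "in_slots N f"
  shows "tp f = tens2 (tpr 2 f) f"
  by (subst tens2_tpr[OF in_slots_mono[OF assms N2] assms]) simp

lemma VI_tens2:
  assumes "in_slots N f" "c \<in> compl S 2"
  shows "intVI S N (tens2 c f) = tens2 (intV S c) f"
  using VI_tensor[OF N21(1) assms(2) tpr_in_slots[OF N21(1) tail_slots[OF assms(1)]]] unfolding N21(2) tens2_def .

text \<open>Needed because \<open>intV S c\<close> need not be elementary even if c is. Both sides
  are bounded in c, so elementary c suffice.\<close>

lemma tens2_eqI:
  fixes L M :: "'b \<Rightarrow> 'b"
  assumes "bounded_clinear_on X Y L" "bounded_clinear_on (compl S 2) Z M" "in_slots N f"
    and "\<And>h. in_slots 2 h \<Longrightarrow> L (tp (\<lambda>i. if i \<le> 2 then h i else f i)) = M (tpr 2 h)" "c \<in> compl S 2"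
  shows "L (tens2 c f) = M c"
  by (rule bounded_eqI[OF le12 bounded_clinear_on_compose[OF tens2_bounded[OF assms(3)] assms(1)] assms(2) _ assms(5)])
    (simp add: assms(3,4) tens2_tpr)

lemma ins_tens2:
  assumes l: "l \<in> {1..N}" "l > 2" and g: "g \<in> X1" and f: "in_slots N f" and c: "c \<in> compl S 2"
  shows "ins g l (tens2 c f) = tr (f l) *\<^sub>C tens2 c (f(l := g))"
proof (rule tens2_eqI[OF ins_bounded[OF l(1) g] bounded_clinear_on_scaleC[OF tens2_bounded[OF in_slots_upd[OF f g]] X] f _ c])
  fix h assume h: "in_slots 2 h"
  have "(\<lambda>i. if i \<le> 2 then h i else f i)(l := g) = (\<lambda>i. if i \<le> 2 then h i else (f(l := g)) i)"
    using l by auto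
  then show "ins g l (tp (\<lambda>i. if i \<le> 2 then h i else f i)) = tr (f l) *\<^sub>C tens2 (tpr 2 h) (f(l := g))"
    using ins_tp[OF l(1) g tens2_slots[OF h f]] tens2_tpr[OF h in_slots_upd[OF f g], of l] l by simp
qed

lemma otens_11_tpr:
  assumes "a \<in> X1" "b \<in> X1"
  shows "otens S 1 1 a b = tpr 2 (\<lambda>i. if i = 1 then a else b)"
proof -
  have "tpr (Suc 1) (\<lambda>i. if i = 1 then a else b) = otens S 1 1 a b"
    by (subst tprod_fun_Suc) simp_all
  then show ?thesis by (simp add: numeral_2_eq_2 One_nat_def)
qed

lemma pair_slots: "a \<in> X1 \<Longrightarrow> b \<in> X1 \<Longrightarrow> in_slots 2 (\<lambda>i. if i = 1 then a else b)"
  by (simp add: in_slots_def)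

lemma ptr2_bounded: "bounded_clinear_on (compl S 2) X1 (ptr S 2)"
  using ptr_bounded[of 2] by (simp add: One_nat_def)

lemma ins_2_tens2:
  assumes g: "g \<in> X1" and f: "in_slots N f" and c: "c \<in> compl S 2"
  shows "ins g 2 (tens2 c f) = tens2 (otens S 1 1 (ptr S 2 c) g) f"
proof (rule tens2_eqI[OF ins_bounded[OF slots12(2) g] _ f _ c])
  have "bounded_clinear_on X1 (compl S 2) (\<lambda>b. otens S 1 1 b g)"
    using otens_bounded_left[of 1 1 g] g by (simp add: numeral_2_eq_2 One_nat_def)
  then show "bounded_clinear_on (compl S 2) X (\<lambda>c. tens2 (otens S 1 1 (ptr S 2 c) g) f)"
    by (rule bounded_clinear_on_compose[OF bounded_clinear_on_compose[OF ptr2_bounded] tens2_bounded[OF f]])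
  fix h assume h: "in_slots 2 h"
  have h12: "h 1 \<in> X1" "h 2 \<in> X1" using h by (auto simp: in_slots_def)
  have p: "ptr S 2 (tpr 2 h) = tr (h 2) *\<^sub>C h 1" using ptr_tpr[OF order_refl h] tprod_fun_1[of "otens S" h]
    by (simp add: One_nat_def)
  let ?k = "\<lambda>i::nat. if i = 1 then h 1 else g"
  have k: "in_slots 2 ?k" by (rule pair_slots[OF h12(1) g])
  have "otens S 1 1 (tr (h 2) *\<^sub>C h 1) g = tr (h 2) *\<^sub>C tpr 2 ?k"
    using clinear_on_scaleC[OF otens_clinear_left[OF order_refl order_refl g] h12(1)] otens_11_tpr[OF h12(1) g] by simp
  then have "tens2 (otens S 1 1 (ptr S 2 (tpr 2 h)) g) f = tr (h 2) *\<^sub>C tens2 (tpr 2 ?k) f"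
    using clinear_on_scaleC[OF bounded_clinear_onD(1)[OF tens2_bounded[OF f]] tpr_in_slots[OF le12 k]] p by simp
  also have "tens2 (tpr 2 ?k) f = tp ((\<lambda>i. if i \<le> 2 then h i else f i)(2 := g))"
    unfolding tens2_tpr[OF k f]
  proof (rule tprod_fun_cong)
    fix i assume "i \<in> {1..N}"
    then have "i = 1 \<or> i = 2 \<or> i > 2" by auto
    then show "(if i \<le> 2 then if i = 1 then h 1 else g else f i) = ((\<lambda>i. if i \<le> 2 then h i else f i)(2 := g)) i"
      by auto
  qed
  finally show "ins g 2 (tp (\<lambda>i. if i \<le> 2 then h i else f i)) = tens2 (otens S 1 1 (ptr S 2 (tpr 2 h)) g) f"
    using ins_tp[OF slots12(2) g tens2_slots[OF h f]] by simp
qed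

lemma ins_1_tens2:
  assumes g: "g \<in> X1" and b: "b \<in> X1" and h: "h \<in> X1" and f: "in_slots N f"
  shows "ins g 1 (tens2 (otens S 1 1 b h) f) = tr b *\<^sub>C tens2 (otens S 1 1 g h) f"
proof -
  note sl = tens2_slots[OF pair_slots[OF b h] f]
  have "tp ((\<lambda>i. if i \<le> 2 then if i = 1 then b else h else f i)(1 := g)) = tp (\<lambda>i. if i \<le> 2 then if i = 1 then g else h else f i)"
    by (rule tprod_fun_cong) simp
  then show ?thesis
    using ins_tp[OF slots12(1) g sl]
    by (simp add: otens_11_tpr b g h tens2_tpr[OF pair_slots[OF b h] f] tens2_tpr[OF pair_slots[OF g h] f])
qed

text \<open>Read off from \<open>marg_V\<close> with j = 1, i = 2, r = 3: c is moved to the slots 2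
  and 3 of an element with F elsewhere; after the interaction the marginal on slot 1 is F times the
  functional of V c, and F is not 0.\<close>

lemma ell_V:
  assumes F: "F \<in> X1" "tr F = 1" and c: "c \<in> compl S 2"
  shows "ell S 2 (intV S c) = 0"
proof -
  let ?f = "\<lambda>_::nat. F" and ?c = "\<lambda>x. oconj S N 1 2 (oconj S N 2 3 x)"
  have s3: "3 \<in> {1..N}" using N3 by simp
  note o12 = slots12 and o23 = slots12(2) s3
  have f: "in_slots N ?f" using F by (simp add: in_slots_def)
  have Vc: "intV S x \<in> compl S 2" if "x \<in> compl S 2" for x using bounded_clinear_onD(2)[OF V_bounded that] .
  \<comment> \<open>Chosen so that the exchanges inside \<open>Tir S N 2 3\<close> bring c back to
    the slots 1 and 2.\<close>
  define a where "a = ?c (tens2 c ?f)"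
  have t: "tens2 c ?f \<in> X" by (rule tens2_in[OF f c])
  have a: "a \<in> X" unfolding a_def by (intro oconj_in o12 o23 t)
  have undo: "oconj S N 2 3 (oconj S N 1 2 a) = tens2 c ?f"
    unfolding a_def using oconj_in[OF o23 t] by (simp add: oconj_involutive o12 o23 t del: atLeastAtMost_iff)
  have main: "marg S 1 N (?c (tens2 c' ?f)) = ell S 2 c' *\<^sub>C F" if c': "c' \<in> compl S 2" for c'
  proof (rule tens2_eqI[OF bounded_clinear_on_compose[OF bounded_clinear_on_compose[OF oconj_bounded[OF o23] oconj_bounded[OF o12]]
          marg_bounded[OF order_refl N1]] _ f _ c'])
    show "bounded_clinear_on (compl S 2) X1 (\<lambda>c. ell S 2 c *\<^sub>C F)"
    proof (rule bounded_clinear_onI[where C = "norm F"])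
      show "clinear_on (compl S 2) (\<lambda>c. ell S 2 c *\<^sub>C F)"
        by (rule clinear_onI) (simp_all add: ell_linear scaleC_add_left scaleC_scaleC)
      show "ell S 2 x *\<^sub>C F \<in> X1" for x by (rule closed_csubspaceD(3)[OF X1 F(1)])
      show "norm (ell S 2 x *\<^sub>C F) \<le> norm F * norm x" if "x \<in> compl S 2" for x
        using mult_right_mono[OF norm_ell[OF le12 that], of "norm F"] by (simp add: norm_scaleC mult.commute)
    qed
    fix h assume h: "in_slots 2 h"
    let ?k = "\<lambda>i. if i \<le> 2 then h i else ?f i"
    have k: "in_slots N ?k" by (rule tens2_slots[OF h f])
    note k' = in_slots_swap[OF k o23] note k'' = in_slots_swap[OF k' o12]
    have "?c (tp ?k) = tp (?k \<circ> slot_swap 2 3 \<circ> slot_swap 1 2)"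
      using oconj_tpr_slots[OF o23 k] oconj_tpr_slots[OF o12 k'] by simp
    moreover have "marg S 1 N (tp (?k \<circ> slot_swap 2 3 \<circ> slot_swap 1 2))
        = (\<Prod>i\<in>{1<..N}. tr ((?k \<circ> slot_swap 2 3 \<circ> slot_swap 1 2) i)) *\<^sub>C tpr 1 (?k \<circ> slot_swap 2 3 \<circ> slot_swap 1 2)"
      by (rule marg_tpr[OF order_refl N1 k''])
    moreover have "{1<..N} = {2, 3} \<union> {3<..N}" using N3 by auto
    then have "(\<Prod>i\<in>{1<..N}. tr ((?k \<circ> slot_swap 2 3 \<circ> slot_swap 1 2) i)) = tr (h 1) * tr (h 2)"
      using F(2) by (simp add: prod.union_disjoint Transposition.transpose_def)
    moreover have "tpr 1 (?k \<circ> slot_swap 2 3 \<circ> slot_swap 1 2) = F"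
      by (simp add: Transposition.transpose_def)
    moreover have "ell S 2 (tpr 2 h) = tr (h 1) * tr (h 2)"
      using ell_tpr[OF le12 h] by (simp add: numeral_2_eq_2 One_nat_def)
    ultimately show "marg S 1 N (?c (tp ?k)) = ell S 2 (tpr 2 h) *\<^sub>C F" by simp
  qed
  have "marg S 1 N (Tir S N 2 3 a) = 0" by (rule marg_V) (use N3 a in simp_all)
  then have "marg S 1 N (?c (tens2 (intV S c) ?f)) = 0"
    by (simp add: Tir_def undo VI_tens2[OF f c])
  then have "ell S 2 (intV S c) *\<^sub>C F = 0" using main[OF Vc[OF c]] by simp
  moreover have "norm F \<noteq> 0" using F(2) norm_ell[OF order_refl F(1)] by auto
  ultimately have "cmod (ell S 2 (intV S c)) * norm F = 0"
    by (metis norm_scaleC norm_zero)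
  then show ?thesis using \<open>norm F \<noteq> 0\<close> by simp
qed

abbreviation VI :: "'b \<Rightarrow> 'b" where "VI \<equiv> intVI S N"

lemma VI_X: "bounded_clinear_on X X VI" by (rule VI_bounded[OF N2])

lemma V_in: "c \<in> compl S 2 \<Longrightarrow> intV S c \<in> compl S 2"
  by (rule bounded_clinear_onD(2)[OF V_bounded])

lemma VI_tp: "in_slots N f \<Longrightarrow> VI (tp f) = tens2 (intV S (tpr 2 f)) f"
  using tp_tens2[of f] VI_tens2[of f "tpr 2 f"] tpr_in_slots[OF le12 in_slots_mono[OF _ N2], of f] by simp

lemma ins_VI:
  assumes l: "l \<in> {1..N}" "l > 2" and g: "g \<in> X1" and a: "a \<in> X"
  shows "ins g l (VI a) = VI (ins g l a)"
proof (rule X_eqI[OF bounded_clinear_on_compose[OF VI_X ins_bounded[OF l(1) g]]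
      bounded_clinear_on_compose[OF ins_bounded[OF l(1) g] VI_X] _ a])
  fix f assume f: "in_slots N f"
  have f2: "tpr 2 f \<in> compl S 2" by (rule tpr_in_slots[OF le12 in_slots_mono[OF f N2]])
  have "tpr 2 (f(l := g)) = tpr 2 f" by (rule tprod_fun_cong) (use l in auto)
  then show "ins g l (VI (tp f)) = VI (ins g l (tp f))"
    using ins_tens2[OF l g f V_in[OF f2]] ins_tp[OF l(1) g f] VI_tp[OF in_slots_upd[OF f g], of l]
      clinear_on_scaleC[OF bounded_clinear_onD(1)[OF VI_X] tp_in[OF in_slots_upd[OF f g]]]
    by (simp add: VI_tp[OF f])
qed

text \<open>Tracing out slot 2 and then slot 1 evaluates the functional on V c, which is 0 by
  \<open>ell_V\<close>.\<close>

lemma ins_12_VI: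
  assumes F: "F \<in> X1" "tr F = 1" and g: "g \<in> X1" and h: "h \<in> X1" and a: "a \<in> X"
  shows "ins g 1 (ins h 2 (VI a)) = 0"
proof (rule X_eqI[OF bounded_clinear_on_compose[OF bounded_clinear_on_compose[OF VI_X ins_bounded[OF slots12(2) h]]
        ins_bounded[OF slots12(1) g]] bounded_clinear_on_zero[OF X] _ a])
  fix f assume f: "in_slots N f"
  let ?c = "intV S (tpr 2 f)"
  have f2: "tpr 2 f \<in> compl S 2" by (rule tpr_in_slots[OF le12 in_slots_mono[OF f N2]])
  have p: "ptr S 2 ?c \<in> X1" by (rule bounded_clinear_onD(2)[OF ptr2_bounded V_in[OF f2]])
  have "tr (ptr S 2 ?c) = 0"
    using ell_ptr[OF order_refl V_in[OF f2]] ell_V[OF F f2] by (simp add: One_nat_def)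
  then show "ins g 1 (ins h 2 (VI (tp f))) = 0"
    using ins_1_tens2[OF g p h f] by (simp add: VI_tp[OF f] ins_2_tens2[OF h f V_in[OF f2]])
qed

lemma meanQ_in: "g \<in> X1 \<Longrightarrow> h \<in> X1 \<Longrightarrow> meanQ S g h \<in> X1"
  unfolding meanQ_def using otens_in[OF order_refl order_refl, of g h]
  by (intro bounded_clinear_onD(2)[OF ptr2_bounded] V_in) (simp add: numeral_2_eq_2 One_nat_def)

text \<open>With F in both slots, tracing out slot 2 after the interaction is the definition of
  Q(F,F), which stays in slot 1.\<close>

lemma VI_ins_12:
  assumes F: "F \<in> X1" and h: "h \<in> X1" and a: "a \<in> X"
  shows "ins h 2 (VI (ins F 1 (ins F 2 a))) = ins h 2 (ins (meanQ S F F) 1 a)"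
proof (rule X_eqI[OF bounded_clinear_on_compose[OF bounded_clinear_on_compose[OF bounded_clinear_on_compose[OF ins_bounded ins_bounded] VI_X] ins_bounded]
      bounded_clinear_on_compose[OF ins_bounded ins_bounded] _ a])
  fix f assume f: "in_slots N f"
  let ?q = "meanQ S F F"
  note q = meanQ_in[OF F F]
  define k where "k = f(2 := F, 1 := F)"
  have k: "in_slots N k" unfolding k_def by (intro in_slots_upd f F)
  have k2: "tpr 2 k = otens S 1 1 F F"
    unfolding otens_11_tpr[OF F F] by (rule tprod_fun_cong) (auto simp: k_def numeral_2_eq_2 One_nat_def)
  have F2: "otens S 1 1 F F \<in> compl S 2" unfolding k2[symmetric] by (rule tpr_in_slots[OF le12 in_slots_mono[OF k N2]])
  have kh: "tens2 (otens S 1 1 ?q h) k = tp (f(1 := ?q, 2 := h))"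
    unfolding otens_11_tpr[OF q h] tens2_tpr[OF pair_slots[OF q h] k]
    by (rule tprod_fun_cong) (auto simp: k_def numeral_2_eq_2 One_nat_def)
  have "ins h 2 (VI (tp k)) = tp (f(1 := ?q, 2 := h))"
    using ins_2_tens2[OF h k V_in[OF F2]] by (simp add: VI_tp[OF k] k2 meanQ_def[symmetric] kh)
  moreover have "VI (tp k) \<in> X" by (rule bounded_clinear_onD(2)[OF VI_X tp_in[OF k]])
  ultimately show "ins h 2 (VI (ins F 1 (ins F 2 (tp f)))) = ins h 2 (ins ?q 1 (tp f))"
    using ins_ins_tp[OF slots12 F F f] ins_ins_tp[OF slots12(2,1) h q f]
      clinear_on_scaleC[OF bounded_clinear_onD(1)[OF VI_X] tp_in[OF k]] ins_scaleC[OF slots12(2) h]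
    by (simp add: k_def[symmetric] mult.commute)
qed (use slots12 F h meanQ_in in simp_all)

text \<open>The permutation of slots by which \<open>Tir S N i r\<close> is conjugate to the interaction of the slots 1 and 2.\<close>

definition rho :: "nat \<Rightarrow> nat \<Rightarrow> nat \<Rightarrow> nat" where
  "rho i r l = slot_swap 2 r (slot_swap 1 i l)"

lemma rho_simps:
  assumes "1 \<le> i" "i < r"
  shows "rho i r i = 1" "rho i r r = 2" "l \<noteq> i \<Longrightarrow> l \<noteq> r \<Longrightarrow> l \<ge> 1 \<Longrightarrow> rho i r l > 2"
    "slot_swap 1 i (slot_swap 2 r 1) = i" "slot_swap 1 i (slot_swap 2 r 2) = r"
    "slot_swap 1 i (slot_swap 2 r (rho i r l)) = l"
  using assms by (auto simp: rho_def Transposition.transpose_def)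

lemma rho_in: "i \<in> {1..N} \<Longrightarrow> r \<in> {1..N} \<Longrightarrow> l \<in> {1..N} \<Longrightarrow> rho i r l \<in> {1..N}"
  unfolding rho_def by (intro transpose_in slots12)

lemma Tir_bounded:
  assumes "j \<ge> 2" "i \<in> {1..j}" "r \<in> {1..j}"
  shows "bounded_clinear_on (compl S j) (compl S j) (Tir S j i r)"
proof -
  have s: "1 \<in> {1..j}" "2 \<in> {1..j}" using assms by auto
  show ?thesis
    unfolding Tir_def
    by (rule bounded_clinear_on_compose[OF bounded_clinear_on_compose[OF bounded_clinear_on_compose[OF
            bounded_clinear_on_compose[OF oconj_bounded[OF s(1) assms(2)] oconj_bounded[OF s(2) assms(3)]]
            VI_bounded[OF assms(1)]] oconj_bounded[OF s(2) assms(3)]] oconj_bounded[OF s(1) assms(2)]])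
qed

lemma norm_Tir:
  assumes j: "j \<ge> 2" and ir: "i \<in> {1..j}" "r \<in> {1..j}" and a: "a \<in> compl S j"
  shows "norm (Tir S j i r a) \<le> normV S * norm a"
proof -
  have s: "1 \<in> {1..j}" "2 \<in> {1..j}" using j by auto
  note in1 = oconj_in[OF s(1) ir(1) a] note in2 = oconj_in[OF s(2) ir(2) in1]
  note in3 = bounded_clinear_onD(2)[OF VI_bounded[OF j] in2]
  note in4 = oconj_in[OF s(2) ir(2) in3]
  show ?thesis
    using norm_oconj[OF s(1) ir(1) in4] norm_oconj[OF s(2) ir(2) in3] VI_norm[OF j in2]
      norm_oconj[OF s(2) ir(2) in1] norm_oconj[OF s(1) ir(1) a]
    by (simp add: Tir_def)
qed

context
  fixes i r assumes i1: "1 \<le> i" and ir: "i < r" and rN: "r \<le> N"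
begin

lemma ir_in: "i \<in> {1..N}" "r \<in> {1..N}"
  using i1 ir rN by auto

lemma oconj_rho_in: "a \<in> X \<Longrightarrow> oconj S N 2 r (oconj S N 1 i a) \<in> X"
  by (intro oconj_in slots12 ir_in)

lemma oconj_rho_ins:
  "l \<in> {1..N} \<Longrightarrow> g \<in> X1 \<Longrightarrow> a \<in> X \<Longrightarrow>
    oconj S N 2 r (oconj S N 1 i (ins g l a)) = ins g (rho i r l) (oconj S N 2 r (oconj S N 1 i a))"
  unfolding rho_def
  by (simp add: oconj_ins oconj_in transpose_in slots12 ir_in del: atLeastAtMost_iff)

lemma oconj_rho_inv_ins:
  "l \<in> {1..N} \<Longrightarrow> g \<in> X1 \<Longrightarrow> a \<in> X \<Longrightarrow>
    oconj S N 1 i (oconj S N 2 r (ins g l a)) = ins g (slot_swap 1 i (slot_swap 2 r l)) (oconj S N 1 i (oconj S N 2 r a))"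
  by (simp add: oconj_ins oconj_in transpose_in slots12 ir_in del: atLeastAtMost_iff)

lemma oconj_rho_inverse: "a \<in> X \<Longrightarrow> oconj S N 1 i (oconj S N 2 r (oconj S N 2 r (oconj S N 1 i a))) = a"
  by (simp add: oconj_involutive oconj_in slots12 ir_in del: atLeastAtMost_iff)

lemma VI_in: "a \<in> X \<Longrightarrow> VI a \<in> X"
  by (rule bounded_clinear_onD(2)[OF VI_X])

lemma ins_Tir:
  assumes l: "l \<in> {1..N}" "l \<noteq> i" "l \<noteq> r" and g: "g \<in> X1" and a: "a \<in> X"
  shows "ins g l (Tir S N i r a) = Tir S N i r (ins g l a)"
proof -
  let ?b = "oconj S N 2 r (oconj S N 1 i a)"
  have b: "?b \<in> X" by (rule oconj_rho_in[OF a])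
  have rl: "rho i r l \<in> {1..N}" "rho i r l > 2"
    using rho_in[OF ir_in l(1)] rho_simps(3)[OF i1 ir, of l] l by auto
  have "Tir S N i r (ins g l a) = oconj S N 1 i (oconj S N 2 r (VI (ins g (rho i r l) ?b)))"
    by (simp only: Tir_def oconj_rho_ins[OF l(1) g a])
  also have "VI (ins g (rho i r l) ?b) = ins g (rho i r l) (VI ?b)" by (rule ins_VI[OF rl g b, symmetric])
  also have "oconj S N 1 i (oconj S N 2 r (ins g (rho i r l) (VI ?b))) = ins g l (Tir S N i r a)"
    unfolding oconj_rho_inv_ins[OF rl(1) g VI_in[OF b]] rho_simps(6)[OF i1 ir] Tir_def ..
  finally show ?thesis by simp
qed

lemma ins_ir_Tir:
  assumes F: "F \<in> X1" "tr F = 1" and g: "g \<in> X1" and h: "h \<in> X1" and a: "a \<in> X"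
  shows "ins g i (ins h r (Tir S N i r a)) = 0"
proof -
  let ?b = "oconj S N 2 r (oconj S N 1 i a)"
  have b: "?b \<in> X" by (rule oconj_rho_in[OF a])
  have "ins h r (Tir S N i r a) = oconj S N 1 i (oconj S N 2 r (ins h 2 (VI ?b)))"
    unfolding oconj_rho_inv_ins[OF slots12(2) h VI_in[OF b]] rho_simps(5)[OF i1 ir] Tir_def ..
  moreover have "ins g i (oconj S N 1 i (oconj S N 2 r (ins h 2 (VI ?b))))
      = oconj S N 1 i (oconj S N 2 r (ins g 1 (ins h 2 (VI ?b))))"
    unfolding oconj_rho_inv_ins[OF slots12(1) g ins_in[OF slots12(2) h]] rho_simps(4)[OF i1 ir] ..
  ultimately show ?thesis
    using ins_12_VI[OF F g h b] clinear_on_zero[OF oconj_clinear[OF slots12(1) ir_in(1)] X]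
      clinear_on_zero[OF oconj_clinear[OF slots12(2) ir_in(2)] X] by simp
qed

lemma Tir_ins_ir:
  assumes F: "F \<in> X1" and h: "h \<in> X1" and a: "a \<in> X"
  shows "ins h r (Tir S N i r (ins F i (ins F r a))) = ins h r (ins (meanQ S F F) i a)"
proof -
  let ?b = "oconj S N 2 r (oconj S N 1 i a)" and ?q = "meanQ S F F"
  have b: "?b \<in> X" by (rule oconj_rho_in[OF a])
  have c: "ins F 1 (ins F 2 ?b) \<in> X" by (rule ins_in[OF slots12(1) F])
  have "oconj S N 2 r (oconj S N 1 i (ins F i (ins F r a))) = ins F 1 (ins F 2 ?b)"
    using oconj_rho_ins[OF ir_in(1) F ins_in[OF ir_in(2) F]] oconj_rho_ins[OF ir_in(2) F a]
    by (simp only: rho_simps(1,2)[OF i1 ir])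
  then have "ins h r (Tir S N i r (ins F i (ins F r a)))
      = oconj S N 1 i (oconj S N 2 r (ins h 2 (VI (ins F 1 (ins F 2 ?b)))))"
    unfolding Tir_def oconj_rho_inv_ins[OF slots12(2) h VI_in[OF c]] rho_simps(5)[OF i1 ir] by (simp only:)
  also have "ins h 2 (VI (ins F 1 (ins F 2 ?b))) = ins h 2 (ins ?q 1 ?b)" by (rule VI_ins_12[OF F h b])
  also have "oconj S N 1 i (oconj S N 2 r (ins h 2 (ins ?q 1 ?b))) = ins h r (ins ?q i (oconj S N 1 i (oconj S N 2 r ?b)))"
    using oconj_rho_inv_ins[OF slots12(2) h ins_in[OF slots12(1) meanQ_in[OF F F]]]
      oconj_rho_inv_ins[OF slots12(1) meanQ_in[OF F F] b]
    by (simp only: rho_simps(4,5)[OF i1 ir])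
  finally show ?thesis by (simp only: oconj_rho_inverse[OF a])
qed

end

end

section \<open>Products of slot operators\<close>

lemma (in mean_field_system) normV_nonneg: "normV S \<ge> 0"
proof -
  have "norm (intV S 0) \<le> onorm_on (compl S 2) (intV S)"
    unfolding onorm_on_def
  proof (rule cSUP_upper)
    show "0 \<in> {x \<in> compl S 2. norm x \<le> 1}" using closed_csubspaceD(1)[OF compl[of 2]] by simp
    obtain C where C: "\<forall>x\<in>compl S 2. norm (intV S x) \<le> C * norm x"
      using bounded_clinear_onD(3)[OF V_bounded] by (rule exE)
    show "bdd_above ((\<lambda>x. norm (intV S x)) ` {x \<in> compl S 2. norm x \<le> 1})"
    proof (intro bdd_aboveI2)
      fix x assume x: "x \<in> {x \<in> compl S 2. norm x \<le> 1}"
      have "norm (intV S x) \<le> C * norm x" using C x by simp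
      also have "\<dots> \<le> \<bar>C\<bar> * 1" using x by (intro mult_mono) auto
      finally show "norm (intV S x) \<le> \<bar>C\<bar>" by simp
    qed
  qed
  then show ?thesis unfolding normV_def by (rule order_trans[OF norm_ge_zero])
qed

context large_system
begin

text \<open>The code \<open>c i\<close> selects the operator acting on slot \<open>i\<close>: the identity for 0, the projection
  \<open>P = ins F i\<close> for 1, and \<open>1 - P\<close> for 2.\<close>

definition slot :: "'b \<Rightarrow> (nat \<Rightarrow> nat) \<Rightarrow> nat \<Rightarrow> 'b \<Rightarrow> 'b" where
  "slot F c i a = (if c i = 0 then a else if c i = 1 then ins F i a else a - ins F i a)"

text \<open>A fold over a set: the slot operators commute, so no order has to be chosen and
  permutations act on the index set.\<close>

definition sops :: "'b \<Rightarrow> (nat \<Rightarrow> nat) \<Rightarrow> nat set \<Rightarrow> 'b \<Rightarrow> 'b" where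
  "sops F c A a = Finite_Set.fold (slot F c) a A"

lemma ins_diff: "i \<in> {1..N} \<Longrightarrow> g \<in> X1 \<Longrightarrow> a \<in> X \<Longrightarrow> b \<in> X \<Longrightarrow> ins g i (a - b) = ins g i a - ins g i b"
  by (rule clinear_on_diff[OF ins_clinear X])

lemma slot_in: "i \<in> {1..N} \<Longrightarrow> F \<in> X1 \<Longrightarrow> a \<in> X \<Longrightarrow> slot F c i a \<in> X"
  using closed_csubspaceD(4)[OF X] ins_in by (simp add: slot_def)

lemma slot_bounded: "i \<in> {1..N} \<Longrightarrow> F \<in> X1 \<Longrightarrow> bounded_clinear_on X X (slot F c i)"
  using bounded_clinear_on_diff[OF bounded_clinear_on_id ins_bounded X, of i F]
    bounded_clinear_on_id[of X] ins_bounded[of i F]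
  unfolding slot_def by (cases "c i = 0"; cases "c i = 1") simp_all

lemma slot_commute:
  assumes il: "i \<in> {1..N}" "l \<in> {1..N}" and F: "F \<in> X1"
  shows "slot F c i (slot F c l a) = slot F c l (slot F c i a)"
proof (cases "i = l")
  case False
  have comm: "ins F i (ins F l a) = ins F l (ins F i a)"
    by (rule ins_commute[OF il F F False])
  show ?thesis
  proof (cases "a \<in> X")
    case True
    note d = ins_diff[OF il(1) F True ins_in[OF il(2) F]] ins_diff[OF il(2) F True ins_in[OF il(1) F]]
    show ?thesis by (simp add: slot_def d comm)
  next
    case False
    then show ?thesis by (simp add: slot_def ins_off ins_zero[OF il(1) F] ins_zero[OF il(2) F])
  qed
qed simp

text \<open>The fold asks for commutation on the whole type, which is why \<open>ins\<close> is 0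
  off \<open>X\<close>.\<close>

lemma slot_comp_fun_commute: "F \<in> X1 \<Longrightarrow> comp_fun_commute_on {1..N} (slot F c)"
  by (unfold_locales) (rule ext, simp only: comp_apply slot_commute)

lemma sops_empty [simp]: "sops F c {} a = a"
  by (simp add: sops_def)

lemma sops_insert:
  assumes "F \<in> X1" "insert i A \<subseteq> {1..N}" "i \<notin> A"
  shows "sops F c (insert i A) a = slot F c i (sops F c A a)"
proof -
  have "finite A" using assms(2) finite_subset by auto
  then show ?thesis
    unfolding sops_def
    by (rule comp_fun_commute_on.fold_insert[OF slot_comp_fun_commute[OF assms(1)] assms(2) _ assms(3)])
qed

lemma slots_induct [consumes 1, case_names empty insert]:
  assumes "A \<subseteq> {1..N}" "P {}"
    and "\<And>i A. insert i A \<subseteq> {1..N} \<Longrightarrow> i \<notin> A \<Longrightarrow> P A \<Longrightarrow> P (insert i A)"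
  shows "P A"
proof -
  have "finite A" using assms(1) finite_subset by auto
  then show ?thesis using assms(1)
    by (induction A rule: finite_induct) (use assms(2,3) in auto)
qed

lemma sops_bounded: "A \<subseteq> {1..N} \<Longrightarrow> F \<in> X1 \<Longrightarrow> bounded_clinear_on X X (sops F c A)"
proof (induction A rule: slots_induct)
  case empty
  then show ?case using bounded_clinear_on_id by (simp add: sops_def)
next
  case (insert i A)
  have i: "i \<in> {1..N}" using insert by simp
  have "bounded_clinear_on X X (\<lambda>a. slot F c i (sops F c A a))"
    by (rule bounded_clinear_on_compose[OF insert.IH slot_bounded]) (use insert i in auto)
  then show ?case using sops_insert[OF insert.prems(1) insert.hyps(1,2)] by presburger
qed

lemma sops_in: "A \<subseteq> {1..N} \<Longrightarrow> F \<in> X1 \<Longrightarrow> a \<in> X \<Longrightarrow> sops F c A a \<in> X"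
  by (rule bounded_clinear_onD(2)[OF sops_bounded])

text \<open>One intertwining principle for three uses: a permutation of slots (\<open>\<pi>\<close>
  is its inverse), an operator commuting with all slot operators of \<open>A\<close>
  (\<open>\<pi>\<close> is the identity), and a change of the code (\<open>L\<close> is the
  identity).\<close>

lemma sops_transfer:
  assumes "A \<subseteq> {1..N}" "F \<in> X1" "a \<in> X" "inj_on \<pi> {1..N}" "\<pi> ` {1..N} \<subseteq> {1..N}"
    and "\<And>a i. a \<in> X \<Longrightarrow> i \<in> A \<Longrightarrow> L (slot F c i a) = slot F c' (\<pi> i) (L a)"
  shows "L (sops F c A a) = sops F c' (\<pi> ` A) (L a)"
  using assms(1,6)
proof (induction A rule: slots_induct)
  case (insert i A)
  have A: "A \<subseteq> {1..N}" using insert by simp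
  have IH: "L (sops F c A a) = sops F c' (\<pi> ` A) (L a)" using insert by auto
  have "insert (\<pi> i) (\<pi> ` A) \<subseteq> {1..N}" using assms(5) insert(1) by blast
  moreover have "\<pi> i \<notin> \<pi> ` A"
    using inj_on_image_mem_iff[OF assms(4), of i A] insert by auto
  ultimately have "sops F c' (\<pi> ` insert i A) (L a) = slot F c' (\<pi> i) (sops F c' (\<pi> ` A) (L a))"
    unfolding image_insert by (rule sops_insert[OF assms(2)])
  then show ?case
    using insert.prems[OF sops_in[OF A assms(2,3)], of i] sops_insert[OF assms(2) insert.hyps(1,2)] IH by simp
qed simp

lemma sops_cong:
  assumes "A \<subseteq> {1..N}" "F \<in> X1" "a \<in> X" "\<And>i. i \<in> A \<Longrightarrow> c i = c' i"
  shows "sops F c A a = sops F c' A a"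
  using sops_transfer[OF assms(1-3), where \<pi> = "\<lambda>i. i" and L = "\<lambda>a. a" and c = c and c' = c'] assms(4)
  by (simp add: slot_def)

lemma sops_pull:
  assumes "A \<subseteq> {1..N}" "F \<in> X1" "a \<in> X" "i \<in> A"
  shows "sops F c A a = slot F c i (sops F (c(i := 0)) A a)"
proof -
  have A: "insert i (A - {i}) = A" using assms by auto
  have sub: "insert i (A - {i}) \<subseteq> {1..N}" using A assms by simp
  have "sops F (c(i := 0)) (A - {i}) a = sops F c (A - {i}) a"
    by (rule sops_cong) (use assms in auto)
  then have "sops F (c(i := 0)) (insert i (A - {i})) a = sops F c (A - {i}) a"
    by (subst sops_insert[OF assms(2) sub]) (simp_all add: slot_def)
  then show ?thesis
    using sops_insert[OF assms(2) sub, of c a] unfolding A by simp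
qed

text \<open>The identity 1 = (1 - P) + P in slot i.\<close>

lemma sops_split:
  assumes "A \<subseteq> {1..N}" "F \<in> X1" "a \<in> X" "i \<in> A"
  shows "sops F (c(i := 0)) A a = sops F (c(i := 2)) A a + sops F (c(i := 1)) A a"
  using sops_pull[OF assms, of "c(i := 2)"] sops_pull[OF assms, of "c(i := 1)"] by (simp add: slot_def)

lemma sops_Un:
  assumes "A \<subseteq> {1..N}" "B \<subseteq> {1..N}" "A \<inter> B = {}" "F \<in> X1"
  shows "sops F c (A \<union> B) a = sops F c A (sops F c B a)"
  using assms(1,3)
proof (induction A rule: slots_induct)
  case (insert i A)
  have "insert i (A \<union> B) \<subseteq> {1..N}" "i \<notin> A \<union> B" using insert assms(2) by auto
  from sops_insert[OF assms(4) this] show ?case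
    using insert sops_insert[OF assms(4) insert.hyps(1,2)] by simp
qed simp

lemma norm_slot:
  assumes "i \<in> {1..N}" "F \<in> X1" "norm F \<le> 1" "a \<in> X"
  shows "norm (slot F c i a) \<le> 2 * norm a"
proof -
  have "norm (ins F i a) \<le> 1 * norm a"
    using norm_ins[OF assms(1,2,4)] mult_right_mono[OF assms(3) norm_ge_zero[of a]] by linarith
  moreover have "norm (a - ins F i a) \<le> norm a + norm (ins F i a)" by (rule norm_triangle_ineq4)
  moreover have "0 \<le> norm a" by simp
  ultimately show ?thesis unfolding slot_def by (cases "c i = 0"; cases "c i = 1"; simp; linarith)
qed

text \<open>P is a contraction because norm F <= 1, and 1 - P has norm at most 2, so only the
  factors 1 - P cost something.\<close>

lemma norm_sops:
  assumes "A \<subseteq> {1..N}" "F \<in> X1" "norm F \<le> 1" "a \<in> X"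
  shows "norm (sops F c A a) \<le> 2 ^ card {i \<in> A. c i \<noteq> 0 \<and> c i \<noteq> 1} * norm a"
  using assms(1)
proof (induction A rule: slots_induct)
  case (insert i A)
  let ?B = "\<lambda>A. {i \<in> A. c i \<noteq> 0 \<and> c i \<noteq> 1}"
  have A: "A \<subseteq> {1..N}" "i \<in> {1..N}" and fin: "finite A" using insert finite_subset[of A "{1..N}"] by auto
  note s = sops_in[OF A(1) assms(2,4), of c]
  have "norm (slot F c i (sops F c A a)) \<le> 2 ^ (card (?B (insert i A)) - card (?B A)) * norm (sops F c A a)
      \<and> card (?B A) \<le> card (?B (insert i A))"
  proof (cases "c i \<noteq> 0 \<and> c i \<noteq> 1")
    case True
    then have "?B (insert i A) = insert i (?B A)" by auto
    moreover have "card (insert i (?B A)) = Suc (card (?B A))" using insert fin by auto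
    ultimately show ?thesis using norm_slot[OF A(2) assms(2,3) s, of c] by simp
  next
    case False
    then have "?B (insert i A) = ?B A" by auto
    moreover have "norm (ins F i (sops F c A a)) \<le> 1 * norm (sops F c A a)"
      using norm_ins[OF A(2) assms(2) s] mult_right_mono[OF assms(3) norm_ge_zero[of "sops F c A a"]] by linarith
    ultimately show ?thesis using False by (auto simp: slot_def)
  qed
  moreover have "2 ^ (card (?B (insert i A)) - card (?B A)) * norm (sops F c A a)
      \<le> 2 ^ (card (?B (insert i A)) - card (?B A)) * (2 ^ card (?B A) * norm a)"
    by (intro mult_left_mono insert.IH) auto
  ultimately show ?case
    using sops_insert[OF assms(2) insert.hyps(1,2), of c a]
    by (simp add: mult.assoc[symmetric] power_add[symmetric])
qed simp

lemma sops_1_tp: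
  assumes "A \<subseteq> {1..N}" "F \<in> X1" "in_slots N f"
  shows "sops F (\<lambda>_. 1) A (tp f) = (\<Prod>i\<in>A. tr (f i)) *\<^sub>C tp (\<lambda>i. if i \<in> A then F else f i)"
  using assms(1)
proof (induction A rule: slots_induct)
  case empty
  then show ?case by simp
next
  case (insert i A)
  have i: "i \<in> {1..N}" and fin: "finite A" using insert finite_subset[of A "{1..N}"] by auto
  let ?g = "\<lambda>l. if l \<in> A then F else f l"
  have g: "in_slots N ?g" using assms by (simp add: in_slots_def)
  have "?g(i := F) = (\<lambda>l. if l \<in> insert i A then F else f l)" by auto
  then show ?case
    using sops_insert[OF assms(2) insert.hyps(1,2), of "\<lambda>_. 1" "tp f"] insert.hyps(2) fin
    by (simp add: insert.IH slot_def ins_scaleC[OF i assms(2) tp_in[OF g]] ins_tp[OF i assms(2) g]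
        scaleC_scaleC mult.commute)
qed

section \<open>Permutations of the slots\<close>

text \<open>The assumptions provide exchanges of two slots; a permutation acts by some product of
  these. The action on elementary tensors fixes the result, while isometry and the invariance of
  symmetric elements are inherited from the factors.\<close>

definition implements :: "(nat \<Rightarrow> nat) \<Rightarrow> ('b \<Rightarrow> 'b) \<Rightarrow> bool" where
  "implements p L \<longleftrightarrow> bounded_clinear_on X X L \<and> (\<forall>f. in_slots N f \<longrightarrow> L (tp f) = tp (f \<circ> p)) \<and>
     (\<forall>a\<in>X. norm (L a) = norm a) \<and> (\<forall>a\<in>X. symmetric_elt S N a \<longrightarrow> L a = a)"

lemma ex_implements: "p permutes {1..N} \<Longrightarrow> \<exists>L. implements p L"
proof (induction p rule: permutes_induct[consumes 1, case_names finite id swap])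
  case finite
  show ?case by simp
next
  case id
  have "implements id (\<lambda>a. a)" by (simp add: implements_def bounded_clinear_on_id)
  then show ?case by (rule exI[of "implements id"])
next
  case (swap k s p)
  then obtain L where L: "implements p L" by auto
  have ks: "k \<in> {1..N}" "s \<in> {1..N}" by fact+
  have "implements (slot_swap k s \<circ> p) (\<lambda>a. L (oconj S N k s a))"
    unfolding implements_def
  proof (intro conjI allI ballI impI)
    show "bounded_clinear_on X X (\<lambda>a. L (oconj S N k s a))"
      by (rule bounded_clinear_on_compose[OF oconj_bounded[OF ks]]) (use L in \<open>simp add: implements_def\<close>)
    show "L (oconj S N k s (tp f)) = tp (f \<circ> (slot_swap k s \<circ> p))" if "in_slots N f" for f
      using L in_slots_swap[OF that ks] oconj_tpr_slots[OF ks that]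
      by (simp add: implements_def comp_assoc)
    show "norm (L (oconj S N k s a)) = norm a" if "a \<in> X" for a
      using L oconj_in[OF ks that] norm_oconj[OF ks that] by (simp add: implements_def)
    show "L (oconj S N k s a) = a" if "a \<in> X" "symmetric_elt S N a" for a
    proof -
      have "oconj S N k s a = a" using that(2) ks by (simp only: symmetric_elt_def)
      then show ?thesis using L that by (simp add: implements_def)
    qed
  qed
  then show ?case by (rule exI[of "implements (slot_swap k s \<circ> p)"])
qed

definition perm_op :: "(nat \<Rightarrow> nat) \<Rightarrow> 'b \<Rightarrow> 'b" where
  "perm_op p = (SOME L. implements p L)"

lemma perm_op:
  assumes "p permutes {1..N}"
  shows "bounded_clinear_on X X (perm_op p)" "in_slots N f \<Longrightarrow> perm_op p (tp f) = tp (f \<circ> p)"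
    "a \<in> X \<Longrightarrow> norm (perm_op p a) = norm a" "a \<in> X \<Longrightarrow> symmetric_elt S N a \<Longrightarrow> perm_op p a = a"
proof -
  have "implements p (perm_op p)" unfolding perm_op_def by (rule someI_ex[OF ex_implements[OF assms]])
  then show "bounded_clinear_on X X (perm_op p)" "in_slots N f \<Longrightarrow> perm_op p (tp f) = tp (f \<circ> p)"
    "a \<in> X \<Longrightarrow> norm (perm_op p a) = norm a" "a \<in> X \<Longrightarrow> symmetric_elt S N a \<Longrightarrow> perm_op p a = a"
    by (simp_all add: implements_def)
qed

lemma perm_op_in: "p permutes {1..N} \<Longrightarrow> a \<in> X \<Longrightarrow> perm_op p a \<in> X"
  by (rule bounded_clinear_onD(2)[OF perm_op(1)])

lemma in_slots_permutes: "in_slots N f \<Longrightarrow> p permutes {1..N} \<Longrightarrow> in_slots N (f \<circ> p)"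
  by (erule in_slots_comp) (simp only: permutes_in_image)

text \<open>Composition f o p is a right action of permutations, hence the reversed order.\<close>

lemma perm_op_compose:
  assumes p: "p permutes {1..N}" and q: "q permutes {1..N}" and a: "a \<in> X"
  shows "perm_op q (perm_op p a) = perm_op (p \<circ> q) a"
proof (rule X_eqI[OF bounded_clinear_on_compose[OF perm_op(1)[OF p] perm_op(1)[OF q]] perm_op(1)[OF permutes_compose[OF q p]] _ a])
  fix f assume f: "in_slots N f"
  show "perm_op q (perm_op p (tp f)) = perm_op (p \<circ> q) (tp f)"
    using perm_op(2)[OF p f] perm_op(2)[OF q in_slots_permutes[OF f p]] perm_op(2)[OF permutes_compose[OF q p] f]
    by (simp add: comp_assoc)
qed

lemma perm_op_swap:
  assumes ks: "k \<in> {1..N}" "s \<in> {1..N}" and a: "a \<in> X"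
  shows "perm_op (slot_swap k s) a = oconj S N k s a"
proof (rule X_eqI[OF perm_op(1)[OF permutes_swap_id[OF ks]] oconj_bounded[OF ks] _ a])
  fix f assume f: "in_slots N f"
  show "perm_op (slot_swap k s) (tp f) = oconj S N k s (tp f)"
    using perm_op(2)[OF permutes_swap_id[OF ks] f] oconj_tpr_slots[OF ks f] by simp
qed

text \<open>The entry of slot i of f stands in slot inv p i of f o p.\<close>

lemma perm_op_ins:
  assumes p: "p permutes {1..N}" and i: "i \<in> {1..N}" and g: "g \<in> X1" and a: "a \<in> X"
  shows "perm_op p (ins g i a) = ins g (inv p i) (perm_op p a)"
proof -
  have ip: "inv p i \<in> {1..N}" using permutes_in_image[OF permutes_inv[OF p]] i by blast
  show ?thesis
  proof (rule X_eqI[OF bounded_clinear_on_compose[OF ins_bounded[OF i g] perm_op(1)[OF p]]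
        bounded_clinear_on_compose[OF perm_op(1)[OF p] ins_bounded[OF ip g]] _ a])
    fix f assume f: "in_slots N f"
    note f' = in_slots_upd[OF f g, of i]
    have "f(i := g) \<circ> p = (f \<circ> p)(inv p i := g)"
      by (rule ext) (metis comp_apply fun_upd_apply p permutes_inverses(1) permutes_inverses(2))
    moreover have "p (inv p i) = i" by (rule permutes_inverses(1)[OF p])
    ultimately show "perm_op p (ins g i (tp f)) = ins g (inv p i) (perm_op p (tp f))"
      using clinear_on_scaleC[OF bounded_clinear_onD(1)[OF perm_op(1)[OF p]] tp_in[OF f'], of "tr (f i)"]
      by (simp add: ins_tp[OF i g f] perm_op(2)[OF p f] perm_op(2)[OF p f'] ins_tp[OF ip g in_slots_permutes[OF f p]])
  qed
qed

lemma perm_op_sops: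
  assumes p: "p permutes {1..N}" and F: "F \<in> X1" and a: "a \<in> X"
  shows "perm_op p (sops F c {1..N} a) = sops F (c \<circ> p) {1..N} (perm_op p a)"
proof -
  have ip: "inv p permutes {1..N}" by (rule permutes_inv[OF p])
  have "perm_op p (sops F c {1..N} a) = sops F (c \<circ> p) (inv p ` {1..N}) (perm_op p a)"
  proof (rule sops_transfer[OF order_refl F a])
    show "inj_on (inv p) {1..N}" by (rule permutes_inj_on[OF ip])
    show "inv p ` {1..N} \<subseteq> {1..N}" using permutes_image[OF ip] by simp
    fix b i assume b: "b \<in> X" and i: "i \<in> {1..N}"
    have "(c \<circ> p) (inv p i) = c i" using permutes_inverses(1)[OF p] by simp
    then show "perm_op p (slot F c i b) = slot F (c \<circ> p) (inv p i) (perm_op p b)"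
      using perm_op_ins[OF p i F b] clinear_on_diff[OF bounded_clinear_onD(1)[OF perm_op(1)[OF p]] X b ins_in[OF i F, of b]]
      by (simp add: slot_def)
  qed
  then show ?thesis using permutes_image[OF ip] by simp
qed

lemma ex_permutes_code:
  fixes c c' :: "nat \<Rightarrow> nat"
  assumes A: "finite A" and c: "\<And>i. i \<in> A \<Longrightarrow> c i = 1 \<or> c i = 2" "\<And>i. i \<in> A \<Longrightarrow> c' i = 1 \<or> c' i = 2"
    and card: "card {i \<in> A. c i = 2} = card {i \<in> A. c' i = 2}"
  shows "\<exists>p. p permutes A \<and> (\<forall>i\<in>A. c (p i) = c' i)"
proof -
  let ?B = "{i \<in> A. c i = 2}" and ?B' = "{i \<in> A. c' i = 2}"
  have fin: "finite ?B" "finite ?B'" "finite (A - ?B)" "finite (A - ?B')" using A by auto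
  have "card (A - ?B') = card (A - ?B)" using card A by (simp add: card_Diff_subset)
  then obtain g where g: "bij_betw g (A - ?B') (A - ?B)"
    using fin finite_same_card_bij by blast
  obtain f where f: "bij_betw f ?B' ?B" using finite_same_card_bij[OF fin(2,1)] card by auto
  define p where "p i = (if i \<in> ?B' then f i else if i \<in> A then g i else i)" for i
  have p1: "bij_betw p ?B' ?B" using f by (rule bij_betw_cong[THEN iffD1, rotated]) (simp add: p_def)
  have p2: "bij_betw p (A - ?B') (A - ?B)" using g by (rule bij_betw_cong[THEN iffD1, rotated]) (auto simp: p_def)
  have "bij_betw p (?B' \<union> (A - ?B')) (?B \<union> (A - ?B))"
    by (rule bij_betw_combine[OF p1 p2]) auto
  moreover have "?B' \<union> (A - ?B') = A" "?B \<union> (A - ?B) = A" by auto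
  ultimately have "bij_betw p A A" by simp
  then have "p permutes A" by (rule bij_imp_permutes) (simp add: p_def)
  moreover have "c (p i) = c' i" if i: "i \<in> A" for i
  proof (cases "i \<in> ?B'")
    case True
    then have "p i \<in> ?B" using p1 by (auto dest: bij_betwE)
    then show ?thesis using True by simp
  next
    case False
    then have "p i \<in> A - ?B" using p2 i by (auto dest: bij_betwE)
    then have "c (p i) = 1" using c(1) by auto
    moreover have "c' i = 1" using False i c(2)[OF i] by simp
    ultimately show ?thesis by simp
  qed
  ultimately show ?thesis by blast
qed

definition code :: "nat \<Rightarrow> nat \<Rightarrow> nat" where
  "code j i = (if i \<le> j then 2 else 1)"

text \<open>Turns out to be the norm of E_j, see \<open>norm_corr_error\<close>. The slots beyond j
  are filled with F instead of being dropped, so that all orders are compared inside one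
  space.\<close>

definition err :: "'b \<Rightarrow> 'b \<Rightarrow> nat \<Rightarrow> real" where
  "err F a j = norm (sops F (code j) {1..N} a)"

text \<open>A permutation carries \<open>c\<close> into \<open>code j\<close>; it is isometric and
  fixes the symmetric element a.\<close>

lemma norm_sops_err:
  assumes F: "F \<in> X1" and a: "a \<in> X" "symmetric_elt S N a"
    and c: "\<And>i. i \<in> {1..N} \<Longrightarrow> c i = 1 \<or> c i = 2" and j: "card {i \<in> {1..N}. c i = 2} = j"
  shows "norm (sops F c {1..N} a) = err F a j"
proof -
  have "j \<le> card {1..N}" unfolding j[symmetric] by (rule card_mono) auto
  then have "{i \<in> {1..N}. code j i = 2} = {1..j}" by (auto simp: code_def)
  then have "card {i \<in> {1..N}. c i = 2} = card {i \<in> {1..N}. code j i = 2}" using j by simp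
  then have "\<exists>p. p permutes {1..N} \<and> (\<forall>i\<in>{1..N}. c (p i) = code j i)"
    using c by (intro ex_permutes_code) (auto simp: code_def)
  then obtain p where p: "p permutes {1..N}" "\<forall>i\<in>{1..N}. c (p i) = code j i" by blast
  have "norm (sops F c {1..N} a) = norm (perm_op p (sops F c {1..N} a))"
    using perm_op(3)[OF p(1) sops_in[OF order_refl F a(1)]] by simp
  also have "\<dots> = norm (sops F (c \<circ> p) {1..N} a)"
    using perm_op_sops[OF p(1) F a(1)] perm_op(4)[OF p(1) a] by simp
  also have "sops F (c \<circ> p) {1..N} a = sops F (code j) {1..N} a"
    by (rule sops_cong[OF order_refl F a(1)]) (use p(2) in simp)
  finally show ?thesis by (simp add: err_def)
qed

section \<open>Estimates of the interaction terms\<close>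

lemma marg_sops_1:
  assumes j: "1 \<le> j" and A: "A \<subseteq> {j<..N}" and F: "F \<in> X1" "tr F = 1" and a: "a \<in> X"
    and c: "\<And>i. i \<in> A \<Longrightarrow> c i = 0 \<or> c i = 1"
  shows "marg S j N (sops F c A a) = marg S j N a"
proof -
  have "A \<subseteq> {1..N}" using A by auto
  then show ?thesis using A c
  proof (induction A rule: slots_induct)
    case (insert i A)
    have i: "j < i" "i \<le> N" and A: "A \<subseteq> {1..N}" using insert by auto
    have "marg S j N (slot F c i (sops F c A a)) = marg S j N (sops F c A a)"
      using marg_ins[OF j i F sops_in[OF A F(1) a]] insert.prems(2)[of i] by (auto simp: slot_def)
    then show ?case using insert sops_insert[OF F(1) insert.hyps(1,2), of c a] by simp
  qed simp
qed

lemma ins_sops_commute: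
  assumes A: "A \<subseteq> {1..N}" and F: "F \<in> X1" and g: "g \<in> X1" and a: "a \<in> X" and i: "i \<in> {1..N}" and c: "i \<in> A \<Longrightarrow> c i = 0"
  shows "ins g i (sops F c A a) = sops F c A (ins g i a)"
proof -
  have "ins g i (sops F c A a) = sops F c ((\<lambda>i. i) ` A) (ins g i a)"
  proof (rule sops_transfer[OF A F a])
    fix b l assume b: "b \<in> X" and l: "l \<in> A"
    then have l': "l \<in> {1..N}" using A by auto
    show "ins g i (slot F c l b) = slot F c l (ins g i b)"
    proof (cases "l = i")
      case True
      then show ?thesis using c l by (simp add: slot_def)
    next
      case False
      then show ?thesis
        using ins_commute[OF i l' g F, of b] ins_diff[OF i g b ins_in[OF l' F]] by (simp add: slot_def)
    qed
  qed auto
  then show ?thesis by simp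
qed

lemma Tir_X: "1 \<le> i \<Longrightarrow> i < r \<Longrightarrow> r \<le> N \<Longrightarrow> bounded_clinear_on X X (Tir S N i r)"
  by (rule Tir_bounded[OF N2]) auto

lemma Tir_in: "1 \<le> i \<Longrightarrow> i < r \<Longrightarrow> r \<le> N \<Longrightarrow> a \<in> X \<Longrightarrow> Tir S N i r a \<in> X"
  by (rule bounded_clinear_onD(2)[OF Tir_X])

lemma norm_Tir_X: "1 \<le> i \<Longrightarrow> i < r \<Longrightarrow> r \<le> N \<Longrightarrow> a \<in> X \<Longrightarrow> norm (Tir S N i r a) \<le> normV S * norm a"
  by (rule norm_Tir[OF N2]) auto

lemma sops_Tir:
  assumes ir: "1 \<le> i" "i < r" "r \<le> N" and A: "A \<subseteq> {1..N}" and F: "F \<in> X1" and a: "a \<in> X"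
    and c: "i \<in> A \<Longrightarrow> c i = 0" "r \<in> A \<Longrightarrow> c r = 0"
  shows "sops F c A (Tir S N i r a) = Tir S N i r (sops F c A a)"
proof -
  have "Tir S N i r (sops F c A a) = sops F c ((\<lambda>i. i) ` A) (Tir S N i r a)"
  proof (rule sops_transfer[OF A F a])
    fix b l assume b: "b \<in> X" and l: "l \<in> A"
    then have l': "l \<in> {1..N}" using A by auto
    show "Tir S N i r (slot F c l b) = slot F c l (Tir S N i r b)"
    proof (cases "l = i \<or> l = r")
      case True
      then show ?thesis using c l by (auto simp: slot_def)
    next
      case False
      then show ?thesis
        using ins_Tir[OF ir l' _ _ F b] clinear_on_diff[OF bounded_clinear_onD(1)[OF Tir_X[OF ir]] X b ins_in[OF l' F]]
        by (simp add: slot_def)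
    qed
  qed auto
  then show ?thesis by simp
qed

lemma norm_meanQ:
  assumes "g \<in> X1" "h \<in> X1"
  shows "norm (meanQ S g h) \<le> normV S * (norm g * norm h)"
proof -
  have gh: "otens S 1 1 g h \<in> compl S 2"
    using tpr_in_slots[OF le12 pair_slots[OF assms]] by (simp add: otens_11_tpr[OF assms])
  have "norm (meanQ S g h) \<le> norm (intV S (otens S 1 1 g h))"
    unfolding meanQ_def by (rule norm_ptr[OF order_refl V_in[OF gh]])
  also have "\<dots> \<le> normV S * norm (otens S 1 1 g h)"
    unfolding normV_def by (rule onorm_on_bound[OF V_bounded compl[OF le12] gh])
  finally show ?thesis using norm_otens[OF order_refl order_refl assms] by simp
qed

context
  fixes F a assumes F: "F \<in> X1" "tr F = 1" "norm F = 1" and a: "a \<in> X" "symmetric_elt S N a"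
begin

text \<open>Bookkeeping for the four terms of \<open>sops_two_slots\<close>: \<open>k\<close> counts
  the factors 1 - P outside the slots i and r.\<close>

lemma two_slots_err:
  assumes ir: "i \<in> {1..N}" "r \<in> {1..N}" "i \<noteq> r" and xy: "x = 1 \<or> x = 2" "y = 1 \<or> y = 2"
    and k: "card {l \<in> {1..N} - {i, r}. code j l = 2} = k" and m: "m = k + (if x = 2 then 1 else 0) + (if y = 2 then 1 else 0)"
  shows "norm (sops F ((code j)(i := x, r := y)) {1..N} a) = err F a m"
proof (rule norm_sops_err[OF F(1) a])
  show "((code j)(i := x, r := y)) l = 1 \<or> ((code j)(i := x, r := y)) l = 2" for l
    using xy by (auto simp: code_def)
  have "{l \<in> {1..N}. ((code j)(i := x, r := y)) l = 2}
      = {l \<in> {1..N} - {i, r}. code j l = 2} \<union> ((if x = 2 then {i} else {}) \<union> (if y = 2 then {r} else {}))"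
    using ir by auto
  moreover have "card ({l \<in> {1..N} - {i, r}. code j l = 2} \<union> ((if x = 2 then {i} else {}) \<union> (if y = 2 then {r} else {})))
      = card {l \<in> {1..N} - {i, r}. code j l = 2} + card ((if x = 2 then {i} else {}) \<union> (if y = 2 then {r} else {}))"
    by (rule card_Un_disjoint) auto
  moreover have "card ((if x = 2 then {i} else {}) \<union> (if y = 2 then {r} else {})) = (if x = 2 then 1 else 0) + (if y = 2 then 1 else 0)"
    using ir(3) by (auto simp: card_insert_if)
  ultimately show "card {l \<in> {1..N}. ((code j)(i := x, r := y)) l = 2} = m" unfolding m k[symmetric] by simp
qed

text \<open>Splitting both slots by 1 = (1 - P) + P isolates \<open>s 1 1\<close>, the only one of
  the four terms with F in both slots; on it the effect of the interaction is known through
  Q(F,F).\<close>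

lemma sops_two_slots:
  fixes J :: nat
  assumes ir: "i \<in> {1..N}" "r \<in> {1..N}" "i \<noteq> r"
  defines "s \<equiv> \<lambda>x y. sops F ((code J)(i := x, r := y)) {1..N} a"
  shows "s 0 0 = s 2 2 + s 2 1 + s 1 2 + s 1 1"
    "s 1 1 = ins F i (ins F r (s 0 0))"
proof -
  note sp = sops_split[OF order_refl F(1) a(1)]
  have tw: "(code J)(i := x, r := y) = (code J)(r := y, i := x)" for x y
    using ir(3) by (simp add: fun_upd_twist)
  have 1: "s x 0 = s x 2 + s x 1" for x
    unfolding s_def by (rule sp[OF ir(2)])
  have 2: "s 0 y = s 2 y + s 1 y" for y
    unfolding s_def tw by (rule sp[OF ir(1)])
  show "s 0 0 = s 2 2 + s 2 1 + s 1 2 + s 1 1"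
    using 1[of 0] 2[of 1] 2[of 2] by simp
  note pl = sops_pull[OF order_refl F(1) a(1)]
  have "s 1 1 = ins F i (s 0 1)"
    using pl[OF ir(1), of "(code J)(r := 1, i := 1)"] unfolding s_def tw by (simp add: slot_def)
  moreover have "s 0 1 = ins F r (s 0 0)"
    using pl[OF ir(2), of "(code J)(i := 0, r := 1)"] unfolding s_def by (simp add: slot_def)
  ultimately show "s 1 1 = ins F i (ins F r (s 0 0))" by simp
qed

text \<open>The operators of the slots i and r are pulled to the front; all others commute with the
  interaction and pass to its right.\<close>

lemma sops_code_Tir:
  assumes ir: "1 \<le> i" "i < r" "r \<le> N"
  shows "sops F (code j) {1..N} (Tir S N i r a)
    = slot F (code j) i (slot F (code j) r (Tir S N i r (sops F ((code j)(i := 0, r := 0)) {1..N} a)))"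
proof -
  have irN: "i \<in> {1..N}" "r \<in> {1..N}" using ir by auto
  note T = Tir_in[OF ir a(1)]
  have "sops F (code j) {1..N} (Tir S N i r a) = slot F (code j) i (sops F ((code j)(i := 0)) {1..N} (Tir S N i r a))"
    by (rule sops_pull[OF order_refl F(1) T irN(1)])
  also have "sops F ((code j)(i := 0)) {1..N} (Tir S N i r a)
      = slot F (code j) r (sops F ((code j)(i := 0, r := 0)) {1..N} (Tir S N i r a))"
    using sops_pull[OF order_refl F(1) T irN(2), of "(code j)(i := 0)"] ir by (simp add: slot_def)
  also have "sops F ((code j)(i := 0, r := 0)) {1..N} (Tir S N i r a)
      = Tir S N i r (sops F ((code j)(i := 0, r := 0)) {1..N} a)"
    by (rule sops_Tir[OF ir order_refl F(1) a(1)]) simp_all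
  finally show ?thesis .
qed

text \<open>Left of the interaction both slots carry 1 - P, which costs 2 * 2. On its right the
  slots i and r are split; j - 2 factors 1 - P sit in the other slots, so the four terms have j, j -
  1 (twice) and j - 2 of them.\<close>

lemma err_Tir_inner:
  assumes ir: "1 \<le> i" "i < r" "r \<le> j" "j \<le> N"
  shows "norm (sops F (code j) {1..N} (Tir S N i r a))
    \<le> 4 * normV S * (err F a j + 2 * err F a (j - 1) + err F a (j - 2))"
proof -
  have rN: "r \<le> N" and irN: "i \<in> {1..N}" "r \<in> {1..N}" "i \<noteq> r" using ir by auto
  let ?s = "\<lambda>x y. sops F ((code j)(i := x, r := y)) {1..N} a"
  have s: "?s x y \<in> X" for x y by (rule sops_in[OF order_refl F(1) a(1)])
  note T = Tir_in[OF ir(1,2) rN]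
  have F1: "norm F \<le> 1" using F by simp
  have "{l \<in> {1..N} - {i, r}. code j l = 2} = {1..j} - {i, r}" using ir by (auto simp: code_def)
  moreover have "card ({1..j} - {i, r}) = j - 2" using ir by (subst card_Diff_subset) auto
  ultimately have card: "card {l \<in> {1..N} - {i, r}. code j l = 2} = j - 2" by simp
  have "norm (?s 0 0) \<le> norm (?s 2 2) + norm (?s 2 1) + norm (?s 1 2) + norm (?s 1 1)"
    unfolding sops_two_slots(1)[OF irN] by (intro norm_triangle_mono order_refl)
  also have "\<dots> = err F a j + err F a (j - 1) + err F a (j - 1) + err F a (j - 2)"
    using two_slots_err[OF irN _ _ card, where x = 2 and y = 2 and m = j] two_slots_err[OF irN _ _ card, where x = 2 and y = 1 and m = "j - 1"]
      two_slots_err[OF irN _ _ card, where x = 1 and y = 2 and m = "j - 1"] two_slots_err[OF irN _ _ card, where x = 1 and y = 1 and m = "j - 2"] ir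
    by (simp add: One_nat_def[symmetric])
  finally have s00: "norm (?s 0 0) \<le> err F a j + 2 * err F a (j - 1) + err F a (j - 2)" by simp
  have "norm (sops F (code j) {1..N} (Tir S N i r a)) \<le> 2 * (2 * (normV S * norm (?s 0 0)))"
    unfolding sops_code_Tir[OF ir(1,2) rN]
    using norm_slot[OF irN(1) F(1) F1 slot_in[OF irN(2) F(1) T[OF s]], of "code j" "code j" 0 0]
      norm_slot[OF irN(2) F(1) F1 T[OF s], of "code j" 0 0] norm_Tir_X[OF ir(1,2) rN s, of 0 0] by linarith
  also have "\<dots> \<le> 2 * (2 * (normV S * (err F a j + 2 * err F a (j - 1) + err F a (j - 2))))"
    by (intro mult_left_mono s00 normV_nonneg) auto
  finally show ?thesis by (simp add: mult.assoc)
qed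

text \<open>Left of the interaction slot i carries 1 - P, at cost 2, and slot r carries P, at cost
  1. The term with P in both slots is not estimated: it equals the mean-field term that is
  subtracted. Of the others, one has j + 1 and two have j factors 1 - P.\<close>

lemma err_Tir_outer:
  assumes ir: "1 \<le> i" "i \<le> j" "j < r" "r \<le> N"
  shows "norm (sops F (code j) {1..N} (Tir S N i r a) - ins (meanQ S F F) i (sops F ((code j)(i := 0)) {1..N} a))
    \<le> 2 * normV S * (err F a (j + 1) + 2 * err F a j)"
proof -
  have lt: "i < r" and irN: "i \<in> {1..N}" "r \<in> {1..N}" "i \<noteq> r" using ir by auto
  let ?s = "\<lambda>x y. sops F ((code j)(i := x, r := y)) {1..N} a" and ?q = "meanQ S F F" and ?T = "Tir S N i r"
  have s: "?s x y \<in> X" for x y by (rule sops_in[OF order_refl F(1) a(1)])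
  note T = Tir_in[OF ir(1) lt ir(4)] and Tlin = bounded_clinear_onD(1)[OF Tir_X[OF ir(1) lt ir(4)]]
  have F1: "norm F \<le> 1" using F by simp
  define u where "u = ?s 2 2 + ?s 2 1 + ?s 1 2"
  have u: "u \<in> X" unfolding u_def by (intro closed_csubspaceD(2)[OF X] s)
  have s00: "?s 0 0 = u + ?s 1 1" unfolding sops_two_slots(1)[OF irN] u_def ..
  have Tsum: "?T (?s 0 0) = ?T u + ?T (?s 1 1)" unfolding s00 by (rule clinear_on_add[OF Tlin u s])
  note insF = clinear_on_add[OF ins_clinear[OF irN(2) F(1)] T[OF u] T[OF s]]
  have i11: "ins F r (?T (?s 1 1)) = ins F r (ins ?q i (?s 0 0))"
    unfolding sops_two_slots(2)[OF irN] by (rule Tir_ins_ir[OF ir(1) lt ir(4) F(1) F(1) s])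
  \<comment> \<open>By the vanishing trace of V, P_i annihilates this term, so 1 - P_i leaves it
    unchanged.\<close>
  have z: "ins F i (ins F r (?T (?s 1 1))) = 0" by (rule ins_ir_Tir[OF ir(1) lt ir(4) F(1,2) F(1) F(1) s])
  let ?slot = "slot F (code j) i"
  have ci: "code j i = 2" and cr: "code j r = 1" using ir by (auto simp: code_def)
  have "sops F (code j) {1..N} (?T a) = ?slot (ins F r (?T (?s 0 0)))"
    unfolding sops_code_Tir[OF ir(1) lt ir(4)] by (simp add: slot_def cr)
  also have "\<dots> = ?slot (ins F r (?T u)) + ?slot (ins F r (?T (?s 1 1)))"
    unfolding Tsum insF
    by (rule clinear_on_add[OF bounded_clinear_onD(1)[OF slot_bounded[OF irN(1) F(1)]] ins_in[OF irN(2) F(1)] ins_in[OF irN(2) F(1)]])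
  also have "?slot (ins F r (?T (?s 1 1))) = ins F r (ins ?q i (?s 0 0))"
    using z i11 by (simp add: slot_def ci)
  also have "\<dots> = ins ?q i (ins F r (?s 0 0))"
    using ins_commute[OF irN(2,1) F(1) meanQ_in[OF F(1) F(1)]] irN(3) by simp
  also have "ins F r (?s 0 0) = sops F ((code j)(i := 0)) {1..N} a"
    using sops_pull[OF order_refl F(1) a(1) irN(2), of "(code j)(i := 0)"] irN(3) cr by (simp add: slot_def)
  finally have "sops F (code j) {1..N} (?T a) - ins ?q i (sops F ((code j)(i := 0)) {1..N} a) = ?slot (ins F r (?T u))" by simp
  moreover have "norm (?slot (ins F r (?T u))) \<le> 2 * (1 * (normV S * norm u))"
    using norm_slot[OF irN(1) F(1) F1 ins_in[OF irN(2) F(1), of "?T u"], of "code j"]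
      norm_ins[OF irN(2) F(1) T[OF u]] norm_Tir_X[OF ir(1) lt ir(4) u] F(3) by simp
  moreover have "norm u \<le> err F a (j + 1) + 2 * err F a j"
  proof -
    have "{l \<in> {1..N} - {i, r}. code j l = 2} = {1..j} - {i}" using ir by (auto simp: code_def)
    moreover have "card ({1..j} - {i}) = j - 1" using ir by (subst card_Diff_subset) auto
    ultimately have card: "card {l \<in> {1..N} - {i, r}. code j l = 2} = j - 1" by simp
    have "norm u \<le> norm (?s 2 2) + norm (?s 2 1) + norm (?s 1 2)"
      unfolding u_def by (intro norm_triangle_mono order_refl)
    also have "\<dots> = err F a (j + 1) + err F a j + err F a j"
      using two_slots_err[OF irN _ _ card, where x = 2 and y = 2 and m = "j + 1"] two_slots_err[OF irN _ _ card, where x = 2 and y = 1 and m = j]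
        two_slots_err[OF irN _ _ card, where x = 1 and y = 2 and m = j] ir by (simp add: card)
    finally show ?thesis by simp
  qed
  then have "2 * (normV S * norm u) \<le> 2 * (normV S * (err F a (j + 1) + 2 * err F a j))"
    by (intro mult_left_mono normV_nonneg) auto
  ultimately show ?thesis by (simp add: mult.assoc)
qed

text \<open>Inserting Q(F,F) traces slot i out first, so the free slot may as well carry P; then j -
  1 factors 1 - P remain.\<close>

lemma err_meanQ:
  assumes i: "1 \<le> i" "i \<le> j" "j \<le> N"
  shows "norm (ins (meanQ S F F) i (sops F ((code j)(i := 0)) {1..N} a)) \<le> normV S * err F a (j - 1)"
proof -
  have iN: "i \<in> {1..N}" using i by auto
  note q = meanQ_in[OF F(1) F(1)]
  let ?s = "\<lambda>x. sops F ((code j)(i := x)) {1..N} a"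
  have s: "?s x \<in> X" for x by (rule sops_in[OF order_refl F(1) a(1)])
  have "?s 1 = ins F i (?s 0)"
    using sops_pull[OF order_refl F(1) a(1) iN, of "(code j)(i := 1)"] by (simp add: slot_def)
  then have "ins (meanQ S F F) i (?s 0) = ins (meanQ S F F) i (?s 1)"
    using ins_absorb[OF iN q F(1,2)] by simp
  then have "norm (ins (meanQ S F F) i (?s 0)) \<le> norm (meanQ S F F) * norm (?s 1)"
    using norm_ins[OF iN q s, of 1] by simp
  also have "\<dots> \<le> normV S * norm (?s 1)"
    using norm_meanQ[OF F(1) F(1)] F(3) by (intro mult_right_mono) auto
  also have "norm (?s 1) = err F a (j - 1)"
  proof (rule norm_sops_err[OF F(1) a])
    have "{l \<in> {1..N}. ((code j)(i := 1)) l = 2} = {1..j} - {i}" using i by (auto simp: code_def)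
    then show "card {l \<in> {1..N}. ((code j)(i := 1)) l = 2} = j - 1" using i by (simp add: card_Diff_subset)
  qed (auto simp: code_def)
  finally show ?thesis .
qed

end

end

section \<open>The correlation errors\<close>

text \<open>The permutation performed by \<open>conj_slots\<close> with the list of slots \<open>is\<close>, starting at slot \<open>p\<close>.\<close>

fun slots_perm :: "nat list \<Rightarrow> nat \<Rightarrow> nat \<Rightarrow> nat" where
  "slots_perm [] p = id"
| "slots_perm (i # is) p = slots_perm is (Suc p) \<circ> slot_swap i p"

lemma slots_perm_less: "x < p \<Longrightarrow> (\<And>i. i \<in> set is \<Longrightarrow> x < i) \<Longrightarrow> slots_perm is p x = x"
proof (induction "is" arbitrary: p)
  case (Cons i "is")
  have "x < i" using Cons.prems by simp
  then have "slot_swap i p x = x" using Cons.prems by (intro transpose_apply_other) auto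
  then show ?case using Cons by simp
qed simp

text \<open>The list increases and stays at or above p, so the exchange of i and p moves no later
  entry of the list, and the exchanges after it do not touch slot p.\<close>

lemma slots_perm_nth:
  "sorted_wrt (<) is \<Longrightarrow> (\<And>i. i \<in> set is \<Longrightarrow> p \<le> i) \<Longrightarrow> k < length is \<Longrightarrow> slots_perm is p (is ! k) = p + k"
proof (induction "is" arbitrary: p k)
  case (Cons i "is")
  have gt: "\<And>x. x \<in> set is \<Longrightarrow> i < x" and srt: "sorted_wrt (<) is" using Cons.prems(1) by auto
  have p: "p \<le> i" using Cons.prems(2) by simp
  show ?case
  proof (cases k)
    case 0
    have "slots_perm is (Suc p) p = p"
      using gt p by (intro slots_perm_less) force+
    then show ?thesis using 0 by simp
  next
    case (Suc l)
    then have l: "l < length is" using Cons.prems(3) by simp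
    have "i < is ! l" using gt l by simp
    then have "slot_swap i p (is ! l) = is ! l" using p by (intro transpose_apply_other) auto
    moreover have "slots_perm is (Suc p) (is ! l) = Suc p + l"
      using Cons.IH[OF srt _ l, of "Suc p"] gt p by force
    ultimately show ?thesis using Suc by simp
  qed
qed simp

lemma slots_perm_permutes:
  "set is \<subseteq> A \<Longrightarrow> {p..<p + length is} \<subseteq> A \<Longrightarrow> slots_perm is p permutes A"
proof (induction "is" arbitrary: p)
  case (Cons i "is")
  have "slots_perm is (Suc p) permutes A" by (rule Cons.IH) (use Cons.prems in auto)
  moreover have "slot_swap i p permutes A" using Cons.prems by (intro permutes_swap_id) auto
  ultimately show ?case unfolding slots_perm.simps by (rule permutes_compose[rotated])
qed (simp add: permutes_id)

text \<open>I goes onto the first card I slots, hence its complement onto the rest. The image as a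
  set is enough, since all slots of the complement hold F.\<close>

lemma slots_perm_image:
  assumes I: "I \<subseteq> {1..j}"
  defines "\<pi> \<equiv> slots_perm (sorted_list_of_set I) 1"
  shows "\<pi> permutes {1..j}" "\<pi> ` ({1..j} - I) = {card I<..j}"
proof -
  let ?is = "sorted_list_of_set I"
  have fin: "finite I" using I finite_subset by auto
  have len: "length ?is = card I" and set: "set ?is = I" using fin by auto
  have cardI: "card I \<le> j" using card_mono[OF _ I] by simp
  show perm: "\<pi> permutes {1..j}"
    unfolding \<pi>_def by (rule slots_perm_permutes) (use I len set cardI in auto)
  have nth: "\<pi> (?is ! k) = 1 + k" if "k < card I" for k
    unfolding \<pi>_def using that len set I
    by (intro slots_perm_nth) auto
  have "\<pi> ` I = {1..card I}"
  proof
    show "\<pi> ` I \<subseteq> {1..card I}"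
    proof
      fix y assume "y \<in> \<pi> ` I"
      then obtain x where x: "x \<in> set ?is" "y = \<pi> x" using set by auto
      then obtain k where "k < card I" "x = ?is ! k" using len by (metis in_set_conv_nth)
      then show "y \<in> {1..card I}" using nth x by auto
    qed
    show "{1..card I} \<subseteq> \<pi> ` I"
    proof
      fix y assume y: "y \<in> {1..card I}"
      then have k: "y - 1 < card I" "1 + (y - 1) = y" by auto
      have "?is ! (y - 1) \<in> I" using k(1) len set by (metis nth_mem)
      then show "y \<in> \<pi> ` I" using nth[OF k(1)] k(2) by (metis image_eqI)
    qed
  qed
  moreover have "\<pi> ` ({1..j} - I) = \<pi> ` {1..j} - \<pi> ` I"
    by (rule image_set_diff) (use perm permutes_inj in blast)
  ultimately show "\<pi> ` ({1..j} - I) = {card I<..j}"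
    using permutes_image[OF perm] by auto
qed

section \<open>Expansion of the correlation errors into marginals\<close>

context large_system
begin

text \<open>Expansion of a product of factors 1 - P; the subsets of \<open>insert i A\<close> are
  those of \<open>A\<close> with and without i.\<close>

lemma sops_2_expand:
  assumes "A \<subseteq> {1..N}" "F \<in> X1" "a \<in> X"
  shows "sops F (\<lambda>_. 2) A a = (\<Sum>K\<in>Pow A. (-1) ^ card K *\<^sub>R sops F (\<lambda>_. 1) K a)"
  using assms(1)
proof (induction A rule: slots_induct)
  case empty
  then show ?case by simp
next
  case (insert i A)
  let ?t = "\<lambda>K. (-1) ^ card K *\<^sub>R sops F (\<lambda>_. 1) K a"
  have i: "i \<in> {1..N}" and A: "A \<subseteq> {1..N}" and fin: "finite A"
    using insert finite_subset[of A "{1..N}"] by auto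
  have s: "sops F (\<lambda>_. 1) K a \<in> X" if "K \<in> Pow A" for K
    using that A by (intro sops_in assms) auto
  have inj: "inj_on (insert i) (Pow A)" using insert.hyps(2) by (auto simp: inj_on_def)
  have dis: "Pow A \<inter> insert i ` Pow A = {}" using insert.hyps(2) by auto
  have ti: "?t (insert i K) = - ins F i (?t K)" if K: "K \<in> Pow A" for K
  proof -
    have K': "insert i K \<subseteq> {1..N}" "i \<notin> K" "finite K" using K A i insert.hyps(2) fin finite_subset by auto
    show ?thesis
      using sops_insert[OF assms(2) K'(1,2), of "\<lambda>_. 1" a] K'(2,3) clinear_on_scaleR[OF ins_clinear[OF i assms(2)] s[OF K]]
      by (simp add: slot_def)
  qed
  have "sum ?t (Pow (insert i A)) = sum ?t (Pow A) + sum ?t (insert i ` Pow A)"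
    unfolding Pow_insert by (rule sum.union_disjoint) (use fin dis in auto)
  also have "sum ?t (insert i ` Pow A) = (\<Sum>K\<in>Pow A. ?t (insert i K))"
    using sum.reindex[OF inj] by simp
  also have "\<dots> = - (\<Sum>K\<in>Pow A. ins F i (?t K))"
    using ti by (simp add: sum_negf)
  also have "(\<Sum>K\<in>Pow A. ins F i (?t K)) = ins F i (sum ?t (Pow A))"
    using s by (intro clinear_on_sum[OF ins_clinear[OF i assms(2)] X, symmetric] closed_csubspaceD(6)[OF X]) auto
  finally show ?case
    using sops_insert[OF assms(2) insert.hyps(1,2), of "\<lambda>_. 2" a] insert.IH by (simp add: slot_def)
qed

lemma const_slots: "g \<in> X1 \<Longrightarrow> in_slots n (\<lambda>_. g)"
  by (simp add: in_slots_def)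

lemma ell_times_bounded:
  assumes "n \<ge> 1" "v \<in> compl S m" "m \<ge> 1"
  shows "bounded_clinear_on (compl S n) (compl S m) (\<lambda>a. ell S n a *\<^sub>C v)"
proof (rule bounded_clinear_onI[where C = "norm v"])
  show "clinear_on (compl S n) (\<lambda>a. ell S n a *\<^sub>C v)"
    by (rule clinear_onI) (simp_all add: ell_linear assms scaleC_add_left scaleC_scaleC)
  show "ell S n x *\<^sub>C v \<in> compl S m" for x by (rule closed_csubspaceD(3)[OF compl[OF assms(3)] assms(2)])
  show "norm (ell S n x *\<^sub>C v) \<le> norm v * norm x" if "x \<in> compl S n" for x
    using mult_right_mono[OF norm_ell[OF assms(1) that], of "norm v"] by (simp add: norm_scaleC mult.commute)
qed

lemma marg_sops_all:
  assumes j: "1 \<le> j" "j \<le> N" and F: "F \<in> X1" and a: "a \<in> X"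
  shows "marg S j N (sops F (\<lambda>_. 1) {1..j} a) = ell S N a *\<^sub>C tpr j (\<lambda>_. F)"
proof -
  have A: "{1..j} \<subseteq> {1..N}" using j by auto
  show ?thesis
  proof (rule X_eqI[OF bounded_clinear_on_compose[OF sops_bounded[OF A F] marg_bounded[OF j]]
        ell_times_bounded[OF N1 tpr_in_slots[OF j(1) const_slots[OF F]] j(1)] _ a])
    fix f assume f: "in_slots N f"
    let ?g = "\<lambda>i. if i \<in> {1..j} then F else f i"
    have g: "in_slots N ?g" using f F by (simp add: in_slots_def)
    have "(\<Prod>i\<in>{j<..N}. tr (?g i)) = (\<Prod>i\<in>{j<..N}. tr (f i))" by (rule prod.cong) auto
    moreover have "{1..N} = {1..j} \<union> {j<..N}" using j by auto
    then have "(\<Prod>i\<in>{1..N}. tr (f i)) = (\<Prod>i\<in>{1..j}. tr (f i)) * (\<Prod>i\<in>{j<..N}. tr (f i))"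
      proof -
      have "{1..j} \<inter> {j<..N} = {}" by auto
      with \<open>{1..N} = {1..j} \<union> {j<..N}\<close> show ?thesis
        by (metis finite_atLeastAtMost finite_greaterThanAtMost prod.union_disjoint)
    qed
    moreover have "tpr j ?g = tpr j (\<lambda>_. F)" by (rule tprod_fun_cong) simp
    ultimately show "marg S j N (sops F (\<lambda>_. 1) {1..j} (tp f)) = ell S N (tp f) *\<^sub>C tpr j (\<lambda>_. F)"
      using sops_1_tp[OF A F f] clinear_on_scaleC[OF bounded_clinear_onD(1)[OF marg_bounded[OF j]] tp_in[OF g]]
        marg_tpr[OF j g] ell_tpr[OF N1 f] by (simp add: scaleC_scaleC)
  qed
qed

text \<open>The projections trace the slots m + 1, ..., j out of a and put F there, which leaves the
  m-particle marginal in the first m slots.\<close>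

lemma tens_pow_marg:
  assumes m: "1 \<le> m" "m \<le> j" "j \<le> N" and F: "F \<in> X1" and a: "a \<in> X"
  shows "tens_pow S m (j - m) (marg S m N a) F = marg S j N (sops F (\<lambda>_. 1) {m<..j} a)"
proof (cases "m = j")
  case True
  then show ?thesis by (simp add: tens_pow_def)
next
  case False
  then have k: "j - m \<ge> 1" "m + (j - m) = j" and j: "1 \<le> j" "m \<le> N" using m by auto
  have A: "{m<..j} \<subseteq> {1..N}" using m by auto
  note Fk = tpr_in_slots[OF k(1) const_slots[OF F]]
  note ot = otens_bounded_left[OF m(1) k(1) Fk, unfolded k(2)]
  have "otens S m (j - m) (marg S m N a) (tpr (j - m) (\<lambda>_. F)) = marg S j N (sops F (\<lambda>_. 1) {m<..j} a)"
  proof (rule X_eqI[OF bounded_clinear_on_compose[OF marg_bounded[OF m(1) j(2)] ot]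
        bounded_clinear_on_compose[OF sops_bounded[OF A F] marg_bounded[OF j(1) m(3)]] _ a])
    fix f assume f: "in_slots N f"
    let ?g = "\<lambda>i. if i \<in> {m<..j} then F else f i"
    have g: "in_slots N ?g" using f F by (simp add: in_slots_def)
    have fm: "in_slots m f" by (rule in_slots_mono[OF f j(2)])
    have "(\<Prod>i\<in>{j<..N}. tr (?g i)) = (\<Prod>i\<in>{j<..N}. tr (f i))" by (rule prod.cong) auto
    moreover have "{m<..N} = {m<..j} \<union> {j<..N}" using m by auto
    then have "(\<Prod>i\<in>{m<..N}. tr (f i)) = (\<Prod>i\<in>{m<..j}. tr (f i)) * (\<Prod>i\<in>{j<..N}. tr (f i))"
      using prod.union_disjoint[of "{m<..j}" "{j<..N}" "\<lambda>i. tr (f i)"] by auto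
    moreover have "otens S m (j - m) (tpr m f) (tpr (j - m) (\<lambda>_. F)) = tpr j ?g"
    proof -
      have "tpr j (\<lambda>i. if i \<le> m then f i else F) = tpr j ?g" by (rule tprod_fun_cong) auto
      then show ?thesis using tpr_append_slots[OF m(1) k(1) fm const_slots[OF F]] k(2) by simp
    qed
    ultimately show "otens S m (j - m) (marg S m N (tp f)) (tpr (j - m) (\<lambda>_. F)) = marg S j N (sops F (\<lambda>_. 1) {m<..j} (tp f))"
      using sops_1_tp[OF A F f] clinear_on_scaleC[OF bounded_clinear_onD(1)[OF marg_bounded[OF j(1) m(3)]] tp_in[OF g]]
        marg_tpr[OF j(1) m(3) g] marg_tpr[OF m(1) j(2) f]
        clinear_on_scaleC[OF bounded_clinear_onD(1)[OF ot] tpr_in_slots[OF m(1) fm]]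
      by (simp add: scaleC_scaleC)
  qed
  then show ?thesis using k m by (simp add: tens_pow_def tprod_list_replicate)
qed

text \<open>Exchanges within the first j slots commute with the marginal, so conjugating the
  marginal amounts to permuting a.\<close>

lemma foldr_oconj_marg:
  assumes j: "1 \<le> j" "j \<le> N" and a: "a \<in> X"
  shows "set is \<subseteq> {1..j} \<Longrightarrow> {p..<p + length is} \<subseteq> {1..j} \<Longrightarrow>
    foldr (\<lambda>(i, p). oconj S j i p) (zip is [p..<p + length is]) (marg S j N a) = marg S j N (perm_op (slots_perm is p) a)"
proof (induction "is" arbitrary: p)
  case Nil
  have "perm_op id a = a"
  proof (rule X_eqI[OF perm_op(1) bounded_clinear_on_id _ a])
    show "perm_op id (tp f) = tp f" if "in_slots N f" for f using perm_op(2)[OF permutes_id that] by simp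
  qed (rule permutes_id)
  then have "perm_op (\<lambda>a. a) a = a" by (simp add: id_def)
  then show ?case by simp
next
  case (Cons i "is")
  have "p \<in> {p..<p + length (i # is)}" by simp
  then have "p \<in> {1..j}" using Cons.prems(2) by blast
  then have ip: "i \<in> {1..j}" "p \<in> {1..j}" and "is": "set is \<subseteq> {1..j}" "{Suc p..<Suc p + length is} \<subseteq> {1..j}"
    using Cons.prems by auto
  have ipN: "i \<in> {1..N}" "p \<in> {1..N}" using ip j by auto
  have perm: "slots_perm is (Suc p) permutes {1..N}"
    by (rule slots_perm_permutes) (use "is" j in auto)
  have upt: "[p..<p + length (i # is)] = p # [Suc p..<Suc p + length is]"
    by (subst upt_conv_Cons) (simp_all del: upt_Suc)
  have "foldr (\<lambda>(i, p). oconj S j i p) (zip (i # is) [p..<p + length (i # is)]) (marg S j N a)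
      = oconj S j i p (foldr (\<lambda>(i, p). oconj S j i p) (zip is [Suc p..<Suc p + length is]) (marg S j N a))"
    unfolding upt by (simp del: upt_Suc)
  also have "\<dots> = oconj S j i p (marg S j N (perm_op (slots_perm is (Suc p)) a))"
    by (simp only: Cons.IH[OF "is"])
  also have "\<dots> = marg S j N (oconj S N i p (perm_op (slots_perm is (Suc p)) a))"
    by (rule marg_oconj[OF j ip perm_op_in[OF perm a], symmetric])
  also have "oconj S N i p (perm_op (slots_perm is (Suc p)) a) = perm_op (slots_perm (i # is) p) a"
    using perm_op_swap[OF ipN perm_op_in[OF perm a]] perm_op_compose[OF perm permutes_swap_id[OF ipN] a] by simp
  finally show ?case .
qed

text \<open>If K consists of the last slots, this is \<open>tens_pow_marg\<close>. In general the
  permutation behind \<open>conj_slots\<close> carries the last slots to K and fixes the symmetric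
  element a.\<close>

lemma conj_slots_term:
  assumes j: "1 \<le> j" "j \<le> N" and K: "K \<subseteq> {1..j}" and F: "F \<in> X1"
    and a: "a \<in> X" "symmetric_elt S N a" "ell S N a = 1"
  shows "conj_slots S ({1..j} - K) j (tens_pow S (j - card K) (card K) (marg S (j - card K) N a) F)
    = marg S j N (sops F (\<lambda>_. 1) K a)"
proof -
  let ?I = "{1..j} - K"
  have finK: "finite K" using K finite_subset by auto
  have cK: "card K \<le> j" using card_mono[OF _ K] by simp
  have cI: "card ?I = j - card K" using K finK by (simp add: card_Diff_subset)
  show ?thesis
  proof (cases "card K = j")
    \<comment> \<open>Here the marginal has index 0, below the range of the marginals;
      \<open>tens_pow\<close> discards it, and on the other side the factor ell a = 1
      appears.\<close>
    case True
    then have Kj: "K = {1..j}" using K card_subset_eq[of "{1..j}" K] by simp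
    then have "conj_slots S ?I j = id" by (simp add: conj_slots_def)
    then show ?thesis
      using marg_sops_all[OF j F a(1)] a(3) j(1) by (simp add: Kj tens_pow_def tprod_list_replicate)
  next
    case False
    define m where "m = j - card K"
    have m: "1 \<le> m" "m \<le> j" "card K = j - m" using False cK by (auto simp: m_def)
    define \<pi> where "\<pi> = slots_perm (sorted_list_of_set ?I) 1"
    have Isub: "?I \<subseteq> {1..j}" by auto
    have "{1..j} - ?I = K" using K by auto
    then have perm_j: "\<pi> permutes {1..j}" and im: "\<pi> ` K = {m<..j}"
      using slots_perm_image[OF Isub] cI by (simp_all add: \<pi>_def m_def)
    have perm: "\<pi> permutes {1..N}" using permutes_subset[OF perm_j] j by auto
    have x: "sops F (\<lambda>_. 1) {m<..j} a \<in> X" using j by (intro sops_in F a) auto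
    have len: "length (sorted_list_of_set ?I) = card ?I" by simp
    have "conj_slots S ?I j (marg S j N (sops F (\<lambda>_. 1) {m<..j} a))
        = marg S j N (perm_op \<pi> (sops F (\<lambda>_. 1) {m<..j} a))"
    proof -
      have "foldr (\<lambda>(i, p). oconj S j i p) (zip (sorted_list_of_set ?I) [1..<1 + length (sorted_list_of_set ?I)])
          (marg S j N (sops F (\<lambda>_. 1) {m<..j} a)) = marg S j N (perm_op \<pi> (sops F (\<lambda>_. 1) {m<..j} a))"
        unfolding \<pi>_def using cI by (intro foldr_oconj_marg[OF j x]) auto
      then show ?thesis by (simp add: conj_slots_def)
    qed
    also have "perm_op \<pi> (sops F (\<lambda>_. 1) {m<..j} a) = sops F (\<lambda>_. 1) (inv \<pi> ` {m<..j}) (perm_op \<pi> a)"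
    proof (rule sops_transfer[OF _ F a(1)])
      have ip: "inv \<pi> permutes {1..N}" by (rule permutes_inv[OF perm])
      show "inj_on (inv \<pi>) {1..N}" by (rule permutes_inj_on[OF ip])
      show "inv \<pi> ` {1..N} \<subseteq> {1..N}" using permutes_image[OF ip] by simp
      show "{m<..j} \<subseteq> {1..N}" using j by auto
      fix b i assume b: "b \<in> X" and i: "i \<in> {m<..j}"
      then have "i \<in> {1..N}" using j by auto
      then show "perm_op \<pi> (slot F (\<lambda>_. 1) i b) = slot F (\<lambda>_. 1) (inv \<pi> i) (perm_op \<pi> b)"
        using perm_op_ins[OF perm _ F b] by (simp add: slot_def)
    qed
    also have "inv \<pi> ` {m<..j} = K"
      unfolding im[symmetric] image_image by (simp add: permutes_inverses(2)[OF perm])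
    finally show ?thesis
      using tens_pow_marg[OF m(1,2) j(2) F a(1)] perm_op(4)[OF perm a(1,2)] m by simp
  qed
qed

lemma corr_error_eq:
  assumes j: "1 \<le> j" "j \<le> N" and F: "F \<in> X1" and a: "a \<in> X" "symmetric_elt S N a" "ell S N a = 1"
  shows "corr_error S N a F j = marg S j N (sops F (\<lambda>_. 2) {1..j} a)"
proof -
  have A: "{1..j} \<subseteq> {1..N}" using j by auto
  have s: "sops F (\<lambda>_. 1) K a \<in> X" if "K \<in> Pow {1..j}" for K using that A by (intro sops_in F a) auto
  note lin = bounded_clinear_onD(1)[OF marg_bounded[OF j]]
  have "marg S j N (sops F (\<lambda>_. 2) {1..j} a) = (\<Sum>K\<in>Pow {1..j}. marg S j N ((-1) ^ card K *\<^sub>R sops F (\<lambda>_. 1) K a))"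
    unfolding sops_2_expand[OF A F a(1)] by (rule clinear_on_sum[OF lin X]) (rule closed_csubspaceD(6)[OF X s])
  also have "\<dots> = corr_error S N a F j"
    unfolding corr_error_def
    by (rule sum.cong[OF refl]) (simp only: conj_slots_term[OF j _ F a] Pow_iff clinear_on_scaleR[OF lin s])
  finally show ?thesis by simp
qed

section \<open>Norms of the correlation errors\<close>

lemma marg_sops_code:
  assumes j: "1 \<le> j" "j \<le> N" and F: "F \<in> X1" "tr F = 1" and b: "b \<in> X"
  shows "marg S j N (sops F (code j) {1..N} b) = marg S j N (sops F (\<lambda>_. 2) {1..j} b)"
    "sops F (code j) {1..N} b = sops F (\<lambda>_. 1) {j<..N} (sops F (\<lambda>_. 2) {1..j} b)"
proof -
  have sub: "{j<..N} \<subseteq> {1..N}" "{1..j} \<subseteq> {1..N}" "{1..N} = {j<..N} \<union> {1..j}" using j by auto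
  have 1: "sops F (code j) {1..j} b = sops F (\<lambda>_. 2) {1..j} b"
    by (rule sops_cong[OF sub(2) F(1) b]) (simp add: code_def)
  have s: "sops F (\<lambda>_. 2) {1..j} b \<in> X" by (rule sops_in[OF sub(2) F(1) b])
  have "sops F (code j) {1..N} b = sops F (code j) {j<..N} (sops F (code j) {1..j} b)"
    unfolding sub(3) by (rule sops_Un[OF sub(1,2) _ F(1)]) auto
  also have "\<dots> = sops F (\<lambda>_. 1) {j<..N} (sops F (\<lambda>_. 2) {1..j} b)"
    unfolding 1 by (rule sops_cong[OF sub(1) F(1) s]) (simp add: code_def)
  finally show eq: "sops F (code j) {1..N} b = sops F (\<lambda>_. 1) {j<..N} (sops F (\<lambda>_. 2) {1..j} b)" .
  show "marg S j N (sops F (code j) {1..N} b) = marg S j N (sops F (\<lambda>_. 2) {1..j} b)"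
    unfolding eq by (rule marg_sops_1[OF j(1) order_refl F s]) simp
qed

text \<open>For j < N the element on the right is the tensor product of the marginal with copies of
  F, each of norm 1.\<close>

lemma norm_marg_sops:
  assumes j: "1 \<le> j" "j \<le> N" and F: "F \<in> X1" "tr F = 1" "norm F = 1" and b: "b \<in> X"
  shows "norm (marg S j N (sops F (\<lambda>_. 2) {1..j} b)) = norm (sops F (code j) {1..N} b)"
proof (cases "j = N")
  case True
  then show ?thesis
    using marg_same[OF j(1)] sops_cong[OF order_refl F(1) b, of "code N" "\<lambda>_. 2"] by (simp add: code_def)
next
  case False
  define y where "y = sops F (\<lambda>_. 2) {1..j} b"
  have y: "y \<in> X" unfolding y_def using j by (intro sops_in F b) auto
  have k: "N - j \<ge> 1" using False j by simp
  have my: "marg S j N y \<in> compl S j" by (rule bounded_clinear_onD(2)[OF marg_bounded[OF j] y])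
  have "tens_pow S j (N - j) (marg S j N y) F = marg S N N (sops F (\<lambda>_. 1) {j<..N} y)"
    by (rule tens_pow_marg[OF j order_refl F(1) y])
  then have "otens S j (N - j) (marg S j N y) (tpr (N - j) (\<lambda>_. F)) = sops F (\<lambda>_. 1) {j<..N} y"
    using j(1) marg_same[OF N1] False j(2) by (simp add: tens_pow_def tprod_list_replicate)
  moreover have "norm (tpr (N - j) (\<lambda>_. F)) = 1"
    using norm_tpr[OF k, of "\<lambda>_. F"] F by simp
  ultimately have "norm (sops F (\<lambda>_. 1) {j<..N} y) = norm (marg S j N y)"
    using norm_otens[OF j(1) k my tpr_in_slots[OF k const_slots[OF F(1)]]] by simp
  then show ?thesis
    using marg_sops_code(2)[OF j F(1,2) b] by (simp add: y_def)
qed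

lemma norm_corr_error:
  assumes "1 \<le> j" "j \<le> N" "F \<in> X1" "tr F = 1" "norm F = 1" "a \<in> X" "symmetric_elt S N a" "ell S N a = 1"
  shows "norm (corr_error S N a F j) = err F a j"
  using norm_marg_sops[OF assms(1-6)] corr_error_eq[OF assms(1-3,6-8)] by (simp add: err_def)

text \<open>Every slot is projected, which leaves F in all slots with the factor ell a = 1. This
  value serves the index j - 1 at j = 1, and also j - 2 there, because subtraction is
  truncated.\<close>

lemma err_0:
  assumes "F \<in> X1" "norm F = 1" "a \<in> X" "ell S N a = 1"
  shows "err F a 0 = 1"
proof -
  have "sops F (code 0) {1..N} a = sops F (\<lambda>_. 1) {1..N} a"
    by (rule sops_cong[OF order_refl assms(1,3)]) (simp add: code_def)
  also have "\<dots> = tp (\<lambda>_. F)"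
    using marg_sops_all[OF N1 order_refl assms(1,3)] assms(4) marg_same[OF N1] by simp
  finally show ?thesis using norm_tpr[OF N1, of "\<lambda>_. F"] assms by (simp add: err_def)
qed

lemma err_le:
  assumes "F \<in> X1" "norm F = 1" "a \<in> X" "norm a = 1" "j \<le> N"
  shows "err F a j \<le> 2 ^ j"
proof -
  have "{i \<in> {1..N}. code j i \<noteq> 0 \<and> code j i \<noteq> 1} = {1..j}" using assms(5) by (auto simp: code_def)
  then show ?thesis
    using norm_sops[OF order_refl assms(1) _ assms(3), of "code j"] assms(2,4) by (simp add: err_def)
qed

end

section \<open>The graph of the free Hamiltonian\<close>

context tensor_algebra
begin

definition K0_generators :: "nat \<Rightarrow> ('b \<times> 'b) set" where
  "K0_generators n = {(tpr n f, \<Sum>i\<in>{1..n}. tpr n (f(i := K0 S (f i)))) | f. \<forall>i\<in>{1..n}. f i \<in> K0dom S}"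

lemma K0_pair_eq:
  assumes "length as = n" "\<And>k. k \<in> {1..n} \<Longrightarrow> as ! (k - 1) = f k"
  shows "tprod_list (otens S) as = tpr n f"
    "(\<Sum>i<n. tprod_list (otens S) (as[i := K0 S (as ! i)])) = (\<Sum>i\<in>{1..n}. tpr n (f(i := K0 S (f i))))"
proof -
  show "tprod_list (otens S) as = tpr n f"
    unfolding tprod_list_eq_fun assms(1) by (rule tprod_fun_cong) (rule assms(2))
  have each: "tprod_list (otens S) (as[i := K0 S (as ! i)]) = tpr n (f(Suc i := K0 S (f (Suc i))))" if i: "i < n" for i
  proof -
    have "as ! i = f (Suc i)" using assms(2)[of "Suc i"] i by simp
    moreover have "as[i := v] ! (k - 1) = (f(Suc i := v)) k" if "k \<in> {1..n}" for k v
      using assms(2)[OF that] that assms(1) by (auto simp: nth_list_update)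
    ultimately show ?thesis
      unfolding tprod_list_eq_fun by (simp only: length_list_update assms(1)) (rule tprod_fun_cong, simp)
  qed
  have "{1..n} = Suc ` {..<n}" by (metis One_nat_def image_Suc_lessThan)
  then have "(\<Sum>i\<in>{1..n}. tpr n (f(i := K0 S (f i)))) = (\<Sum>i<n. tpr n (f(Suc i := K0 S (f (Suc i)))))"
    by (simp add: sum.reindex)
  then show "(\<Sum>i<n. tprod_list (otens S) (as[i := K0 S (as ! i)])) = (\<Sum>i\<in>{1..n}. tpr n (f(i := K0 S (f i))))"
    using each by simp
qed

lemma K0_graph_eq: "K0_graph S n = closure (cvec.span (K0_generators n))"
proof -
  have "{(tprod_list (otens S) as, \<Sum>i<n. tprod_list (otens S) (as[i := K0 S (as ! i)])) | as.
        length as = n \<and> set as \<subseteq> K0dom S} = K0_generators n" (is "?L = _")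
  proof
    show "?L \<subseteq> K0_generators n"
    proof
      fix z assume "z \<in> ?L"
      then obtain as where as: "length as = n" "set as \<subseteq> K0dom S"
        "z = (tprod_list (otens S) as, \<Sum>i<n. tprod_list (otens S) (as[i := K0 S (as ! i)]))" by auto
      let ?f = "\<lambda>i. as ! (i - 1)"
      have "\<forall>i\<in>{1..n}. ?f i \<in> K0dom S" using as(1,2) by (auto simp: subset_iff)
      moreover have "z = (tpr n ?f, \<Sum>i\<in>{1..n}. tpr n (?f(i := K0 S (?f i))))"
        unfolding as(3) using K0_pair_eq[OF as(1), of ?f] by simp
      ultimately show "z \<in> K0_generators n"
        unfolding K0_generators_def by (intro CollectI exI[of _ ?f] conjI)
    qed
    show "K0_generators n \<subseteq> ?L"
    proof
      fix z assume "z \<in> K0_generators n"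
      then obtain f where f: "\<forall>i\<in>{1..n}. f i \<in> K0dom S" "z = (tpr n f, \<Sum>i\<in>{1..n}. tpr n (f(i := K0 S (f i))))"
        unfolding K0_generators_def by auto
      let ?as = "map f [1..<Suc n]"
      have len: "length ?as = n" by simp
      have nth: "?as ! (k - 1) = f k" if "k \<in> {1..n}" for k
      proof -
        have "k - 1 < length [1..<Suc n]" "[1..<Suc n] ! (k - 1) = k" using that by (auto simp: nth_append)
        then show ?thesis by (simp only: nth_map)
      qed
      have "set ?as \<subseteq> K0dom S" using f(1) by auto
      moreover have "z = (tprod_list (otens S) ?as, \<Sum>i<n. tprod_list (otens S) (?as[i := K0 S (?as ! i)]))"
        unfolding f(2) using K0_pair_eq[OF len nth] by simp
      ultimately show "z \<in> ?L" using len by (intro CollectI exI[of _ ?as] conjI)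
    qed
  qed
  then show ?thesis unfolding K0_graph_def by simp
qed

lemma K0_graph_csubspace: "closed_csubspace (K0_graph S n)"
  unfolding K0_graph_eq by (rule closed_csubspace_closure[OF cvec.subspace_span])

lemma K0_graph_scaleC: "(x, y) \<in> K0_graph S n \<Longrightarrow> (c *\<^sub>C x, c *\<^sub>C y) \<in> K0_graph S n"
  using closed_csubspaceD(3)[OF K0_graph_csubspace, of "(x, y)" n c] by (simp add: scaleC_prod_def)

lemma K0_graph_diff: "(x, y) \<in> K0_graph S n \<Longrightarrow> (x', y') \<in> K0_graph S n \<Longrightarrow> (x - x', y - y') \<in> K0_graph S n"
  using closed_csubspaceD(4)[OF K0_graph_csubspace, of "(x, y)" n "(x', y')"] by simp

lemma K0_graph_sum:
  assumes "\<And>i. i \<in> I \<Longrightarrow> (f i, g i) \<in> K0_graph S n"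
  shows "(\<Sum>i\<in>I. f i, \<Sum>i\<in>I. g i) \<in> K0_graph S n"
proof -
  have "(\<Sum>i\<in>I. (f i, g i)) \<in> K0_graph S n"
    using assms by (rule closed_csubspace_sum[OF K0_graph_csubspace])
  then show ?thesis by (simp add: sum_prod)
qed

lemma K0_generatorI:
  assumes "\<And>i. i \<in> {1..n} \<Longrightarrow> f i \<in> K0dom S"
  shows "(tpr n f, \<Sum>i\<in>{1..n}. tpr n (f(i := K0 S (f i)))) \<in> K0_graph S n"
proof -
  have "(tpr n f, \<Sum>i\<in>{1..n}. tpr n (f(i := K0 S (f i)))) \<in> K0_generators n"
    unfolding K0_generators_def using assms by (intro CollectI exI[of _ f] conjI) simp_all
  then show ?thesis
    unfolding K0_graph_eq by (intro subsetD[OF closure_subset] cvec.span_base)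
qed

end

section \<open>Bounded maps on the graph of the free Hamiltonian\<close>

context mean_field_system
begin

lemma K0dom_in: "f \<in> K0dom S \<Longrightarrow> f \<in> compl S 1" "f \<in> K0dom S \<Longrightarrow> K0 S f \<in> compl S 1"
  using K0_dom(2) K0_range by auto

lemma K0_generator_slots:
  assumes "\<forall>i\<in>{1..n}. f i \<in> K0dom S"
  shows "in_slots n f" "i \<in> {1..n} \<Longrightarrow> in_slots n (f(i := K0 S (f i)))"
  using assms K0dom_in by (auto simp: in_slots_def)

lemma K0_graph_subset:
  assumes n: "n \<ge> 1" and xy: "(x, y) \<in> K0_graph S n"
  shows "x \<in> compl S n" "y \<in> compl S n"
proof -
  have cs: "closed_csubspace (compl S n \<times> compl S n)"
    using closed_csubspaceD[OF compl[OF n]]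
    by (auto simp: closed_csubspace_def cvec.subspace_def scaleC_prod_def zero_prod_def intro!: closed_Times)
  have "(x, y) \<in> compl S n \<times> compl S n"
  proof (rule dense_subspace_induct[OF xy[unfolded K0_graph_eq] _ cs])
    fix b assume "b \<in> K0_generators n"
    then obtain f where f: "\<forall>i\<in>{1..n}. f i \<in> K0dom S" "b = (tpr n f, \<Sum>i\<in>{1..n}. tpr n (f(i := K0 S (f i))))"
      unfolding K0_generators_def by auto
    have "tpr n f \<in> compl S n" by (rule tpr_in_slots[OF n K0_generator_slots(1)[OF f(1)]])
    moreover have "(\<Sum>i\<in>{1..n}. tpr n (f(i := K0 S (f i)))) \<in> compl S n"
      by (rule closed_csubspace_sum[OF compl[OF n]]) (rule tpr_in_slots[OF n K0_generator_slots(2)[OF f(1)]])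
    ultimately show "b \<in> compl S n \<times> compl S n" using f(2) by simp
  qed
  then show "x \<in> compl S n" "y \<in> compl S n" by auto
qed

text \<open>A commutation relation K A x = A K x + C x with bounded A and C, stated on graphs so
  that no domain has to be identified. It survives linear combinations and limits and is checked on
  tensors from the domain of \<open>K0\<close>.\<close>

lemma K0_graph_map:
  assumes n: "n \<ge> 1" and A: "bounded_clinear_on (compl S n) Y A" and C: "bounded_clinear_on (compl S n) Z C"
    and gen: "\<And>f. \<forall>i\<in>{1..n}. f i \<in> K0dom S \<Longrightarrow>
      (A (tpr n f), A (\<Sum>i\<in>{1..n}. tpr n (f(i := K0 S (f i)))) + C (tpr n f)) \<in> K0_graph S m"
    and xy: "(x, y) \<in> K0_graph S n"
  shows "(A x, A y + C x) \<in> K0_graph S m"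
proof -
  let ?G = "K0_graph S n"
  define L where "L p = (A (fst p), A (snd p) + C (fst p))" for p
  note sub = K0_graph_subset[OF n] and A' = bounded_clinear_onD(1)[OF A] and C' = bounded_clinear_onD(1)[OF C]
  have fst: "fst p \<in> compl S n" and snd: "snd p \<in> compl S n" if "p \<in> ?G" for p
    using sub[of "fst p" "snd p"] that by auto
  have contA: "continuous_on ?G (\<lambda>p. A (fst p))" "continuous_on ?G (\<lambda>p. A (snd p))" "continuous_on ?G (\<lambda>p. C (fst p))"
    by (rule continuous_on_compose2[OF bounded_clinear_on_continuous[OF A compl[OF n]]]
          continuous_on_compose2[OF bounded_clinear_on_continuous[OF C compl[OF n]]];
        use fst snd in \<open>auto intro!: continuous_intros\<close>)+
  have "L (x, y) \<in> K0_graph S m"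
  proof (rule clinear_on_dense_mem[OF _ _ K0_graph_eq _ K0_graph_csubspace xy])
    show "clinear_on ?G L"
      by (rule clinear_onI)
        (simp_all add: L_def fst snd clinear_onD[OF A'] clinear_onD[OF C'] scaleC_prod_def scaleC_add_right)
    show "continuous_on ?G L"
      unfolding L_def by (intro continuous_on_Pair continuous_on_add contA)
    fix b assume "b \<in> K0_generators n"
    then obtain f where f: "\<forall>i\<in>{1..n}. f i \<in> K0dom S" "b = (tpr n f, \<Sum>i\<in>{1..n}. tpr n (f(i := K0 S (f i))))"
      unfolding K0_generators_def by auto
    show "L b \<in> K0_graph S m" using gen[OF f(1)] f(2) by (simp add: L_def)
  qed
  then show ?thesis by (simp add: L_def)
qed

lemma Tsum_bounded: "n \<ge> 1 \<Longrightarrow> bounded_clinear_on (compl S n) (compl S n) (Tsum S n)"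
proof -
  assume n: "n \<ge> 1"
  have T: "bounded_clinear_on (compl S n) (compl S n) (Tir S n i r)" if "r \<in> {1..n}" "i \<in> {1..<r}" for i r
  proof -
    have j: "n \<ge> 2" "1 \<in> {1..n}" "2 \<in> {1..n}" "i \<in> {1..n}" "r \<in> {1..n}" using that by auto
    show ?thesis
      unfolding Tir_def
      by (rule bounded_clinear_on_compose[OF bounded_clinear_on_compose[OF bounded_clinear_on_compose[OF
            bounded_clinear_on_compose[OF oconj_bounded[OF j(2,4)] oconj_bounded[OF j(3,5)]]
            VI_bounded[OF j(1)]] oconj_bounded[OF j(3,5)]] oconj_bounded[OF j(2,4)]])
  qed
  show ?thesis unfolding Tsum_def
    by (intro bounded_clinear_on_sum T compl n)
qed

end

context large_system
begin

lemma K0_graph_perm: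
  assumes p: "p permutes {1..N}" and xy: "(x, y) \<in> K0_graph S N"
  shows "(perm_op p x, perm_op p y) \<in> K0_graph S N"
proof -
  have "(perm_op p x, perm_op p y + 0) \<in> K0_graph S N"
  proof (rule K0_graph_map[OF N1 perm_op(1)[OF p] bounded_clinear_on_zero[OF X, of X] _ xy])
    fix f assume f: "\<forall>i\<in>{1..N}. f i \<in> K0dom S"
    note sl = K0_generator_slots[OF f]
    have ip: "inv p permutes {1..N}" by (rule permutes_inv[OF p])
    have upd: "(f(i := v)) \<circ> p = (f \<circ> p)(inv p i := v)" for i v
      by (rule ext) (metis comp_apply fun_upd_apply p permutes_inverses(1) permutes_inverses(2))
    have "perm_op p (\<Sum>i\<in>{1..N}. tp (f(i := K0 S (f i)))) = (\<Sum>i\<in>{1..N}. perm_op p (tp (f(i := K0 S (f i)))))"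
      by (rule clinear_on_sum[OF bounded_clinear_onD(1)[OF perm_op(1)[OF p]] X]) (rule tp_in[OF sl(2)])
    also have "\<dots> = (\<Sum>i\<in>{1..N}. tp ((f \<circ> p)(inv p i := K0 S ((f \<circ> p) (inv p i)))))"
      by (rule sum.cong[OF refl]) (simp only: perm_op(2)[OF p sl(2)] upd comp_apply permutes_inverses(1)[OF p])
    also have "\<dots> = (\<Sum>i\<in>{1..N}. tp ((f \<circ> p)(i := K0 S ((f \<circ> p) i))))"
      by (rule sum.reindex_bij_betw[OF permutes_imp_bij[OF ip]])
    finally have eq: "perm_op p (\<Sum>i\<in>{1..N}. tp (f(i := K0 S (f i)))) = (\<Sum>i\<in>{1..N}. tp ((f \<circ> p)(i := K0 S ((f \<circ> p) i))))" .
    have "(f \<circ> p) i \<in> K0dom S" if "i \<in> {1..N}" for i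
      using f permutes_in_image[OF p] that by simp
    then show "(perm_op p (tp f), perm_op p (\<Sum>i\<in>{1..N}. tp (f(i := K0 S (f i)))) + 0) \<in> K0_graph S N"
      using K0_generatorI[of N "f \<circ> p"] unfolding eq perm_op(2)[OF p sl(1)] by simp
  qed
  then show ?thesis by simp
qed

text \<open>The term in which K0 acts on the old entry of slot i vanishes, since K0 f has trace 0.
  The free Hamiltonian of the new tensor acts on g instead, and this is the added term.\<close>

lemma K0_graph_ins:
  assumes i: "i \<in> {1..N}" and g: "g \<in> K0dom S" and xy: "(x, y) \<in> K0_graph S N"
  shows "(ins g i x, ins g i y + ins (K0 S g) i x) \<in> K0_graph S N"
proof (rule K0_graph_map[OF N1 ins_bounded[OF i K0dom_in(1)[OF g]] ins_bounded[OF i K0dom_in(2)[OF g]] _ xy])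
  fix f assume f: "\<forall>i\<in>{1..N}. f i \<in> K0dom S"
  note sl = K0_generator_slots[OF f] and g1 = K0dom_in[OF g]
  let ?f = "f(i := g)" and ?d = "\<lambda>f l. tp (f(l := K0 S (f l)))"
  have each: "ins g i (?d f l) = (if l = i then 0 else tr (f i) *\<^sub>C ?d ?f l)" if l: "l \<in> {1..N}" for l
    using ins_tp[OF i g1(1) sl(2)[OF l]] ell_K0[of "f i"] f i by (auto simp: fun_upd_twist)
  have "ins g i (\<Sum>l\<in>{1..N}. ?d f l) = (\<Sum>l\<in>{1..N}. ins g i (?d f l))"
    by (rule clinear_on_sum[OF ins_clinear[OF i g1(1)] X]) (rule tp_in[OF sl(2)])
  also have "\<dots> = (\<Sum>l\<in>{1..N}. if l = i then 0 else tr (f i) *\<^sub>C ?d ?f l)"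
    by (rule sum.cong[OF refl each])
  also have "\<dots> = (\<Sum>l\<in>{1..N} - {i}. tr (f i) *\<^sub>C ?d ?f l)"
    by (rule sum.mono_neutral_cong_right) auto
  finally have eq: "ins g i (\<Sum>l\<in>{1..N}. ?d f l) = (\<Sum>l\<in>{1..N} - {i}. tr (f i) *\<^sub>C ?d ?f l)" .
  have "ins (K0 S g) i (tp f) = tr (f i) *\<^sub>C ?d ?f i"
    using ins_tp[OF i g1(2) sl(1)] by simp
  then have "ins g i (\<Sum>l\<in>{1..N}. ?d f l) + ins (K0 S g) i (tp f) = (\<Sum>l\<in>{1..N}. tr (f i) *\<^sub>C ?d ?f l)"
    unfolding eq using sum.remove[of "{1..N}" i "\<lambda>l. tr (f i) *\<^sub>C ?d ?f l"] i by simp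
  also have "\<dots> = tr (f i) *\<^sub>C (\<Sum>l\<in>{1..N}. ?d ?f l)" by (rule scaleC_sum_right[symmetric])
  finally have eq2: "ins g i (\<Sum>l\<in>{1..N}. ?d f l) + ins (K0 S g) i (tp f) = tr (f i) *\<^sub>C (\<Sum>l\<in>{1..N}. ?d ?f l)" .
  have "?f l \<in> K0dom S" if "l \<in> {1..N}" for l using f g that by simp
  then show "(ins g i (tp f), ins g i (\<Sum>l\<in>{1..N}. ?d f l) + ins (K0 S g) i (tp f)) \<in> K0_graph S N"
    unfolding eq2 ins_tp[OF i g1(1) sl(1)] by (intro K0_graph_scaleC K0_generatorI)
qed

text \<open>Terms in which K0 acts on a traced-out slot vanish, since K0 f has trace 0.\<close>

lemma K0_graph_marg:
  assumes j: "1 \<le> j" "j \<le> N" and xy: "(x, y) \<in> K0_graph S N"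
  shows "(marg S j N x, marg S j N y) \<in> K0_graph S j"
proof -
  have "(marg S j N x, marg S j N y + 0) \<in> K0_graph S j"
  proof (rule K0_graph_map[OF N1 marg_bounded[OF j] bounded_clinear_on_zero[OF X, of X] _ xy])
    fix f assume f: "\<forall>i\<in>{1..N}. f i \<in> K0dom S"
    note sl = K0_generator_slots[OF f]
    let ?d = "\<lambda>l. f(l := K0 S (f l))" and ?c = "\<Prod>i\<in>{j<..N}. tr (f i)"
    have each: "marg S j N (tp (?d l)) = (if l \<le> j then ?c *\<^sub>C tpr j (?d l) else 0)" if l: "l \<in> {1..N}" for l
    proof (cases "l \<le> j")
      case True
      have "(\<Prod>i\<in>{j<..N}. tr (?d l i)) = ?c" using True by (intro prod.cong) auto
      then show ?thesis using marg_tpr[OF j sl(2)[OF l]] True by simp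
    next
      case False
      then have "l \<in> {j<..N}" using l by auto
      moreover have "tr (?d l l) = 0" using ell_K0 f l by simp
      ultimately have "(\<Prod>i\<in>{j<..N}. tr (?d l i)) = 0"
        by (intro prod_zero bexI[of _ l]) auto
      then show ?thesis using marg_tpr[OF j sl(2)[OF l]] False by simp
    qed
    have "marg S j N (\<Sum>l\<in>{1..N}. tp (?d l)) = (\<Sum>l\<in>{1..N}. marg S j N (tp (?d l)))"
      by (rule clinear_on_sum[OF bounded_clinear_onD(1)[OF marg_bounded[OF j]] X]) (rule tp_in[OF sl(2)])
    also have "\<dots> = (\<Sum>l\<in>{1..N}. if l \<le> j then ?c *\<^sub>C tpr j (?d l) else 0)"
      by (rule sum.cong[OF refl each])
    also have "\<dots> = (\<Sum>l\<in>{1..j}. ?c *\<^sub>C tpr j (?d l))"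
      by (rule sum.mono_neutral_cong_right) (use j in auto)
    also have "\<dots> = ?c *\<^sub>C (\<Sum>l\<in>{1..j}. tpr j (?d l))" by (rule scaleC_sum_right[symmetric])
    finally have eq: "marg S j N (\<Sum>l\<in>{1..N}. tp (?d l)) = ?c *\<^sub>C (\<Sum>l\<in>{1..j}. tpr j (?d l))" .
    have "f l \<in> K0dom S" if "l \<in> {1..j}" for l using f j that by simp
    then show "(marg S j N (tp f), marg S j N (\<Sum>l\<in>{1..N}. tp (?d l)) + 0) \<in> K0_graph S j"
      unfolding eq marg_tpr[OF j sl(1)] by (simp only: add_0_right) (intro K0_graph_scaleC K0_generatorI)
  qed
  then show ?thesis by simp
qed

section \<open>Symmetry of the interaction\<close>

lemma permutes_pair:
  assumes "p permutes {1..N}" "p 1 = 1" "p 2 = 2" "i \<in> {1..N}" "i > 2"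
  shows "p i > 2"
proof -
  have "p i \<in> {1..N}" using permutes_in_image[OF assms(1)] assms(4) by blast
  moreover have "p i \<noteq> p 1" "p i \<noteq> p 2" using permutes_inj[OF assms(1)] assms(5) by (auto simp: inj_eq)
  ultimately show ?thesis using assms(2,3) by auto
qed

lemma perm_op_VI:
  assumes p: "p permutes {1..N}" "p 1 = 1" "p 2 = 2" and a: "a \<in> X"
  shows "perm_op p (VI a) = VI (perm_op p a)"
proof (rule X_eqI[OF bounded_clinear_on_compose[OF VI_X perm_op(1)[OF p(1)]] bounded_clinear_on_compose[OF perm_op(1)[OF p(1)] VI_X] _ a])
  fix f assume f: "in_slots N f"
  note fp = in_slots_permutes[OF f p(1)]
  have f2: "tpr 2 f \<in> compl S 2" by (rule tpr_in_slots[OF le12 in_slots_mono[OF f N2]])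
  have t2: "tpr 2 (f \<circ> p) = tpr 2 f"
  proof (rule tprod_fun_cong)
    fix i :: nat assume "i \<in> {1..2}"
    then have "i = 1 \<or> i = 2" by auto
    then show "(f \<circ> p) i = f i" using p by auto
  qed
  have "perm_op p (tens2 (intV S (tpr 2 f)) f) = tens2 (intV S (tpr 2 f)) (f \<circ> p)"
  proof (rule tens2_eqI[OF perm_op(1)[OF p(1)] tens2_bounded[OF fp] f _ V_in[OF f2]])
    fix h assume h: "in_slots 2 h"
    have "tp ((\<lambda>i. if i \<le> 2 then h i else f i) \<circ> p) = tp (\<lambda>i. if i \<le> 2 then h i else (f \<circ> p) i)"
    proof (rule tprod_fun_cong)
      fix i assume i: "i \<in> {1..N}"
      then have "i = 1 \<or> i = 2 \<or> i > 2" by auto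
      then show "((\<lambda>i. if i \<le> 2 then h i else f i) \<circ> p) i = (if i \<le> 2 then h i else (f \<circ> p) i)"
        using p permutes_pair[OF p i] by auto
    qed
    then show "perm_op p (tp (\<lambda>i. if i \<le> 2 then h i else f i)) = tens2 (tpr 2 h) (f \<circ> p)"
      unfolding tens2_tpr[OF h fp] perm_op(2)[OF p(1) tens2_slots[OF h f]] .
  qed
  then show "perm_op p (VI (tp f)) = VI (perm_op p (tp f))"
    using VI_tp[OF fp] t2 by (simp add: VI_tp[OF f] perm_op(2)[OF p(1) f])
qed

text \<open>V respects the exchange of its slots on symmetric elements, whereas density arguments
  use elementary tensors, which need not be symmetric. In this form the claim is linear in an
  arbitrary a, and for elementary a the two-particle part of the sum is symmetric.\<close>

lemma VI_swap_symmetrized: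
  assumes a: "a \<in> X"
  shows "oconj S N 1 2 (VI (a + oconj S N 1 2 a)) = VI (a + oconj S N 1 2 a)"
proof -
  note o12 = oconj_bounded[OF slots12]
  have bM: "bounded_clinear_on X X (\<lambda>a. VI (a + oconj S N 1 2 a))"
    by (rule bounded_clinear_on_compose[OF bounded_clinear_on_add[OF bounded_clinear_on_id o12 X] VI_X])
  show ?thesis
  proof (rule X_eqI[OF bounded_clinear_on_compose[OF bM o12] bM _ a])
    fix f assume f: "in_slots N f"
    let ?t = "slot_swap 1 2"
    note ft = in_slots_swap[OF f slots12]
    have f2: "in_slots 2 f" by (rule in_slots_mono[OF f N2])
    have s2: "1 \<in> {1..2::nat}" "2 \<in> {1..2::nat}" by auto
    note ft2 = in_slots_swap[OF f2 s2]
    define c where "c = tpr 2 f + tpr 2 (f \<circ> ?t)"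
    have tin: "tpr 2 f \<in> compl S 2" "tpr 2 (f \<circ> ?t) \<in> compl S 2"
      by (rule tpr_in_slots[OF le12 f2] tpr_in_slots[OF le12 ft2])+
    have c: "c \<in> compl S 2" unfolding c_def by (rule closed_csubspaceD(2)[OF compl[OF le12] tin])
    have "tp (f \<circ> ?t) = tens2 (tpr 2 (f \<circ> ?t)) f"
      unfolding tens2_tpr[OF ft2 f]
    proof (rule tprod_fun_cong)
      fix i assume "i \<in> {1..N}"
      show "(f \<circ> ?t) i = (if i \<le> 2 then (f \<circ> ?t) i else f i)"
        by (auto simp: Transposition.transpose_def)
    qed
    then have sum: "tp f + oconj S N 1 2 (tp f) = tens2 c f"
      using oconj_tpr_slots[OF slots12 f] tp_tens2[OF f]
      by (simp add: c_def clinear_on_add[OF bounded_clinear_onD(1)[OF tens2_bounded[OF f]] tin])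
    have "symmetric_elt S 2 c"
      unfolding symmetric_elt_def
    proof (intro ballI)
      fix k s :: nat assume ks: "k \<in> {1..2}" "s \<in> {1..2}"
      have "slot_swap k s = id \<or> slot_swap k s = ?t"
      proof -
        have "k = 1 \<or> k = 2" "s = 1 \<or> s = 2" using ks by auto
        then show ?thesis by (auto simp: transpose_commute)
      qed
      moreover have "f \<circ> ?t \<circ> ?t = f" by (simp add: comp_assoc)
      ultimately have "tpr 2 (f \<circ> slot_swap k s) + tpr 2 (f \<circ> ?t \<circ> slot_swap k s) = c"
        by (auto simp: c_def)
      then show "oconj S 2 k s c = c"
        using clinear_on_add[OF oconj_clinear[OF ks] tin] oconj_tpr_slots[OF ks f2] oconj_tpr_slots[OF ks ft2]
        by (simp add: c_def)
    qed
    then have Vc: "oconj S 2 1 2 (intV S c) = intV S c"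
      using V_symmetric[OF c] s2 by (simp only: symmetric_elt_def)
    have "oconj S N 1 2 (tens2 (intV S c) f) = tens2 (oconj S 2 1 2 (intV S c)) f"
    proof (rule tens2_eqI[OF o12 bounded_clinear_on_compose[OF oconj_bounded[OF s2] tens2_bounded[OF f]] f _ V_in[OF c]])
      fix h assume h: "in_slots 2 h"
      have "tp ((\<lambda>i. if i \<le> 2 then h i else f i) \<circ> ?t) = tp (\<lambda>i. if i \<le> 2 then (h \<circ> ?t) i else f i)"
      proof (rule tprod_fun_cong)
        fix i :: nat
        show "((\<lambda>i. if i \<le> 2 then h i else f i) \<circ> ?t) i = (if i \<le> 2 then (h \<circ> ?t) i else f i)"
          by (auto simp: Transposition.transpose_def)
      qed
      then show "oconj S N 1 2 (tp (\<lambda>i. if i \<le> 2 then h i else f i)) = tens2 (oconj S 2 1 2 (tpr 2 h)) f"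
        unfolding oconj_tpr_slots[OF slots12 tens2_slots[OF h f]] oconj_tpr_slots[OF s2 h] tens2_tpr[OF in_slots_swap[OF h s2] f] .
    qed
    then show "oconj S N 1 2 (VI (tp f + oconj S N 1 2 (tp f))) = VI (tp f + oconj S N 1 2 (tp f))"
      unfolding sum VI_tens2[OF f c] Vc .
  qed
qed

text \<open>For symmetric a the symmetrized element is 2 a.\<close>

lemma VI_swap:
  assumes a: "a \<in> X" "symmetric_elt S N a"
  shows "oconj S N 1 2 (VI a) = VI a"
proof -
  have "oconj S N 1 2 a = a" using a(2) slots12 by (simp only: symmetric_elt_def)
  then have "oconj S N 1 2 (VI (a + a)) = VI (a + a)" using VI_swap_symmetrized[OF a(1)] by simp
  moreover have "VI (a + a) = VI a + VI a" by (rule clinear_on_add[OF bounded_clinear_onD(1)[OF VI_X] a(1) a(1)])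
  moreover have "VI a \<in> X" by (rule bounded_clinear_onD(2)[OF VI_X a(1)])
  ultimately have "oconj S N 1 2 (VI a) + oconj S N 1 2 (VI a) = VI a + VI a"
    using clinear_on_add[OF oconj_clinear[OF slots12], of "VI a" "VI a"] by simp
  then have "2 *\<^sub>R oconj S N 1 2 (VI a) = 2 *\<^sub>R VI a" by (simp only: scaleR_2)
  then show ?thesis by simp
qed

context
  fixes a assumes a: "a \<in> X" "symmetric_elt S N a"
begin

lemma VI_a_in: "VI a \<in> X"
  by (rule bounded_clinear_onD(2)[OF VI_X a(1)])

text \<open>Either q fixes 1 and 2, or it does so after composition with their exchange.\<close>

lemma perm_op_VI_pair:
  assumes q: "q permutes {1..N}" "q ` {1, 2} = {1, 2}"
  shows "perm_op q (VI a) = VI a"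
proof -
  have fixed: "perm_op p (VI a) = VI a" if p: "p permutes {1..N}" "p 1 = 1" "p 2 = 2" for p
    using perm_op_VI[OF p a(1)] perm_op(4)[OF p(1) a] by simp
  have "q 1 = 1 \<and> q 2 = 2 \<or> q 1 = 2 \<and> q 2 = 1"
    using q(2) permutes_inj[OF q(1)] by (auto simp: doubleton_eq_iff)
  then show ?thesis
  proof
    assume "q 1 = 2 \<and> q 2 = 1"
    let ?t = "slot_swap 1 2" and ?p = "q \<circ> slot_swap 1 2"
    have t: "?t permutes {1..N}" by (rule permutes_swap_id[OF slots12])
    have p: "?p permutes {1..N}" by (rule permutes_compose[OF t q(1)])
    have "?p 1 = 1" "?p 2 = 2" using \<open>q 1 = 2 \<and> q 2 = 1\<close> by auto
    then have "perm_op ?p (VI a) = VI a" by (rule fixed[OF p])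
    then have "perm_op (?p \<circ> ?t) (VI a) = oconj S N 1 2 (VI a)"
      using perm_op_compose[OF p t VI_a_in] perm_op_swap[OF slots12 VI_a_in] by simp
    then show ?thesis using VI_swap[OF a] by (simp add: comp_assoc)
  qed (rule fixed[OF q(1)], auto)
qed

text \<open>p composed with the inverse of q preserves {1, 2}, so \<open>perm_op_VI_pair\<close>
  applies to it.\<close>

lemma perm_op_VI_eq:
  assumes p: "p permutes {1..N}" and q: "q permutes {1..N}" and P: "p ` P = {1, 2}" "q ` P = {1, 2}"
  shows "perm_op p (VI a) = perm_op q (VI a)"
proof -
  let ?r = "p \<circ> inv q"
  have r: "?r permutes {1..N}" by (rule permutes_compose[OF permutes_inv[OF q] p])
  have "inv q ` {1, 2} = P"
    unfolding P(2)[symmetric] image_image by (simp add: permutes_inverses(2)[OF q])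
  then have "?r ` {1, 2} = {1, 2}" using P(1) by (metis image_comp)
  then have "perm_op ?r (VI a) = VI a" by (rule perm_op_VI_pair[OF r])
  moreover have "perm_op q (perm_op ?r (VI a)) = perm_op (?r \<circ> q) (VI a)"
    by (rule perm_op_compose[OF r q VI_a_in])
  moreover have "?r \<circ> q = p" by (rule ext) (simp add: permutes_inverses(2)[OF q])
  ultimately show ?thesis by simp
qed

text \<open>The interaction on an unordered pair: by \<open>perm_op_VI_eq\<close> the chosen
  permutation is immaterial. This removes the order i < r from \<open>Tsum\<close>.\<close>

definition pair_term :: "nat set \<Rightarrow> 'b" where
  "pair_term P = perm_op (SOME p. p permutes {1..N} \<and> p ` P = {1, 2}) (VI a)"

lemma pair_term_eq:
  assumes p: "p permutes {1..N}" "p ` P = {1, 2}"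
  shows "perm_op p (VI a) = pair_term P"
proof -
  let ?q = "SOME p. p permutes {1..N} \<and> p ` P = {1, 2}"
  have "?q permutes {1..N} \<and> ?q ` P = {1, 2}" by (rule someI[of _ p]) (simp add: p)
  then show ?thesis unfolding pair_term_def by (intro perm_op_VI_eq[OF p(1) _ p(2)]) auto
qed

lemma Tir_pair_term:
  assumes ir: "1 \<le> i" "i < r" "r \<le> N" and p: "p permutes {1..N}"
  shows "perm_op p (Tir S N i r a) = pair_term (inv p ` {i, r})" "Tir S N i r a = pair_term {i, r}"
proof -
  have irN: "i \<in> {1..N}" "r \<in> {1..N}" using ir by auto
  have inv: "oconj S N 2 r (oconj S N 1 i a) = a"
  proof -
    have "oconj S N 1 i a = a" "oconj S N 2 r a = a"
      using a(2) slots12 irN by (simp_all only: symmetric_elt_def)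
    then show ?thesis by simp
  qed
  have rho: "rho i r = slot_swap 2 r \<circ> slot_swap 1 i" by (rule ext) (simp add: rho_def)
  note p1 = permutes_swap_id[OF slots12(1) irN(1)] and p2 = permutes_swap_id[OF slots12(2) irN(2)]
  have rp: "rho i r permutes {1..N}" unfolding rho by (rule permutes_compose[OF p1 p2])
  have T: "Tir S N i r a = perm_op (rho i r) (VI a)"
    unfolding Tir_def inv rho using perm_op_compose[OF p2 p1 VI_a_in] perm_op_swap[OF slots12(2) irN(2) VI_a_in]
      perm_op_swap[OF slots12(1) irN(1) oconj_in[OF slots12(2) irN(2) VI_a_in]] by simp
  have im: "rho i r ` {i, r} = {1, 2}" using rho_simps(1,2)[OF ir(1,2)] by simp
  show "Tir S N i r a = pair_term {i, r}" unfolding T by (rule pair_term_eq[OF rp im])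
  have "perm_op p (Tir S N i r a) = perm_op (rho i r \<circ> p) (VI a)"
    unfolding T by (rule perm_op_compose[OF rp p VI_a_in])
  also have "\<dots> = pair_term (inv p ` {i, r})"
  proof (rule pair_term_eq[OF permutes_compose[OF p rp]])
    have "(rho i r \<circ> p) ` inv p ` {i, r} = rho i r ` {i, r}"
      by (simp add: permutes_inverses(1)[OF p])
    then show "(rho i r \<circ> p) ` inv p ` {i, r} = {1, 2}" using im by simp
  qed
  finally show "perm_op p (Tir S N i r a) = pair_term (inv p ` {i, r})" .
qed

lemma sum_pairs:
  "(\<Sum>r\<in>{1..N}. \<Sum>i\<in>{1..<r}. g {i, r}) = (\<Sum>P | P \<subseteq> {1..N} \<and> card P = 2. (g P :: 'b))"
proof -
  have "(\<Sum>r\<in>{1..N}. \<Sum>i\<in>{1..<r}. g {i, r}) = (\<Sum>(r, i)\<in>(SIGMA r:{1..N}. {1..<r}). g {i, r})"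
    by (rule sum.Sigma) auto
  also have "\<dots> = (\<Sum>x\<in>(SIGMA r:{1..N}. {1..<r}). g ((\<lambda>(r, i). {i, r}) x))"
    by (rule sum.cong) auto
  also have "\<dots> = (\<Sum>P | P \<subseteq> {1..N} \<and> card P = 2. g P)"
  proof (rule sum.reindex_bij_betw, unfold bij_betw_def, intro conjI)
    show "inj_on (\<lambda>(r, i). {i, r}) (SIGMA r:{1..N}. {1..<r})"
      by (auto simp: inj_on_def doubleton_eq_iff)
    show "(\<lambda>(r, i). {i, r}) ` (SIGMA r:{1..N}. {1..<r}) = {P. P \<subseteq> {1..N} \<and> card P = 2}"
    proof
      show "(\<lambda>(r, i). {i, r}) ` (SIGMA r:{1..N}. {1..<r}) \<subseteq> {P. P \<subseteq> {1..N} \<and> card P = 2}" by auto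
      show "{P. P \<subseteq> {1..N} \<and> card P = 2} \<subseteq> (\<lambda>(r, i). {i, r}) ` (SIGMA r:{1..N}. {1..<r})"
      proof
        fix P assume P: "P \<in> {P. P \<subseteq> {1..N} \<and> card P = 2}"
        then obtain x y where xy: "P = {x, y}" "x \<noteq> y" by (auto simp: card_2_iff)
        then have "P = {min x y, max x y}" "min x y < max x y" "min x y \<in> {1..N}" "max x y \<in> {1..N}"
          using P by (auto simp: min_def max_def)
        then show "P \<in> (\<lambda>(r, i). {i, r}) ` (SIGMA r:{1..N}. {1..<r})"
          by (intro image_eqI[of _ _ "(max x y, min x y)"]) auto
      qed
    qed
  qed
  finally show ?thesis .
qed

text \<open>Written over unordered pairs, the sum is only reindexed by a permutation.\<close>

lemma Tsum_symmetric:
  assumes p: "p permutes {1..N}"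
  shows "perm_op p (Tsum S N a) = Tsum S N a"
proof -
  let ?P = "{P. P \<subseteq> {1..N} \<and> card P = 2}"
  have ip: "inv p permutes {1..N}" by (rule permutes_inv[OF p])
  note lin = bounded_clinear_onD(1)[OF perm_op(1)[OF p]]
  have Tin: "Tir S N i r a \<in> X" if "r \<in> {1..N}" "i \<in> {1..<r}" for i r
    using that by (intro Tir_in a(1)) auto
  have "perm_op p (Tsum S N a) = (\<Sum>r\<in>{1..N}. perm_op p (\<Sum>i\<in>{1..<r}. Tir S N i r a))"
    unfolding Tsum_def by (rule clinear_on_sum[OF lin X]) (rule closed_csubspace_sum[OF X Tin])
  also have "\<dots> = (\<Sum>r\<in>{1..N}. \<Sum>i\<in>{1..<r}. perm_op p (Tir S N i r a))"
    by (rule sum.cong[OF refl], rule clinear_on_sum[OF lin X]) (rule Tin)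
  also have "\<dots> = (\<Sum>r\<in>{1..N}. \<Sum>i\<in>{1..<r}. pair_term (inv p ` {i, r}))"
    by (intro sum.cong[OF refl] Tir_pair_term(1)[OF _ _ _ p]) auto
  also have "\<dots> = (\<Sum>P\<in>?P. pair_term (inv p ` P))" by (rule sum_pairs)
  also have "\<dots> = (\<Sum>P\<in>?P. pair_term P)"
  proof (rule sum.reindex_bij_betw, rule bij_betw_byWitness[where f' = "\<lambda>P. p ` P"])
    show "\<forall>P\<in>?P. p ` inv p ` P = P" by (simp add: image_image permutes_inverses(1)[OF p])
    show "\<forall>P\<in>?P. inv p ` p ` P = P" by (simp add: image_image permutes_inverses(2)[OF p])
    have im: "q ` P \<subseteq> {1..N} \<and> card (q ` P) = 2" if "q permutes {1..N}" "P \<in> ?P" for q P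
    proof
      show "q ` P \<subseteq> {1..N}" using that(2) permutes_image[OF that(1)] by blast
      show "card (q ` P) = 2" using that(2) card_image[OF permutes_inj_on[OF that(1)], of P] by simp
    qed
    show "image (inv p) ` ?P \<subseteq> ?P" using im[OF ip] by auto
    show "image p ` ?P \<subseteq> ?P" using im[OF p] by auto
  qed
  also have "\<dots> = (\<Sum>r\<in>{1..N}. \<Sum>i\<in>{1..<r}. pair_term {i, r})" by (rule sum_pairs[symmetric])
  also have "\<dots> = Tsum S N a"
    unfolding Tsum_def by (intro sum.cong[OF refl] Tir_pair_term(2)[OF _ _ _ p, symmetric]) auto
  finally show ?thesis .
qed

end

end

section \<open>Comparison of continuous functions\<close>

text \<open>At the first time where some member of the family is not positive, all members are still
  nonnegative by continuity, which \<open>step\<close> contradicts. Finiteness of \<open>K\<close>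
  makes the set of such times closed, so its infimum is attained.\<close>

lemma first_crossing:
  fixes d :: "'k \<Rightarrow> real \<Rightarrow> real"
  assumes K: "finite K" and cont: "\<And>k. k \<in> K \<Longrightarrow> continuous_on {0..} (d k)"
    and 0: "\<And>k. k \<in> K \<Longrightarrow> d k 0 > 0"
    and step: "\<And>t k. t > 0 \<Longrightarrow> k \<in> K \<Longrightarrow> (\<And>s k. 0 \<le> s \<Longrightarrow> s \<le> t \<Longrightarrow> k \<in> K \<Longrightarrow> d k s \<ge> 0) \<Longrightarrow> d k t > 0"
    and t: "t \<ge> 0" "k \<in> K"
  shows "d k t > 0"
proof (rule ccontr)
  assume neg: "\<not> d k t > 0"
  define B where "B = (\<Union>k\<in>K. {s \<in> {0..}. d k s \<le> 0})"
  have "closed {s \<in> {0..}. d k s \<le> 0}" if "k \<in> K" for k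
  proof -
    have "closed ({0..} \<inter> d k -` {..0})"
      by (rule continuous_closed_preimage[OF cont[OF that]]) auto
    moreover have "{0..} \<inter> d k -` {..0} = {s \<in> {0..}. d k s \<le> 0}" by auto
    ultimately show ?thesis by simp
  qed
  then have closed: "closed B" unfolding B_def by (intro closed_UN K) auto
  have ne: "B \<noteq> {}" using neg t by (auto simp: B_def not_less)
  have bdd: "bdd_below B" by (auto simp: B_def intro!: bdd_belowI[of _ 0])
  define \<tau> where "\<tau> = Inf B"
  have \<tau>B: "\<tau> \<in> B" unfolding \<tau>_def by (rule closed_contains_Inf[OF ne bdd closed])
  then obtain m where m: "m \<in> K" "\<tau> \<ge> 0" "d m \<tau> \<le> 0" by (auto simp: B_def)
  have \<tau>0: "\<tau> > 0"
    using m 0[OF m(1)] by (cases "\<tau> = 0") auto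
  have before: "d k s > 0" if "0 \<le> s" "s < \<tau>" "k \<in> K" for s k
  proof (rule ccontr)
    assume "\<not> d k s > 0"
    then have "s \<in> B" using that by (auto simp: B_def not_less)
    then have "\<tau> \<le> s" unfolding \<tau>_def by (rule cInf_lower[OF _ bdd])
    then show False using that by simp
  qed
  have at: "d k \<tau> \<ge> 0" if k: "k \<in> K" for k
  proof -
    have "continuous_on {0..\<tau>} (d k)" using cont[OF k] by (rule continuous_on_subset) auto
    then have "(d k \<longlongrightarrow> d k \<tau>) (at_left \<tau>)" by (rule continuous_on_Icc_at_leftD[OF _ \<tau>0])
    moreover have "\<forall>\<^sub>F s in at_left \<tau>. d k s \<ge> 0"
      using eventually_at_left_real[OF \<tau>0] by eventually_elim (use before[OF _ _ k] in \<open>auto intro: less_imp_le\<close>)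
    ultimately show ?thesis by (intro tendsto_lowerbound[of "d k" "d k \<tau>"]) auto
  qed
  have "d m \<tau> > 0"
  proof (rule step[OF \<tau>0 m(1)])
    fix s k assume "0 \<le> s" "s \<le> \<tau>" "k \<in> K"
    then show "d k s \<ge> 0" using before[of s k] at[of k] by (cases "s = \<tau>") auto
  qed
  then show False using m by simp
qed

lemma integral_le_increment:
  fixes \<gamma> m m' :: "real \<Rightarrow> real"
  assumes t: "0 \<le> t" and \<gamma>: "continuous_on {0..t} \<gamma>"
    and m: "\<And>s. 0 \<le> s \<Longrightarrow> s \<le> t \<Longrightarrow> (m has_real_derivative m' s) (at s)"
    and le: "\<And>s. 0 \<le> s \<Longrightarrow> s \<le> t \<Longrightarrow> \<gamma> s \<le> m' s"
  shows "integral {0..t} \<gamma> \<le> m t - m 0"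
proof (rule has_integral_le)
  show "(\<gamma> has_integral integral {0..t} \<gamma>) {0..t}"
    using \<gamma> by (simp add: integrable_continuous_interval integrable_integral)
  show "(m' has_integral m t - m 0) {0..t}"
  proof (rule fundamental_theorem_of_calculus[OF t])
    fix s assume "s \<in> {0..t}"
    then show "(m has_vector_derivative m' s) (at s within {0..t})"
      using m[of s] by (auto simp: has_real_derivative_iff_has_vector_derivative intro: has_vector_derivative_at_within)
  qed
qed (use le in auto)

text \<open>With slack e the function (b + e) exp (C t) starts above \<phi> and is never reached,
  because its increments dominate the integral; then e tends to 0.\<close>

lemma gronwall:
  fixes \<phi> :: "real \<Rightarrow> real"
  assumes \<phi>: "continuous_on {0..} \<phi>" and C: "C \<ge> 0" and b: "b \<ge> 0"
    and le: "\<And>t. t \<ge> 0 \<Longrightarrow> \<phi> t \<le> b + integral {0..t} (\<lambda>s. C * \<phi> s)" and t: "t \<ge> 0"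
  shows "\<phi> t \<le> b * exp (C * t)"
proof -
  have "\<phi> t \<le> (b + e) * exp (C * t)" if e: "e > 0" for e
  proof -
    define m where "m t = (b + e) * exp (C * t)" for t
    have "m t - \<phi> t > 0"
    proof (rule first_crossing[of "{()}" "\<lambda>_ t. m t - \<phi> t" t "()"])
      show "continuous_on {0..} (\<lambda>t. m t - \<phi> t)" unfolding m_def by (intro continuous_intros \<phi>)
      show "m 0 - \<phi> 0 > 0" using le[of 0] e by (simp add: m_def)
      fix t :: real assume t: "t > 0" and pos: "\<And>s k. 0 \<le> s \<Longrightarrow> s \<le> t \<Longrightarrow> k \<in> {()} \<Longrightarrow> m s - \<phi> s \<ge> 0"
      have "integral {0..t} (\<lambda>s. C * \<phi> s) \<le> m t - m 0"
      proof (rule integral_le_increment[where m' = "\<lambda>s. C * m s"])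
        show "continuous_on {0..t} (\<lambda>s. C * \<phi> s)"
          by (intro continuous_intros continuous_on_subset[OF \<phi>]) auto
        show "(m has_real_derivative C * m s) (at s)" for s
          unfolding m_def by (auto intro!: derivative_eq_intros)
        show "C * \<phi> s \<le> C * m s" if "0 \<le> s" "s \<le> t" for s
          using pos[OF that] C by (intro mult_left_mono) auto
      qed (use t in simp)
      then show "m t - \<phi> t > 0" using le[of t] t e by (simp add: m_def)
    qed (use t in auto)
    then show ?thesis by (simp add: m_def)
  qed
  then have lim: "\<forall>\<^sub>F e in at_right 0. \<phi> t \<le> (b + e) * exp (C * t)"
    using eventually_at_right_less[of "0::real"] by (auto elim: eventually_mono)
  have "((\<lambda>e. (b + e) * exp (C * t)) \<longlongrightarrow> (b + 0) * exp (C * t)) (at_right 0)"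
    by (intro tendsto_intros)
  then have "\<phi> t \<le> (b + 0) * exp (C * t)"
    using lim by (rule tendsto_lowerbound) simp
  then show ?thesis by simp
qed

section \<open>Propagation of symmetry\<close>

context mean_field_system
begin

lemma flow_contraction: "j \<in> {1..N} \<Longrightarrow> contraction_semigroup (compl S j) (flow S N j)"
proof
  assume j: "j \<in> {1..N}"
  have j1: "j \<ge> 1" using j by simp
  show "closed_csubspace (compl S j)" by (rule compl[OF j1])
  show "c0_semigroup (compl S j) (flow S N j)" by (rule flow_semigroup[OF j])
  fix t x assume t: "(t::real) \<ge> 0" and x: "x \<in> compl S j"
  have "bounded_clinear_on (compl S j) (compl S j) (flow S N j t)"
    using flow_semigroup[OF j] t by (simp add: c0_semigroup_def)
  from onorm_on_bound[OF this compl[OF j1] x] show "norm (flow S N j t x) \<le> norm x"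
    using flow_norm[OF j t] by simp
qed

lemma K0_contraction: "contraction_semigroup (compl S 1) (expK0 S)"
  by unfold_locales (use compl K0_semigroup K0_isometric in \<open>auto simp: isometric_on_def\<close>)

end

context large_system
begin

sublocale UN: contraction_semigroup X "flow S N N"
  by (rule flow_contraction[OF NN])

sublocale U1: contraction_semigroup X1 "expK0 S"
  by (rule K0_contraction)

abbreviation perms :: "(nat \<Rightarrow> nat) set" where "perms \<equiv> {p. p permutes {1..N}}"

definition symmetrize :: "'b \<Rightarrow> 'b" where
  "symmetrize a = (\<Sum>p\<in>perms. perm_op p a) /\<^sub>R real (card perms)"

lemma card_perms: "card perms > 0"
proof -
  have "finite perms" by (rule finite_permutations) simp
  moreover have "id \<in> perms" using permutes_id by simp
  ultimately show ?thesis unfolding card_gt_0_iff by blast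
qed

lemma symmetrize_bounded: "bounded_clinear_on X X symmetrize"
  unfolding symmetrize_def by (intro bounded_clinear_on_scaleR bounded_clinear_on_sum X perm_op(1)) simp

lemma symmetrize_in: "a \<in> X \<Longrightarrow> symmetrize a \<in> X"
  by (rule bounded_clinear_onD(2)[OF symmetrize_bounded])

lemma symmetrize_fixed:
  assumes "\<And>p. p permutes {1..N} \<Longrightarrow> perm_op p a = a"
  shows "symmetrize a = a"
proof -
  have "(\<Sum>p\<in>perms. perm_op p a) = (\<Sum>p\<in>perms. a)" by (rule sum.cong) (use assms in auto)
  then show ?thesis using card_perms by (simp add: symmetrize_def sum_constant_scaleR)
qed

lemma symmetric_symmetrize:
  assumes a: "a \<in> X"
  shows "symmetric_elt S N (symmetrize a)"
  unfolding symmetric_elt_def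
proof (intro ballI)
  fix k s assume ks: "k \<in> {1..N}" "s \<in> {1..N}"
  let ?t = "slot_swap k s"
  have t: "?t permutes {1..N}" by (rule permutes_swap_id[OF ks])
  have pin: "perm_op p a \<in> X" if "p \<in> perms" for p using perm_op_in[OF _ a] that by simp
  note lin = oconj_clinear[OF ks]
  have sum_in: "(\<Sum>p\<in>perms. perm_op p a) \<in> X"
    by (rule closed_csubspace_sum[OF X]) (rule pin)
  have "oconj S N k s (\<Sum>p\<in>perms. perm_op p a) = (\<Sum>p\<in>perms. oconj S N k s (perm_op p a))"
    by (rule clinear_on_sum[OF lin X]) (rule pin)
  then have "oconj S N k s (symmetrize a) = (\<Sum>p\<in>perms. oconj S N k s (perm_op p a)) /\<^sub>R real (card perms)"
    unfolding symmetrize_def clinear_on_scaleR[OF lin sum_in] by simp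
  also have "(\<Sum>p\<in>perms. oconj S N k s (perm_op p a)) = (\<Sum>p\<in>perms. perm_op (p \<circ> ?t) a)"
    by (rule sum.cong[OF refl]) (use perm_op_compose[OF _ t a] perm_op_swap[OF ks pin] in simp)
  also have "\<dots> = (\<Sum>p\<in>perms. perm_op p a)"
  proof (rule sum.reindex_bij_betw, rule bij_betw_byWitness[where f' = "\<lambda>p. p \<circ> ?t"])
    show "\<forall>p\<in>perms. (p \<circ> ?t) \<circ> ?t = p" by (simp add: comp_assoc)
    show "\<forall>p\<in>perms. (p \<circ> ?t) \<circ> ?t = p" by (simp add: comp_assoc)
    show "(\<lambda>p. p \<circ> ?t) ` perms \<subseteq> perms" "(\<lambda>p. p \<circ> ?t) ` perms \<subseteq> perms"
      using permutes_compose[OF t] by auto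
  qed
  finally show "oconj S N k s (symmetrize a) = symmetrize a" by (simp add: symmetrize_def)
qed

lemma symmetrize_T:
  assumes a: "a \<in> X"
  shows "symmetrize (Tsum S N (symmetrize a)) = Tsum S N (symmetrize a)"
  by (rule symmetrize_fixed) (rule Tsum_symmetric[OF symmetrize_in[OF a] symmetric_symmetrize[OF a]])

lemma T_in: "a \<in> X \<Longrightarrow> Tsum S N a \<in> X"
  by (rule bounded_clinear_onD(2)[OF Tsum_bounded[OF N1]])

lemma K0_graph_symmetrize:
  assumes "(x, y) \<in> K0_graph S N"
  shows "(symmetrize x, symmetrize y) \<in> K0_graph S N"
proof -
  have "(\<Sum>p\<in>perms. perm_op p x, \<Sum>p\<in>perms. perm_op p y) \<in> K0_graph S N"
    by (rule K0_graph_sum) (use K0_graph_perm[OF _ assms] in simp)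
  from closed_csubspaceD(6)[OF K0_graph_csubspace this]
  show ?thesis by (simp add: symmetrize_def scaleR_prod_def)
qed

lemma generator_N: "generator X (flow S N N) = hamiltonian_graph S N N"
  by (rule flow_generates[OF NN])

lemma hamiltonian_graphE:
  assumes "(x, y) \<in> hamiltonian_graph S N j"
  shows "(x, y - Tsum S j x /\<^sub>R real N) \<in> K0_graph S j"
  using assms by (auto simp: hamiltonian_graph_def)

lemma hamiltonian_graphI:
  assumes "(x, y) \<in> K0_graph S j"
  shows "(x, y + Tsum S j x /\<^sub>R real N) \<in> hamiltonian_graph S N j"
  using assms by (auto simp: hamiltonian_graph_def)

lemma bounded_right_derivative:
  assumes L: "bounded_clinear_on Y Z L" "closed_csubspace Y" and u: "\<And>s. s \<ge> t \<Longrightarrow> u s \<in> Y"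
    and d: "has_right_derivative u t d"
  shows "d \<in> Y" "has_right_derivative (\<lambda>s. L (u s)) t (L d)"
proof -
  have ev: "\<forall>\<^sub>F h in at_right 0. (u (t + h) - u t) /\<^sub>R h \<in> Y"
    using eventually_at_right_less[of "0::real"]
    by eventually_elim (intro closed_csubspaceD(4,6)[OF L(2)] u, auto)
  show dY: "d \<in> Y"
    using d ev unfolding has_right_derivative_def
    by (intro Lim_in_closed_set[OF closed_csubspaceD(7)[OF L(2)], where F = "at_right (0::real)"]) auto
  have "((\<lambda>h. L ((u (t + h) - u t) /\<^sub>R h)) \<longlongrightarrow> L d) (at_right 0)"
    using d unfolding has_right_derivative_def by (rule bounded_clinear_on_tendsto[OF L _ ev dY])
  then show "has_right_derivative (\<lambda>s. L (u s)) t (L d)"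
    unfolding has_right_derivative_def
  proof (rule Lim_transform_eventually)
    show "\<forall>\<^sub>F h in at_right 0. L ((u (t + h) - u t) /\<^sub>R h) = (L (u (t + h)) - L (u t)) /\<^sub>R h"
      using eventually_at_right_less[of "0::real"]
      by eventually_elim
        (simp add: clinear_on_scaleR[OF bounded_clinear_onD(1)[OF L(1)]] clinear_on_diff[OF bounded_clinear_onD(1)[OF L(1)] L(2)]
          u closed_csubspaceD(4)[OF L(2)])
  qed
qed

text \<open>A permuted solution is not known to be a solution, as the interaction commutes with
  permutations on symmetric elements only. Let D = 1 - Sym. From Sym T Sym = T Sym and the symmetry
  of the free part, D u solves the equation with source - Sym T D u / N, which is bounded by a
  multiple of norm (D u); since D a = 0, Gronwall gives D u = 0. Averages of a come first, so that
  the orbit lies in the domain.\<close>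

lemma flow_symmetric:
  assumes a: "a \<in> X" "symmetric_elt S N a" and t: "t \<ge> 0"
  shows "symmetric_elt S N (flow S N N t a)"
proof -
  let ?U = "flow S N N" and ?T = "Tsum S N"
  define D where "D b = b - symmetrize b" for b
  have D: "bounded_clinear_on X X D"
    unfolding D_def by (rule bounded_clinear_on_diff[OF bounded_clinear_on_id symmetrize_bounded X])
  note D_in = bounded_clinear_onD(2)[OF D] and sym_lin = bounded_clinear_onD(1)[OF symmetrize_bounded]
  have Tlin: "clinear_on X ?T" by (rule bounded_clinear_onD(1)[OF Tsum_bounded[OF N1]])
  have "bounded_clinear_on X X (\<lambda>b. symmetrize (?T b))"
    by (rule bounded_clinear_on_compose[OF Tsum_bounded[OF N1] symmetrize_bounded])
  then obtain C0 where C0: "\<forall>b\<in>X. norm (symmetrize (?T b)) \<le> C0 * norm b"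
    using bounded_clinear_onD(3) by blast
  define C where "C = \<bar>C0\<bar>"
  have C: "norm (symmetrize (?T b) /\<^sub>R real N) \<le> C * norm b" if "b \<in> X" for b
  proof -
    have "norm (symmetrize (?T b)) \<le> C * norm b"
      unfolding C_def by (rule order_trans[OF bspec[OF C0 that]]) (intro mult_right_mono, auto)
    moreover have "norm (symmetrize (?T b) /\<^sub>R real N) \<le> norm (symmetrize (?T b))"
      using N1 mult_right_mono[of 1 "real N" "norm (symmetrize (?T b))"] by (simp add: field_simps)
    ultimately show ?thesis by linarith
  qed
  have bound: "norm (D (?U t (UN.avg h a))) \<le> norm (D (UN.avg h a)) * exp (C * t)" if h: "h > 0" for h
  proof -
    let ?x = "UN.avg h a"
    define u where "u s = ?U s ?x" for s
    define y where "y = (?U h a - a) /\<^sub>R h"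
    note gen = UN.avg_generator[OF a(1) h, folded y_def]
    have x: "?x \<in> X" by (rule UN.avg_in[OF a(1)])
    have uX: "u s \<in> X" if "s \<ge> 0" for s unfolding u_def by (rule UN.U_in[OF that x])
    have ucont: "continuous_on {0..} u" unfolding u_def by (rule UN.U_cont[OF x])
    have Dcont: "continuous_on {0..} (\<lambda>s. D (u s))"
      by (rule continuous_on_compose2[OF bounded_clinear_on_continuous[OF D X] ucont]) (use uX in auto)
    have "norm (D (u t)) \<le> norm (D (u 0)) * exp (C * t)"
    proof (rule gronwall[OF continuous_on_norm[OF Dcont] _ norm_ge_zero _ t])
      show "C \<ge> 0" by (simp add: C_def)
      fix T :: real assume T: "T \<ge> 0"
      show "norm (D (u T)) \<le> norm (D (u 0)) + integral {0..T} (\<lambda>s. C * norm (D (u s)))"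
      proof (rule UN.duhamel_norm_bound[OF T, where y = "\<lambda>s. D (?U s y)" and g = "\<lambda>s. - (symmetrize (?T (D (u s))) /\<^sub>R real N)"])
        show "continuous_on {0..T} (\<lambda>s. D (u s))" by (rule continuous_on_subset[OF Dcont]) auto
        show "D (u T) \<in> X" by (rule D_in[OF uX[OF T]])
        show "continuous_on {0..T} (\<lambda>s. C * norm (D (u s)))"
          by (intro continuous_intros continuous_on_subset[OF Dcont]) auto
        fix s assume s: "0 \<le> s" "s < T"
        note orb = UN.orbit_right_derivative[OF gen s(1), folded u_def]
        have "has_right_derivative u s (?U s y)" using orb(1) by (simp add: u_def[abs_def])
        then show "has_right_derivative (\<lambda>s. D (u s)) s (D (?U s y))"
          using bounded_right_derivative(2)[OF D X, of s u] uX s(1) by simp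
        define z where "z = ?U s y - ?T (u s) /\<^sub>R real N"
        have "(u s, z) \<in> K0_graph S N"
          unfolding z_def using orb(2) hamiltonian_graphE unfolding generator_N by blast
        then have "(D (u s), z - symmetrize z) \<in> K0_graph S N"
          unfolding D_def by (intro K0_graph_diff K0_graph_symmetrize)
        then have "(D (u s), z - symmetrize z + ?T (D (u s)) /\<^sub>R real N) \<in> generator X ?U"
          unfolding generator_N by (rule hamiltonian_graphI)
        moreover have "z - symmetrize z + ?T (D (u s)) /\<^sub>R real N = D (?U s y) - - (symmetrize (?T (D (u s))) /\<^sub>R real N)"
        proof -
          have us: "u s \<in> X" "symmetrize (u s) \<in> X" "?T (u s) \<in> X" "?U s y \<in> X" "?T (symmetrize (u s)) \<in> X"
            using uX[OF s(1)] symmetrize_in T_in UN.generator_in(2)[OF orb(2)] by (auto simp: u_def)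
          have "symmetrize z = symmetrize (?U s y) - symmetrize (?T (u s)) /\<^sub>R real N"
            unfolding z_def using us
            by (simp add: clinear_on_diff[OF sym_lin X] clinear_on_scaleR[OF sym_lin] closed_csubspaceD(6)[OF X])
          moreover have "?T (D (u s)) = ?T (u s) - ?T (symmetrize (u s))"
            unfolding D_def by (rule clinear_on_diff[OF Tlin X us(1,2)])
          moreover from this have "symmetrize (?T (D (u s))) = symmetrize (?T (u s)) - ?T (symmetrize (u s))"
            using clinear_on_diff[OF sym_lin X us(3,5)] symmetrize_T[OF us(1)] by simp
          ultimately show ?thesis by (simp add: z_def D_def scaleR_diff_right)
        qed
        ultimately show "(D (u s), D (?U s y) - - (symmetrize (?T (D (u s))) /\<^sub>R real N)) \<in> generator X ?U" by simp
        show "norm (- (symmetrize (?T (D (u s))) /\<^sub>R real N)) \<le> C * norm (D (u s))"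
          using C[OF D_in[OF uX[OF s(1)]]] by simp
      qed
    qed
    then show ?thesis using UN.U_zero[OF x] by (simp add: u_def)
  qed
  have lim: "((\<lambda>h. UN.avg h a) \<longlongrightarrow> a) (at_right 0)" by (rule UN.avg_tendsto[OF a(1)])
  have ev: "\<forall>\<^sub>F h in at_right 0. UN.avg h a \<in> X" using UN.avg_in[OF a(1)] by simp
  have l1: "((\<lambda>h. norm (D (?U t (UN.avg h a)))) \<longlongrightarrow> norm (D (?U t a))) (at_right 0)"
    by (intro tendsto_norm bounded_clinear_on_tendsto[OF D X] UN.tendsto_U tendsto_const lim ev a UN.U_in t)
      (use UN.avg_in[OF a(1)] UN.U_in[OF t] t in auto)
  have l2: "((\<lambda>h. norm (D (UN.avg h a)) * exp (C * t)) \<longlongrightarrow> norm (D a) * exp (C * t)) (at_right 0)"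
    by (intro tendsto_mult tendsto_norm bounded_clinear_on_tendsto[OF D X] tendsto_const lim ev a)
  have "norm (D (?U t a)) \<le> norm (D a) * exp (C * t)"
    by (rule tendsto_le[OF _ l2 l1]) (use bound eventually_at_right_less[of "0::real"] in \<open>auto elim: eventually_mono\<close>)
  moreover have "D a = 0" unfolding D_def using symmetrize_fixed[of a] perm_op(4)[OF _ a] by simp
  ultimately have "D (?U t a) = 0" by simp
  then have "?U t a = symmetrize (?U t a)" by (simp add: D_def)
  then show ?thesis using symmetric_symmetrize[OF UN.U_in[OF t a(1)]] by simp
qed

section \<open>The drift of the correlation errors\<close>

text \<open>\<open>qs f m\<close> is \<open>(1 - P\<^sub>1) \<dots> (1 - P\<^sub>m)\<close>; if \<open>x' = K\<^sub>0 x + z\<close> and \<open>f' = K\<^sub>0 f + g\<close>, then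
  \<open>qs f m x\<close> solves the same equation with the source \<open>zs f g x z m\<close>.\<close>

primrec qs :: "'b \<Rightarrow> nat \<Rightarrow> 'b \<Rightarrow> 'b" where
  "qs f 0 x = x"
| "qs f (Suc m) x = qs f m x - ins f (Suc m) (qs f m x)"

primrec zs :: "'b \<Rightarrow> 'b \<Rightarrow> 'b \<Rightarrow> 'b \<Rightarrow> nat \<Rightarrow> 'b" where
  "zs f g x z 0 = z"
| "zs f g x z (Suc m) = zs f g x z m - ins f (Suc m) (zs f g x z m) - ins g (Suc m) (qs f m x)"

lemma qs_in: "f \<in> X1 \<Longrightarrow> x \<in> X \<Longrightarrow> m \<le> N \<Longrightarrow> qs f m x \<in> X"
  by (induction m) (auto intro!: closed_csubspaceD(4)[OF X] ins_in)

lemma zs_in: "f \<in> X1 \<Longrightarrow> g \<in> X1 \<Longrightarrow> x \<in> X \<Longrightarrow> z \<in> X \<Longrightarrow> m \<le> N \<Longrightarrow> zs f g x z m \<in> X"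
  by (induction m) (auto intro!: closed_csubspaceD(4)[OF X] ins_in)

lemma qs_eq_sops: "f \<in> X1 \<Longrightarrow> m \<le> N \<Longrightarrow> qs f m x = sops f (\<lambda>_. 2) {1..m} x"
proof (induction m)
  case (Suc m)
  have "{1..Suc m} = insert (Suc m) {1..m}" by auto
  moreover have "sops f (\<lambda>_. 2) (insert (Suc m) {1..m}) x = slot f (\<lambda>_. 2) (Suc m) (sops f (\<lambda>_. 2) {1..m} x)"
    by (rule sops_insert) (use Suc in auto)
  ultimately show ?case using Suc by (simp add: slot_def)
qed simp

text \<open>Unfolds the recursion: z passes through all factors 1 - P, and for each i the derivative
  of P_i removes the factor of slot i and inserts g there.\<close>

lemma zs_eq:
  assumes f: "f \<in> X1" and g: "g \<in> X1" and x: "x \<in> X" and z: "z \<in> X"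
  shows "m \<le> N \<Longrightarrow> zs f g x z m
    = qs f m z - (\<Sum>i\<in>{1..m}. ins g i (sops f (\<lambda>l. if l = i then 0 else 2) {1..m} x))"
proof (induction m)
  case 0
  then show ?case by simp
next
  case (Suc m)
  let ?c = "\<lambda>i l. if l = i then 0 else (2::nat)"
  let ?s = "\<lambda>i m. sops f (?c i) {1..m} x"
  have mN: "Suc m \<in> {1..N}" "m \<le> N" and sub: "{1..m} \<subseteq> {1..N}" "insert (Suc m) {1..m} \<subseteq> {1..N}"
    using Suc.prems by auto
  have ins1: "{1..Suc m} = insert (Suc m) {1..m}" by auto
  have s: "?s i m \<in> X" for i by (rule sops_in[OF sub(1) f x])
  have t: "ins g i (?s i m) \<in> X" if "i \<in> {1..m}" for i by (rule ins_in[OF _ g]) (use that sub in auto)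
  note q = qs_in[OF f z mN(2)] qs_in[OF f x mN(2)]
  have sumin: "(\<Sum>i\<in>{1..m}. ins g i (?s i m)) \<in> X" by (rule closed_csubspace_sum[OF X]) (rule t)
  have step: "ins g i (?s i m) - ins f (Suc m) (ins g i (?s i m)) = ins g i (?s i (Suc m))" if i: "i \<in> {1..m}" for i
  proof -
    have iN: "i \<in> {1..N}" "i \<noteq> Suc m" using i sub by auto
    have "?s i (Suc m) = ?s i m - ins f (Suc m) (?s i m)"
      unfolding ins1 using sops_insert[OF f sub(2), of "?c i" x] iN(2) by (simp add: slot_def)
    then have "ins g i (?s i (Suc m)) = ins g i (?s i m) - ins g i (ins f (Suc m) (?s i m))"
      using ins_diff[OF iN(1) g s ins_in[OF mN(1) f]] by simp
    then show ?thesis using ins_commute[OF iN(1) mN(1) g f iN(2)] by simp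
  qed
  have last: "?s (Suc m) (Suc m) = qs f m x"
  proof -
    have "?s (Suc m) (Suc m) = ?s (Suc m) m"
      unfolding ins1 using sops_insert[OF f sub(2), of "?c (Suc m)" x] by (simp add: slot_def)
    also have "\<dots> = sops f (\<lambda>_. 2) {1..m} x" by (rule sops_cong[OF sub(1) f x]) auto
    finally show ?thesis using qs_eq_sops[OF f mN(2)] by simp
  qed
  have "ins f (Suc m) (\<Sum>i\<in>{1..m}. ins g i (?s i m)) = (\<Sum>i\<in>{1..m}. ins f (Suc m) (ins g i (?s i m)))"
    by (rule clinear_on_sum[OF ins_clinear[OF mN(1) f] X]) (rule t)
  then have "ins f (Suc m) (zs f g x z m) = ins f (Suc m) (qs f m z) - (\<Sum>i\<in>{1..m}. ins f (Suc m) (ins g i (?s i m)))"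
    unfolding Suc.IH[OF mN(2)] using ins_diff[OF mN(1) f q(1) sumin] by simp
  then have "zs f g x z (Suc m) = qs f (Suc m) z
      - (\<Sum>i\<in>{1..m}. ins g i (?s i m) - ins f (Suc m) (ins g i (?s i m))) - ins g (Suc m) (qs f m x)"
    using Suc.IH[OF mN(2)] by (simp add: sum_subtractf)
  also have "(\<Sum>i\<in>{1..m}. ins g i (?s i m) - ins f (Suc m) (ins g i (?s i m))) = (\<Sum>i\<in>{1..m}. ins g i (?s i (Suc m)))"
    by (rule sum.cong[OF refl step])
  finally show ?case using last by (simp add: ins1)
qed

text \<open>The (N - j) j pairs i <= j < r cost 2 (e_{j+1} + 2 e_j) each, and the at most j^2 pairs
  up to j cost 4 (e_j + 2 e_{j-1} + e_{j-2}) each. A further e_j comes from T_j E_j, which the flow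
  already contains, and a further e_{j-1} from the part j/N of the mean-field terms that does not
  cancel. All is divided by N.\<close>

definition drift_bound :: "'b \<Rightarrow> 'b \<Rightarrow> nat \<Rightarrow> real" where
  "drift_bound F a j = normV S *
    ((real N - real j) / real N * (2 * real j * (err F a (j + 1) + 2 * err F a j))
     + (real j)\<^sup>2 / real N * (5 * err F a j + 9 * err F a (j - 1) + 4 * err F a (j - 2)))"

lemma err_nonneg: "err F a j \<ge> 0"
  by (simp add: err_def)

lemma norm_sum_le:
  fixes f :: "'i \<Rightarrow> 'b"
  assumes "\<And>i. i \<in> I \<Longrightarrow> norm (f i) \<le> b" "card I \<le> n" "b \<ge> 0"
  shows "norm (sum f I) \<le> real n * b"
proof -
  have "norm (sum f I) \<le> real (card I) * b" using sum_norm_bound[of I f b] assms(1) by simp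
  also have "\<dots> \<le> real n * b" using assms(2,3) by (intro mult_right_mono) auto
  finally show ?thesis .
qed

lemma drift_le:
  assumes F: "F \<in> X1" "tr F = 1" "norm F = 1" and a: "a \<in> X" "symmetric_elt S N a"
    and j: "1 \<le> j" "j \<le> N"
  shows "norm (marg S j N (zs F (meanQ S F F) a (Tsum S N a /\<^sub>R real N) j)
      - Tsum S j (marg S j N (qs F j a)) /\<^sub>R real N) \<le> drift_bound F a j"
proof -
  let ?v = "normV S" and ?q = "meanQ S F F" and ?M = "marg S j N" and ?s = "sops F (code j) {1..N}"
  let ?e = "err F a"
  note q = meanQ_in[OF F(1) F(1)] and v0 = normV_nonneg
  note lin = bounded_clinear_onD(1)[OF marg_bounded[OF j]]
  have N0: "real N > 0" using N1 by simp
  have sub: "{1..j} \<subseteq> {1..N}" "{j<..N} \<subseteq> {1..N}" "{1..N} = {j<..N} \<union> {1..j}" using j by auto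
  have slin: "clinear_on X ?s" by (rule bounded_clinear_onD(1)[OF sops_bounded[OF order_refl F(1)]])
  have Mqs: "?M (qs F j b) = ?M (?s b)" if "b \<in> X" for b
    using marg_sops_code(1)[OF j F(1,2) that] qs_eq_sops[OF F(1) j(2)] by simp
  define A where "A r i = ?M (?s (Tir S N i r a))" for r i
  define G where "G i = ?M (ins ?q i (sops F ((code j)(i := 0)) {1..N} a))" for i
  have sin: "?s b \<in> X" if "b \<in> X" for b by (rule sops_in[OF order_refl F(1) that])
  have Tin: "Tir S N i r a \<in> X" if "r \<in> {1..N}" "i \<in> {1..<r}" for i r using that by (intro Tir_in a(1)) auto
  have T: "?M (qs F j (Tsum S N a /\<^sub>R real N)) = (\<Sum>r\<in>{1..N}. \<Sum>i\<in>{1..<r}. A r i) /\<^sub>R real N"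
  proof -
    have "?s (Tsum S N a) = (\<Sum>r\<in>{1..N}. \<Sum>i\<in>{1..<r}. ?s (Tir S N i r a))"
      unfolding Tsum_def
      by (subst clinear_on_sum[OF slin X], rule closed_csubspace_sum[OF X], rule Tin, assumption, assumption)
        (intro sum.cong refl clinear_on_sum[OF slin X] Tin)
    then have "?M (?s (Tsum S N a)) = ?M (\<Sum>r\<in>{1..N}. \<Sum>i\<in>{1..<r}. ?s (Tir S N i r a))" by simp
    also have "\<dots> = (\<Sum>r\<in>{1..N}. \<Sum>i\<in>{1..<r}. A r i)"
      unfolding A_def
      by (subst clinear_on_sum[OF lin X], rule closed_csubspace_sum[OF X], rule sin, rule Tin, assumption, assumption)
        (intro sum.cong refl clinear_on_sum[OF lin X] sin Tin)
    finally have "?M (?s (Tsum S N a)) = (\<Sum>r\<in>{1..N}. \<Sum>i\<in>{1..<r}. A r i)" .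
    then show ?thesis
      using Mqs[OF closed_csubspaceD(6)[OF X T_in[OF a(1)]]] T_in[OF a(1)] sin[OF T_in[OF a(1)]]
      by (simp add: clinear_on_scaleR[OF slin] clinear_on_scaleR[OF lin])
  qed
  \<comment> \<open>Filling the slots beyond j with F does not change the marginal and brings the
    term into the form estimated by \<open>err_meanQ\<close>.\<close>
  have Gi: "?M (ins ?q i (sops F (\<lambda>l. if l = i then 0 else 2) {1..j} a)) = G i" if i: "i \<in> {1..j}" for i
  proof -
    have iN: "i \<in> {1..N}" "i \<notin> {j<..N}" using i j by auto
    let ?b = "sops F (\<lambda>l. if l = i then 0 else 2) {1..j} a"
    have b: "?b \<in> X" by (rule sops_in[OF sub(1) F(1) a(1)])
    have b1: "sops F ((code j)(i := 0)) {1..j} a = ?b"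
      by (rule sops_cong[OF sub(1) F(1) a(1)]) (auto simp: code_def)
    have "sops F ((code j)(i := 0)) {1..N} a = sops F ((code j)(i := 0)) {j<..N} ?b"
      unfolding sub(3) b1[symmetric] by (rule sops_Un[OF sub(2,1) _ F(1)]) auto
    then have "ins ?q i (sops F ((code j)(i := 0)) {1..N} a) = sops F ((code j)(i := 0)) {j<..N} (ins ?q i ?b)"
      using ins_sops_commute[OF sub(2) F(1) q b iN(1)] iN(2) by simp
    then show ?thesis
      unfolding G_def
      using marg_sops_1[OF j(1) order_refl F(1,2) ins_in[OF iN(1) q, of ?b], of "(code j)(i := 0)"]
      by (simp add: code_def)
  qed
  have zsum: "?M (zs F ?q a (Tsum S N a /\<^sub>R real N) j) = (\<Sum>r\<in>{1..N}. \<Sum>i\<in>{1..<r}. A r i) /\<^sub>R real N - (\<Sum>i\<in>{1..j}. G i)"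
  proof -
    have t: "ins ?q i (sops F (\<lambda>l. if l = i then 0 else 2) {1..j} a) \<in> X" if "i \<in> {1..j}" for i
      by (rule ins_in[OF _ q]) (use that j in auto)
    have z: "Tsum S N a /\<^sub>R real N \<in> X" by (rule closed_csubspaceD(6)[OF X T_in[OF a(1)]])
    let ?w = "\<lambda>i. ins ?q i (sops F (\<lambda>l. if l = i then 0 else 2) {1..j} a)"
    have w: "(\<Sum>i\<in>{1..j}. ?w i) \<in> X" by (rule closed_csubspace_sum[OF X]) (rule t)
    have "?M (\<Sum>i\<in>{1..j}. ?w i) = (\<Sum>i\<in>{1..j}. ?M (?w i))" by (rule clinear_on_sum[OF lin X]) (rule t)
    also have "\<dots> = (\<Sum>i\<in>{1..j}. G i)" by (rule sum.cong[OF refl Gi])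
    finally show ?thesis
      unfolding zs_eq[OF F(1) q a(1) z j(2)] T[symmetric]
      using clinear_on_diff[OF lin X qs_in[OF F(1) z j(2)] w] by simp
  qed
  \<comment> \<open>For a pair beyond j the factors in the first j slots commute with the
    interaction, and \<open>marg_V\<close> applies to what results.\<close>
  have zero: "A r i = 0" if "j < i" "i < r" "r \<le> N" for r i
  proof -
    have ir: "1 \<le> i" "i < r" "r \<le> N" using that j by auto
    have "?M (?s (Tir S N i r a)) = ?M (sops F (\<lambda>_. 2) {1..j} (Tir S N i r a))"
      by (rule marg_sops_code(1)[OF j F(1,2) Tir_in[OF ir a(1)]])
    also have "sops F (\<lambda>_. 2) {1..j} (Tir S N i r a) = Tir S N i r (sops F (\<lambda>_. 2) {1..j} a)"
      by (rule sops_Tir[OF ir sub(1) F(1) a(1)]) (use that in auto)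
    also have "?M \<dots> = 0" by (rule marg_V[OF j(1) that(1,2,3) sops_in[OF sub(1) F(1) a(1)]])
    finally show ?thesis by (simp add: A_def)
  qed
  \<comment> \<open>\<open>S1\<close> collects the pairs up to j, \<open>S2\<close> the pairs across
    j with their mean-field terms removed, and \<open>S3\<close> these mean-field terms, one for
    each i.\<close>
  define S1 where "S1 = (\<Sum>r\<in>{1..j}. \<Sum>i\<in>{1..<r}. A r i)"
  define S2 where "S2 = (\<Sum>r\<in>{j<..N}. \<Sum>i\<in>{1..j}. A r i - G i)"
  define S3 where "S3 = (\<Sum>i\<in>{1..j}. G i)"
  have "(\<Sum>r\<in>{1..N}. \<Sum>i\<in>{1..<r}. A r i) = S1 + (\<Sum>r\<in>{j<..N}. \<Sum>i\<in>{1..<r}. A r i)"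
  proof -
    have "{1..j} \<inter> {j<..N} = {}" "{1..N} = {1..j} \<union> {j<..N}" using j by auto
    then show ?thesis unfolding S1_def by (metis finite_atLeastAtMost finite_greaterThanAtMost sum.union_disjoint)
  qed
  also have "(\<Sum>r\<in>{j<..N}. \<Sum>i\<in>{1..<r}. A r i) = (\<Sum>r\<in>{j<..N}. \<Sum>i\<in>{1..j}. A r i)"
    by (intro sum.cong refl sum.mono_neutral_right) (use zero in auto)
  also have "\<dots> = S2 + real (N - j) *\<^sub>R S3"
    unfolding S2_def S3_def by (simp add: sum_subtractf sum_constant_scaleR)
  finally have sumA: "(\<Sum>r\<in>{1..N}. \<Sum>i\<in>{1..<r}. A r i) = S1 + (S2 + real (N - j) *\<^sub>R S3)" .
  have S3N: "S3 = (real N *\<^sub>R S3) /\<^sub>R real N" using N0 by simp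
  have "?M (zs F ?q a (Tsum S N a /\<^sub>R real N) j) = (S1 + (S2 + real (N - j) *\<^sub>R S3)) /\<^sub>R real N - (real N *\<^sub>R S3) /\<^sub>R real N"
    unfolding zsum sumA S3_def[symmetric] S3N[symmetric] ..
  also have "\<dots> = (S1 + S2 - real j *\<^sub>R S3) /\<^sub>R real N"
  proof -
    \<comment> \<open>In units of 1/N, each mean-field term is supplied N - j times, by the slots
      beyond j, and removed N times, by the derivative of P_i.\<close>
    have "real (N - j) *\<^sub>R S3 - real N *\<^sub>R S3 = - (real j *\<^sub>R S3)"
      using j by (simp add: of_nat_diff scaleR_diff_left)
    then have "S1 + (S2 + real (N - j) *\<^sub>R S3) - real N *\<^sub>R S3 = S1 + S2 - real j *\<^sub>R S3"
      by (simp add: algebra_simps)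
    then show ?thesis by (simp only: scaleR_diff_right[symmetric])
  qed
  finally have Z: "?M (zs F ?q a (Tsum S N a /\<^sub>R real N) j) = (S1 + S2 - real j *\<^sub>R S3) /\<^sub>R real N" .
  define E where "E = ?M (qs F j a)"
  define P where "P = Tsum S j E"
  have E: "E \<in> compl S j" unfolding E_def by (rule bounded_clinear_onD(2)[OF marg_bounded[OF j] qs_in[OF F(1) a(1) j(2)]])
  have normE: "norm E = ?e j"
    unfolding E_def qs_eq_sops[OF F(1) j(2)] err_def by (rule norm_marg_sops[OF j F a(1)])
  have "norm (\<Sum>i\<in>{1..<r}. A r i) \<le> real j * (4 * ?v * (?e j + 2 * ?e (j - 1) + ?e (j - 2)))" if r: "r \<in> {1..j}" for r
  proof (rule norm_sum_le)
    fix i assume i: "i \<in> {1..<r}"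
    have ir: "1 \<le> i" "i < r" "r \<le> j" "r \<le> N" using i r j by auto
    have "norm (A r i) \<le> norm (?s (Tir S N i r a))"
      unfolding A_def by (rule norm_marg[OF j sin[OF Tir_in[OF ir(1,2,4) a(1)]]])
    also have "\<dots> \<le> 4 * ?v * (?e j + 2 * ?e (j - 1) + ?e (j - 2))"
      by (rule err_Tir_inner[OF F a ir(1-3) j(2)])
    finally show "norm (A r i) \<le> 4 * ?v * (?e j + 2 * ?e (j - 1) + ?e (j - 2))" .
  qed (use r v0 in \<open>auto intro!: mult_nonneg_nonneg add_nonneg_nonneg err_nonneg\<close>)
  then have n1: "norm S1 \<le> real j * (real j * (4 * ?v * (?e j + 2 * ?e (j - 1) + ?e (j - 2))))"
    unfolding S1_def by (rule norm_sum_le) (use v0 in \<open>auto intro!: mult_nonneg_nonneg add_nonneg_nonneg err_nonneg\<close>)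
  have "norm (\<Sum>i\<in>{1..j}. A r i - G i) \<le> real j * (2 * ?v * (?e (j + 1) + 2 * ?e j))" if r: "r \<in> {j<..N}" for r
  proof (rule norm_sum_le)
    fix i assume i: "i \<in> {1..j}"
    have ir: "1 \<le> i" "i \<le> j" "j < r" "r \<le> N" "i < r" and iN: "i \<in> {1..N}" using i r j by auto
    let ?g = "ins ?q i (sops F ((code j)(i := 0)) {1..N} a)"
    note in1 = sin[OF Tir_in[OF ir(1,5,4) a(1)]] and in2 = ins_in[OF iN q, of "sops F ((code j)(i := 0)) {1..N} a"]
    have "A r i - G i = ?M (?s (Tir S N i r a) - ?g)"
      unfolding A_def G_def by (rule clinear_on_diff[OF lin X in1 in2, symmetric])
    then have "norm (A r i - G i) \<le> norm (?s (Tir S N i r a) - ?g)"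
      using norm_marg[OF j closed_csubspaceD(4)[OF X in1 in2]] by simp
    also have "\<dots> \<le> 2 * ?v * (?e (j + 1) + 2 * ?e j)" by (rule err_Tir_outer[OF F a ir(1-4)])
    finally show "norm (A r i - G i) \<le> 2 * ?v * (?e (j + 1) + 2 * ?e j)" .
  qed (use v0 in \<open>auto intro!: mult_nonneg_nonneg add_nonneg_nonneg err_nonneg\<close>)
  then have "norm S2 \<le> real (N - j) * (real j * (2 * ?v * (?e (j + 1) + 2 * ?e j)))"
    unfolding S2_def by (rule norm_sum_le) (use v0 in \<open>auto intro!: mult_nonneg_nonneg add_nonneg_nonneg err_nonneg\<close>)
  then have n2: "norm S2 \<le> (real N - real j) * (real j * (2 * ?v * (?e (j + 1) + 2 * ?e j)))"
    using j by (simp add: of_nat_diff)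
  have n3: "norm S3 \<le> real j * (?v * ?e (j - 1))"
    unfolding S3_def
  proof (rule norm_sum_le)
    fix i assume i: "i \<in> {1..j}"
    then have iN: "i \<in> {1..N}" using j by auto
    have "norm (G i) \<le> norm (ins ?q i (sops F ((code j)(i := 0)) {1..N} a))"
      unfolding G_def by (rule norm_marg[OF j ins_in[OF iN q]])
    also have "\<dots> \<le> ?v * ?e (j - 1)" by (rule err_meanQ[OF F a]) (use i j in auto)
    finally show "norm (G i) \<le> ?v * ?e (j - 1)" .
  qed (use v0 in \<open>auto intro!: mult_nonneg_nonneg err_nonneg\<close>)
  have "norm (\<Sum>i\<in>{1..<r}. Tir S j i r E) \<le> real j * (?v * ?e j)" if r: "r \<in> {1..j}" for r
  proof (rule norm_sum_le)
    fix i assume i: "i \<in> {1..<r}"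
    then show "norm (Tir S j i r E) \<le> ?v * ?e j"
      using norm_Tir[of j i r E] E normE r by auto
  qed (use r v0 in \<open>auto intro!: mult_nonneg_nonneg err_nonneg\<close>)
  then have n4: "norm P \<le> real j * (real j * (?v * ?e j))"
    unfolding P_def Tsum_def by (rule norm_sum_le) (use v0 in \<open>auto intro!: mult_nonneg_nonneg err_nonneg\<close>)
  have "norm (?M (zs F ?q a (Tsum S N a /\<^sub>R real N) j) - P /\<^sub>R real N) = norm (S1 + S2 - real j *\<^sub>R S3 - P) / real N"
    unfolding Z using N0 by (simp add: scaleR_diff_right[symmetric] divide_inverse mult.commute)
  also have "\<dots> \<le> (norm S1 + norm S2 + real j * norm S3 + norm P) / real N"
  proof (rule divide_right_mono)
    have "norm (S1 + S2 - real j *\<^sub>R S3 - P) \<le> norm (S1 + S2 - real j *\<^sub>R S3) + norm P" by (rule norm_triangle_ineq4)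
    also have "norm (S1 + S2 - real j *\<^sub>R S3) \<le> norm (S1 + S2) + norm (real j *\<^sub>R S3)" by (rule norm_triangle_ineq4)
    also have "norm (S1 + S2) \<le> norm S1 + norm S2" by (rule norm_triangle_ineq)
    finally show "norm (S1 + S2 - real j *\<^sub>R S3 - P) \<le> norm S1 + norm S2 + real j * norm S3 + norm P" by simp
  qed simp
  also have "\<dots> \<le> (real j * (real j * (4 * ?v * (?e j + 2 * ?e (j - 1) + ?e (j - 2))))
      + (real N - real j) * (real j * (2 * ?v * (?e (j + 1) + 2 * ?e j))) + real j * (real j * (?v * ?e (j - 1)))
      + real j * (real j * (?v * ?e j))) / real N"
    by (intro divide_right_mono add_mono n1 n2 n4 mult_left_mono n3) auto
  also have "\<dots> = drift_bound F a j"
    using N0 by (simp add: drift_bound_def field_simps power2_eq_square)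
  finally show ?thesis by (simp add: P_def E_def)
qed

end

section \<open>The integral inequality for the correlation errors\<close>

lemma has_right_derivative_diff:
  assumes "has_right_derivative f t a" "has_right_derivative g t b"
  shows "has_right_derivative (\<lambda>s. f s - g s) t (a - b)"
proof -
  have "(f (t + h) - g (t + h) - (f t - g t)) /\<^sub>R h = (f (t + h) - f t) /\<^sub>R h - (g (t + h) - g t) /\<^sub>R h" for h
    unfolding scaleR_diff_right[symmetric] by simp
  then show ?thesis
    using tendsto_diff[OF assms[unfolded has_right_derivative_def]] unfolding has_right_derivative_def by simp
qed

lemma has_right_derivative_tendsto:
  assumes "has_right_derivative f t d"
  shows "((\<lambda>h. f (t + h)) \<longlongrightarrow> f t) (at_right 0)"
proof -
  have "((\<lambda>h. h *\<^sub>R ((f (t + h) - f t) /\<^sub>R h)) \<longlongrightarrow> 0 *\<^sub>R d) (at_right 0)"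
    by (rule tendsto_scaleR[OF tendsto_ident_at assms[unfolded has_right_derivative_def]])
  from tendsto_add[OF tendsto_const[of "f t"] this]
  have "((\<lambda>h. f t + h *\<^sub>R ((f (t + h) - f t) /\<^sub>R h)) \<longlongrightarrow> f t) (at_right 0)" by simp
  then show ?thesis
  proof (rule Lim_transform_eventually)
    show "\<forall>\<^sub>F h in at_right 0. f t + h *\<^sub>R ((f (t + h) - f t) /\<^sub>R h) = f (t + h)"
      using eventually_at_right_less[of "0::real"] by eventually_elim simp
  qed
qed

context large_system
begin

lemma right_derivative_in:
  assumes "closed_csubspace Y" "\<And>s. s \<ge> t \<Longrightarrow> u s \<in> Y" "has_right_derivative u t d"
  shows "d \<in> Y"
proof -
  have "\<forall>\<^sub>F h in at_right 0. (u (t + h) - u t) /\<^sub>R h \<in> Y"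
    using eventually_at_right_less[of "0::real"]
  proof eventually_elim
    case (elim h)
    then have "u (t + h) \<in> Y" "u t \<in> Y" using assms(2) by auto
    then show ?case by (rule closed_csubspaceD(6)[OF assms(1) closed_csubspaceD(4)[OF assms(1)]])
  qed
  from Lim_in_closed_set[OF closed_csubspaceD(7)[OF assms(1)] this _ assms(3)[unfolded has_right_derivative_def]]
  show ?thesis by simp
qed

text \<open>Product rule. In the second difference quotient f stands at the later time t + h, which
  joint continuity of \<open>ins\<close> allows.\<close>

lemma ins_right_derivative:
  assumes i: "i \<in> {1..N}" and f: "\<And>s. s \<ge> t \<Longrightarrow> f s \<in> X1" "has_right_derivative f t f'"
    and x: "\<And>s. s \<ge> t \<Longrightarrow> x s \<in> X" "has_right_derivative x t x'"
  shows "has_right_derivative (\<lambda>s. ins (f s) i (x s)) t (ins f' i (x t) + ins (f t) i x')"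
proof -
  note f' = right_derivative_in[OF X1 f] and x' = right_derivative_in[OF X x]
  have ft: "f t \<in> X1" and xt: "x t \<in> X" using f(1) x(1) by auto
  have ev: "\<forall>\<^sub>F h in at_right 0. 0 < (h :: real)" by (rule eventually_at_right_less)
  have evf: "\<forall>\<^sub>F h in at_right 0. (f (t + h) - f t) /\<^sub>R h \<in> X1"
    using ev by eventually_elim (simp add: closed_csubspaceD(4,6)[OF X1] f(1) ft)
  have evf': "\<forall>\<^sub>F h in at_right 0. f (t + h) \<in> X1"
    using ev by eventually_elim (simp add: f(1))
  have evx: "\<forall>\<^sub>F h in at_right 0. (x (t + h) - x t) /\<^sub>R h \<in> X"
    using ev by eventually_elim (simp add: closed_csubspaceD(4,6)[OF X] x(1) xt)
  have xt': "\<forall>\<^sub>F h in at_right (0::real). x t \<in> X" using xt by simp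
  have "((\<lambda>h. ins ((f (t + h) - f t) /\<^sub>R h) i (x t) + ins (f (t + h)) i ((x (t + h) - x t) /\<^sub>R h))
      \<longlongrightarrow> ins f' i (x t) + ins (f t) i x') (at_right 0)"
    by (rule tendsto_add[OF
          ins_tendsto[OF i f(2)[unfolded has_right_derivative_def] evf f' tendsto_const xt' xt]
          ins_tendsto[OF i has_right_derivative_tendsto[OF f(2)] evf' ft x(2)[unfolded has_right_derivative_def] evx x']])
  then show ?thesis
    unfolding has_right_derivative_def
  proof (rule Lim_transform_eventually)
    show "\<forall>\<^sub>F h in at_right 0. ins ((f (t + h) - f t) /\<^sub>R h) i (x t) + ins (f (t + h)) i ((x (t + h) - x t) /\<^sub>R h)
        = (ins (f (t + h)) i (x (t + h)) - ins (f t) i (x t)) /\<^sub>R h"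
      using eventually_at_right_less[of "0::real"]
    proof eventually_elim
      case (elim h)
      then have fh: "f (t + h) \<in> X1" and xh: "x (t + h) \<in> X" using f(1) x(1) by auto
      note dx = closed_csubspaceD(4)[OF X xh xt] and df = closed_csubspaceD(4)[OF X1 fh ft]
      have "ins (f (t + h)) i ((x (t + h) - x t) /\<^sub>R h) = (ins (f (t + h)) i (x (t + h)) - ins (f (t + h)) i (x t)) /\<^sub>R h"
        using clinear_on_scaleR[OF ins_clinear[OF i fh] dx] ins_diff[OF i fh xh xt] by simp
      moreover have "ins ((f (t + h) - f t) /\<^sub>R h) i (x t) = (ins (f (t + h)) i (x t) - ins (f t) i (x t)) /\<^sub>R h"
        using clinear_on_scaleR[OF ins_clinear_arg[OF i xt] df] clinear_on_diff[OF ins_clinear_arg[OF i xt] X1 fh ft] by simp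
      ultimately show ?case by (simp add: scaleR_diff_right)
    qed
  qed
qed

text \<open>Product rule for the factors 1 - P. The part \<open>K0 S (f t)\<close> of the derivative
  of f is the commutator term of \<open>K0_graph_ins\<close> and is absorbed by the graph; the part
  g remains and enters \<open>zs\<close>.\<close>

lemma qs_right_derivative:
  assumes f: "\<And>s. s \<ge> t \<Longrightarrow> f s \<in> X1" "f t \<in> K0dom S" "has_right_derivative f t (K0 S (f t) + g)" and g: "g \<in> X1"
    and x: "\<And>s. s \<ge> t \<Longrightarrow> x s \<in> X" "has_right_derivative x t y" and z: "(x t, y - z) \<in> K0_graph S N" "z \<in> X"
  shows "m \<le> N \<Longrightarrow> \<exists>Y. has_right_derivative (\<lambda>s. qs (f s) m (x s)) t Y \<and>
    (qs (f t) m (x t), Y - zs (f t) g (x t) z m) \<in> K0_graph S N"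
proof (induction m)
  case 0
  show ?case using x(2) z(1) by auto
next
  case (Suc m)
  have i: "Suc m \<in> {1..N}" and m: "m \<le> N" using Suc.prems by auto
  let ?Q = "\<lambda>s. qs (f s) m (x s)" and ?Z = "zs (f t) g (x t) z m" and ?i = "Suc m"
  obtain Y where Y: "has_right_derivative ?Q t Y" "(?Q t, Y - ?Z) \<in> K0_graph S N" using Suc.IH[OF m] by blast
  have Q: "?Q s \<in> X" if "s \<ge> t" for s using qs_in[OF f(1)[OF that] x(1)[OF that] m] .
  have ft: "f t \<in> X1" and Qt: "?Q t \<in> X" using f(1) Q by auto
  have YX: "Y \<in> X" by (rule right_derivative_in[OF X Q Y(1)])
  have ZX: "?Z \<in> X" by (rule zs_in[OF ft g x(1) z(2) m]) simp
  note K0f = K0dom_in(2)[OF f(2)]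
  let ?D = "ins (K0 S (f t) + g) ?i (?Q t) + ins (f t) ?i Y"
  have "has_right_derivative (\<lambda>s. ?Q s - ins (f s) ?i (?Q s)) t (Y - ?D)"
    by (rule has_right_derivative_diff[OF Y(1) ins_right_derivative[OF i f(1,3) Q Y(1)]])
  then have 1: "has_right_derivative (\<lambda>s. qs (f s) (Suc m) (x s)) t (Y - ?D)" by simp
  have "(?Q t - ins (f t) ?i (?Q t), (Y - ?Z) - (ins (f t) ?i (Y - ?Z) + ins (K0 S (f t)) ?i (?Q t))) \<in> K0_graph S N"
    by (rule K0_graph_diff[OF Y(2) K0_graph_ins[OF i f(2) Y(2)]])
  moreover have "(Y - ?Z) - (ins (f t) ?i (Y - ?Z) + ins (K0 S (f t)) ?i (?Q t)) = (Y - ?D) - zs (f t) g (x t) z (Suc m)"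
    using ins_diff[OF i ft YX ZX] clinear_on_add[OF ins_clinear_arg[OF i Qt] K0f g] by simp
  ultimately have 2: "(qs (f t) (Suc m) (x t), (Y - ?D) - zs (f t) g (x t) z (Suc m)) \<in> K0_graph S N" by simp
  show ?case by (rule exI[of _ "Y - ?D"], rule conjI, rule 1, rule 2)
qed

lemma qs_tendsto:
  assumes f: "(f \<longlongrightarrow> f0) G" "\<forall>\<^sub>F s in G. f s \<in> X1" "f0 \<in> X1"
    and x: "(x \<longlongrightarrow> x0) G" "\<forall>\<^sub>F s in G. x s \<in> X" "x0 \<in> X"
  shows "m \<le> N \<Longrightarrow> ((\<lambda>s. qs (f s) m (x s)) \<longlongrightarrow> qs f0 m x0) G"
proof (induction m)
  case (Suc m)
  have i: "Suc m \<in> {1..N}" and m: "m \<le> N" using Suc.prems by auto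
  have "\<forall>\<^sub>F s in G. qs (f s) m (x s) \<in> X" using f(2) x(2) by eventually_elim (rule qs_in[OF _ _ m])
  then show ?case using Suc.IH[OF m] qs_in[OF f(3) x(3) m]
    by (simp, intro tendsto_diff ins_tendsto[OF i f]) auto
qed (simp add: x)

lemma zs_tendsto:
  assumes f: "(f \<longlongrightarrow> f0) G" "\<forall>\<^sub>F s in G. f s \<in> X1" "f0 \<in> X1"
    and g: "(g \<longlongrightarrow> g0) G" "\<forall>\<^sub>F s in G. g s \<in> X1" "g0 \<in> X1"
    and x: "(x \<longlongrightarrow> x0) G" "\<forall>\<^sub>F s in G. x s \<in> X" "x0 \<in> X"
    and z: "(z \<longlongrightarrow> z0) G" "\<forall>\<^sub>F s in G. z s \<in> X" "z0 \<in> X"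
  shows "m \<le> N \<Longrightarrow> ((\<lambda>s. zs (f s) (g s) (x s) (z s) m) \<longlongrightarrow> zs f0 g0 x0 z0 m) G"
proof (induction m)
  case (Suc m)
  have i: "Suc m \<in> {1..N}" and m: "m \<le> N" using Suc.prems by auto
  have "\<forall>\<^sub>F s in G. qs (f s) m (x s) \<in> X" using f(2) x(2) by eventually_elim (rule qs_in[OF _ _ m])
  moreover have "\<forall>\<^sub>F s in G. zs (f s) (g s) (x s) (z s) m \<in> X"
    using f(2) g(2) x(2) z(2) by eventually_elim (rule zs_in[OF _ _ _ _ m])
  ultimately show ?case
    using Suc.IH[OF m] qs_in[OF f(3) x(3) m] zs_in[OF f(3) g(3) x(3) z(3) m] qs_tendsto[OF f x m]
    by (simp, intro tendsto_diff ins_tendsto[OF i f] ins_tendsto[OF i g]) auto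
qed (simp add: z)

lemma norm_qs:
  assumes "f \<in> X1" "norm f \<le> 1" "x \<in> X"
  shows "m \<le> N \<Longrightarrow> norm (qs f m x) \<le> 2 ^ m * norm x"
proof (induction m)
  case (Suc m)
  have i: "Suc m \<in> {1..N}" and m: "m \<le> N" using Suc.prems by auto
  have "norm (slot f (\<lambda>_. 2) (Suc m) (qs f m x)) \<le> 2 * norm (qs f m x)"
    by (rule norm_slot[OF i assms(1,2) qs_in[OF assms(1,3) m]])
  then show ?case using Suc.IH[OF m] by (simp add: slot_def)
qed simp

lemma norm_zs:
  assumes "f \<in> X1" "norm f \<le> 1" "g \<in> X1" "x \<in> X" "z \<in> X"
  shows "m \<le> N \<Longrightarrow> norm (zs f g x z m) \<le> 2 ^ m * (norm z + real m * (norm g * norm x))"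
proof (induction m)
  case (Suc m)
  have i: "Suc m \<in> {1..N}" and m: "m \<le> N" using Suc.prems by auto
  let ?Z = "zs f g x z m" and ?Q = "qs f m x"
  have "norm (slot f (\<lambda>_. 2) (Suc m) ?Z) \<le> 2 * norm ?Z"
    by (rule norm_slot[OF i assms(1,2) zs_in[OF assms(1,3-5) m]])
  moreover have "norm (ins g (Suc m) ?Q) \<le> norm g * (2 ^ m * norm x)"
    by (rule order_trans[OF norm_ins[OF i assms(3) qs_in[OF assms(1,4) m]]])
      (intro mult_left_mono norm_qs[OF assms(1,2,4) m], simp)
  moreover have "norm (zs f g x z (Suc m)) \<le> norm (slot f (\<lambda>_. 2) (Suc m) ?Z) + norm (ins g (Suc m) ?Q)"
    by (simp add: slot_def norm_triangle_ineq4)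
  moreover have "norm g * (2 ^ m * norm x) \<le> 2 ^ Suc m * (norm g * norm x)"
    by (simp add: mult.left_commute mult_right_mono)
  ultimately have "norm (zs f g x z (Suc m)) \<le> 2 * norm ?Z + 2 ^ Suc m * (norm g * norm x)" by linarith
  also have "\<dots> \<le> 2 * (2 ^ m * (norm z + real m * (norm g * norm x))) + 2 ^ Suc m * (norm g * norm x)"
    using Suc.IH[OF m] by simp
  also have "\<dots> = 2 ^ Suc m * (norm z + real (Suc m) * (norm g * norm x))"
  proof -
    have "2 * (c * (u + r * p)) + (2 * c) * p = (2 * c) * (u + (1 + r) * p)" for c u r p :: real
      by (simp add: algebra_simps)
    then show ?thesis unfolding power_Suc of_nat_Suc .
  qed
  finally show ?case .
qed simp

text \<open>The interaction T_j / N is subtracted because the j-particle flow contains it.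
  \<open>g\<close> is a separate argument, since it will be an average of Q(F,F), in general
  different from Q of the average.\<close>

definition source :: "nat \<Rightarrow> 'b \<Rightarrow> 'b \<Rightarrow> 'b \<Rightarrow> 'b" where
  "source j f g x = marg S j N (zs f g x (Tsum S N x /\<^sub>R real N) j)
    - Tsum S j (marg S j N (qs f j x)) /\<^sub>R real N"

lemma T_scaled_bounded: "bounded_clinear_on X X (\<lambda>x. Tsum S N x /\<^sub>R real N)"
  by (rule bounded_clinear_on_scaleR[OF Tsum_bounded[OF N1] X])

lemma T_marg_bounded: "1 \<le> j \<Longrightarrow> j \<le> N \<Longrightarrow> bounded_clinear_on X (compl S j) (\<lambda>x. Tsum S j (marg S j N x) /\<^sub>R real N)"
  by (intro bounded_clinear_on_scaleR bounded_clinear_on_compose[OF marg_bounded] Tsum_bounded compl)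

lemma source_tendsto:
  assumes j: "1 \<le> j" "j \<le> N" and f: "(f \<longlongrightarrow> f0) G" "\<forall>\<^sub>F s in G. f s \<in> X1" "f0 \<in> X1"
    and g: "(g \<longlongrightarrow> g0) G" "\<forall>\<^sub>F s in G. g s \<in> X1" "g0 \<in> X1"
    and x: "(x \<longlongrightarrow> x0) G" "\<forall>\<^sub>F s in G. x s \<in> X" "x0 \<in> X"
  shows "((\<lambda>s. source j (f s) (g s) (x s)) \<longlongrightarrow> source j f0 g0 x0) G"
proof -
  note T = bounded_clinear_onD(2)[OF T_scaled_bounded]
  have evT: "\<forall>\<^sub>F s in G. Tsum S N (x s) /\<^sub>R real N \<in> X" using x(2) by eventually_elim (rule T)
  have evq: "\<forall>\<^sub>F s in G. qs (f s) j (x s) \<in> X" using f(2) x(2) by eventually_elim (rule qs_in[OF _ _ j(2)])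
  have evz: "\<forall>\<^sub>F s in G. zs (f s) (g s) (x s) (Tsum S N (x s) /\<^sub>R real N) j \<in> X"
    using f(2) g(2) x(2) evT by eventually_elim (rule zs_in[OF _ _ _ _ j(2)])
  note T_lim = bounded_clinear_on_tendsto[OF T_scaled_bounded X x]
  note z_lim = zs_tendsto[OF f g x T_lim evT T[OF x(3)] j(2)]
  show ?thesis
    unfolding source_def
    by (rule tendsto_diff[OF
          bounded_clinear_on_tendsto[OF marg_bounded[OF j] X z_lim evz zs_in[OF f(3) g(3) x(3) T[OF x(3)] j(2)]]
          bounded_clinear_on_tendsto[OF T_marg_bounded[OF j] X qs_tendsto[OF f x j(2)] evq qs_in[OF f(3) x(3) j(2)]]])
qed

text \<open>Provides the constant dominating function for the limit in
  \<open>marg_qs_bound\<close>.\<close>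

lemma source_bounded:
  assumes j: "1 \<le> j" "j \<le> N"
  shows "\<exists>C. \<forall>f g x. f \<in> X1 \<longrightarrow> norm f \<le> 1 \<longrightarrow> g \<in> X1 \<longrightarrow> norm g \<le> b \<longrightarrow> x \<in> X \<longrightarrow> norm x \<le> 1 \<longrightarrow>
    norm (source j f g x) \<le> C"
proof -
  obtain C where C: "\<forall>x\<in>X. norm (Tsum S N x /\<^sub>R real N) \<le> C * norm x"
    using bounded_clinear_onD(3)[OF T_scaled_bounded] by blast
  obtain D where D: "\<forall>x\<in>X. norm (Tsum S j (marg S j N x) /\<^sub>R real N) \<le> D * norm x"
    using bounded_clinear_onD(3)[OF T_marg_bounded[OF j]] by blast
  have "norm (source j f g x) \<le> 2 ^ j * (\<bar>C\<bar> + real j * \<bar>b\<bar>) + \<bar>D\<bar> * 2 ^ j"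
    if f: "f \<in> X1" "norm f \<le> 1" and g: "g \<in> X1" "norm g \<le> b" and x: "x \<in> X" "norm x \<le> 1" for f g x
  proof -
    let ?T = "Tsum S N x /\<^sub>R real N"
    note T = bounded_clinear_onD(2)[OF T_scaled_bounded x(1)]
    have nT: "norm ?T \<le> \<bar>C\<bar>"
    proof -
      have "norm ?T \<le> C * norm x" using C x(1) by simp
      also have "\<dots> \<le> \<bar>C\<bar> * 1" using x(2) by (intro mult_mono) auto
      finally show ?thesis by simp
    qed
    have "norm g * norm x \<le> \<bar>b\<bar> * 1" using g(2) x(2) by (intro mult_mono) auto
    then have "real j * (norm g * norm x) \<le> real j * \<bar>b\<bar>" by (intro mult_left_mono) auto
    then have "norm ?T + real j * (norm g * norm x) \<le> \<bar>C\<bar> + real j * \<bar>b\<bar>" using nT by linarith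
    then have "2 ^ j * (norm ?T + real j * (norm g * norm x)) \<le> 2 ^ j * (\<bar>C\<bar> + real j * \<bar>b\<bar>)"
      by (rule mult_left_mono) simp
    then have 1: "norm (marg S j N (zs f g x ?T j)) \<le> 2 ^ j * (\<bar>C\<bar> + real j * \<bar>b\<bar>)"
      using norm_marg[OF j zs_in[OF f(1) g(1) x(1) T j(2)]] norm_zs[OF f g(1) x(1) T j(2)] by linarith
    have q: "norm (qs f j x) \<le> 2 ^ j"
      by (rule order_trans[OF norm_qs[OF f x(1) j(2)]]) (use mult_left_mono[OF x(2), of "2 ^ j"] in simp)
    have "norm (Tsum S j (marg S j N (qs f j x)) /\<^sub>R real N) \<le> D * norm (qs f j x)"
      using D qs_in[OF f(1) x(1) j(2)] by blast
    also have "\<dots> \<le> \<bar>D\<bar> * 2 ^ j" using q by (intro mult_mono) auto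
    finally have 2: "norm (Tsum S j (marg S j N (qs f j x)) /\<^sub>R real N) \<le> \<bar>D\<bar> * 2 ^ j" .
    have "norm (source j f g x) \<le> norm (marg S j N (zs f g x ?T j)) + norm (Tsum S j (marg S j N (qs f j x)) /\<^sub>R real N)"
      unfolding source_def by (rule norm_triangle_ineq4)
    then show ?thesis using 1 2 by linarith
  qed
  then show ?thesis by blast
qed

lemma meanQ_tendsto:
  assumes "(f \<longlongrightarrow> f0) G" "\<forall>\<^sub>F s in G. f s \<in> X1" "f0 \<in> X1"
  shows "((\<lambda>s. meanQ S (f s) (f s)) \<longlongrightarrow> meanQ S f0 f0) G"
proof -
  have in2: "otens S 1 1 g g \<in> compl S 2" if "g \<in> X1" for g
    using tpr_in_slots[OF le12 pair_slots[OF that that]] by (simp add: otens_11_tpr[OF that that])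
  have ev: "\<forall>\<^sub>F s in G. otens S 1 1 (f s) (f s) \<in> compl S 2" using assms(2) by eventually_elim (rule in2)
  have "bounded_clinear_on (compl S 2) X1 (\<lambda>c. ptr S 2 (intV S c))"
    by (rule bounded_clinear_on_compose[OF V_bounded ptr2_bounded])
  from bounded_clinear_on_tendsto[OF this compl[OF le12] otens_tendsto[OF order_refl order_refl assms(1,1,2,2,3,3)] ev in2[OF assms(3)]]
  show ?thesis unfolding meanQ_def .
qed

lemma continuous_onI_tendsto:
  assumes "\<And>s. s \<in> A \<Longrightarrow> (f \<longlongrightarrow> f s) (at s within A)"
  shows "continuous_on A f"
  using assms by (simp add: continuous_on_def)

lemma eventually_in_within: "(\<And>s. s \<in> A \<Longrightarrow> P s) \<Longrightarrow> \<forall>\<^sub>F s in at s within A. P s"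
  by (simp add: eventually_at_filter)

section \<open>From time averages to mild solutions\<close>

context
  fixes a F
  assumes a: "a \<in> X" "norm a = 1" and F_cont: "continuous_on {0..} F"
    and F: "\<And>t. t \<ge> 0 \<Longrightarrow> F t \<in> X1" "\<And>t. t \<ge> 0 \<Longrightarrow> norm (F t) = 1"
    and F_mild: "\<And>t. t \<ge> 0 \<Longrightarrow> F t = expK0 S t (F 0) + integral {0..t} (\<lambda>s. expK0 S (t - s) (meanQ S (F s) (F s)))"
begin

abbreviation (input) flow_a :: "real \<Rightarrow> 'b" where "flow_a t \<equiv> flow S N N t a"

lemma flow_a: "t \<ge> 0 \<Longrightarrow> flow_a t \<in> X" "t \<ge> 0 \<Longrightarrow> norm (flow_a t) \<le> 1"
  using UN.U_in[OF _ a(1)] UN.contraction[OF _ a(1)] a(2) by auto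

lemma Q_cont: "continuous_on {0..} (\<lambda>t. meanQ S (F t) (F t))"
proof (rule continuous_onI_tendsto)
  fix s :: real assume s: "s \<in> {0..}"
  show "((\<lambda>t. meanQ S (F t) (F t)) \<longlongrightarrow> meanQ S (F s) (F s)) (at s within {0..})"
    by (rule meanQ_tendsto) (use F_cont F s in \<open>auto simp: continuous_on_def intro!: eventually_in_within\<close>)
qed

text \<open>The averages are classical: f lies in the domain of \<open>K0\<close> with f' = K0 f +
  g, and x is the orbit of an averaged vector. So the marginal of \<open>qs\<close> has a right
  derivative, and \<open>duhamel_norm_bound\<close> applies to it with the j-particle flow.\<close>

lemma regularized_bound:
  assumes j: "1 \<le> j" "j \<le> N" and t: "t \<ge> 0" and h: "h > 0"
  defines "f \<equiv> \<lambda>s. U1.avg h (F s)" and "x \<equiv> \<lambda>s. UN.avg h (flow_a s)" and "g \<equiv> \<lambda>s. U1.avg h (meanQ S (F s) (F s))"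
  shows "norm (marg S j N (qs (f t) j (x t))) \<le> norm (marg S j N (qs (f 0) j (x 0)))
    + integral {0..t} (\<lambda>s. norm (source j (f s) (g s) (x s)))"
    "continuous_on {0..t} (\<lambda>s. norm (source j (f s) (g s) (x s)))"
proof -
  have jN: "j \<in> {1..N}" using j by simp
  interpret Uj: contraction_semigroup "compl S j" "flow S N j" by (rule flow_contraction[OF jN])
  let ?U = "flow S N N" and ?Q = "\<lambda>s. meanQ S (F s) (F s)"
  have Q: "?Q s \<in> X1" if "s \<ge> 0" for s using meanQ_in[OF F(1) F(1)] that by simp
  define x0 where "x0 = UN.avg h a"
  define y0 where "y0 = (?U h a - a) /\<^sub>R h"
  have gen0: "(x0, y0) \<in> generator X ?U" unfolding x0_def y0_def by (rule UN.avg_generator[OF a(1) h])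
  have x0: "x0 \<in> X" unfolding x0_def by (rule UN.avg_in[OF a(1)])
  have x_eq: "x s = ?U s x0" if "s \<ge> 0" for s
    unfolding x_def x0_def using UN.avg_commute[OF a(1) that] by simp
  have fX: "f s \<in> X1" if "s \<ge> 0" for s unfolding f_def by (rule U1.avg_in[OF F(1)[OF that]])
  have gX: "g s \<in> X1" if "s \<ge> 0" for s unfolding g_def by (rule U1.avg_in[OF Q[OF that]])
  have xX: "x s \<in> X" if "s \<ge> 0" for s unfolding x_def by (rule UN.avg_in[OF flow_a(1)[OF that]])
  have avg_cont: "continuous_on {0..} (\<lambda>s. U1.avg h (u s))" if "continuous_on {0..} u" "\<And>s. s \<ge> 0 \<Longrightarrow> u s \<in> X1" for u
  proof (rule continuous_on_compose2[OF clinear_on_continuous_on[OF U1.avg_clinear X1, where C = 1] that(1)])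
    show "norm (U1.avg h x) \<le> 1 * norm x" if "x \<in> X1" for x using U1.norm_avg[OF that h] by simp
  qed (use that(2) in auto)
  have f_cont: "continuous_on {0..} f" unfolding f_def by (rule avg_cont[OF F_cont F(1)])
  have g_cont: "continuous_on {0..} g" unfolding g_def by (rule avg_cont[OF Q_cont Q])
  have "continuous_on {0..} x = continuous_on {0..} (\<lambda>s. ?U s x0)" by (rule continuous_on_cong) (use x_eq in auto)
  then have x_cont: "continuous_on {0..} x" using UN.U_cont[OF x0] by simp
  have ev: "\<forall>\<^sub>F s in at r within {0..t}. s \<ge> 0" for r by (rule eventually_in_within) simp
  have sub: "continuous_on {0..t} f" "continuous_on {0..t} g" "continuous_on {0..t} x"
    by (rule continuous_on_subset[OF f_cont] continuous_on_subset[OF g_cont] continuous_on_subset[OF x_cont]; auto)+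
  show cont: "continuous_on {0..t} (\<lambda>s. norm (source j (f s) (g s) (x s)))"
  proof (rule continuous_on_norm, rule continuous_onI_tendsto)
    fix r assume r: "r \<in> {0..t}"
    show "((\<lambda>s. source j (f s) (g s) (x s)) \<longlongrightarrow> source j (f r) (g r) (x r)) (at r within {0..t})"
    proof (rule source_tendsto[OF j])
      show "\<forall>\<^sub>F s in at r within {0..t}. f s \<in> X1" using ev by eventually_elim (rule fX)
      show "\<forall>\<^sub>F s in at r within {0..t}. g s \<in> X1" using ev by eventually_elim (rule gX)
      show "\<forall>\<^sub>F s in at r within {0..t}. x s \<in> X" using ev by eventually_elim (rule xX)
    qed (use sub r fX gX xX in \<open>auto simp: continuous_on_def\<close>)
  qed
  define w where "w s = marg S j N (qs (f s) j (x s))" for s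
  have wX: "w s \<in> compl S j" if "s \<ge> 0" for s
    unfolding w_def by (rule bounded_clinear_onD(2)[OF marg_bounded[OF j] qs_in[OF fX[OF that] xX[OF that] j(2)]])
  have w_cont: "continuous_on {0..t} w"
  proof (rule continuous_onI_tendsto)
    fix r assume r: "r \<in> {0..t}"
    have r0: "r \<ge> 0" using r by simp
    have ef: "\<forall>\<^sub>F s in at r within {0..t}. f s \<in> X1" using ev by eventually_elim (rule fX)
    have ex: "\<forall>\<^sub>F s in at r within {0..t}. x s \<in> X" using ev by eventually_elim (rule xX)
    have eq: "\<forall>\<^sub>F s in at r within {0..t}. qs (f s) j (x s) \<in> X" using ef ex by eventually_elim (rule qs_in[OF _ _ j(2)])
    have lim: "(f \<longlongrightarrow> f r) (at r within {0..t})" "(x \<longlongrightarrow> x r) (at r within {0..t})"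
      using sub r by (auto simp: continuous_on_def)
    show "(w \<longlongrightarrow> w r) (at r within {0..t})"
      unfolding w_def
      by (rule bounded_clinear_on_tendsto[OF marg_bounded[OF j] X qs_tendsto[OF lim(1) ef fX[OF r0] lim(2) ex xX[OF r0] j(2)]
            eq qs_in[OF fX[OF r0] xX[OF r0] j(2)]])
  qed
  have deriv: "\<exists>Y. has_right_derivative w s Y \<and> (w s, Y - source j (f s) (g s) (x s)) \<in> generator (compl S j) (flow S N j)"
    if s: "s \<ge> 0" for s
  proof -
    have "(f s, (expK0 S h (F s) - F s) /\<^sub>R h) \<in> generator X1 (expK0 S)"
      unfolding f_def by (rule U1.avg_generator[OF F(1)[OF s] h])
    then have K0: "f s \<in> K0dom S" "K0 S (f s) = (expK0 S h (F s) - F s) /\<^sub>R h"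
      unfolding K0_generates by auto
    have df: "has_right_derivative f s (K0 S (f s) + g s)"
      unfolding K0(2) unfolding f_def g_def
      by (rule U1.avg_mild_solution_right_derivative[OF F_mild F(1) F(1)[OF order_refl] Q_cont _ s h]) (use Q in auto)
    note orb = UN.orbit_right_derivative[OF gen0 s]
    have dx: "has_right_derivative x s (?U s y0)"
      using orb(1) unfolding has_right_derivative_def
    proof (rule Lim_transform_eventually)
      show "\<forall>\<^sub>F k in at_right 0. (?U (s + k) x0 - ?U s x0) /\<^sub>R k = (x (s + k) - x s) /\<^sub>R k"
        using eventually_at_right_less[of "0::real"] by eventually_elim (use s x_eq in simp)
    qed
    have gr: "(x s, ?U s y0 - Tsum S N (x s) /\<^sub>R real N) \<in> K0_graph S N"
      using orb(2) unfolding generator_N x_eq[OF s, symmetric] by (rule hamiltonian_graphE)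
    note Tx = bounded_clinear_onD(2)[OF T_scaled_bounded xX[OF s]]
    have "\<exists>Y. has_right_derivative (\<lambda>s. qs (f s) j (x s)) s Y \<and>
        (qs (f s) j (x s), Y - zs (f s) (g s) (x s) (Tsum S N (x s) /\<^sub>R real N) j) \<in> K0_graph S N"
      by (rule qs_right_derivative[OF _ K0(1) df gX[OF s] _ dx gr Tx j(2)]) (use fX xX s in auto)
    then obtain Y where Y: "has_right_derivative (\<lambda>s. qs (f s) j (x s)) s Y"
      "(qs (f s) j (x s), Y - zs (f s) (g s) (x s) (Tsum S N (x s) /\<^sub>R real N) j) \<in> K0_graph S N" by blast
    have q: "qs (f r) j (x r) \<in> X" if "r \<ge> s" for r using fX xX that s by (intro qs_in j) auto
    note br = bounded_right_derivative[OF marg_bounded[OF j] X q Y(1)]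
    have zX: "zs (f s) (g s) (x s) (Tsum S N (x s) /\<^sub>R real N) j \<in> X"
      by (rule zs_in[OF fX[OF s] gX[OF s] xX[OF s] Tx j(2)])
    have gm: "(w s, marg S j N (Y - zs (f s) (g s) (x s) (Tsum S N (x s) /\<^sub>R real N) j)) \<in> K0_graph S j"
      unfolding w_def by (rule K0_graph_marg[OF j Y(2)])
    have "(w s, marg S j N (Y - zs (f s) (g s) (x s) (Tsum S N (x s) /\<^sub>R real N) j)
        + Tsum S j (w s) /\<^sub>R real N) \<in> hamiltonian_graph S N j" by (rule hamiltonian_graphI[OF gm])
    moreover have "marg S j N (Y - zs (f s) (g s) (x s) (Tsum S N (x s) /\<^sub>R real N) j)
        = marg S j N Y - marg S j N (zs (f s) (g s) (x s) (Tsum S N (x s) /\<^sub>R real N) j)"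
      by (rule clinear_on_diff[OF bounded_clinear_onD(1)[OF marg_bounded[OF j]] X br(1) zX])
    ultimately have "(w s, marg S j N Y - source j (f s) (g s) (x s)) \<in> hamiltonian_graph S N j"
      by (simp add: source_def w_def algebra_simps)
    then have "(w s, marg S j N Y - source j (f s) (g s) (x s)) \<in> generator (compl S j) (flow S N j)"
      unfolding flow_generates[OF jN] .
    then show ?thesis using br(2) unfolding w_def by blast
  qed
  define y where "y s = (SOME Y. has_right_derivative w s Y \<and> (w s, Y - source j (f s) (g s) (x s)) \<in> generator (compl S j) (flow S N j))" for s
  have y: "has_right_derivative w s (y s)" "(w s, y s - source j (f s) (g s) (x s)) \<in> generator (compl S j) (flow S N j)" if "s \<ge> 0" for s
    using someI_ex[OF deriv[OF that]] unfolding y_def by blast+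
  have "norm (w t) \<le> norm (w 0) + integral {0..t} (\<lambda>s. norm (source j (f s) (g s) (x s)))"
    by (rule Uj.duhamel_norm_bound[OF t w_cont wX[OF t] y(1) y(2) cont]) auto
  then show "norm (marg S j N (qs (f t) j (x t))) \<le> norm (marg S j N (qs (f 0) j (x 0)))
    + integral {0..t} (\<lambda>s. norm (source j (f s) (g s) (x s)))" by (simp add: w_def)
qed

text \<open>The averaging times 1/(n + 1) tend to 0; the sources converge pointwise under one
  constant bound, so their integrals converge.\<close>

lemma marg_qs_bound:
  assumes j: "1 \<le> j" "j \<le> N" and t: "t \<ge> 0"
  shows "norm (marg S j N (qs (F t) j (flow_a t))) \<le> norm (marg S j N (qs (F 0) j (flow_a 0)))
    + integral {0..t} (\<lambda>s. norm (source j (F s) (meanQ S (F s) (F s)) (flow_a s)))"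
proof -
  let ?Q = "\<lambda>s. meanQ S (F s) (F s)"
  have Q: "?Q s \<in> X1" if "s \<ge> 0" for s using meanQ_in[OF F(1) F(1)] that by simp
  have nQ: "norm (?Q s) \<le> normV S" if "s \<ge> 0" for s using norm_meanQ[OF F(1) F(1)] F(2) that by simp
  define h where "h n = inverse (real (Suc n))" for n
  have h0: "h n > 0" for n by (simp add: h_def)
  have h: "filterlim h (at_right 0) sequentially"
    unfolding h_def by (rule tendsto_imp_filterlim_at_right[OF LIMSEQ_inverse_real_of_nat]) simp
  define f where "f n s = U1.avg (h n) (F s)" for n s
  define g where "g n s = U1.avg (h n) (?Q s)" for n s
  define x where "x n s = UN.avg (h n) (flow_a s)" for n s
  have fX: "f n s \<in> X1" and gX: "g n s \<in> X1" and xX: "x n s \<in> X" if "s \<ge> 0" for n s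
    unfolding f_def g_def x_def using U1.avg_in[OF F(1)] U1.avg_in[OF Q] UN.avg_in[OF flow_a(1)] that by auto
  have fl: "(\<lambda>n. f n s) \<longlonglongrightarrow> F s" and gl: "(\<lambda>n. g n s) \<longlonglongrightarrow> ?Q s" and xl: "(\<lambda>n. x n s) \<longlonglongrightarrow> flow_a s" if "s \<ge> 0" for s
    unfolding f_def g_def x_def
    using filterlim_compose[OF U1.avg_tendsto[OF F(1)[OF that]] h] filterlim_compose[OF U1.avg_tendsto[OF Q[OF that]] h]
      filterlim_compose[OF UN.avg_tendsto[OF flow_a(1)[OF that]] h] by auto
  have norms: "norm (f n s) \<le> 1" "norm (g n s) \<le> normV S" "norm (x n s) \<le> 1" if s: "s \<ge> 0" for n s
    unfolding f_def g_def x_def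
    using U1.norm_avg[OF F(1)[OF s] h0, of n] F(2)[OF s] U1.norm_avg[OF Q[OF s] h0, of n] nQ[OF s]
      UN.norm_avg[OF flow_a(1)[OF s] h0, of n] flow_a(2)[OF s] by auto
  note reg = regularized_bound[OF j t h0, folded f_def g_def x_def]
  let ?\<gamma> = "\<lambda>n s. norm (source j (f n s) (g n s) (x n s))"
  obtain C where C: "\<And>f g x. f \<in> X1 \<Longrightarrow> norm f \<le> 1 \<Longrightarrow> g \<in> X1 \<Longrightarrow> norm g \<le> normV S \<Longrightarrow> x \<in> X \<Longrightarrow> norm x \<le> 1 \<Longrightarrow> norm (source j f g x) \<le> C"
    using source_bounded[OF j, of "normV S"] by blast
  have int: "(\<lambda>n. integral {0..t} (?\<gamma> n)) \<longlonglongrightarrow> integral {0..t} (\<lambda>s. norm (source j (F s) (?Q s) (flow_a s)))"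
  proof (rule dominated_convergence(2)[where h = "\<lambda>_. C"])
    show "?\<gamma> n integrable_on {0..t}" for n by (rule integrable_continuous_interval[OF reg(2)])
    show "(\<lambda>_. C) integrable_on {0..t}" by (rule integrable_const_ivl)
    fix s assume s: "s \<in> {0..t}"
    then have s0: "s \<ge> 0" by simp
    show "norm (?\<gamma> n s) \<le> C" for n
      using C[OF fX[OF s0] norms(1)[OF s0] gX[OF s0] norms(2)[OF s0] xX[OF s0] norms(3)[OF s0], of n n n] by simp
    show "(\<lambda>n. ?\<gamma> n s) \<longlonglongrightarrow> norm (source j (F s) (?Q s) (flow_a s))"
      by (intro tendsto_norm source_tendsto[OF j] fl gl xl s0 F(1) Q flow_a(1) always_eventually allI fX gX xX)
  qed
  have lim: "(\<lambda>n. norm (marg S j N (qs (f n s) j (x n s)))) \<longlonglongrightarrow> norm (marg S j N (qs (F s) j (flow_a s)))" if s: "s \<ge> 0" for s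
    by (intro tendsto_norm bounded_clinear_on_tendsto[OF marg_bounded[OF j] X] qs_tendsto fl xl F(1) flow_a(1)
        always_eventually allI fX xX qs_in s j(2))
  show ?thesis
    by (rule LIMSEQ_le[OF lim[OF t] tendsto_add[OF lim[OF order_refl] int]]) (use reg(1) in blast)
qed

lemma source_cont:
  assumes j: "1 \<le> j" "j \<le> N"
  shows "continuous_on {0..} (\<lambda>s. norm (source j (F s) (meanQ S (F s) (F s)) (flow_a s)))"
    "continuous_on {0..} (\<lambda>s. norm (marg S j N (qs (F s) j (flow_a s))))"
proof -
  let ?Q = "\<lambda>s. meanQ S (F s) (F s)"
  have Q: "?Q s \<in> X1" if "s \<ge> 0" for s using meanQ_in[OF F(1) F(1)] that by simp
  have lim: "(F \<longlongrightarrow> F r) (at r within {0..})" "(?Q \<longlongrightarrow> ?Q r) (at r within {0..})"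
    "((\<lambda>s. flow_a s) \<longlongrightarrow> flow_a r) (at r within {0..})" if "r \<ge> 0" for r
    using F_cont Q_cont UN.U_cont[OF a(1)] that by (auto simp: continuous_on_def)
  have ev: "\<forall>\<^sub>F s in at r within {0..}. F s \<in> X1" "\<forall>\<^sub>F s in at r within {0..}. ?Q s \<in> X1"
    "\<forall>\<^sub>F s in at r within {0..}. flow_a s \<in> X" "\<forall>\<^sub>F s in at r within {0..}. qs (F s) j (flow_a s) \<in> X" for r
    by (rule eventually_in_within, use F(1) Q flow_a(1) qs_in[OF _ _ j(2)] in auto)+
  show "continuous_on {0..} (\<lambda>s. norm (source j (F s) (?Q s) (flow_a s)))"
  proof (rule continuous_on_norm, rule continuous_onI_tendsto)
    fix r :: real assume "r \<in> {0..}"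
    then have r: "r \<ge> 0" by simp
    show "((\<lambda>s. source j (F s) (?Q s) (flow_a s)) \<longlongrightarrow> source j (F r) (?Q r) (flow_a r)) (at r within {0..})"
      by (rule source_tendsto[OF j lim(1)[OF r] ev(1) F(1)[OF r] lim(2)[OF r] ev(2) Q[OF r] lim(3)[OF r] ev(3) flow_a(1)[OF r]])
  qed
  show "continuous_on {0..} (\<lambda>s. norm (marg S j N (qs (F s) j (flow_a s))))"
  proof (rule continuous_on_norm, rule continuous_onI_tendsto)
    fix r :: real assume "r \<in> {0..}"
    then have r: "r \<ge> 0" by simp
    show "((\<lambda>s. marg S j N (qs (F s) j (flow_a s))) \<longlongrightarrow> marg S j N (qs (F r) j (flow_a r))) (at r within {0..})"
      by (rule bounded_clinear_on_tendsto[OF marg_bounded[OF j] X qs_tendsto[OF lim(1)[OF r] ev(1) F(1)[OF r]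
            lim(3)[OF r] ev(3) flow_a(1)[OF r] j(2)] ev(4) qs_in[OF F(1)[OF r] flow_a(1)[OF r] j(2)]])
  qed
qed

lemma err_integral:
  assumes sym: "symmetric_elt S N a" and trF: "\<And>t. t \<ge> 0 \<Longrightarrow> tr (F t) = 1" and j: "1 \<le> j" "j \<le> N"
  shows "continuous_on {0..} (\<lambda>t. err (F t) (flow_a t) j)"
    and "\<exists>\<gamma>. continuous_on {0..} \<gamma> \<and> (\<forall>s\<ge>0. \<gamma> s \<le> drift_bound (F s) (flow_a s) j) \<and>
      (\<forall>t\<ge>0. err (F t) (flow_a t) j \<le> err (F 0) (flow_a 0) j + integral {0..t} \<gamma>)"
proof -
  let ?\<gamma> = "\<lambda>s. norm (source j (F s) (meanQ S (F s) (F s)) (flow_a s))"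
  have e: "norm (marg S j N (qs (F t) j (flow_a t))) = err (F t) (flow_a t) j" if t: "t \<ge> 0" for t
    using norm_marg_sops[OF j F(1)[OF t] trF[OF t] F(2)[OF t] flow_a(1)[OF t]] qs_eq_sops[OF F(1)[OF t] j(2)]
    by (simp add: err_def)
  show "continuous_on {0..} (\<lambda>t. err (F t) (flow_a t) j)"
    by (rule continuous_on_eq[OF source_cont(2)[OF j]]) (use e in auto)
  have "?\<gamma> s \<le> drift_bound (F s) (flow_a s) j" if s: "s \<ge> 0" for s
    unfolding source_def by (rule drift_le[OF F(1)[OF s] trF[OF s] F(2)[OF s] flow_a(1)[OF s] flow_symmetric[OF a(1) sym s] j])
  moreover have "err (F t) (flow_a t) j \<le> err (F 0) (flow_a 0) j + integral {0..t} ?\<gamma>" if t: "t \<ge> 0" for t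
    using marg_qs_bound[OF j t] e[OF t] e[OF order_refl] by simp
  ultimately show "\<exists>\<gamma>. continuous_on {0..} \<gamma> \<and> (\<forall>s\<ge>0. \<gamma> s \<le> drift_bound (F s) (flow_a s) j) \<and>
      (\<forall>t\<ge>0. err (F t) (flow_a t) j \<le> err (F 0) (flow_a 0) j + integral {0..t} \<gamma>)"
    using source_cont(1)[OF j] by (intro exI[of _ ?\<gamma>] conjI allI impI)
qed

end

end

section \<open>The constants\<close>

lemma exp1_ge: "exp 1 \<ge> (5/2 :: real)"
  using exp_lower_Taylor_quadratic[of "1::real"] by simp

text \<open>The common factor of the constants: C_1 = 64 cc / |ln (1 - 1/(24 e))| and C_2 = 16 cc
  C_0.\<close>

definition cc :: real where "cc = (2 * exp 1) powr (1 + 1 / (12 * exp 1))"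

lemma cc_ge: "cc \<ge> 5"
proof -
  have "(2 * exp 1) powr 1 \<le> cc" unfolding cc_def using exp1_ge by (intro powr_mono) auto
  then show ?thesis using exp1_ge by simp
qed

text \<open>From 5/2 <= e <= 3 the number y = 1/(24 e) lies between 1/72 and 1/60; ln x <= x - 1 at
  1 - y and at its inverse puts |ln (1 - y)| between y and 1/59. The value 58 is the coefficient in
  \<open>drift_le_maj\<close>.\<close>

lemma const_C1_bounds: "const_C1 \<ge> 58" "const_C1 \<le> 4608 * cc"
proof -
  define y :: real where "y = 1 / (24 * exp 1)"
  have y: "0 < y" "y \<le> 1 / 60" "y \<ge> 1 / 72"
    using exp1_ge exp_le by (auto simp: y_def field_simps)
  have "ln (1 - y) \<le> (1 - y) - 1" by (rule ln_le_minus_one) (use y in simp)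
  then have L: "\<bar>ln (1 - y)\<bar> \<ge> y" "ln (1 - y) \<le> 0" using y by linarith+
  have "ln (1 / (1 - y)) \<le> 1 / (1 - y) - 1" by (rule ln_le_minus_one) (use y in simp)
  moreover have "ln (1 / (1 - y)) = - ln (1 - y)" using y by (simp add: ln_div)
  moreover have "1 / (1 - y) \<le> 60 / 59" using y by (simp add: field_simps)
  ultimately have L': "\<bar>ln (1 - y)\<bar> \<le> 1 / 59" using L(2) by linarith
  have C1: "const_C1 = 64 * cc / \<bar>ln (1 - y)\<bar>" by (simp add: const_C1_def y_def cc_def add.commute)
  have "58 * \<bar>ln (1 - y)\<bar> \<le> 64 * cc" using L' cc_ge by linarith
  then show "const_C1 \<ge> 58" using L(1) y(1) unfolding C1 by (simp add: le_divide_eq)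
  have "64 * cc / \<bar>ln (1 - y)\<bar> \<le> 64 * cc / (1 / 72)"
    using L(1) y cc_ge by (intro divide_left_mono mult_pos_pos) auto
  then show "const_C1 \<le> 4608 * cc" unfolding C1 by simp
qed

lemma const_C2_bounds: "C0 \<ge> 1 \<Longrightarrow> const_C2 C0 \<ge> 80" "C0 \<ge> 1 \<Longrightarrow> const_C2 C0 > C0" "C0 \<ge> 1 \<Longrightarrow> const_C2 C0 \<ge> 16 * cc"
proof -
  assume C0: "C0 \<ge> 1"
  have 1: "16 * cc * 1 \<le> 16 * cc * C0" using C0 cc_ge by (intro mult_left_mono) auto
  have "80 * C0 \<le> 16 * cc * C0" using C0 cc_ge by (intro mult_right_mono) auto
  then show "const_C2 C0 \<ge> 80" "const_C2 C0 > C0" "const_C2 C0 \<ge> 16 * cc"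
    using C0 1 unfolding const_C2_def cc_def[symmetric] by linarith+
qed

text \<open>The quotient in B_2 is at least 4, because C_2^2 is at least 256 cc^2 while C_1 is at
  most a multiple of cc. The bound 4 settles at most two particles and absorbs the constant 13 in
  \<open>er_1\<close>.\<close>

lemma const_B2_bounds:
  assumes "C0 \<ge> 1" "B0 > 0"
  shows "const_B2 C0 B0 \<ge> 4" "const_B2 C0 B0 > B0" "16 * (const_C2 C0)\<^sup>2 \<le> (const_C1 - 2) * const_B2 C0 B0"
proof -
  let ?q = "16 * (const_C2 C0)\<^sup>2 / (const_C1 - 2)"
  note C1 = const_C1_bounds
  have "16 * 16 * cc * cc \<le> const_C2 C0 * const_C2 C0"
    using mult_mono[OF const_C2_bounds(3)[OF assms(1)] const_C2_bounds(3)[OF assms(1)]] const_C2_bounds(1)[OF assms(1)] cc_ge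
    by (simp add: mult_ac)
  then have 1: "4096 * cc * cc \<le> 16 * (const_C2 C0)\<^sup>2" by (simp add: power2_eq_square)
  have "4 * (const_C1 - 2) \<le> 4 * (4608 * cc)" using C1(2) by simp
  also have "\<dots> \<le> 4096 * cc * cc" using mult_right_mono[OF cc_ge, of cc] cc_ge by linarith
  finally have "4 * (const_C1 - 2) \<le> 16 * (const_C2 C0)\<^sup>2" using 1 by linarith
  then have q: "?q \<ge> 4" using C1(1) by (simp add: le_divide_eq)
  show "const_B2 C0 B0 \<ge> 4" "const_B2 C0 B0 > B0" using q assms(2) unfolding const_B2_def by linarith+
  have "(const_C1 - 2) * ?q \<le> (const_C1 - 2) * const_B2 C0 B0"
    using C1(1) assms(2) unfolding const_B2_def by (intro mult_left_mono) auto
  then show "16 * (const_C2 C0)\<^sup>2 \<le> (const_C1 - 2) * const_B2 C0 B0" using C1(1) by simp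
qed

text \<open>With \<open>a = C\<^sub>2 e\<^bsup>C\<^sub>1 t \<parallel>V\<parallel>\<^esup> / \<surd>N\<close> this is the right-hand side of the theorem.\<close>

definition maj :: "real \<Rightarrow> nat \<Rightarrow> real" where "maj a j = (a * real j) ^ j"

lemma maj_pos: "a > 0 \<Longrightarrow> maj a j > 0"
  by (cases j) (auto simp: maj_def)

text \<open>18 = 6 * 3, from a (j + 1) <= 2 a j <= 6 and (1 + 1/j)^j <= e <= 3.\<close>

lemma maj_Suc:
  assumes "a > 0" "j \<ge> 1" "a * real j \<le> 3"
  shows "maj a (j + 1) \<le> 18 * maj a j"
proof -
  have j: "real j \<ge> 1" using assms(2) by simp
  have "(1 + 1 / real j) ^ j \<le> exp (1 / real j) ^ j"
    using exp_ge_add_one_self[of "1 / real j"] by (intro power_mono) auto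
  also have "\<dots> = exp 1" using j by (simp add: exp_of_nat_mult[symmetric])
  finally have e: "(1 + 1 / real j) ^ j \<le> 3" using exp_le by linarith
  have "a * real (j + 1) = (a * real j) * (1 + 1 / real j)" using j by (simp add: field_simps)
  then have "maj a (j + 1) = (a * real (j + 1)) * (maj a j * (1 + 1 / real j) ^ j)"
    unfolding maj_def by (simp only: power_add power_one_right power_mult_distrib mult_ac)
  also have "\<dots> \<le> 6 * (maj a j * 3)"
  proof (rule mult_mono)
    have "a * real (j + 1) \<le> a * (2 * real j)" using j assms(1) by (intro mult_left_mono) auto
    then show "a * real (j + 1) \<le> 6" using assms(3) by linarith
    show "maj a j * (1 + 1 / real j) ^ j \<le> maj a j * 3"
      using e maj_pos[OF assms(1), of j] by (intro mult_left_mono) auto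
    show "0 \<le> maj a j * (1 + 1 / real j) ^ j" using maj_pos[OF assms(1), of j] j by simp
  qed simp
  finally show ?thesis by simp
qed

lemma maj_pred:
  assumes "a > 0" "j \<ge> 1"
  shows "(a * real j) * maj a (j - 1) \<le> maj a j"
proof -
  have "maj a (j - 1) \<le> (a * real j) ^ (j - 1)"
    unfolding maj_def using assms by (intro power_mono mult_left_mono) auto
  then have "(a * real j) * maj a (j - 1) \<le> (a * real j) * (a * real j) ^ (j - 1)"
    using assms by (intro mult_left_mono) auto
  also have "\<dots> = maj a j" using assms(2) by (cases j) (auto simp: maj_def)
  finally show ?thesis .
qed

text \<open>The factor 3 comes from j = 1, where the truncated index is 0 and the claim reads a^2 <=
  3 a.\<close>

lemma maj_pred2:
  assumes "a > 0" "j \<ge> 1" "a * real j \<le> 3"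
  shows "(a * real j)\<^sup>2 * maj a (j - 2) \<le> 3 * maj a j"
proof (cases "j = 1")
  case True
  have "a * a \<le> 3 * a" using assms True by (intro mult_right_mono) auto
  then show ?thesis using True by (simp add: maj_def power2_eq_square)
next
  case False
  then have j: "j \<ge> 2" using assms(2) by simp
  have "maj a (j - 2) \<le> (a * real j) ^ (j - 2)"
    unfolding maj_def using assms by (intro power_mono mult_left_mono) auto
  then have "(a * real j)\<^sup>2 * maj a (j - 2) \<le> (a * real j)\<^sup>2 * (a * real j) ^ (j - 2)"
    by (intro mult_left_mono) auto
  also have "\<dots> = maj a j" unfolding maj_def power_add[symmetric] le_add_diff_inverse[OF j] by (rule refl)
  finally show ?thesis using maj_pos[OF assms(1), of j] by linarith
qed

text \<open>58 = 40 + 18: the first summand gives 2 (18 + 2), the second 5 + 9 + 4. There j^2 / n is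
  at most j and, by a^2 n >= 3, at most (a j)^2 / 3, which compensates the lower index of
  \<open>maj\<close>.\<close>

lemma drift_le_maj:
  fixes e :: "nat \<Rightarrow> real"
  assumes a: "a > 0" "a * real j \<le> 3" "a\<^sup>2 * real n \<ge> 3" and j: "1 \<le> j" "j \<le> n"
    and e: "\<And>k. k \<le> n \<Longrightarrow> e k \<le> maj a k" "\<And>k. e k \<ge> 0"
  shows "(real n - real j) / real n * (2 * real j * (e (j + 1) + 2 * e j))
     + (real j)\<^sup>2 / real n * (5 * e j + 9 * e (j - 1) + 4 * e (j - 2)) \<le> 58 * real j * maj a j"
proof -
  let ?m = "maj a j"
  have n: "real n > 0" and jr: "real j \<ge> 1" using j by auto
  note m0 = maj_pos[OF a(1), of j]
  have jm: "?m \<le> real j * ?m" using mult_right_mono[OF jr, of ?m] m0 by simp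
  have 1: "(real n - real j) / real n * (2 * real j * (e (j + 1) + 2 * e j)) \<le> 2 * real j * (20 * ?m)"
  proof (cases "j = n")
    \<comment> \<open>The hypotheses do not bound e (n + 1), but its factor n - j is 0.\<close>
    case True
    then show ?thesis using jr m0 by simp
  next
    case False
    then have "e (j + 1) \<le> 18 * ?m" using maj_Suc[OF a(1) j(1) a(2)] e(1)[of "j + 1"] j by simp
    then have "e (j + 1) + 2 * e j \<le> 20 * ?m" using e(1)[OF j(2)] by linarith
    then have "2 * real j * (e (j + 1) + 2 * e j) \<le> 2 * real j * (20 * ?m)" by (intro mult_left_mono) auto
    moreover have "(real n - real j) / real n \<le> 1" "0 \<le> (real n - real j) / real n" using n j by auto
    moreover have "0 \<le> 2 * real j * (e (j + 1) + 2 * e j)" using e(2)[of j] e(2)[of "j + 1"] by simp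
    ultimately have "(real n - real j) / real n * (2 * real j * (e (j + 1) + 2 * e j)) \<le> 1 * (2 * real j * (20 * ?m))"
      using mult_mono[of "(real n - real j) / real n" 1 "2 * real j * (e (j + 1) + 2 * e j)" "2 * real j * (20 * ?m)"]
      by linarith
    then show ?thesis by simp
  qed
  have q: "(real j)\<^sup>2 / real n \<le> (a * real j)\<^sup>2 / 3"
  proof -
    have "(real j)\<^sup>2 * 3 \<le> (real j)\<^sup>2 * (a\<^sup>2 * real n)" using a(3) by (intro mult_left_mono) auto
    then show ?thesis using n by (simp add: field_simps power_mult_distrib)
  qed
  have q0: "0 \<le> (real j)\<^sup>2 / real n" by simp
  have t0: "(real j)\<^sup>2 / real n * e j \<le> real j * ?m"
  proof (rule mult_mono)
    show "(real j)\<^sup>2 / real n \<le> real j" using n j by (simp add: field_simps power2_eq_square)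
  qed (use e(1)[OF j(2)] e(2) in auto)
  have t1: "(real j)\<^sup>2 / real n * e (j - 1) \<le> real j * ?m"
  proof -
    have "(real j)\<^sup>2 / real n * e (j - 1) \<le> (a * real j)\<^sup>2 / 3 * maj a (j - 1)"
      using q e(1)[of "j - 1"] e(2) j by (intro mult_mono) auto
    also have "\<dots> = (a * real j) / 3 * ((a * real j) * maj a (j - 1))" by (simp add: power2_eq_square)
    also have "\<dots> \<le> 1 * ?m"
      using maj_pred[OF a(1) j(1)] a maj_pos[OF a(1), of "j - 1"] by (intro mult_mono) auto
    finally show ?thesis using jm by simp
  qed
  have t2: "(real j)\<^sup>2 / real n * e (j - 2) \<le> real j * ?m"
  proof -
    have "(real j)\<^sup>2 / real n * e (j - 2) \<le> (a * real j)\<^sup>2 / 3 * maj a (j - 2)"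
      using q e(1)[of "j - 2"] e(2) j by (intro mult_mono) auto
    also have "\<dots> \<le> ?m" using maj_pred2[OF a(1) j(1) a(2)] by simp
    finally show ?thesis using jm by simp
  qed
  have "(real j)\<^sup>2 / real n * (5 * e j + 9 * e (j - 1) + 4 * e (j - 2)) \<le> 18 * (real j * ?m)"
  proof -
    have "q * (5 * x + 9 * y + 4 * z) \<le> 18 * m" if "q * x \<le> m" "q * y \<le> m" "q * z \<le> m" for q x y z m :: real
      using that by (simp add: distrib_left)
    then show ?thesis using t0 t1 t2 by blast
  qed
  then show ?thesis using 1 by linarith
qed

section \<open>The bound by the number of terms\<close>

context tensor_algebra
begin

lemma foldr_oconj_isometry:
  assumes "set ps \<subseteq> {1..j} \<times> {1..j}" "x \<in> compl S j"
  shows "foldr (\<lambda>(i, p). oconj S j i p) ps x \<in> compl S j \<and> norm (foldr (\<lambda>(i, p). oconj S j i p) ps x) = norm x"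
  using assms(1)
proof (induction ps)
  case (Cons ip ps)
  obtain i p where ip: "ip = (i, p)" by (rule prod.exhaust)
  then show ?case using Cons oconj_in[of i j p] norm_oconj[of i j p] by simp
qed (simp add: assms(2))

lemma norm_conj_slots:
  assumes "I \<subseteq> {1..j}" "x \<in> compl S j"
  shows "norm (conj_slots S I j x) = norm x"
proof -
  have fin: "finite I" and c: "card I \<le> j" using assms(1) finite_subset card_mono[OF _ assms(1)] by auto
  have "set (zip (sorted_list_of_set I) [1..<Suc (card I)]) \<subseteq> set (sorted_list_of_set I) \<times> set [1..<Suc (card I)]"
    by (auto dest: set_zip_leftD set_zip_rightD simp del: upt_Suc)
  also have "\<dots> \<subseteq> {1..j} \<times> {1..j}" using assms(1) fin c by (auto simp del: upt_Suc)
  finally show ?thesis unfolding conj_slots_def using foldr_oconj_isometry[OF _ assms(2)] by blast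
qed

lemma norm_tens_pow:
  assumes "1 \<le> j" "k \<le> j" "F \<in> compl S 1" "norm F \<le> 1" "j - k \<ge> 1 \<Longrightarrow> a \<in> compl S (j - k)" "norm a \<le> 1"
  shows "tens_pow S (j - k) k a F \<in> compl S j \<and> norm (tens_pow S (j - k) k a F) \<le> 1"
proof -
  have F: "in_slots k (\<lambda>_. F)" using assms(3) by (simp add: in_slots_def)
  have nF: "norm (tpr k (\<lambda>_. F)) \<le> 1" if "k \<ge> 1"
    using norm_tpr[OF that, of "\<lambda>_. F"] assms(3,4) by (simp add: power_le_one)
  consider "k = 0" | "k = j" | "k \<ge> 1" "j - k \<ge> 1" "k \<noteq> 0" "j - k \<noteq> 0" using assms(2) by force
  then show ?thesis
  proof cases
    case 1
    then show ?thesis using assms by (simp add: tens_pow_def)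
  next
    case 2
    then show ?thesis using tpr_in_slots[OF assms(1)] F nF assms(1)
      by (simp add: tens_pow_def tprod_list_replicate)
  next
    case 3
    note T = tpr_in_slots[OF 3(1) F]
    have e: "tens_pow S (j - k) k a F = otens S (j - k) k a (tpr k (\<lambda>_. F))"
      using 3(3,4) by (simp add: tens_pow_def tprod_list_replicate)
    have "otens S (j - k) k a (tpr k (\<lambda>_. F)) \<in> compl S (j - k + k)"
      by (rule otens_in[OF 3(2,1) assms(5)[OF 3(2)] T])
    moreover have "norm a * norm (tpr k (\<lambda>_. F)) \<le> 1 * 1"
      using nF[OF 3(1)] assms(6) by (intro mult_mono) auto
    ultimately show ?thesis
      using norm_otens[OF 3(2,1) assms(5)[OF 3(2)] T] assms(2) unfolding e by simp
  qed
qed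

text \<open>Each of the 2^j terms has norm at most 1; this is the bound used for at most two
  particles.\<close>

lemma norm_corr_error_le:
  assumes j: "1 \<le> j" "j \<le> N" and F: "F \<in> compl S 1" "norm F \<le> 1" and a: "a \<in> compl S N" "norm a \<le> 1"
  shows "norm (corr_error S N a F j) \<le> 2 ^ j"
proof -
  have "norm ((-1) ^ card K *\<^sub>R conj_slots S ({1..j} - K) j (tens_pow S (j - card K) (card K) (marg S (j - card K) N a) F)) \<le> 1"
    if K: "K \<in> Pow {1..j}" for K
  proof -
    have cK: "card K \<le> j" using card_mono[of "{1..j}" K] K by simp
    let ?a = "marg S (j - card K) N a"
    let ?t = "tens_pow S (j - card K) (card K) ?a F"
    have t: "?t \<in> compl S j \<and> norm ?t \<le> 1"
    proof (cases "j - card K \<ge> 1")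
      case True
      have jN: "j - card K \<le> N" using j by simp
      show ?thesis
        by (rule norm_tens_pow[OF j(1) cK F bounded_clinear_onD(2)[OF marg_bounded[OF True jN] a(1)]
              order_trans[OF norm_marg[OF True jN a(1)] a(2)]])
    next
      case False
      then have c: "card K = j" using cK by simp
      \<comment> \<open>\<open>tens_pow\<close> discards the marginal of index 0, so 0 may stand in
        its place.\<close>
      have "tens_pow S (j - j) j 0 F \<in> compl S j \<and> norm (tens_pow S (j - j) j 0 F) \<le> 1"
        by (rule norm_tens_pow[OF j(1) order_refl F]) simp_all
      then show ?thesis using c j(1) by (simp add: tens_pow_def)
    qed
    then show ?thesis using norm_conj_slots[of "{1..j} - K" j ?t] by simp
  qed
  then have "norm (corr_error S N a F j) \<le> real (card (Pow {1..j})) * 1"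
    unfolding corr_error_def by (rule sum_norm_bound)
  then show ?thesis by (simp add: card_Pow)
qed

end

section \<open>Comparison with the majorants\<close>

context large_system
begin

definition amp :: "real \<Rightarrow> real \<Rightarrow> real" where
  "amp C0 t = const_C2 C0 * exp (const_C1 * t * normV S) / sqrt (real N)"

context
  fixes a F C0
  assumes a: "a \<in> X" "norm a = 1" and F_cont: "continuous_on {0..} F"
    and F: "\<And>t. t \<ge> 0 \<Longrightarrow> F t \<in> X1" "\<And>t. t \<ge> 0 \<Longrightarrow> norm (F t) = 1"
    and F_mild: "\<And>t. t \<ge> 0 \<Longrightarrow> F t = expK0 S t (F 0) + integral {0..t} (\<lambda>s. expK0 S (t - s) (meanQ S (F s) (F s)))"
    and sym: "symmetric_elt S N a" and trF: "\<And>t. t \<ge> 0 \<Longrightarrow> tr (F t) = 1"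
    and flow_a: "\<And>t. t \<ge> 0 \<Longrightarrow> norm (flow S N N t a) = 1" "\<And>t. t \<ge> 0 \<Longrightarrow> ell S N (flow S N N t a) = 1"
    and C0: "C0 \<ge> 1"
    and init: "\<And>j. j \<in> {1..N} \<Longrightarrow> err (F 0) a j \<le> (C0 / sqrt (real N) * real j) ^ j"
begin

abbreviation (input) er :: "real \<Rightarrow> nat \<Rightarrow> real" where "er t j \<equiv> err (F t) (flow S N N t a) j"

lemma er_cont:
  assumes "j \<in> {1..N}"
  shows "continuous_on {0..} (\<lambda>t. er t j)"
  by (rule err_integral(1)) (fact | use assms in simp)+

lemma er_integral:
  assumes "j \<in> {1..N}"
  shows "\<exists>\<gamma>. continuous_on {0..} \<gamma> \<and>
    (\<forall>s\<ge>0. \<gamma> s \<le> drift_bound (F s) (flow S N N s a) j) \<and> (\<forall>t\<ge>0. er t j \<le> er 0 j + integral {0..t} \<gamma>)"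
  by (rule err_integral(2)) (fact | use assms in simp)+

lemma er_growth:
  assumes j: "j \<in> {1..N}" and t: "t \<ge> 0"
    and m: "\<And>s. 0 \<le> s \<Longrightarrow> s \<le> t \<Longrightarrow> (m has_real_derivative m' s) (at s)"
    and le: "\<And>s. 0 \<le> s \<Longrightarrow> s \<le> t \<Longrightarrow> drift_bound (F s) (flow S N N s a) j \<le> m' s"
  shows "er t j \<le> er 0 j + m t - m 0"
proof -
  obtain \<gamma> where \<gamma>: "continuous_on {0..} \<gamma>" "\<And>s. s \<ge> 0 \<Longrightarrow> \<gamma> s \<le> drift_bound (F s) (flow S N N s a) j"
    "\<And>t. t \<ge> 0 \<Longrightarrow> er t j \<le> er 0 j + integral {0..t} \<gamma>"
    using er_integral[OF j] by blast
  have "integral {0..t} \<gamma> \<le> m t - m 0"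
  proof (rule integral_le_increment[OF t _ m])
    show "continuous_on {0..t} \<gamma>" by (rule continuous_on_subset[OF \<gamma>(1)]) auto
    show "\<gamma> s \<le> m' s" if "0 \<le> s" "s \<le> t" for s using \<gamma>(2)[OF that(1)] le[OF that] by linarith
  qed
  then show ?thesis using \<gamma>(3)[OF t] by linarith
qed

lemma amp_facts:
  shows "amp C0 t > 0" "t \<ge> 0 \<Longrightarrow> (amp C0 t)\<^sup>2 * real N \<ge> 3" "s \<le> t \<Longrightarrow> amp C0 s \<le> amp C0 t"
    "amp C0 t = const_C2 C0 / sqrt (real N) * exp (const_C1 * normV S * t)"
proof -
  have N: "real N > 0" and c2: "const_C2 C0 \<ge> 80" using N1 const_C2_bounds(1)[OF C0] by auto
  show eq: "amp C0 t = const_C2 C0 / sqrt (real N) * exp (const_C1 * normV S * t)" for t by (simp add: amp_def mult_ac)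
  have k: "const_C1 * normV S \<ge> 0" using const_C1_bounds normV_nonneg by simp
  show "amp C0 t > 0" using N c2 by (simp add: amp_def)
  show "amp C0 s \<le> amp C0 t" if "s \<le> t"
    unfolding eq using mult_left_mono[OF that k] N c2 by (intro mult_left_mono) auto
  show "(amp C0 t)\<^sup>2 * real N \<ge> 3" if "t \<ge> 0"
  proof -
    have "1 \<le> exp (const_C1 * normV S * t)" using k that by simp
    then have "80 * 1 \<le> const_C2 C0 * exp (const_C1 * normV S * t)" using c2 by (intro mult_mono) auto
    then have "80\<^sup>2 \<le> (const_C2 C0 * exp (const_C1 * normV S * t))\<^sup>2" by (intro power_mono) auto
    then show ?thesis using N unfolding eq by (simp add: power_mult_distrib power_divide)
  qed
qed

text \<open>\<open>first_crossing\<close> is applied to all orders at once, because the drift of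
  order j involves the orders from j - 2 to j + 1.\<close>

lemma er_maj:
  assumes "t \<ge> 0" "j \<in> {1..N}"
  shows "er t j < maj (amp C0 t) j"
proof -
  let ?v = "normV S"
  have "maj (amp C0 t) j - er t j > 0"
  proof (rule first_crossing[where K = "{1..N}" and d = "\<lambda>j t. maj (amp C0 t) j - er t j", OF _ _ _ _ assms])
    show "continuous_on {0..} (\<lambda>t. maj (amp C0 t) j - er t j)" if "j \<in> {1..N}" for j
      unfolding maj_def amp_facts(4) by (intro continuous_intros er_cont that)
    show 0: "maj (amp C0 0) j - er 0 j > 0" if j: "j \<in> {1..N}" for j
    proof -
      \<comment> \<open>C_2 > C_0 puts the majorant strictly above the error at time 0, as
        \<open>first_crossing\<close> requires.\<close>
      have "C0 / sqrt (real N) < amp C0 0"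
        using const_C2_bounds(2)[OF C0] N1 unfolding amp_facts(4) by (simp add: divide_strict_right_mono)
      then have "C0 / sqrt (real N) * real j < amp C0 0 * real j" using j by (intro mult_strict_right_mono) auto
      then have "(C0 / sqrt (real N) * real j) ^ j < maj (amp C0 0) j"
        unfolding maj_def using C0 j by (intro power_strict_mono) auto
      then show ?thesis using init[OF j] UN.U_zero[OF a(1)] by simp
    qed
    fix t :: real and j assume t: "t > 0" and j: "j \<in> {1..N}"
      and le: "\<And>s k. 0 \<le> s \<Longrightarrow> s \<le> t \<Longrightarrow> k \<in> {1..N} \<Longrightarrow> maj (amp C0 s) k - er s k \<ge> 0"
    have j': "1 \<le> j" "j \<le> N" using j by auto
    show "maj (amp C0 t) j - er t j > 0"
    proof (cases "amp C0 t * real j \<ge> 3")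
      case True
      have "er t j \<le> 2 ^ j"
        using t by (intro err_le F UN.U_in a flow_a j') auto
      also have "(2::real) ^ j < 3 ^ j" using j' by (intro power_strict_mono) auto
      also have "(3::real) ^ j \<le> maj (amp C0 t) j" unfolding maj_def using True by (intro power_mono) auto
      finally show ?thesis by simp
    next
      case False
      \<comment> \<open>In time the majorant is a pure exponential of rate c, so its derivative is c
        times itself; C_1 >= 58 makes this dominate the drift.\<close>
      define c where "c = const_C1 * normV S * real j"
      define M where "M = (const_C2 C0 / sqrt (real N) * real j) ^ j"
      have maj: "maj (amp C0 s) j = M * exp (c * s)" for s
      proof -
        have "exp (c * s) = exp (const_C1 * normV S * s) ^ j"
          unfolding c_def exp_of_nat_mult[symmetric] by (simp add: mult_ac)
        moreover have "(p * e * r) ^ j = (p * r) ^ j * e ^ j" for p e r :: real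
          unfolding power_mult_distrib by (simp only: mult_ac)
        ultimately show ?thesis unfolding maj_def M_def amp_facts(4) by (simp only:)
      qed
      have "er t j \<le> er 0 j + M * exp (c * t) - M * exp (c * 0)"
      proof (rule er_growth[where m = "\<lambda>s. M * exp (c * s)" and m' = "\<lambda>s. c * (M * exp (c * s))", OF j])
        show "t \<ge> 0" using t by simp
        show "((\<lambda>s. M * exp (c * s)) has_real_derivative c * (M * exp (c * s))) (at s)" for s
          by (auto intro!: derivative_eq_intros)
        fix s assume s: "0 \<le> s" "s \<le> t"
        let ?e = "er s"
        have e0: "er s 0 = 1" using s by (intro err_0 F UN.U_in a flow_a) auto
        \<comment> \<open>The amplitude increases, so the smallness of a j at time t holds at all
          earlier times.\<close>
        have "amp C0 s * real j \<le> amp C0 t * real j" using amp_facts(3)[OF s(2)] by (intro mult_right_mono) auto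
        then have as: "amp C0 s * real j \<le> 3" using False by linarith
        have "(real N - real j) / real N * (2 * real j * (?e (j + 1) + 2 * ?e j))
           + (real j)\<^sup>2 / real N * (5 * ?e j + 9 * ?e (j - 1) + 4 * ?e (j - 2)) \<le> 58 * real j * maj (amp C0 s) j"
        proof (rule drift_le_maj[OF amp_facts(1) as amp_facts(2)[OF s(1)] j'])
          show "?e k \<le> maj (amp C0 s) k" if "k \<le> N" for k
            using le[OF s, of k] that e0 by (cases "k = 0") (auto simp: maj_def)
        qed (rule err_nonneg)
        then have "drift_bound (F s) (flow S N N s a) j \<le> ?v * (58 * real j * maj (amp C0 s) j)"
          unfolding drift_bound_def by (rule mult_left_mono[OF _ normV_nonneg])
        also have "\<dots> \<le> ?v * (const_C1 * real j * maj (amp C0 s) j)"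
          using const_C1_bounds(1) maj_pos[OF amp_facts(1), of s j] normV_nonneg by (intro mult_left_mono mult_right_mono) auto
        also have "\<dots> = c * (M * exp (c * s))" unfolding maj[symmetric] by (simp add: c_def mult_ac)
        finally show "drift_bound (F s) (flow S N N s a) j \<le> c * (M * exp (c * s))" .
      qed
      then have "er t j \<le> er 0 j + maj (amp C0 t) j - maj (amp C0 0) j" unfolding maj .
      then show ?thesis using 0[OF j] by linarith
    qed
  qed simp
  then show ?thesis by simp
qed

text \<open>With E = exp (B_1 s v), v the norm of V, \<open>er_maj\<close> gives e_2 <= 4 C_2^2 E /
  N: the square of exp (C_1 s v) explains B_1 = 2 C_1. All terms of the drift at j = 1 are then
  bounded by multiples of E / N.\<close>

lemma er_1:
  assumes B0: "B0 > 0" "err (F 0) a 1 \<le> B0 / real N" and t: "t \<ge> 0"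
  shows "er t 1 < const_B2 C0 B0 / real N * exp (const_B1 * normV S * t)"
proof -
  let ?v = "normV S" and ?B = "const_B2 C0 B0"
  define c where "c = const_B1 * ?v"
  note B2 = const_B2_bounds[OF C0 B0(1)] and C1 = const_C1_bounds(1)
  have N: "real N > 0" and one: "1 \<in> {1..N}" "1 \<le> N" and two: "2 \<in> {1..N}" using N3 N1 unfolding atLeastAtMost_iff by linarith+
  have c0: "c \<ge> 0" using C1 normV_nonneg by (simp add: c_def const_B1_def)
  \<comment> \<open>The coefficients of the drift at j = 1: 2 e_2 gives 8 C_2^2, e_1 carries 4 + 5,
    and e_0 = 1 carries 9 + 4, from the indices j - 1 and (truncated) j - 2.\<close>
  have key: "8 * (const_C2 C0)\<^sup>2 + 9 * ?B + 13 \<le> const_B1 * ?B"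
  proof -
    have "58 * ?B \<le> const_C1 * ?B" using C1 B2(1) by (intro mult_right_mono) auto
    moreover have "16 * (const_C2 C0)\<^sup>2 \<le> const_C1 * ?B - 2 * ?B" using B2(3) by (simp add: left_diff_distrib)
    ultimately show ?thesis using B2(1) unfolding const_B1_def by linarith
  qed
  have "(\<lambda>(_::unit) t. ?B / real N * exp (c * t) - er t 1) () t > 0"
  proof (rule first_crossing[where K = "{()}", OF _ _ _ _ t])
    show "continuous_on {0..} (\<lambda>t. ?B / real N * exp (c * t) - er t 1)"
      by (intro continuous_intros er_cont one)
    have "B0 / real N < ?B / real N" using B2(2) N by (intro divide_strict_right_mono)
    then show 0: "?B / real N * exp (c * 0) - er 0 1 > 0" using B0(2) UN.U_zero[OF a(1)] by simp
    fix t :: real and k :: unit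
    assume t: "t > 0" and le: "\<And>s k::unit. 0 \<le> s \<Longrightarrow> s \<le> t \<Longrightarrow> k \<in> {()} \<Longrightarrow> ?B / real N * exp (c * s) - er s 1 \<ge> 0"
    have "er t 1 \<le> er 0 1 + ?B / real N * exp (c * t) - ?B / real N * exp (c * 0)"
    proof (rule er_growth[where m = "\<lambda>s. ?B / real N * exp (c * s)" and m' = "\<lambda>s. c * (?B / real N * exp (c * s))", OF one(1)])
      show "t \<ge> 0" using t by simp
      show "((\<lambda>s. ?B / real N * exp (c * s)) has_real_derivative c * (?B / real N * exp (c * s))) (at s)" for s
        using N by (auto intro!: derivative_eq_intros)
      fix s assume s: "0 \<le> s" "s \<le> t"
      define E where "E = exp (c * s)"
      have E: "E \<ge> 1" unfolding E_def using c0 s by simp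
      have e0: "er s 0 = 1" using s by (intro err_0 F UN.U_in a flow_a) auto
      have e1: "er s 1 \<le> ?B * E / real N" using le[OF s, of "()"] by (simp add: E_def)
      have n1: "er s 1 \<ge> 0" "er s 2 \<ge> 0" by (rule err_nonneg)+
      have e2: "er s 2 \<le> 4 * (const_C2 C0)\<^sup>2 * E / real N"
      proof -
        have "(exp (const_C1 * ?v * s))\<^sup>2 = E"
          unfolding E_def c_def const_B1_def exp_of_nat_mult[symmetric] power2_eq_square mult_exp_exp by simp
        moreover have "maj (amp C0 s) 2 = 4 * ((const_C2 C0)\<^sup>2 / real N * (exp (const_C1 * ?v * s))\<^sup>2)"
          using N unfolding maj_def amp_facts(4) by (simp add: power_mult_distrib power_divide)
        ultimately show ?thesis using er_maj[OF s(1) two] by simp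
      qed
      have "(real N - 1) / real N * (2 * (er s 2 + 2 * er s 1)) \<le> 1 * (2 * (er s 2 + 2 * er s 1))"
        using n1 N by (intro mult_right_mono) auto
      moreover have "1 / real N * (5 * er s 1 + 13) \<le> 5 * er s 1 + 13 * E / real N"
      proof -
        have "5 * er s 1 / real N \<le> 5 * er s 1 / 1" using n1 one(2) by (intro divide_left_mono) auto
        moreover have "13 / real N \<le> 13 * E / real N" using E N by (intro divide_right_mono) auto
        ultimately show ?thesis by (simp add: add_divide_distrib)
      qed
      ultimately have "(real N - 1) / real N * (2 * (er s 2 + 2 * er s 1)) + 1 / real N * (5 * er s 1 + 13)
          \<le> 1 * (2 * (er s 2 + 2 * er s 1)) + (5 * er s 1 + 13 * E / real N)" by (rule add_mono)
      also have "\<dots> = 2 * er s 2 + 9 * er s 1 + 13 * E / real N" by simp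
      also have "\<dots> \<le> (8 * (const_C2 C0)\<^sup>2 + 9 * ?B + 13) * (E / real N)"
      proof -
        have "2 * x2 + 9 * x1 + 13 * E / n \<le> (8 * q + 9 * B + 13) * (E / n)"
          if "x1 \<le> B * E / n" "x2 \<le> 4 * q * E / n" for x1 x2 B q n :: real
        proof -
          have "2 * x2 + 9 * x1 + 13 * E / n \<le> 2 * (4 * q * E / n) + 9 * (B * E / n) + 13 * E / n"
            using that by (intro add_mono mult_left_mono) auto
          also have "\<dots> = (8 * q + 9 * B + 13) * (E / n)" by (simp add: distrib_right add_divide_distrib)
          finally show ?thesis .
        qed
        from this[OF e1 e2] show ?thesis .
      qed
      also have "\<dots> \<le> const_B1 * ?B * (E / real N)"
        using key E N by (intro mult_right_mono) auto
      finally have "?v * ((real N - 1) / real N * (2 * (er s 2 + 2 * er s 1)) + 1 / real N * (5 * er s 1 + 13))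
          \<le> ?v * (const_B1 * ?B * (E / real N))" by (rule mult_left_mono[OF _ normV_nonneg])
      moreover have "drift_bound (F s) (flow S N N s a) 1
          = ?v * ((real N - 1) / real N * (2 * (er s 2 + 2 * er s 1)) + 1 / real N * (5 * er s 1 + 13))"
        using e0 by (simp add: drift_bound_def)
      ultimately show "drift_bound (F s) (flow S N N s a) 1 \<le> c * (?B / real N * exp (c * s))"
        by (simp add: c_def E_def mult_ac)
    qed
    then show "?B / real N * exp (c * t) - er t 1 > 0" using 0 by linarith
  qed auto
  then show ?thesis by (simp add: c_def)
qed

end

end

theorem theorem2p2:
  fixes S :: "('h::chilbert, 'b::cbanach) mean_field_data"
    and N :: nat
    and FN F :: "real \<Rightarrow> 'b"
    and C0 :: real
  assumes system: "mean_field_system S N"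
    and FN_state: "is_state S N (FN 0)"
    and FN_sol: "nbody_mild S N (FN 0) FN"
    and F_init: "F 0 \<in> pcone S 1" "norm (F 0) = 1"
    and F_sol: "mf_mild S (F 0) F"
    and C0: "C0 \<ge> 1"
    and E_init: "\<And>j. j \<in> {1..N} \<Longrightarrow>
      norm (corr_error S N (FN 0) (F 0) j) \<le> C0 ^ j * (real j / sqrt (real N)) ^ j"
  shows "(\<forall>t>0. \<forall>j\<in>{1..N}.
            norm (corr_error S N (FN t) (F t) j)
              \<le> (const_C2 C0 * exp (const_C1 * t * normV S)) ^ j * (real j / sqrt (real N)) ^ j) \<and>
         (\<forall>B0>0. norm (corr_error S N (FN 0) (F 0) 1) \<le> B0 / real N \<longrightarrow>
            (\<forall>t>0. norm (corr_error S N (FN t) (F t) 1)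
              \<le> 1 / real N * const_B2 C0 B0 * exp (const_B1 * t * normV S)))"
proof -
  interpret mean_field_system S N by (rule system)
  let ?A = "\<lambda>t. const_C2 C0 * exp (const_C1 * t * normV S)"
  have N0: "real N > 0" and N1: "1 \<le> N" using N_pos by auto
  have one: "1 \<le> (1::nat)" by simp
  \<comment> \<open>By uniqueness the given mild solution is the one of \<open>mf_unique\<close>,
    from which it inherits positivity and norm 1.\<close>
  obtain u where u: "mf_mild S (F 0) u \<and> (\<forall>t\<ge>0. u t \<in> pcone S 1 \<and> norm (u t) = 1) \<and>
      (\<forall>v. mf_mild S (F 0) v \<longrightarrow> (\<forall>t\<ge>0. v t = u t))"
    using mf_unique[OF F_init] by (rule exE)
  note Fu = conjunct2[OF conjunct2[OF u], THEN spec, THEN mp, OF F_sol, rule_format]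
  note up = conjunct1[OF conjunct2[OF u], rule_format]
  have Fp: "F t \<in> pcone S 1" and Fn: "norm (F t) = 1" if "t \<ge> 0" for t unfolding Fu[OF that] using up[OF that] by simp_all
  have F1: "F t \<in> compl S 1" if "t \<ge> 0" for t by (rule pcone_subset[OF Fp[OF that]])
  have trF: "ell S 1 (F t) = 1" if "t \<ge> 0" for t using ell_pcone[OF one Fp[OF that]] Fn[OF that] by simp
  note m = F_sol[unfolded mild_solution_def]
  note F_cont = conjunct1[OF m]
  note F_mild = conjunct2[OF conjunct2[OF m, rule_format]]
  have G: "FN 0 \<in> pcone S N" "symmetric_elt S N (FN 0)" "norm (FN 0) = 1" using FN_state unfolding is_state_def by auto
  note GX = pcone_subset[OF G(1)]
  have NN: "N \<in> {1..N}" using N1 by simp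
  have flow0: "flow S N N s 0 = 0" if "s \<ge> 0" for s
  proof -
    have "bounded_clinear_on (compl S N) (compl S N) (flow S N N s)"
      using flow_semigroup[OF NN] that unfolding c0_semigroup_def by simp
    then show ?thesis by (rule clinear_on_zero[OF bounded_clinear_onD(1) compl[OF N1]])
  qed
  \<comment> \<open>The source of the mild equation is 0, which the linear flow maps to 0, so the
    solution is the orbit of its initial datum.\<close>
  have FN: "FN t = flow S N N t (FN 0)" if t: "t \<ge> 0" for t
  proof -
    have "integral {0..t} (\<lambda>s. flow S N N (t - s) 0) = integral {0..t} (\<lambda>s. 0)"
      by (rule integral_cong) (simp add: flow0)
    with conjunct2[OF conjunct2[OF FN_sol[unfolded mild_solution_def], rule_format, OF t]] show ?thesis by simp
  qed
  have FNp: "FN t \<in> pcone S N" if "t \<ge> 0" for t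
    unfolding FN[OF that] using flow_positive[OF that] G(1) by blast
  have FNn: "norm (FN t) = 1" if "t \<ge> 0" for t
    unfolding FN[OF that] using flow_isometric that GX G(3) unfolding isometric_on_def by simp
  have FN1: "ell S N (FN t) = 1" if "t \<ge> 0" for t using ell_pcone[OF N1 FNp[OF that]] FNn[OF that] by simp
  have A: "?A t \<ge> 80" if "t \<ge> 0" for t
  proof -
    have "1 \<le> exp (const_C1 * t * normV S)" using const_C1_bounds(1) that normV_nonneg by simp
    then have "80 * 1 \<le> ?A t" using const_C2_bounds(1)[OF C0] by (intro mult_mono) auto
    then show ?thesis by simp
  qed
  show ?thesis
  proof (cases "N \<ge> 3")
    \<comment> \<open>For at most two particles 2^j is enough: the base on the right is at least 80
      / 2 and B_2 / N is at least 2.\<close>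
    case False
    have triv: "norm (corr_error S N (FN t) (F t) j) \<le> 2 ^ j" if "t \<ge> 0" "j \<in> {1..N}" for t j
      using norm_corr_error_le[OF _ _ F1[OF that(1)] _ pcone_subset[OF FNp[OF that(1)]], of j]
        Fn[OF that(1)] FNn[OF that(1)] that(2) by simp
    have "norm (corr_error S N (FN t) (F t) j) \<le> ?A t ^ j * (real j / sqrt (real N)) ^ j" if t: "t > 0" and j: "j \<in> {1..N}" for t j
    proof -
      have "sqrt (real N) \<le> sqrt 4" using False by (intro real_sqrt_le_mono) simp
      then have "1 / 2 \<le> 1 / sqrt (real N)" using N0 by (intro divide_left_mono) auto
      also have "\<dots> \<le> real j / sqrt (real N)" using j by (intro divide_right_mono) auto
      finally have "80 * (1 / 2) \<le> ?A t * (real j / sqrt (real N))" using A[of t] t by (intro mult_mono) auto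
      then have "2 ^ j \<le> (?A t * (real j / sqrt (real N))) ^ j" by (intro power_mono) auto
      then show ?thesis using triv[of t j] t j unfolding power_mult_distrib by linarith
    qed
    moreover have "norm (corr_error S N (FN t) (F t) 1) \<le> 1 / real N * const_B2 C0 B0 * exp (const_B1 * t * normV S)"
      if t: "t > 0" and B0: "B0 > 0" for t B0
    proof -
      have "1 \<le> exp (const_B1 * t * normV S)" using const_C1_bounds(1) t normV_nonneg by (simp add: const_B1_def)
      moreover have "1 / 2 * 4 \<le> 1 / real N * const_B2 C0 B0"
        using const_B2_bounds(1)[OF C0 B0] N0 False by (intro mult_mono divide_left_mono) auto
      moreover have "2 \<le> x * y" if "1 \<le> y" "1 / 2 * 4 \<le> x" for x y :: real
        using mult_mono[of 2 x 1 y] that by simp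
      ultimately have "2 \<le> 1 / real N * const_B2 C0 B0 * exp (const_B1 * t * normV S)" by blast
      then show ?thesis using triv[of t 1] t N1 by simp
    qed
    ultimately show ?thesis by blast
  next
    case True
    interpret large_system S N by unfold_locales (rule True)
    have sym: "symmetric_elt S N (FN t)" if "t \<ge> 0" for t
      unfolding FN[OF that] by (rule flow_symmetric[OF GX G(2) that])
    have E: "norm (corr_error S N (FN t) (F t) j) = err (F t) (FN t) j" if "t \<ge> 0" "j \<in> {1..N}" for t j
      using norm_corr_error[OF _ _ F1[OF that(1)] trF[OF that(1)] Fn[OF that(1)] pcone_subset[OF FNp[OF that(1)]]
          sym[OF that(1)] FN1[OF that(1)], of j] that(2) by simp
    have fn: "norm (flow S N N t (FN 0)) = 1" "ell S N (flow S N N t (FN 0)) = 1" if "t \<ge> 0" for t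
      using FNn[OF that] FN1[OF that] unfolding FN[OF that] by simp_all
    have init: "err (F 0) (FN 0) j \<le> (C0 / sqrt (real N) * real j) ^ j" if "j \<in> {1..N}" for j
    proof -
      have "(C0 / sqrt (real N) * real j) ^ j = C0 ^ j * (real j / sqrt (real N)) ^ j"
        unfolding power_mult_distrib[symmetric] by simp
      then show ?thesis using E_init[OF that] E[OF order_refl that] by simp
    qed
    have 1: "err (F t) (FN t) j < maj (amp C0 t) j" if "t \<ge> 0" "j \<in> {1..N}" for t j
      unfolding FN[OF that(1)] by (rule er_maj[OF GX G(3) F_cont]; fact)
    have 2: "err (F t) (FN t) 1 < const_B2 C0 B0 / real N * exp (const_B1 * normV S * t)"
      if "B0 > 0" "err (F 0) (FN 0) 1 \<le> B0 / real N" "t \<ge> 0" for t B0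
      unfolding FN[OF that(3)] by (rule er_1[OF GX G(3) F_cont]; fact)
    have "norm (corr_error S N (FN t) (F t) j) \<le> ?A t ^ j * (real j / sqrt (real N)) ^ j" if "t > 0" "j \<in> {1..N}" for t j
      using 1[of t j] E[of t j] that unfolding maj_def amp_def power_mult_distrib[symmetric] by simp
    moreover have "norm (corr_error S N (FN t) (F t) 1) \<le> 1 / real N * const_B2 C0 B0 * exp (const_B1 * t * normV S)"
      if "t > 0" "B0 > 0" "norm (corr_error S N (FN 0) (F 0) 1) \<le> B0 / real N" for t B0
    proof -
      have 11: "1 \<in> {1..N}" using N1 by simp
      have "err (F t) (FN t) 1 < const_B2 C0 B0 / real N * exp (const_B1 * normV S * t)"
        using 2[of B0 t] that E[OF order_refl 11] by simp
      then show ?thesis using E[of t 1] that 11 by (simp add: mult_ac)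
    qed
    ultimately show ?thesis by blast
  qed
qed

end
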